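(* Under the setting below, $G_7$ is a plane $6$-spanner of the visibility graph $\mathrm{Vis}(V,S)$ in which every vertex has degree at most $7$.
   Context: Setting: $V$ is a finite set of points (vertices) in the plane and $S$ a finite set of simple polygonal obstacles, pairwise non-intersecting, all of whose corners lie in $V$; each vertex is a corner of at most one obstacle and occurs at most once on its boundary. General position: no three vertices collinear and no two vertices on a line parallel to a cone boundary ray. Points $p,q$ are visible if segment $pq$ does not properly intersect any obstacle (touching at vertices or running along boundaries is allowed, meeting an obstacle interior is not). $\mathrm{Vis}(V,S)$ is the graph on $V$ with an edge for every visible pair, weighted by Euclidean length; $d_G$ is shortest-path length, and a subgraph $H$ is a $t$-spanner of $G$ if $d_H(x,y)\le t\,d_G(x,y)$ for all $x,y$. Plane means no two edges properly cross. Cones: around each vertex $u$ the plane is partitioned into six cones of angle $\pi/3$ with apex $u$; $C_0^u$ has the upward vertical bisector, and counterclockwise the cones are $C_0^u,\overline{C_2^u},C_1^u,\overline{C_0^u},C_2^u,\overline{C_1^u}$ (positive cones $C_i$, negative cones $\overline{C_i}$, indices mod 3; $v\in\overline{C_i^u}$ iff $u\in C_i^v$). If the obstacle having $u$ as a corner splits a cone so that there are vertices visible from $u$ on both sides of the obstacle within it, the cone is regarded as two subcones; otherwise a single subcone. "Closest" within a (sub)cone refers to smallest orthogonal projection onto the cone's bisector. $G_\infty$: for every vertex $u$ and every positive subcone of $u$, add an edge from $u$ to the closest vertex visible from $u$ in that subcone. The canonical sequence of a negative subcone of $u$ is the list of vertices adjacent to $u$ in $G_\infty$ lying in that subcone,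 in counterclockwise order around $u$; its canonical path consists of the segments joining consecutive vertices of this sequence. $G_{10}$ is the graph on $V$ whose edges are, for every vertex $u$ and every negative subcone of $u$: the edge from $u$ to the closest $G_\infty$-neighbour of $u$ in that subcone, and all edges of the canonical path of that subcone. $G_7$ is obtained from $G_{10}$ by applying the following transformation at every applicable configuration: let $u$ be a vertex and $v$ a vertex on the canonical path of a negative subcone of $\overline{C_i^u}$ such that the positive cone $C_i^v$ is not split by an obstacle and $v$ has two neighbours $x\in\overline{C_{i-1}^v}$ and $y\in\overline{C_{i+1}^v}$ on this canonical path, labelled so that $x$ precedes $y$ along the canonical path. If neither $x$ is the closest $G_\infty$-neighbour of $v$ in the negative subcone of $v$ containing $x$, nor $y$ is the closest $G_\infty$-neighbour of $v$ in the negative subcone of $v$ containing $y$, then remove the edge $vy$ and add the edge $xy$; then let $w$ be the neighbour of $x$ on the canonical path of the negative subcone of $v$ containing $x$, and if $w\in\overline{C_i^x}$ and $w$ is not the closest $G_\infty$-neighbour of $x$ in the subcone containing it, remove the edge $xw$. *)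

theory Defs
  imports "HOL-Analysis.Analysis"
begin

type_synonym pt = "real \<times> real"

definition cross2 :: "pt \<Rightarrow> pt \<Rightarrow> real" where
  "cross2 a b = fst a * snd b - snd a * fst b"

text \<open>An obstacle is given by the cyclic list of its corners.\<close>

definition pedge :: "pt list \<Rightarrow> nat \<Rightarrow> pt set" where
  "pedge P k = closed_segment (P ! k) (P ! (Suc k mod length P))"

definition pbound :: "pt list \<Rightarrow> pt set" where
  "pbound P = (\<Union>k<length P. pedge P k)"

definition simple_polygon :: "pt list \<Rightarrow> bool" where
  "simple_polygon P \<longleftrightarrow> length P \<ge> 3 \<and> distinct P \<and>
     (\<forall>k<length P. \<forall>l<length P. k \<noteq> l \<longrightarrow>
        (if l = Suc k mod length P then pedge P k \<inter> pedge P l = {P ! l}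
         else if k = Suc l mod length P then pedge P k \<inter> pedge P l = {P ! k}
         else pedge P k \<inter> pedge P l = {}))"

definition pinterior :: "pt list \<Rightarrow> pt set" where
  "pinterior P = inside (pbound P)"

definition pregion :: "pt list \<Rightarrow> pt set" where
  "pregion P = pbound P \<union> pinterior P"

definition valid_setting :: "pt set \<Rightarrow> pt list set \<Rightarrow> bool" where
  "valid_setting V S \<longleftrightarrow> finite V \<and> finite S \<and>
     (\<forall>P\<in>S. simple_polygon P \<and> set P \<subseteq> V) \<and>
     (\<forall>P\<in>S. \<forall>Q\<in>S. P \<noteq> Q \<longrightarrow> pregion P \<inter> pregion Q = {} \<and> set P \<inter> set Q = {})"

text \<open>Bisector direction of the positive cone C_i (indices mod 3):
  C_0 upward, C_1 at angle 7pi/6, C_2 at angle 11pi/6. The negative cone has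
  the opposite bisector.\<close>

definition cdir :: "int \<Rightarrow> pt" where
  "cdir i = (if i mod 3 = 0 then (0, 1)
             else if i mod 3 = 1 then (- sqrt 3 / 2, - 1 / 2)
             else (sqrt 3 / 2, - 1 / 2))"

definition pc :: "int \<Rightarrow> pt" where "pc i = cdir i"
definition nc :: "int \<Rightarrow> pt" where "nc i = - cdir i"

text \<open>Open cone of angle pi/3 with apex u and unit bisector d.\<close>
definition cone :: "pt \<Rightarrow> pt \<Rightarrow> pt set" where
  "cone u d = {v. v \<noteq> u \<and> (v - u) \<bullet> d > sqrt 3 / 2 * norm (v - u)}"

definition proj :: "pt \<Rightarrow> pt \<Rightarrow> pt \<Rightarrow> real" where
  "proj u d v = (v - u) \<bullet> d"

definition general_position :: "pt set \<Rightarrow> bool" where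
  "general_position V \<longleftrightarrow>
     (\<forall>p\<in>V. \<forall>q\<in>V. \<forall>r\<in>V. p \<noteq> q \<and> p \<noteq> r \<and> q \<noteq> r \<longrightarrow> cross2 (q - p) (r - p) \<noteq> 0) \<and>
     (\<forall>p\<in>V. \<forall>q\<in>V. p \<noteq> q \<longrightarrow>
        cross2 (q - p) (1, 0) \<noteq> 0 \<and> cross2 (q - p) (1, sqrt 3) \<noteq> 0 \<and>
        cross2 (q - p) (- 1, sqrt 3) \<noteq> 0)"

definition visible :: "pt list set \<Rightarrow> pt \<Rightarrow> pt \<Rightarrow> bool" where
  "visible S p q \<longleftrightarrow> (\<forall>P\<in>S. closed_segment p q \<inter> pinterior P = {})"

definition Vis :: "pt set \<Rightarrow> pt list set \<Rightarrow> pt set set" where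
  "Vis V S = {{p, q} | p q. p \<in> V \<and> q \<in> V \<and> p \<noteq> q \<and> visible S p q}"

definition visK :: "pt set \<Rightarrow> pt list set \<Rightarrow> pt \<Rightarrow> pt \<Rightarrow> pt set" where
  "visK V S u d = {v \<in> V. v \<in> cone u d \<and> visible S u v}"

definition corner_at :: "pt list \<Rightarrow> pt \<Rightarrow> pt \<Rightarrow> pt \<Rightarrow> bool" where
  "corner_at P u a b \<longleftrightarrow> (\<exists>k<length P. P ! k = u \<and>
      a = P ! ((k + length P - 1) mod length P) \<and> b = P ! (Suc k mod length P))"

text \<open>The obstacle with corner u cuts the cone (apex u, bisector d): both boundary
  edges at u point into the cone, a clockwise of b, and the obstacle lies in the
  wedge between them.\<close>
definition geom_split :: "pt list set \<Rightarrow> pt \<Rightarrow> pt \<Rightarrow> pt \<Rightarrow> pt \<Rightarrow> bool" where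
  "geom_split S u d a b \<longleftrightarrow> (\<exists>P\<in>S. (corner_at P u a b \<or> corner_at P u b a) \<and>
      cross2 (a - u) (b - u) > 0 \<and> a \<in> cone u d \<and> b \<in> cone u d \<and>
      eventually (\<lambda>t. u + t *\<^sub>R ((a - u) + (b - u)) \<in> pinterior P) (at_right 0))"

definition side1 :: "pt set \<Rightarrow> pt list set \<Rightarrow> pt \<Rightarrow> pt \<Rightarrow> pt \<Rightarrow> pt set" where
  "side1 V S u d a = {v \<in> visK V S u d. cross2 (a - u) (v - u) \<le> 0}"

definition side2 :: "pt set \<Rightarrow> pt list set \<Rightarrow> pt \<Rightarrow> pt \<Rightarrow> pt \<Rightarrow> pt set" where
  "side2 V S u d b = {v \<in> visK V S u d. cross2 (b - u) (v - u) \<ge> 0}"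

definition split_cfg :: "pt set \<Rightarrow> pt list set \<Rightarrow> pt \<Rightarrow> pt \<Rightarrow> pt \<Rightarrow> pt \<Rightarrow> bool" where
  "split_cfg V S u d a b \<longleftrightarrow> geom_split S u d a b \<and>
      side1 V S u d a \<noteq> {} \<and> side2 V S u d b \<noteq> {}"

definition is_split :: "pt set \<Rightarrow> pt list set \<Rightarrow> pt \<Rightarrow> pt \<Rightarrow> bool" where
  "is_split V S u d \<longleftrightarrow> (\<exists>a b. split_cfg V S u d a b)"

text \<open>Subcones of the cone (u,d), each given as its set of vertices visible from u.\<close>
definition subcones :: "pt set \<Rightarrow> pt list set \<Rightarrow> pt \<Rightarrow> pt \<Rightarrow> pt set set" where
  "subcones V S u d =
     (if is_split V S u d
      then {X. \<exists>a b. split_cfg V S u d a b \<and> (X = side1 V S u d a \<or> X = side2 V S u d b)}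
      else {visK V S u d})"

definition Ginf :: "pt set \<Rightarrow> pt list set \<Rightarrow> pt set set" where
  "Ginf V S = {{u, w} | u w. u \<in> V \<and> (\<exists>i\<in>{0,1,2::int}. \<exists>X\<in>subcones V S u (pc i).
      w \<in> X \<and> (\<forall>z\<in>X. proj u (pc i) w \<le> proj u (pc i) z))}"

definition Nb :: "pt set \<Rightarrow> pt list set \<Rightarrow> pt \<Rightarrow> pt set" where
  "Nb V S u = {v. {u, v} \<in> Ginf V S}"

definition closestN :: "pt set \<Rightarrow> pt list set \<Rightarrow> pt \<Rightarrow> pt \<Rightarrow> pt set \<Rightarrow> pt \<Rightarrow> bool" where
  "closestN V S u d X w \<longleftrightarrow> w \<in> X \<inter> Nb V S u \<and>
      (\<forall>z\<in>X \<inter> Nb V S u. proj u d w \<le> proj u d z)"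

text \<open>Canonical sequence (as a set, ordered counterclockwise around u).\<close>
definition cseq :: "pt set \<Rightarrow> pt list set \<Rightarrow> pt \<Rightarrow> pt set \<Rightarrow> pt set" where
  "cseq V S u X = X \<inter> Nb V S u"

definition ccw_before :: "pt \<Rightarrow> pt \<Rightarrow> pt \<Rightarrow> bool" where
  "ccw_before u v w \<longleftrightarrow> cross2 (v - u) (w - u) > 0"

definition cnext :: "pt \<Rightarrow> pt set \<Rightarrow> pt \<Rightarrow> pt \<Rightarrow> bool" where
  "cnext u C v w \<longleftrightarrow> v \<in> C \<and> w \<in> C \<and> ccw_before u v w \<and>
      \<not> (\<exists>z\<in>C. ccw_before u v z \<and> ccw_before u z w)"

definition cpath_edges :: "pt set \<Rightarrow> pt list set \<Rightarrow> pt \<Rightarrow> pt set \<Rightarrow> pt set set" where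
  "cpath_edges V S u X = {{v, w} | v w. cnext u (cseq V S u X) v w}"

definition G10 :: "pt set \<Rightarrow> pt list set \<Rightarrow> pt set set" where
  "G10 V S =
     {{u, w} | u w. u \<in> V \<and> (\<exists>i\<in>{0,1,2::int}. \<exists>X\<in>subcones V S u (nc i). closestN V S u (nc i) X w)}
     \<union> {e. \<exists>u\<in>V. \<exists>i\<in>{0,1,2::int}. \<exists>X\<in>subcones V S u (nc i). e \<in> cpath_edges V S u X}"

definition g7_config :: "pt set \<Rightarrow> pt list set \<Rightarrow> pt \<Rightarrow> int \<Rightarrow> pt set \<Rightarrow> pt \<Rightarrow> pt \<Rightarrow> pt \<Rightarrow> bool" where
  "g7_config V S u i X v x y \<longleftrightarrow>
     u \<in> V \<and> i \<in> {0,1,2} \<and> X \<in> subcones V S u (nc i) \<and>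
     v \<in> cseq V S u X \<and> \<not> is_split V S v (pc i) \<and>
     cnext u (cseq V S u X) x v \<and> cnext u (cseq V S u X) v y \<and>
     x \<in> cone v (nc (i - 1)) \<and> y \<in> cone v (nc (i + 1)) \<and>
     (\<forall>X'\<in>subcones V S v (nc (i - 1)). x \<in> X' \<longrightarrow> \<not> closestN V S v (nc (i - 1)) X' x) \<and>
     (\<forall>Y'\<in>subcones V S v (nc (i + 1)). y \<in> Y' \<longrightarrow> \<not> closestN V S v (nc (i + 1)) Y' y)"

definition g7_removed :: "pt set \<Rightarrow> pt list set \<Rightarrow> pt set set" where
  "g7_removed V S =
     {{v, y} | v y. \<exists>u i X x. g7_config V S u i X v x y}
     \<union> {{x, w} | x w. \<exists>u i X v y X'. g7_config V S u i X v x y \<and>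
          X' \<in> subcones V S v (nc (i - 1)) \<and> x \<in> X' \<and>
          (cnext v (cseq V S v X') x w \<or> cnext v (cseq V S v X') w x) \<and>
          w \<in> cone x (nc i) \<and>
          (\<forall>W\<in>subcones V S x (nc i). w \<in> W \<longrightarrow> \<not> closestN V S x (nc i) W w)}"

definition g7_added :: "pt set \<Rightarrow> pt list set \<Rightarrow> pt set set" where
  "g7_added V S = {{x, y} | x y. \<exists>u i X v. g7_config V S u i X v x y}"

definition G7 :: "pt set \<Rightarrow> pt list set \<Rightarrow> pt set set" where
  "G7 V S = (G10 V S - g7_removed V S) \<union> g7_added V S"

definition is_path :: "pt set set \<Rightarrow> pt list \<Rightarrow> pt \<Rightarrow> pt \<Rightarrow> bool" where
  "is_path E p x y \<longleftrightarrow> p \<noteq> [] \<and> hd p = x \<and> last p = y \<and>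
      (\<forall>k. Suc k < length p \<longrightarrow> {p ! k, p ! Suc k} \<in> E)"

definition path_len :: "pt list \<Rightarrow> real" where
  "path_len p = (\<Sum>k<length p - 1. dist (p ! k) (p ! Suc k))"

definition gdist :: "pt set set \<Rightarrow> pt \<Rightarrow> pt \<Rightarrow> ereal" where
  "gdist E x y = (INF p\<in>{p. is_path E p x y}. ereal (path_len p))"

definition is_spanner :: "pt set \<Rightarrow> pt set set \<Rightarrow> pt set set \<Rightarrow> real \<Rightarrow> bool" where
  "is_spanner V G H t \<longleftrightarrow> H \<subseteq> G \<and>
      (\<forall>x\<in>V. \<forall>y\<in>V. gdist H x y \<le> ereal t * gdist G x y)"

definition is_plane :: "pt set set \<Rightarrow> bool" where
  "is_plane E \<longleftrightarrow> (\<forall>a b c d. {a, b} \<in> E \<longrightarrow> {c, d} \<in> E \<longrightarrow> {a, b} \<noteq> {c, d} \<longrightarrow>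
      open_segment a b \<inter> open_segment c d = {})"

definition vdegree :: "pt set set \<Rightarrow> pt \<Rightarrow> nat" where
  "vdegree E u = card {v. {u, v} \<in> E}"

end

theory Submission
  imports Defs
begin

text \<open>Coordinates. With the three bisector directions as linear functionals \<open>cc i\<close> (their sum is \<open>0\<close>), the
  cones become sign conditions on two of the coordinates, and everything is linear inequalities.

  Empty triangles. If a sector at \<open>o\<close> between a vertex \<open>v\<close> and a visible point is free of obstacles near \<open>o\<close>,
  then the first vertex met when the ray from \<open>v\<close> turns away from \<open>o\<close> spans with \<open>o\<close> and \<open>v\<close> a triangle
  without obstacles and further vertices. It follows that edges of \<open>G\<^sub>\<infinity>\<close> do not cross, and that
  consecutive vertices of a canonical sequence span an empty face with the apex, whose third side is again an edge of \<open>G\<^sub>\<infinity>\<close>.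

  Degree. A vertex has at most seven subcones, since its obstacle corner splits at most one cone. The edges of \<open>G\<^sub>7\<close>
  at a vertex are charged injectively to its subcones; the transformation makes this possible where a positive cone
  of \<open>G\<^sub>1\<^sub>0\<close> would receive two canonical path edges.

  Planarity. An added edge \<open>xy\<close> lies in the two faces at \<open>uv\<close>, and \<open>uv\<close> is not an edge of \<open>G\<^sub>1\<^sub>0\<close>.

  Stretch. \<open>G\<^sub>\<infinity>\<close> is a 2-spanner of the visibility graph: for a visible pair \<open>u\<close>, \<open>w\<close> with closest vertex \<open>v\<close>, gift
  wrapping inside the triangle \<open>u v w\<close> gives a chain from \<open>v\<close> to \<open>w\<close> of smaller visible pairs, to which induction
  applies. \<open>G\<^sub>7\<close> is a 3-spanner of \<open>G\<^sub>\<infinity>\<close>: an edge is replaced by the closest neighbour and the canonical path,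
  along which coordinates are monotone.\<close>

section \<open>Polygons as Jordan curves\<close>

text \<open>Obstacles enter the combinatorics mainly through two local facts: a sight segment
  crosses no obstacle edge (\<open>clear\<close>), and two vertices seen in one cone share a subcone
  exactly when the sector between them is obstacle-free near the apex (\<open>secfree\<close>). With
  the second, most later arguments need no case distinction on split cones. The empty-triangle lemma
  admits an apex that is not a vertex, so that it also applies at a crossing point of two segments.

  Stretch bounds are kept in cone coordinates until the end, because there they add up along
  detours; only the final comparison with the norm produces 3 for \<open>G7\<close> over
  \<open>Ginf\<close> and 2 for \<open>Ginf\<close> over the visibility graph, hence 6. The
  induction for the factor 2 carries two estimates at once: a chain step may turn out of the cone of
  the pair, and is then bounded backwards in another cone by a sharper estimate, valid when one side
  of the segment is empty. Pairs are ordered by a size that is symmetric in its two points, since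
  steps are read in both directions.\<close>

fun polyarc :: "pt list \<Rightarrow> real \<Rightarrow> pt" where
  "polyarc (a # b # c # r) = linepath a b +++ polyarc (b # c # r)"
| "polyarc [a, b] = linepath a b"
| "polyarc _ = linepath 0 0"

lemma polyarc_start: "length ps \<ge> 2 \<Longrightarrow> pathstart (polyarc ps) = hd ps"
  by (induction ps rule: polyarc.induct) auto

lemma polyarc_finish: "length ps \<ge> 2 \<Longrightarrow> pathfinish (polyarc ps) = last ps"
  by (induction ps rule: polyarc.induct) auto

lemma polyarc_image:
  "length ps \<ge> 2 \<Longrightarrow>
     path_image (polyarc ps) = (\<Union>k<length ps - 1. closed_segment (ps ! k) (ps ! Suc k))"
proof (induction ps rule: polyarc.induct)
  case (1 a b c r)
  let ?ps = "b # c # r"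
  have e: "{..<length (a # ?ps) - 1} = insert 0 (Suc ` {..<length ?ps - 1})"
    by (auto simp: less_Suc_eq_0_disj image_iff lessThan_def)
  have "path_image (polyarc (a # ?ps)) = closed_segment a b \<union> path_image (polyarc ?ps)"
    by (simp add: path_image_join polyarc_start)
  also have "\<dots> = closed_segment a b \<union> (\<Union>k<length ?ps - 1. closed_segment (?ps ! k) (?ps ! Suc k))"
    using 1 by simp
  also have "\<dots> = (\<Union>k<length (a # ?ps) - 1. closed_segment ((a # ?ps) ! k) ((a # ?ps) ! Suc k))"
    unfolding e by simp
  finally show ?case .
qed auto

lemma arc_polyarc:
  assumes "length ps \<ge> 2" "distinct ps"
    and "\<And>k l. k < l \<Longrightarrow> Suc l < length ps \<Longrightarrow>
       closed_segment (ps ! k) (ps ! Suc k) \<inter> closed_segment (ps ! l) (ps ! Suc l)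
         \<subseteq> (if l = Suc k then {ps ! l} else {})"
  shows "arc (polyarc ps)"
  using assms
proof (induction ps rule: polyarc.induct)
  case (1 a b c r)
  let ?ps = "b # c # r"
  have arc: "arc (polyarc ?ps)"
  proof (rule "1.IH")
    show "distinct ?ps" "2 \<le> length ?ps" using "1.prems" by auto
    fix k l assume "k < l" "Suc l < length ?ps"
    then show "closed_segment (?ps ! k) (?ps ! Suc k) \<inter> closed_segment (?ps ! l) (?ps ! Suc l)
         \<subseteq> (if l = Suc k then {?ps ! l} else {})"
      using "1.prems"(3)[of "Suc k" "Suc l"] by (cases "l = Suc k") simp_all
  qed
  have "closed_segment a b \<inter> path_image (polyarc ?ps) \<subseteq> {b}"
  proof -
    have "closed_segment a b \<inter> closed_segment (?ps ! l) (?ps ! Suc l) \<subseteq> {b}"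
      if "l < length ?ps - 1" for l
    proof -
      have "closed_segment a b \<inter> closed_segment (?ps ! l) (?ps ! Suc l)
         \<subseteq> (if Suc l = Suc 0 then {(a # ?ps) ! Suc l} else {})"
        using "1.prems"(3)[of 0 "Suc l"] that by simp
      then show ?thesis by (auto split: if_splits)
    qed
    then show ?thesis by (subst polyarc_image) auto
  qed
  then show ?case
    using arc "1.prems"(2) by (simp del: polyarc.simps(2) add: arc_join polyarc_start)
qed auto

text \<open>The edges other than the closing one form an arc by \<open>arc_polyarc\<close>; the
  closing edge meets it only at its two ends, so the joined loop is a simple path.\<close>

lemma simple_polygon_loop:
  assumes "simple_polygon P"
  obtains g where "simple_path g" "pathfinish g = pathstart g" "path_image g = pbound P"
proof -
  define n where "n = length P"
  have n: "n \<ge> 3" and d: "distinct P" using assms by (auto simp: simple_polygon_def n_def)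
  have pe: "pedge P k \<inter> pedge P l =
        (if l = Suc k mod n then {P ! l} else if k = Suc l mod n then {P ! k} else {})"
    if "k < n" "l < n" "k \<noteq> l" for k l
    using assms that unfolding simple_polygon_def n_def by (auto split: if_splits)
  have pedge: "pedge P k = closed_segment (P ! k) (P ! Suc k)" if "Suc k < n" for k
    using that by (simp add: pedge_def n_def)
  have arc: "arc (polyarc P)"
  proof (rule arc_polyarc)
    show "2 \<le> length P" "distinct P" using n d by (auto simp: n_def)
    fix k l assume kl: "k < l" "Suc l < length P"
    then have "pedge P k \<inter> pedge P l = (if l = Suc k then {P ! l} else {})"
      using pe[of k l] by (simp add: n_def)
    then show "closed_segment (P ! k) (P ! Suc k) \<inter> closed_segment (P ! l) (P ! Suc l)
        \<subseteq> (if l = Suc k then {P ! l} else {})"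
      using kl pedge[of k] pedge[of l] by (simp add: n_def)
  qed
  have P0: "pathstart (polyarc P) = P ! 0" "pathfinish (polyarc P) = P ! (n - 1)"
    using n by (cases "P = []", auto simp: polyarc_start polyarc_finish n_def hd_conv_nth last_conv_nth)+
  have last: "pedge P (n - 1) = closed_segment (P ! (n - 1)) (P ! 0)"
    using n by (cases n) (simp_all add: pedge_def flip: n_def)
  have im: "path_image (polyarc P) = (\<Union>k<n - 1. pedge P k)"
    using n pedge by (subst polyarc_image) (auto simp: n_def)
  let ?g = "polyarc P +++ linepath (P ! (n - 1)) (P ! 0)"
  have "P ! (n - 1) \<noteq> P ! 0"
    using d n nth_eq_iff_index_eq[of P "n - 1" 0] by (cases "P = []") (simp_all add: n_def)
  have "path_image (polyarc P) \<inter> path_image (linepath (P ! (n - 1)) (P ! 0)) \<subseteq> {P ! 0, P ! (n - 1)}"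
  proof -
    have "pedge P k \<inter> pedge P (n - 1) \<subseteq> {P ! 0, P ! (n - 1)}" if "k < n - 1" for k
      using pe[of k "n - 1"] that n by (auto split: if_splits)
    then show ?thesis unfolding im using last by auto
  qed
  then have sp: "simple_path ?g"
    using arc P0 \<open>P ! (n - 1) \<noteq> P ! 0\<close> by (intro simple_path_join_loop) auto
  have "path_image ?g = (\<Union>k<n - 1. pedge P k) \<union> pedge P (n - 1)"
    using P0 im last by (simp add: path_image_join)
  also have "\<dots> = (\<Union>k\<in>insert (n - 1) {..<n - 1}. pedge P k)" by auto
  also have "insert (n - 1) {..<n - 1} = {..<n}" using n by auto
  also have "(\<Union>k<n. pedge P k) = pbound P" by (simp add: pbound_def n_def)
  finally have "path_image ?g = pbound P" .
  moreover have "pathfinish ?g = pathstart ?g" using P0 by simp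
  ultimately show ?thesis using sp that by blast
qed

text \<open>The Jordan curve theorem of the library is stated for the complex plane.\<close>
definition cplx :: "pt \<Rightarrow> complex" where "cplx p = Complex (fst p) (snd p)"

lemma linear_cplx: "linear cplx"
  by (rule linearI) (simp_all add: cplx_def complex_eq_iff)

lemma inj_cplx: "inj cplx"
  by (rule injI) (simp add: cplx_def complex_eq_iff prod_eq_iff)

lemma norm_cplx: "norm (cplx p) = norm p"
  by (simp add: cplx_def norm_prod_def cmod_def)

lemma surj_cplx: "surj cplx"
  unfolding cplx_def by (rule surjI[of _ "\<lambda>z. (Re z, Im z)"]) simp

lemma inv_cplx: "inv cplx = (\<lambda>z. (Re z, Im z))"
  using inj_cplx by (intro inv_unique_comp) (auto simp: cplx_def fun_eq_iff)

lemma linear_inv_cplx: "linear (inv cplx)"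
  unfolding inv_cplx by (rule linearI) auto

text \<open>\<open>cplx\<close> is a linear bijection with linear inverse, so connected sets
  correspond in both directions.\<close>

lemma connected_component_cplx:
  "connected_component_set (- (cplx ` S)) (cplx x) = cplx ` connected_component_set (- S) x"
proof -
  have compl: "- (cplx ` S) = cplx ` (- S)"
    using inj_cplx surj_cplx by (metis bij_def bij_image_Compl_eq)
  have 1: "connected (cplx ` T)" if "connected T" for T
    by (rule connected_linear_image[OF linear_cplx that])
  have 2: "connected (inv cplx ` T)" if "connected T" for T
    by (rule connected_linear_image[OF linear_inv_cplx that])
  show ?thesis
  proof (intro set_eqI iffI)
    fix z assume "z \<in> connected_component_set (- (cplx ` S)) (cplx x)"
    then obtain T where T: "connected T" "T \<subseteq> cplx ` (- S)" "cplx x \<in> T" "z \<in> T"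
      by (auto simp: connected_component_def compl)
    then have "inv cplx ` T \<subseteq> - S" using inj_cplx by (auto simp: inv_f_f)
    moreover have "x \<in> inv cplx ` T" using T(3) inj_cplx by (metis image_eqI inv_f_f)
    ultimately have "inv cplx z \<in> connected_component_set (- S) x"
      using 2[OF T(1)] T(4) by (auto simp: connected_component_def)
    then show "z \<in> cplx ` connected_component_set (- S) x"
      using surj_f_inv_f[OF surj_cplx, of z] by (metis image_eqI)
  next
    fix z assume "z \<in> cplx ` connected_component_set (- S) x"
    then obtain y T where "z = cplx y" "connected T" "T \<subseteq> - S" "x \<in> T" "y \<in> T"
      by (auto simp: connected_component_def)
    then show "z \<in> connected_component_set (- (cplx ` S)) (cplx x)"
      using 1[of T] unfolding connected_component_def compl by blast
  qed
qed

lemma inside_cplx: "inside (cplx ` S) = cplx ` inside S"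
proof -
  have b: "bounded (cplx ` T) \<longleftrightarrow> bounded T" for T
    by (simp add: bounded_iff norm_cplx)
  have iff: "cplx x \<in> inside (cplx ` S) \<longleftrightarrow> x \<in> inside S" for x
    unfolding inside_def using inj_cplx
    by (simp add: connected_component_cplx b inj_image_mem_iff)
  have "z \<in> inside (cplx ` S) \<longleftrightarrow> z \<in> cplx ` inside S" for z
  proof -
    obtain x where "z = cplx x" using surj_cplx by (metis surjD)
    then show ?thesis using iff inj_cplx by (simp add: inj_image_mem_iff)
  qed
  then show ?thesis by blast
qed

text \<open>By the Jordan curve theorem the frontier of the inside is the curve itself. Every
  boundary point of an obstacle can therefore be approached from its interior, which is why sight
  lines cannot cross obstacle edges.\<close>

lemma pbound_subset_closure_pinterior:
  assumes "simple_polygon P"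
  shows "pbound P \<subseteq> closure (pinterior P)"
proof -
  obtain g where g: "simple_path g" "pathfinish g = pathstart g" "path_image g = pbound P"
    using simple_polygon_loop[OF assms] .
  have "simple_path (cplx \<circ> g)"
    using g(1) linear_cplx inj_cplx by (simp add: simple_path_linear_image_eq)
  moreover have "pathfinish (cplx \<circ> g) = pathstart (cplx \<circ> g)"
    using g(2) by (simp add: pathfinish_def pathstart_def)
  ultimately have "frontier (inside (path_image (cplx \<circ> g))) = path_image (cplx \<circ> g)"
    using Jordan_inside_outside by blast
  then have "frontier (cplx ` pinterior P) = cplx ` pbound P"
    by (simp add: path_image_compose g(3) inside_cplx pinterior_def)
  then have "cplx ` pbound P \<subseteq> closure (cplx ` pinterior P)"
    by (auto simp: frontier_def)
  also have "closure (cplx ` pinterior P) = cplx ` closure (pinterior P)"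
    using linear_cplx inj_cplx by (simp add: closure_injective_linear_image)
  finally show ?thesis using inj_cplx by (simp add: inj_image_subset_iff)
qed

lemma compact_pedge: "compact (pedge P k)"
  by (simp add: pedge_def)

lemma compact_pbound: "compact (pbound P)"
  by (auto simp: pbound_def compact_pedge)

lemma open_pinterior: "open (pinterior P)"
  unfolding pinterior_def by (intro open_inside compact_imp_closed compact_pbound)

lemma pinterior_connected:
  assumes "connected C" "C \<inter> pbound P = {}" "C \<inter> pinterior P \<noteq> {}"
  shows "C \<subseteq> pinterior P"
proof -
  obtain x where x: "x \<in> C" "x \<in> inside (pbound P)" using assms by (auto simp: pinterior_def)
  show ?thesis
  proof
    fix y assume "y \<in> C"
    then have "connected_component (- pbound P) x y"
      using assms x by (auto simp: connected_component_def)
    then show "y \<in> pinterior P"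
      unfolding pinterior_def using x(2) inside_same_component by blast
  qed
qed

section \<open>Obstacles and visibility\<close>

lemma cross2_simps:
  "cross2 (a + b) c = cross2 a c + cross2 b c" "cross2 a (b + c) = cross2 a b + cross2 a c"
  "cross2 (a - b) c = cross2 a c - cross2 b c" "cross2 a (b - c) = cross2 a b - cross2 a c"
  "cross2 (- a) c = - cross2 a c" "cross2 a (- c) = - cross2 a c"
  "cross2 (x *\<^sub>R a) c = x * cross2 a c" "cross2 a (x *\<^sub>R c) = x * cross2 a c"
  "cross2 a a = 0" "cross2 0 a = 0" "cross2 a 0 = 0"
  by (simp_all add: cross2_def algebra_simps)

lemma cross2_commute: "cross2 a b = - cross2 b a"
  by (simp add: cross2_def)

text \<open>The linear relation between three plane vectors, paired with \<open>d\<close>. When all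
  three have a positive product with \<open>d\<close>, it makes their angular order
  transitive.\<close>

lemma cross2_plucker:
  fixes a b v d :: pt
  shows "cross2 v b * (a \<bullet> d) = cross2 v a * (b \<bullet> d) + cross2 a b * (v \<bullet> d)"
  by (simp add: cross2_def inner_prod_def algebra_simps)

lemma cross2_basis:
  assumes "cross2 a b \<noteq> 0"
  shows "p = (cross2 p b / cross2 a b) *\<^sub>R a + (cross2 a p / cross2 a b) *\<^sub>R b"
proof -
  have "cross2 a b *\<^sub>R p = cross2 p b *\<^sub>R a + cross2 a p *\<^sub>R b"
    by (simp add: prod_eq_iff cross2_def algebra_simps)
  then have "(1 / cross2 a b) *\<^sub>R (cross2 a b *\<^sub>R p)
      = (1 / cross2 a b) *\<^sub>R (cross2 p b *\<^sub>R a + cross2 a p *\<^sub>R b)" by simp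
  then show ?thesis using assms by (simp add: scaleR_add_right)
qed

definition obs :: "pt list set \<Rightarrow> pt set" where "obs S = (\<Union>P\<in>S. pinterior P)"
definition bd :: "pt list set \<Rightarrow> pt set" where "bd S = (\<Union>P\<in>S. pbound P)"

lemma visible_iff: "visible S p q \<longleftrightarrow> closed_segment p q \<inter> obs S = {}"
  by (auto simp: visible_def obs_def)

lemma visible_commute: "visible S p q \<longleftrightarrow> visible S q p"
  by (simp add: visible_iff closed_segment_commute)

text \<open>An obstacle edge may run along the segment, but may not cross it.\<close>
definition clear :: "pt list set \<Rightarrow> pt \<Rightarrow> pt \<Rightarrow> bool" where
  "clear S a b \<longleftrightarrow> (\<forall>P\<in>S. \<forall>k<length P. \<forall>p\<in>open_segment a b \<inter> pedge P k.
      cross2 (P ! (Suc k mod length P) - P ! k) (b - a) = 0)"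

text \<open>Obstacle-free near the apex only: distinguishes the two sides of an obstacle splitting a cone.\<close>
definition secfree :: "pt list set \<Rightarrow> pt \<Rightarrow> pt \<Rightarrow> pt \<Rightarrow> bool" where
  "secfree S x u q \<longleftrightarrow> (\<exists>e>0. \<forall>s t. 0 < s \<longrightarrow> s < e \<longrightarrow> 0 < t \<longrightarrow> t < e \<longrightarrow>
      x + s *\<^sub>R (u - x) + t *\<^sub>R (q - x) \<notin> obs S)"

lemma secfree_commute: "secfree S x u q \<longleftrightarrow> secfree S x q u"
proof -
  have e: "x + s *\<^sub>R (u - x) + t *\<^sub>R (q - x) = x + t *\<^sub>R (q - x) + s *\<^sub>R (u - x)" for s t by simp
  show ?thesis unfolding secfree_def e by metis
qed

locale setting =
  fixes V :: "pt set" and S :: "pt list set"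
  assumes valid: "valid_setting V S" and gp: "general_position V"
begin

lemma finV: "finite V" and finS: "finite S"
  using valid by (auto simp: valid_setting_def)

lemma polyS: "P \<in> S \<Longrightarrow> simple_polygon P" and setS: "P \<in> S \<Longrightarrow> set P \<subseteq> V"
  using valid by (auto simp: valid_setting_def)

lemma disjS: "P \<in> S \<Longrightarrow> Q \<in> S \<Longrightarrow> x \<in> pregion P \<Longrightarrow> x \<in> pregion Q \<Longrightarrow> P = Q"
  using valid unfolding valid_setting_def by blast

lemma lenS: "P \<in> S \<Longrightarrow> length P \<ge> 3" and distS: "P \<in> S \<Longrightarrow> distinct P"
  using polyS by (auto simp: simple_polygon_def)

lemma nth_mem_V: "P \<in> S \<Longrightarrow> P ! (k mod length P) \<in> V"
proof -
  assume P: "P \<in> S"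
  then have "length P > 0" using lenS[of P] by linarith
  then have "P ! (k mod length P) \<in> set P" by simp
  then show ?thesis using setS[OF P] by blast
qed

lemma nth_mem_V': "P \<in> S \<Longrightarrow> k < length P \<Longrightarrow> P ! k \<in> V"
  using setS by fastforce

lemma pedge_Int:
  assumes "P \<in> S" "k < length P" "l < length P" "k \<noteq> l"
  shows "pedge P k \<inter> pedge P l =
    (if l = Suc k mod length P then {P ! l} else if k = Suc l mod length P then {P ! k} else {})"
proof -
  have "\<forall>k<length P. \<forall>l<length P. k \<noteq> l \<longrightarrow>
        (if l = Suc k mod length P then pedge P k \<inter> pedge P l = {P ! l}
         else if k = Suc l mod length P then pedge P k \<inter> pedge P l = {P ! k}
         else pedge P k \<inter> pedge P l = {})"
    using polyS[OF assms(1)] unfolding simple_polygon_def by blast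
  then have "if l = Suc k mod length P then pedge P k \<inter> pedge P l = {P ! l}
         else if k = Suc l mod length P then pedge P k \<inter> pedge P l = {P ! k}
         else pedge P k \<inter> pedge P l = {}"
    using assms by blast
  then show ?thesis by presburger
qed

lemma not_collinear:
  "p \<in> V \<Longrightarrow> q \<in> V \<Longrightarrow> r \<in> V \<Longrightarrow> p \<noteq> q \<Longrightarrow> p \<noteq> r \<Longrightarrow> q \<noteq> r \<Longrightarrow> cross2 (q - p) (r - p) \<noteq> 0"
  using gp by (simp add: general_position_def)

lemma not_in_segment:
  assumes "p \<in> V" "q \<in> V" "r \<in> V" "r \<in> closed_segment p q"
  shows "r = p \<or> r = q"
proof (rule ccontr)
  assume n: "\<not> (r = p \<or> r = q)"
  obtain t where t: "r = (1 - t) *\<^sub>R p + t *\<^sub>R q" using assms by (auto simp: in_segment)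
  have "r - p = t *\<^sub>R (q - p)" unfolding t by (simp add: algebra_simps)
  then have "cross2 (q - p) (r - p) = 0" by (simp add: cross2_simps)
  moreover have "p \<noteq> q" using n assms(4) by auto
  ultimately show False using not_collinear n assms by metis
qed

lemma open_obs: "open (obs S)"
  by (auto simp: obs_def open_pinterior)

lemma closed_bd: "closed (bd S)"
  unfolding bd_def using finS by (intro closed_UN) (auto intro: compact_imp_closed compact_pbound)

lemma bd_obs_disjoint: "bd S \<inter> obs S = {}"
proof -
  have "pbound P \<inter> pinterior Q = {}" if "P \<in> S" "Q \<in> S" for P Q
  proof (cases "P = Q")
    case True then show ?thesis
      by (metis inf_commute inside_no_overlap pinterior_def)
  next
    case False then show ?thesis using disjS[OF that] by (auto simp: pregion_def)
  qed
  then show ?thesis by (auto simp: obs_def bd_def)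
qed

lemma bd_closure_obs: "bd S \<subseteq> closure (obs S)"
proof -
  have "pbound P \<subseteq> closure (obs S)" if "P \<in> S" for P
  proof -
    have "pinterior P \<subseteq> obs S" using that by (auto simp: obs_def)
    then show ?thesis using pbound_subset_closure_pinterior[OF polyS[OF that]] closure_mono by blast
  qed
  then show ?thesis by (auto simp: bd_def)
qed

lemma convex_obs:
  assumes "convex C" "C \<inter> bd S = {}" "C \<inter> obs S \<noteq> {}"
  shows "\<exists>P\<in>S. C \<subseteq> pinterior P" "C \<subseteq> obs S"
proof -
  obtain P where P: "P \<in> S" "C \<inter> pinterior P \<noteq> {}" using assms(3) by (auto simp: obs_def)
  then have "C \<inter> pbound P = {}" using assms(2) by (auto simp: bd_def)
  then have "C \<subseteq> pinterior P" using pinterior_connected convex_connected assms(1) P by blast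
  then show "\<exists>P\<in>S. C \<subseteq> pinterior P" "C \<subseteq> obs S" using P by (auto simp: obs_def)
qed

lemma bd_local:
  obtains e where "e > 0" "\<And>P k. P \<in> S \<Longrightarrow> k < length P \<Longrightarrow> p \<notin> pedge P k \<Longrightarrow> ball p e \<inter> pedge P k = {}"
proof -
  let ?U = "\<Union>P\<in>S. \<Union>k\<in>{k. k < length P \<and> p \<notin> pedge P k}. pedge P k"
  have "closed ?U"
    using finS by (intro closed_UN ballI) (simp_all add: compact_imp_closed compact_pedge)
  moreover have "p \<in> - ?U" by auto
  ultimately obtain e where e: "e > 0" "ball p e \<subseteq> - ?U" by (meson open_Compl openE)
  show ?thesis
  proof (rule that[OF e(1)])
    fix P k assume "P \<in> S" "k < length P" "p \<notin> pedge P k"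
    then have "pedge P k \<subseteq> ?U" by blast
    then show "ball p e \<inter> pedge P k = {}" using e(2) by blast
  qed
qed

text \<open>Suppose an edge meets the segment transversally at \<open>p\<close>. As \<open>p\<close>
  is not a vertex, this edge is the only piece of boundary near \<open>p\<close>. Obstacle points
  occur arbitrarily close to \<open>p\<close>, so one of the two half discs cut off by the edge lies
  in the obstacles; but the segment enters both.\<close>

lemma visible_clear_gen:
  assumes free: "closed_segment a b \<inter> obs S = {}" and noV: "open_segment a b \<inter> V = {}"
  shows "clear S a b"
  unfolding clear_def
proof (intro ballI allI impI, rule ccontr)
  fix P k p
  assume P: "P \<in> S" and k: "k < length P" and p: "p \<in> open_segment a b \<inter> pedge P k"
  let ?e = "P ! k" and ?f = "P ! (Suc k mod length P)"
  assume nz: "cross2 (?f - ?e) (b - a) \<noteq> 0"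
  have eV: "?e \<in> V" "?f \<in> V" using P k nth_mem_V' nth_mem_V by auto
  then have pV: "p \<notin> V" using p noV by auto
  obtain e where e: "e > 0" "\<And>Q l. Q \<in> S \<Longrightarrow> l < length Q \<Longrightarrow> p \<notin> pedge Q l \<Longrightarrow> ball p e \<inter> pedge Q l = {}"
    using bd_local[of p] by metis
  have only: "Q = P \<and> l = k" if "Q \<in> S" "l < length Q" "p \<in> pedge Q l" for Q l
  proof -
    have "p \<in> pregion Q" "p \<in> pregion P" using that p k by (auto simp: pregion_def pbound_def)
    then have Q: "Q = P" using disjS that P by blast
    have "l = k"
    proof (rule ccontr)
      assume "l \<noteq> k"
      then have "pedge P k \<inter> pedge P l \<subseteq> {P ! l, P ! k}"
        using pedge_Int[OF P k, of l] that(2) Q by (simp split: if_splits)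
      then have "p = P ! l \<or> p = P ! k" using p that Q by blast
      then show False using pV nth_mem_V' P k that Q by auto
    qed
    with Q show ?thesis by simp
  qed
  define g where "g y = cross2 (?f - ?e) (y - p)" for y
  have gline: "g y = 0" if "y \<in> pedge P k" for y
  proof -
    have "y \<in> closed_segment ?e ?f" "p \<in> closed_segment ?e ?f" using that p by (simp_all add: pedge_def)
    then obtain s t where "y = (1 - s) *\<^sub>R ?e + s *\<^sub>R ?f" "p = (1 - t) *\<^sub>R ?e + t *\<^sub>R ?f"
      unfolding in_segment by blast
    then have "y - p = (s - t) *\<^sub>R (?f - ?e)"
      by (simp only:) (simp add: algebra_simps)
    then show ?thesis by (simp add: g_def cross2_simps)
  qed
  have bdg: "g y = 0" if y: "y \<in> ball p e" "y \<in> bd S" for y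
  proof -
    obtain Q l where Ql: "Q \<in> S" "l < length Q" "y \<in> pedge Q l"
      using y(2) unfolding bd_def pbound_def by blast
    have "p \<in> pedge Q l" using e(2)[OF Ql(1,2)] y(1) Ql(3) by blast
    then show ?thesis using only[OF Ql(1,2)] gline Ql(3) by blast
  qed
  have pbd: "p \<in> bd S" using p P k by (auto simp: bd_def pbound_def)
  then have "p \<in> closure (obs S)" using bd_closure_obs by blast
  then obtain z where z: "z \<in> obs S" "z \<in> ball p e"
    using e(1) by (metis closure_approachable mem_ball dist_commute)
  obtain z' where z': "z' \<in> obs S" "z' \<in> ball p e" "g z' \<noteq> 0"
  proof (cases "g z = 0")
    case False then show ?thesis using that z by blast
  next
    case True
    have "open (obs S \<inter> ball p e)" using open_obs by auto
    then obtain d where d: "d > 0" "ball z d \<subseteq> obs S \<inter> ball p e" using z open_contains_ball by (metis IntI)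
    define w where "w = z + (d / 2 / norm (b - a)) *\<^sub>R (b - a)"
    have ba: "norm (b - a) \<noteq> 0" using nz by (auto simp: cross2_simps)
    have "dist z w = d / 2" using ba d(1) by (simp add: w_def dist_norm)
    then have "w \<in> ball z d" using d(1) by simp
    moreover have "g w = g z + (d / 2 / norm (b - a)) * cross2 (?f - ?e) (b - a)"
      by (simp add: g_def w_def cross2_simps)
    then have "g w \<noteq> 0" using True nz ba d(1) by simp
    ultimately show ?thesis using that d(2) by blast
  qed
  \<comment> \<open>The half disc on the side of \<open>z'\<close> is convex and free of boundary,
    so it lies entirely in the obstacles.\<close>
  let ?H = "{y \<in> ball p e. g y * g z' > 0}"
  have "convex ?H"
  proof -
    have "?H = ball p e \<inter> {y. (g z' *\<^sub>R (- (snd (?f - ?e)), fst (?f - ?e))) \<bullet> y > g z' * cross2 (?f - ?e) p}"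
      by (auto simp: g_def cross2_def inner_prod_def algebra_simps)
    then show ?thesis by (simp add: convex_Int convex_halfspace_gt)
  qed
  moreover have "?H \<inter> bd S = {}" using bdg by auto
  moreover have "z' \<in> ?H \<inter> obs S" using z' by (auto simp: zero_less_mult_iff)
  ultimately have Hobs: "?H \<subseteq> obs S" using convex_obs(2) by blast
  obtain t where t: "0 < t" "t < 1" "p = (1 - t) *\<^sub>R a + t *\<^sub>R b" using p by (auto simp: in_segment)
  \<comment> \<open>The sign \<sigma> is the direction along the segment that leads from
    \<open>p\<close> into \<open>?H\<close>.\<close>
  define \<sigma> :: real where "\<sigma> = sgn (cross2 (?f - ?e) (b - a) * g z')"
  define s where "s = min (min t (1 - t)) (e / 2 / norm (b - a))"
  have ba: "norm (b - a) > 0" using nz by (auto simp: cross2_simps)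
  have s: "s > 0" using t ba e(1) by (simp add: s_def)
  have sg: "\<bar>\<sigma>\<bar> = 1" using nz z'(3) by (simp add: \<sigma>_def abs_sgn_eq)
  define y where "y = p + (\<sigma> * s) *\<^sub>R (b - a)"
  have "y = (1 - (t + \<sigma> * s)) *\<^sub>R a + (t + \<sigma> * s) *\<^sub>R b" unfolding y_def t(3) by (simp add: algebra_simps)
  moreover have "s \<le> t" "s \<le> 1 - t" "\<bar>\<sigma> * s\<bar> = s" using s sg by (simp_all add: s_def abs_mult)
  then have "0 \<le> t + \<sigma> * s" "t + \<sigma> * s \<le> 1" by linarith+
  ultimately have yab: "y \<in> closed_segment a b" by (auto simp: in_segment)
  have "norm ((\<sigma> * s) *\<^sub>R (b - a)) = s * norm (b - a)" using sg s by (simp add: abs_mult)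
  also have "\<dots> \<le> (e / 2 / norm (b - a)) * norm (b - a)"
    by (intro mult_right_mono) (auto simp: s_def)
  also have "\<dots> < e" using ba e(1) by simp
  finally have "y \<in> ball p e" by (simp add: y_def dist_norm)
  moreover have "g y = \<sigma> * s * cross2 (?f - ?e) (b - a)" by (simp add: g_def y_def cross2_simps)
  then have "g y * g z' = (\<sigma> * (cross2 (?f - ?e) (b - a) * g z')) * s" by (simp only: mult_ac)
  then have "g y * g z' = \<bar>cross2 (?f - ?e) (b - a) * g z'\<bar> * s"
    by (metis \<sigma>_def abs_sgn mult.commute)
  then have "g y * g z' > 0" using nz z'(3) s by simp
  ultimately have "y \<in> obs S" using Hobs by blast
  then show False using yab free by blast
qed

lemma visible_clear:
  assumes "a \<in> V" "b \<in> V" "visible S a b"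
  shows "clear S a b"
proof (rule visible_clear_gen)
  show "closed_segment a b \<inter> obs S = {}" using assms(3) by (simp add: visible_iff)
  show "open_segment a b \<inter> V = {}" using not_in_segment assms unfolding open_segment_def by blast
qed

lemma clear_sub:
  assumes "clear S a b" "c \<in> closed_segment a b" "d \<in> closed_segment a b"
  shows "clear S c d"
proof -
  have sub: "open_segment c d \<subseteq> open_segment a b" using assms
    by (simp add: subset_open_segment)
  obtain s t where st: "c = (1 - s) *\<^sub>R a + s *\<^sub>R b" "d = (1 - t) *\<^sub>R a + t *\<^sub>R b"
    using assms by (auto simp: in_segment)
  have "d - c = (t - s) *\<^sub>R (b - a)" unfolding st by (simp add: algebra_simps)
  then have "cross2 x (d - c) = (t - s) * cross2 x (b - a)" for x by (simp add: cross2_simps)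
  moreover have "cross2 (P ! (Suc k mod length P) - P ! k) (b - a) = 0"
    if "P \<in> S" "k < length P" "p \<in> open_segment c d \<inter> pedge P k" for P k p
    using assms(1) sub that unfolding clear_def by blast
  ultimately show ?thesis unfolding clear_def by simp
qed

end

section \<open>Empty triangles\<close>

definition freetri :: "pt set \<Rightarrow> pt list set \<Rightarrow> pt \<Rightarrow> pt \<Rightarrow> pt \<Rightarrow> bool" where
  "freetri V S a b c \<longleftrightarrow> convex hull {a, b, c} \<inter> obs S = {} \<and> V \<inter> convex hull {a, b, c} \<subseteq> {a, b, c}"

lemma in_hull3:
  fixes o' v w p :: pt
  shows "p \<in> convex hull {o', v, w} \<longleftrightarrow>
    (\<exists>\<alpha> \<beta>. 0 \<le> \<alpha> \<and> 0 \<le> \<beta> \<and> \<alpha> + \<beta> \<le> 1 \<and> p = o' + \<alpha> *\<^sub>R (v - o') + \<beta> *\<^sub>R (w - o'))"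
  (is "_ \<longleftrightarrow> ?R")
proof
  assume "p \<in> convex hull {o', v, w}"
  then obtain x y z where "0 \<le> x" "0 \<le> y" "0 \<le> z" "x + y + z = 1" "p = x *\<^sub>R o' + y *\<^sub>R v + z *\<^sub>R w"
    unfolding convex_hull_3 by blast
  moreover from this have "x = 1 - y - z" by linarith
  then have "x *\<^sub>R o' + y *\<^sub>R v + z *\<^sub>R w = o' + y *\<^sub>R (v - o') + z *\<^sub>R (w - o')"
    by (simp only:) (simp add: algebra_simps)
  ultimately show ?R by (intro exI[of _ y] exI[of _ z]) auto
next
  assume ?R
  then obtain \<alpha> \<beta> where "0 \<le> \<alpha>" "0 \<le> \<beta>" "\<alpha> + \<beta> \<le> 1" "p = o' + \<alpha> *\<^sub>R (v - o') + \<beta> *\<^sub>R (w - o')"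
    by blast
  then show "p \<in> convex hull {o', v, w}"
    unfolding convex_hull_3
    by (intro CollectI exI[of _ "1 - \<alpha> - \<beta>"] exI[of _ \<alpha>] exI[of _ \<beta>]) (auto simp: algebra_simps)
qed

lemma small_scale:
  fixes x y e :: real
  assumes "x \<ge> 0" "y \<ge> 0" "e > 0"
  obtains k where "0 < k" "k \<le> 1/2" "k * x < e" "k * y < e"
proof -
  let ?m = "x + y + 1"
  define k where "k = min (1/2) (e / (2 * ?m))"
  have m: "?m > 0" using assms by linarith
  have k0: "0 < e / (2 * ?m)" using m assms by simp
  have "0 < k" using k0 unfolding k_def by linarith
  moreover have "k \<le> 1/2" "k \<le> e / (2 * ?m)" unfolding k_def by (rule min.cobounded1, rule min.cobounded2)
  ultimately have k: "0 < k" "k \<le> 1/2" "k \<le> e / (2 * ?m)" by blast+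
  have "k * ?m \<le> e / (2 * ?m) * ?m" using k m by (intro mult_right_mono) linarith+
  also have "e / (2 * ?m) * ?m = e / 2" using m by (simp add: field_simps)
  finally have km: "k * ?m \<le> e / 2" .
  have "k * x \<le> k * ?m" "k * y \<le> k * ?m" using k assms by (intro mult_left_mono; linarith)+
  then have "k * x < e" "k * y < e" using km assms by linarith+
  then show ?thesis using that[of k] k by blast
qed

text \<open>The three affine functions serve as barycentric coordinates along a segment that leaves
  an open triangle; a zero of their minimum, found by the intermediate value theorem, is a point
  where it meets the boundary of the triangle.\<close>

lemma min3_first_zero:
  fixes a0 b0 c0 a1 b1 c1 :: real
  assumes pos: "a0 > 0" "b0 > 0" "c0 > 0" and "a1 \<le> 0 \<or> b1 \<le> 0 \<or> c1 \<le> 0"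
  obtains t where "0 < t" "t \<le> 1" "a0 + t * (a1 - a0) \<ge> 0" "b0 + t * (b1 - b0) \<ge> 0" "c0 + t * (c1 - c0) \<ge> 0"
    "a0 + t * (a1 - a0) = 0 \<or> b0 + t * (b1 - b0) = 0 \<or> c0 + t * (c1 - c0) = 0"
proof -
  define m where "m t = min (a0 + t * (a1 - a0)) (min (b0 + t * (b1 - b0)) (c0 + t * (c1 - c0)))" for t
  have "continuous_on {0..1} m" unfolding m_def by (intro continuous_intros)
  moreover have "m 0 > 0" "m 1 \<le> 0" using assms by (auto simp: m_def min_def)
  ultimately obtain t where t: "0 \<le> t" "t \<le> 1" "m t = 0"
    using IVT2'[of m 1 0 0] by auto
  then have "t \<noteq> 0" using \<open>m 0 > 0\<close> by auto
  then show ?thesis using that[of t] t unfolding m_def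
    by (smt (verit) t)
qed

context setting
begin

text \<open>Turn a ray about \<open>v\<close>, starting from the direction of \<open>o'\<close>; the
  first vertex met is \<open>q\<close>. The region \<open>R\<close> cut off by the line through
  \<open>v\<close> and \<open>q\<close> contains no vertex. An obstacle edge through a point of
  \<open>R\<close> has to leave \<open>R\<close> towards both of its ends: \<open>clear\<close>
  forbids the sides along \<open>o' v\<close> and \<open>o' w\<close>, \<open>secfree\<close>
  forbids the corner \<open>o'\<close>, and the third side cannot be crossed twice. So
  \<open>R\<close> misses all boundaries, and then all obstacles because \<open>secfree\<close>
  provides a free point. The points \<open>o'\<close> and \<open>w\<close> may be arbitrary. The
  last conjunct records the minimality of \<open>q\<close> for gift wrapping.\<close>

lemma adjacent_vertex_min:
  fixes o' v w z
  assumes v: "v \<in> V" and nz: "cross2 (v - o') (w - o') \<noteq> 0"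
    and cv: "clear S o' v" and cw: "clear S o' w" and sf: "secfree S o' v w"
    and noV: "V \<inter> closed_segment o' v \<subseteq> {o', v}"
    and z: "z \<in> V" "z \<in> convex hull {o', v, w}" "z \<noteq> o'" "z \<noteq> v"
  obtains q where "q \<in> V" "q \<in> convex hull {o', v, w}" "q \<noteq> o'" "q \<noteq> v" "freetri V S o' v q"
    "\<exists>\<alpha> \<beta>. 0 \<le> \<alpha> \<and> \<alpha> < 1 \<and> 0 < \<beta> \<and> q - o' = \<alpha> *\<^sub>R (v - o') + \<beta> *\<^sub>R (w - o') \<and>
       (\<forall>a b. 0 \<le> a \<longrightarrow> 0 \<le> b \<longrightarrow> a + b \<le> 1 \<longrightarrow> o' + a *\<^sub>R (v - o') + b *\<^sub>R (w - o') \<in> V - {o', v} \<longrightarrow> \<beta> * (1 - a) \<le> b * (1 - \<alpha>))"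
proof -
  define D where "D = cross2 (v - o') (w - o')"
  define A where "A p = cross2 (p - o') (w - o') / D" for p
  define B where "B p = cross2 (v - o') (p - o') / D" for p
  have D: "D \<noteq> 0" using nz by (simp add: D_def)
  have rep: "p = o' + A p *\<^sub>R (v - o') + B p *\<^sub>R (w - o')" for p
    using cross2_basis[OF nz, of "p - o'"] by (simp add: A_def B_def D_def algebra_simps)
  have AB: "A (o' + \<alpha> *\<^sub>R (v - o') + \<beta> *\<^sub>R (w - o')) = \<alpha>" "B (o' + \<alpha> *\<^sub>R (v - o') + \<beta> *\<^sub>R (w - o')) = \<beta>" for \<alpha> \<beta>
  proof -
    let ?p = "o' + \<alpha> *\<^sub>R (v - o') + \<beta> *\<^sub>R (w - o')"
    have "?p - o' = \<alpha> *\<^sub>R (v - o') + \<beta> *\<^sub>R (w - o')" by simp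
    then have "cross2 (?p - o') (w - o') = \<alpha> * D" "cross2 (v - o') (?p - o') = \<beta> * D"
      by (simp_all only: cross2_simps(1,2,7,8,9) D_def mult_zero_right add_0_right add_0_left)
    then show "A ?p = \<alpha>" "B ?p = \<beta>" using D by (simp_all add: A_def B_def)
  qed
  have hull: "p \<in> convex hull {o', v, w} \<longleftrightarrow> 0 \<le> A p \<and> 0 \<le> B p \<and> A p + B p \<le> 1" for p
    unfolding in_hull3 using rep[of p] AB by metis
  have lin: "A (x + t *\<^sub>R (y - x)) = A x + t * (A y - A x)" "B (x + t *\<^sub>R (y - x)) = B x + t * (B y - B x)" for x y t
    by (simp_all add: A_def B_def cross2_simps algebra_simps add_divide_distrib diff_divide_distrib)
  have AB_o: "A o' = 0" "B o' = 0" and AB_v: "A v = 1" "B v = 0"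
    using D by (simp_all add: A_def B_def cross2_simps D_def)
  have eqI: "p = p'" if "A p = A p'" "B p = B p'" for p p'
    using rep[of p] rep[of p'] that by simp
  have Bpos: "B p > 0 \<and> A p < 1" if p: "p \<in> V" "p \<in> convex hull {o', v, w}" "p \<noteq> o'" "p \<noteq> v" for p
  proof (rule ccontr)
    assume "\<not> ?thesis"
    moreover have "0 \<le> A p" "0 \<le> B p" "A p + B p \<le> 1" using p hull by auto
    ultimately have B0: "B p = 0" "0 \<le> A p" "A p \<le> 1" by linarith+
    then have "p = (1 - A p) *\<^sub>R o' + A p *\<^sub>R v" using rep[of p] by (simp add: algebra_simps)
    then have "p \<in> closed_segment o' v" unfolding in_segment using B0 by blast
    then show False using noV p by blast
  qed
  define Z where "Z = V \<inter> convex hull {o', v, w} - {o', v}"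
  have Z: "finite Z" "Z \<noteq> {}" using finV z by (auto simp: Z_def)
  \<comment> \<open>With \<open>A\<close>, \<open>B\<close> the coordinates along
    \<open>v - o'\<close> and \<open>w - o'\<close>, this is the slope of the ray from
    \<open>v\<close> to \<open>p\<close>; its minimum is the first vertex met by the turning
    ray.\<close>
  define g where "g p = B p / (1 - A p)" for p
  define q where "q = arg_min_on g Z"
  have qZ: "q \<in> Z" and gmin: "\<And>p. p \<in> Z \<Longrightarrow> g q \<le> g p"
    unfolding q_def using arg_min_if_finite[OF Z, of g] arg_min_least[OF Z] by auto
  have q: "q \<in> V" "q \<in> convex hull {o', v, w}" "q \<noteq> o'" "q \<noteq> v" using qZ by (auto simp: Z_def)
  have qAB: "0 \<le> A q" "B q > 0" "A q < 1" "A q + B q \<le> 1" using Bpos[OF q] q(2) hull by auto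
  define G where "G = g q"
  have G: "0 < G" "G \<le> 1" "B q = G * (1 - A q)" using qAB by (auto simp: G_def g_def)
  \<comment> \<open>\<open>C\<close> is affine, vanishes on the line through \<open>v\<close> and
    \<open>q\<close>, and is positive at \<open>o'\<close>.\<close>
  define C where "C p = G * (1 - A p) - B p" for p
  have linC: "C (x + t *\<^sub>R (y - x)) = C x + t * (C y - C x)" for x y t
    unfolding C_def lin by (simp add: algebra_simps)
  define R where "R = {p. 0 < A p \<and> 0 < B p \<and> 0 < C p}"
  have VR: "p = o' \<or> p = v \<or> p = q" if p: "p \<in> V" "0 \<le> A p" "0 \<le> B p" "0 \<le> C p" for p
  proof (rule ccontr)
    assume n: "\<not> ?thesis"
    have "A p \<le> 1" using p(3,4) G(1) by (simp add: C_def) (smt (verit) mult_pos_neg)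
    then have "G * (1 - A p) \<le> 1 - A p" using G(2) by (simp add: mult_left_le_one_le G(1) less_imp_le)
    then have ph: "p \<in> convex hull {o', v, w}" using p hull by (simp add: C_def)
    then have pB: "B p > 0" "A p < 1" using Bpos p(1) n by auto
    then have "g p \<le> G" using p(4) by (simp add: g_def C_def field_simps)
    moreover have "G \<le> g p" using gmin ph p(1) n by (simp add: Z_def G_def)
    ultimately have Bp: "B p = G * (1 - A p)" using pB by (simp add: g_def field_simps)
    have pv: "p - v = (A p - 1) *\<^sub>R ((v - o') - G *\<^sub>R (w - o'))"
      by (subst rep[of p]) (simp add: Bp algebra_simps)
    have qv: "q - v = (A q - 1) *\<^sub>R ((v - o') - G *\<^sub>R (w - o'))"
      by (subst rep[of q]) (simp add: G(3) algebra_simps)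
    have "cross2 (p - v) (q - v) = 0" unfolding pv qv by (simp only: cross2_simps(7,8,9) mult_zero_right)
    then show False using not_collinear[of v p q] v p(1) q n by auto
  qed
  have segR: False if rC: "r \<in> R" "r \<in> pedge P k" "P \<in> S" "k < length P" for r P k
  proof -
    define e where "e = P ! k"
    define f where "f = P ! (Suc k mod length P)"
    have ef: "pedge P k = closed_segment e f" by (simp add: e_def f_def pedge_def)
    have efV: "e \<in> V" "f \<in> V" using rC nth_mem_V nth_mem_V' by (auto simp: e_def f_def)
    have r: "A r > 0" "B r > 0" "C r > 0" using rC by (auto simp: R_def)
    have key: "\<exists>t>0. C (r + t *\<^sub>R (x - r)) = 0"
      if x: "x = e \<or> x = f" for x
    proof -
      have "A x \<le> 0 \<or> B x \<le> 0 \<or> C x \<le> 0"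
      proof (rule ccontr)
        assume n: "\<not> ?thesis"
        then have "x = o' \<or> x = v \<or> x = q" using VR[of x] x efV by auto
        then show False using n AB_o AB_v G(3) by (auto simp: C_def)
      qed
      then obtain t where t: "0 < t" "t \<le> 1" "A r + t * (A x - A r) \<ge> 0" "B r + t * (B x - B r) \<ge> 0"
          "C r + t * (C x - C r) \<ge> 0"
          "A r + t * (A x - A r) = 0 \<or> B r + t * (B x - B r) = 0 \<or> C r + t * (C x - C r) = 0"
        using min3_first_zero[OF r] by blast
      define p where "p = r + t *\<^sub>R (x - r)"
      have pc: "A p \<ge> 0" "B p \<ge> 0" "C p \<ge> 0" "A p = 0 \<or> B p = 0 \<or> C p = 0"
        using t by (auto simp: p_def lin linC)
      have "p \<in> closed_segment r x" using t by (auto simp: p_def in_segment algebra_simps intro!: exI[of _ t])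
      moreover have "closed_segment r x \<subseteq> closed_segment e f"
        using rC(2) x ef by (auto simp: subset_closed_segment)
      ultimately have pe: "p \<in> pedge P k" using ef by blast
      obtain s1 s2 where s12: "r = (1 - s1) *\<^sub>R e + s1 *\<^sub>R f" "p = (1 - s2) *\<^sub>R e + s2 *\<^sub>R f"
        using rC(2) pe unfolding ef in_segment by blast
      then have rp: "r - p = (s1 - s2) *\<^sub>R (f - e)" by (simp only:) (simp add: algebra_simps)
      have no: "p \<noteq> o'"
      proof
        assume po: "p = o'"
        obtain \<epsilon> where \<epsilon>: "\<epsilon> > 0" "\<And>s t. 0 < s \<Longrightarrow> s < \<epsilon> \<Longrightarrow> 0 < t \<Longrightarrow> t < \<epsilon> \<Longrightarrow> o' + s *\<^sub>R (v - o') + t *\<^sub>R (w - o') \<notin> obs S"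
          using sf unfolding secfree_def by blast
        obtain m where m: "0 < m" "m \<le> 1/2" "m * A r < \<epsilon>" "m * B r < \<epsilon>"
          using small_scale[of "A r" "B r" \<epsilon>] r \<epsilon>(1) by auto
        define y where "y = o' + m *\<^sub>R (r - o')"
        have "y \<in> closed_segment o' r" using m unfolding y_def in_segment
          by (intro exI[of _ m]) (auto simp: algebra_simps)
        moreover have "closed_segment o' r \<subseteq> closed_segment e f"
          using rC(2) pe ef po by (auto simp: subset_closed_segment)
        ultimately have "y \<in> bd S" using rC ef by (auto simp: bd_def pbound_def)
        then have ycl: "y \<in> closure (obs S)" using bd_closure_obs by blast
        have yAB: "A y = m * A r" "B y = m * B r" using AB_o by (simp_all add: y_def lin)
        let ?W = "{p. 0 < A p \<and> A p < \<epsilon> \<and> 0 < B p \<and> B p < \<epsilon>}"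
        have cA: "continuous_on UNIV A" "continuous_on UNIV B"
          unfolding A_def B_def cross2_def using D by (intro continuous_intros; simp)+
        have "open ?W"
          by (intro open_Collect_conj open_Collect_less continuous_on_const cA)
        moreover have "y \<in> ?W" using yAB m r by auto
        ultimately have "?W \<inter> obs S \<noteq> {}" using ycl by (meson open_Int_closure_eq_empty disjoint_iff)
        then obtain y' where "y' \<in> obs S" "0 < A y'" "A y' < \<epsilon>" "0 < B y'" "B y' < \<epsilon>" by blast
        then show False using \<epsilon>(2)[of "A y'" "B y'"] rep[of y'] by auto
      qed
      have BD: "cross2 (v - o') (x - o') = B x * D" and AD: "cross2 (x - o') (w - o') = A x * D" for x
        using D by (simp_all add: A_def B_def)
      have "cross2 (v - o') (r - p) = B r * D - B p * D"
        using BD[of r] BD[of p] unfolding cross2_simps(4) by linarith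
      then have crossB: "cross2 (r - p) (v - o') = - (B r - B p) * D"
        by (simp add: cross2_commute[of "r - p"] left_diff_distrib)
      have crossA: "cross2 (r - p) (w - o') = (A r - A p) * D"
        using AD[of r] AD[of p] unfolding cross2_simps(3) left_diff_distrib by linarith
      have "C p = 0"
      proof (rule ccontr)
        assume C0: "C p \<noteq> 0"
        then have Cp: "C p > 0" using pc by simp
        from C0 consider "B p = 0" | "A p = 0" "B p \<noteq> 0" using pc by auto
        then show False
        proof cases
          case 1
          then have "0 < G * (1 - A p)" using Cp by (simp add: C_def)
          then have "A p < 1" using G(1) by (simp add: zero_less_mult_iff)
          moreover have "A p \<noteq> 0" using eqI[of p o'] 1 AB_o no by auto
          moreover have "p = (1 - A p) *\<^sub>R o' + A p *\<^sub>R v" using rep[of p] 1 by (simp add: algebra_simps)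
          moreover have "o' \<noteq> v" using AB_o AB_v by auto
          ultimately have "p \<in> open_segment o' v" unfolding in_segment using pc(1)
            by (intro conjI exI[of _ "A p"]) auto
          then have "cross2 (f - e) (v - o') = 0" using cv rC pe unfolding clear_def e_def f_def by blast
          then have "cross2 (r - p) (v - o') = 0" by (simp add: rp cross2_simps)
          then show False using crossB 1 r D by simp
        next
          case 2
          have "0 < G - B p" using Cp 2 by (simp add: C_def)
          then have "B p < 1" using G by simp
          moreover have "p = (1 - B p) *\<^sub>R o' + B p *\<^sub>R w" using rep[of p] 2 by (simp add: algebra_simps)
          moreover have "o' \<noteq> w" using nz by (auto simp: cross2_simps)
          ultimately have "p \<in> open_segment o' w" unfolding in_segment using pc(2) 2
            by (intro conjI exI[of _ "B p"]) auto
          then have "cross2 (f - e) (w - o') = 0" using cw rC pe unfolding clear_def e_def f_def by blast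
          then have "cross2 (r - p) (w - o') = 0" by (simp add: rp cross2_simps)
          then show False using crossA 2 r D by simp
        qed
      qed
      then show ?thesis using t(1) p_def by blast
    qed
    \<comment> \<open>Going from \<open>r\<close> towards either end of the edge reaches a zero of
      \<open>C\<close>, but an affine function cannot decrease in both directions along a
      line.\<close>
    obtain t1 t2 where t12: "t1 > 0" "C (r + t1 *\<^sub>R (e - r)) = 0" "t2 > 0" "C (r + t2 *\<^sub>R (f - r)) = 0"
      using key by blast
    obtain s where s: "0 \<le> s" "s \<le> 1" "r = (1 - s) *\<^sub>R e + s *\<^sub>R f" using rC(2) unfolding ef in_segment by blast
    have re: "r = e + s *\<^sub>R (f - e)" using s(3) by (simp add: algebra_simps)
    have Cr: "C r = C e + s * (C f - C e)" using linC[of e s f] re by simp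
    have "C r + t1 * (C e - C r) = 0" "C r + t2 * (C f - C r) = 0" using t12 linC by auto
    then have "C e - C r < 0" "C f - C r < 0" using t12 r(3) by (smt (verit) mult_nonneg_nonneg)+
    moreover have "(1 - s) * (C e - C r) + s * (C f - C r) = 0" using Cr by (simp add: algebra_simps)
    ultimately show False using s(1,2) 
      by (smt (verit) mult_nonneg_nonpos mult_pos_neg)
  qed
  have Rbd: "R \<inter> bd S = {}" using segR unfolding bd_def pbound_def by blast
  have convR: "convex R"
    unfolding convex_alt
  proof (intro ballI allI impI)
    fix x y :: pt and u :: real
    assume "x \<in> R" "y \<in> R" and u: "0 \<le> u \<and> u \<le> 1"
    then have h: "0 \<le> u \<and> u \<le> 1" "0 < A x" "0 < B x" "0 < C x" "0 < A y" "0 < B y" "0 < C y"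
      by (simp_all add: R_def)
    have e: "(1 - u) *\<^sub>R x + u *\<^sub>R y = x + u *\<^sub>R (y - x)" by (simp add: algebra_simps)
    have pos: "0 < a + u * (b - a)" if "0 < a" "0 < b" for a b :: real
    proof -
      have "a + u * (b - a) = (1 - u) * a + u * b" by (simp add: algebra_simps)
      also have "\<dots> > 0" using h(1) that by (smt (verit) mult_nonneg_nonneg mult_pos_pos)
      finally show ?thesis .
    qed
    show "(1 - u) *\<^sub>R x + u *\<^sub>R y \<in> R"
      unfolding e R_def mem_Collect_eq lin linC using pos[OF h(2,5)] pos[OF h(3,6)] pos[OF h(4,7)] by simp_all
  qed
  have Robs: "R \<inter> obs S = {}"
  proof (rule ccontr)
    assume "R \<inter> obs S \<noteq> {}"
    then have sub: "R \<subseteq> obs S" using convex_obs(2)[OF convR Rbd] by blast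
    obtain \<epsilon> where \<epsilon>: "\<epsilon> > 0" "\<And>s t. 0 < s \<Longrightarrow> s < \<epsilon> \<Longrightarrow> 0 < t \<Longrightarrow> t < \<epsilon> \<Longrightarrow> o' + s *\<^sub>R (v - o') + t *\<^sub>R (w - o') \<notin> obs S"
      using sf unfolding secfree_def by blast
    define m where "m = min (\<epsilon> / 2) (G / 4)"
    have m: "0 < m" "m < \<epsilon>" "m \<le> G / 4" "m \<le> 1/4" using \<epsilon> G by (auto simp: m_def)
    have "G * m \<le> G * (1/4)" using m G by (intro mult_left_mono) auto
    then have "0 < G * (1 - m) - m" using m G unfolding right_diff_distrib by linarith
    then have "o' + m *\<^sub>R (v - o') + m *\<^sub>R (w - o') \<in> R"
      unfolding R_def C_def mem_Collect_eq AB using m(1) by blast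
    then show False using sub \<epsilon>(2)[of m m] m by blast
  qed
  \<comment> \<open>Interiors are open, so an obstacle containing a point of the closed region would
    contain nearby points of \<open>R\<close>.\<close>
  have closR: "p \<notin> obs S" if p: "0 \<le> A p" "0 \<le> B p" "0 \<le> C p" for p
  proof
    assume po: "p \<in> obs S"
    define m where "m = o' + (1/4) *\<^sub>R (v - o') + (G / 4) *\<^sub>R (w - o')"
    have mp: "A m > 0" "B m > 0" "C m > 0" unfolding C_def m_def AB using G by auto
    obtain e where e: "e > 0" "ball p e \<subseteq> obs S" using open_obs po openE by blast
    obtain t where t: "0 < t" "t \<le> 1/2" "t * norm (m - p) < e"
      using small_scale[of "norm (m - p)" 0 e] e(1) by auto
    define y where "y = p + t *\<^sub>R (m - p)"
    have "dist p y < e" using t by (simp add: y_def dist_norm)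
    then have "y \<in> obs S" using e(2) by auto
    moreover have "y \<in> R"
    proof -
      have "0 < a + t * (b - a)" if "0 \<le> a" "0 < b" for a b :: real
      proof -
        have "a + t * (b - a) = (1 - t) * a + t * b" by (simp add: algebra_simps)
        also have "\<dots> > 0" using t that by (simp add: add_nonneg_pos)
        finally show ?thesis .
      qed
      then show ?thesis using p mp by (auto simp: R_def y_def lin linC)
    qed
    ultimately show False using Robs by blast
  qed
  have tri: "0 \<le> A p \<and> 0 \<le> B p \<and> 0 \<le> C p" if ph: "p \<in> convex hull {o', v, q}" for p
  proof -
    obtain \<alpha> \<beta> where ab: "0 \<le> \<alpha>" "0 \<le> \<beta>" "\<alpha> + \<beta> \<le> 1" "p = o' + \<alpha> *\<^sub>R (v - o') + \<beta> *\<^sub>R (q - o')"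
      using ph unfolding in_hull3 by blast
    have qq: "q - o' = A q *\<^sub>R (v - o') + B q *\<^sub>R (w - o')" using rep[of q] by (simp add: algebra_simps)
    have "p = o' + (\<alpha> + \<beta> * A q) *\<^sub>R (v - o') + (\<beta> * B q) *\<^sub>R (w - o')"
      unfolding ab(4) qq by (simp add: algebra_simps)
    then have pp: "A p = \<alpha> + \<beta> * A q" "B p = \<beta> * B q" using AB by metis+
    have "C p = G * (1 - \<alpha> - \<beta>)" unfolding C_def pp G(3) by (simp add: algebra_simps)
    then show ?thesis using pp ab(1-3) qAB G(1) by (auto intro!: add_nonneg_nonneg mult_nonneg_nonneg)
  qed
  have "freetri V S o' v q"
    unfolding freetri_def
  proof
    show "convex hull {o', v, q} \<inter> obs S = {}" using tri closR by blast
    show "V \<inter> convex hull {o', v, q} \<subseteq> {o', v, q}" using tri VR by blast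
  qed
  moreover have "B q * (1 - a) \<le> b * (1 - A q)"
    if ab: "0 \<le> a" "0 \<le> b" "a + b \<le> 1" "o' + a *\<^sub>R (v - o') + b *\<^sub>R (w - o') \<in> V - {o', v}" for a b
  proof -
    let ?z = "o' + a *\<^sub>R (v - o') + b *\<^sub>R (w - o')"
    have zh: "?z \<in> convex hull {o', v, w}" unfolding hull AB using ab by simp
    have zB: "b > 0" "a < 1" using Bpos[OF _ zh] ab(4) unfolding AB by blast+
    have "g q \<le> g ?z" using gmin zh ab(4) unfolding Z_def by blast
    then have "B q / (1 - A q) \<le> b / (1 - a)" unfolding g_def AB .
    then show ?thesis using zB qAB by (simp add: field_simps)
  qed
  moreover have "q - o' = A q *\<^sub>R (v - o') + B q *\<^sub>R (w - o')"
    using rep[of q] by (simp add: algebra_simps)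
  ultimately show ?thesis using that[OF q] qAB by blast
qed

lemma adjacent_vertex:
  fixes o' v w z
  assumes v: "v \<in> V" and nz: "cross2 (v - o') (w - o') \<noteq> 0"
    and cv: "clear S o' v" and cw: "clear S o' w" and sf: "secfree S o' v w"
    and noV: "V \<inter> closed_segment o' v \<subseteq> {o', v}"
    and z: "z \<in> V" "z \<in> convex hull {o', v, w}" "z \<noteq> o'" "z \<noteq> v"
  obtains q where "q \<in> V" "q \<in> convex hull {o', v, w}" "q \<noteq> o'" "q \<noteq> v" "freetri V S o' v q"
    "\<exists>\<alpha> \<beta>. 0 \<le> \<alpha> \<and> \<alpha> < 1 \<and> 0 < \<beta> \<and> q - o' = \<alpha> *\<^sub>R (v - o') + \<beta> *\<^sub>R (w - o')"
  by (rule adjacent_vertex_min[OF assms]) (use that in blast)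

end

section \<open>Subcones\<close>

lemma cone_comb:
  assumes v: "v \<in> cone u d" and w: "w \<in> cone u d" and c: "0 \<le> s" "0 \<le> t" "0 < s + t"
    and a: "a - u = s *\<^sub>R (v - u) + t *\<^sub>R (w - u)"
  shows "a \<in> cone u d"
proof -
  have vd: "(v - u) \<bullet> d > sqrt 3 / 2 * norm (v - u)" and wd: "(w - u) \<bullet> d > sqrt 3 / 2 * norm (w - u)"
    using v w by (auto simp: cone_def)
  have "norm (a - u) \<le> s * norm (v - u) + t * norm (w - u)"
    unfolding a using norm_triangle_ineq[of "s *\<^sub>R (v - u)" "t *\<^sub>R (w - u)"] c by simp
  then have "sqrt 3 / 2 * norm (a - u) \<le> sqrt 3 / 2 * (s * norm (v - u) + t * norm (w - u))"
    by (intro mult_left_mono) auto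
  also have "\<dots> = s * (sqrt 3 / 2 * norm (v - u)) + t * (sqrt 3 / 2 * norm (w - u))" by (simp add: algebra_simps)
  also have "\<dots> < s * ((v - u) \<bullet> d) + t * ((w - u) \<bullet> d)"
  proof (cases "s > 0")
    case True
    then show ?thesis using vd wd c by (intro add_less_le_mono mult_strict_left_mono mult_left_mono) auto
  next
    case False
    then have "s = 0" "t > 0" using c by auto
    then show ?thesis using wd by simp
  qed
  also have "\<dots> = (a - u) \<bullet> d" unfolding a by (simp add: inner_add_left)
  finally have lt: "sqrt 3 / 2 * norm (a - u) < (a - u) \<bullet> d" .
  then have "a \<noteq> u" by auto
  then show ?thesis using lt by (simp add: cone_def)
qed

lemma cone_dot_pos: "v \<in> cone u d \<Longrightarrow> (v - u) \<bullet> d > 0"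
proof -
  assume "v \<in> cone u d"
  then have "sqrt 3 / 2 * norm (v - u) < (v - u) \<bullet> d" by (simp add: cone_def)
  moreover have "0 \<le> sqrt 3 / 2 * norm (v - u)" by simp
  ultimately show ?thesis by linarith
qed

text \<open>All three vectors have a positive product with the bisector, so
  \<open>cross2_plucker\<close> applies.\<close>

lemma cone_cross_trans:
  assumes "v \<in> cone u d" "a \<in> cone u d" "b \<in> cone u d"
    and "cross2 (v - u) (a - u) \<ge> 0" "cross2 (a - u) (b - u) \<ge> 0"
    and "cross2 (v - u) (a - u) > 0 \<or> cross2 (a - u) (b - u) > 0"
  shows "cross2 (v - u) (b - u) > 0"
proof -
  note p = cross2_plucker[of "v - u" "b - u" "a - u" d]
  have pos: "(v - u) \<bullet> d > 0" "(a - u) \<bullet> d > 0" "(b - u) \<bullet> d > 0" using assms cone_dot_pos by blast+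
  have "cross2 (v - u) (a - u) * ((b - u) \<bullet> d) + cross2 (a - u) (b - u) * ((v - u) \<bullet> d) > 0"
    using assms(4-6) pos by (smt (verit) mult_nonneg_nonneg mult_pos_pos)
  then have "cross2 (v - u) (b - u) * ((a - u) \<bullet> d) > 0" using p by simp
  then show ?thesis using pos(2) by (simp add: zero_less_mult_iff)
qed

section \<open>Obstacles at an apex; subcones as classes of vertices joined by locally free
  sectors\<close>

lemma split_cfg_geom: "split_cfg V S u d a b \<Longrightarrow> geom_split S u d a b"
  by (simp add: split_cfg_def)

context setting
begin

text \<open>Obstacles are disjoint and the polygon is simple, so only the two edges at the corner
  contain \<open>u\<close>; the finitely many other edges keep a positive distance.\<close>

lemma corner_local:
  assumes P: "P \<in> S" and c: "corner_at P u a b"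
  obtains e where "e > 0" "ball u e \<inter> bd S \<subseteq> closed_segment u a \<union> closed_segment u b"
proof -
  let ?n = "length P"
  have n3: "?n \<ge> 3" using lenS P by simp
  obtain k where k: "k < ?n" "P ! k = u" "a = P ! ((k + ?n - 1) mod ?n)" "b = P ! (Suc k mod ?n)"
    using c unfolding corner_at_def by blast
  obtain e where e: "e > 0" "\<And>Q l. Q \<in> S \<Longrightarrow> l < length Q \<Longrightarrow> u \<notin> pedge Q l \<Longrightarrow> ball u e \<inter> pedge Q l = {}"
    using bd_local[of u] by metis
  have uP: "u \<in> pregion P" using k P by (auto simp: pregion_def pbound_def pedge_def)
  have "y \<in> closed_segment u a \<union> closed_segment u b" if y: "y \<in> ball u e" "y \<in> bd S" for y
  proof -
    obtain Q l where Q: "Q \<in> S" "l < length Q" "y \<in> pedge Q l" using y(2) unfolding bd_def pbound_def by blast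
    then have ue: "u \<in> pedge Q l" using e(2)[OF Q(1,2)] y(1) by blast
    then have "u \<in> pregion Q" using Q by (auto simp: pregion_def pbound_def)
    then have QP: "Q = P" using disjS uP P Q by blast
    show ?thesis
    proof (cases "l = k")
      case True then show ?thesis using Q(3) QP k by (simp add: pedge_def)
    next
      case False
      have uk: "u \<in> pedge P k" using k by (simp add: pedge_def)
      then have ne: "u \<in> pedge P k \<inter> pedge P l" using ue QP by blast
      have l: "l < length P" using Q QP by simp
      note I = pedge_Int[OF P k(1) l, OF False[symmetric]]
      have "k = Suc l mod ?n"
      proof (rule ccontr)
        assume nk: "k \<noteq> Suc l mod ?n"
        then have "u = P ! l" using I ne by (simp split: if_splits)
        then show False using k False l distS[OF P] by (simp add: nth_eq_iff_index_eq)
      qed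
      then have "(k + ?n - 1) mod ?n = l"
      proof (cases "Suc l = ?n")
        case True then show ?thesis using \<open>k = _\<close> by (simp add: True[symmetric])
      next
        case False
        then have "k = Suc l" using \<open>k = _\<close> l by simp
        then show ?thesis using l by simp
      qed
      then show ?thesis using Q(3) QP k \<open>k = Suc l mod ?n\<close>
        by (simp add: pedge_def closed_segment_commute)
    qed
  qed
  then show ?thesis using that[OF e(1)] by blast
qed

lemma corner_in_pbound: "corner_at P u a b \<Longrightarrow> u \<in> pbound P \<and> u \<in> set P"
  unfolding corner_at_def pbound_def pedge_def by force

lemma corner_unique:
  assumes "P \<in> S" "Q \<in> S" "corner_at P u a b" "corner_at Q u a' b'"
  shows "P = Q" "a = a'" "b = b'"
proof -
  have "u \<in> pregion P" "u \<in> pregion Q" using corner_in_pbound assms unfolding pregion_def by blast+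
  then show PQ: "P = Q" using disjS assms by blast
  show "a = a'" "b = b'" using assms PQ distS[OF assms(1)] unfolding corner_at_def
    by (auto simp: nth_eq_iff_index_eq)
qed

lemma V_bd_corner:
  assumes "u \<in> V" "P \<in> S" "u \<in> pbound P"
  obtains a b where "corner_at P u a b"
proof -
  let ?n = "length P"
  have n3: "?n \<ge> 3" using lenS assms by simp
  obtain k where k: "k < ?n" "u \<in> pedge P k" using assms(3) unfolding pbound_def by blast
  have "u = P ! k \<or> u = P ! (Suc k mod ?n)"
    using not_in_segment[of "P ! k" "P ! (Suc k mod ?n)" u] k nth_mem_V nth_mem_V' assms by (simp add: pedge_def)
  then obtain l where "l < ?n" "u = P ! l" using k n3
    by (metis less_le_trans mod_less_divisor zero_less_numeral)
  then show ?thesis using that unfolding corner_at_def by blast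
qed

text \<open>The small open sector \<open>Sec\<close> between the two edges is convex and free of
  boundary, so one obstacle point in it puts all of it inside a single obstacle. Since
  \<open>u\<close> lies in its closure, that obstacle is \<open>P\<close>.\<close>

lemma sector_pinterior:
  assumes P: "P \<in> S" and c: "corner_at P u a b \<or> corner_at P u b a"
    and cr: "cross2 (a - u) (b - u) > 0"
    and inP: "\<And>e. e > 0 \<Longrightarrow> \<exists>s t. 0 < s \<and> s < e \<and> 0 < t \<and> t < e \<and> u + s *\<^sub>R (a - u) + t *\<^sub>R (b - u) \<in> obs S"
  obtains e where "e > 0" "\<And>s t. 0 < s \<Longrightarrow> s < e \<Longrightarrow> 0 < t \<Longrightarrow> t < e \<Longrightarrow> u + s *\<^sub>R (a - u) + t *\<^sub>R (b - u) \<in> pinterior P"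
proof -
  obtain e where e: "e > 0" "ball u e \<inter> bd S \<subseteq> closed_segment u a \<union> closed_segment u b"
    using c corner_local[OF P] by (metis Un_commute)
  obtain h where h': "0 < h" "h \<le> 1/2" "h * norm (a - u) < e / 2" "h * norm (b - u) < e / 2"
    using small_scale[of "norm (a - u)" "norm (b - u)" "e / 2"] e(1) by auto
  have h: "h > 0" by fact
  define Sec where "Sec = {u + s *\<^sub>R (a - u) + t *\<^sub>R (b - u) |s t. 0 < s \<and> s < h \<and> 0 < t \<and> t < h}"
  have Sec_ball: "Sec \<subseteq> ball u e"
  proof
    fix y assume "y \<in> Sec"
    then obtain s t where st: "0 < s" "s < h" "0 < t" "t < h" "y = u + s *\<^sub>R (a - u) + t *\<^sub>R (b - u)"
      by (auto simp: Sec_def)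
    then have "dist u y = norm (s *\<^sub>R (a - u) + t *\<^sub>R (b - u))"
      by (simp add: dist_norm norm_minus_commute add.commute)
    also have "\<dots> \<le> s * norm (a - u) + t * norm (b - u)"
      using norm_triangle_ineq[of "s *\<^sub>R (a - u)" "t *\<^sub>R (b - u)"] st by simp
    also have "\<dots> \<le> h * norm (a - u) + h * norm (b - u)" using st by (intro add_mono mult_right_mono) auto
    also have "\<dots> < e" using h'(3,4) by linarith
    finally show "y \<in> ball u e" by simp
  qed
  have dj: "Sec \<inter> bd S = {}"
  proof (rule ccontr)
    assume "\<not> ?thesis"
    then obtain y where y: "y \<in> Sec" "y \<in> bd S" by blast
    then have ys: "y \<in> closed_segment u a \<or> y \<in> closed_segment u b" using Sec_ball e(2) by blast
    obtain s t where st: "0 < s" "0 < t" "y = u + s *\<^sub>R (a - u) + t *\<^sub>R (b - u)" using y(1) by (auto simp: Sec_def)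
    have c1: "cross2 (a - u) (y - u) = t * cross2 (a - u) (b - u)" "cross2 (y - u) (b - u) = s * cross2 (a - u) (b - u)"
    proof -
      have "y - u = s *\<^sub>R (a - u) + t *\<^sub>R (b - u)" using st by simp
      then show "cross2 (a - u) (y - u) = t * cross2 (a - u) (b - u)" "cross2 (y - u) (b - u) = s * cross2 (a - u) (b - u)"
        by (simp_all only: cross2_simps(1,2,7,8,9) mult_zero_right add_0_left add_0_right)
    qed
    have seg: "cross2 (x - u) (y - u) = 0" if yx: "y \<in> closed_segment u x" for x
    proof -
      obtain r where "y = (1 - r) *\<^sub>R u + r *\<^sub>R x" using yx unfolding in_segment by blast
      then have "y - u = r *\<^sub>R (x - u)" by (simp only:) (simp add: algebra_simps)
      then show ?thesis by (simp add: cross2_simps)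
    qed
    show False using ys
    proof
      assume "y \<in> closed_segment u a" then show False using seg[of a] c1(1) st cr by simp
    next
      assume "y \<in> closed_segment u b"
      then have "cross2 (y - u) (b - u) = 0" using seg[of b] cross2_commute by (metis neg_equal_0_iff_equal)
      then show False using c1(2) st cr by simp
    qed
  qed
  have cv: "convex Sec"
    unfolding convex_alt
  proof (intro ballI allI impI)
    fix x y and r :: real assume "x \<in> Sec" "y \<in> Sec" and r: "0 \<le> r \<and> r \<le> 1"
    then obtain s t s' t' where st: "0 < s" "s < h" "0 < t" "t < h" "x = u + s *\<^sub>R (a - u) + t *\<^sub>R (b - u)"
      "0 < s'" "s' < h" "0 < t'" "t' < h" "y = u + s' *\<^sub>R (a - u) + t' *\<^sub>R (b - u)" unfolding Sec_def by blast
    have "(1 - r) *\<^sub>R x + r *\<^sub>R y = u + ((1 - r) * s + r * s') *\<^sub>R (a - u) + ((1 - r) * t + r * t') *\<^sub>R (b - u)"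
      unfolding st by (simp add: algebra_simps)
    moreover have "0 < (1 - r) * p + r * p' \<and> (1 - r) * p + r * p' < h" if "0 < p" "p < h" "0 < p'" "p' < h" for p p'
    proof -
      have "(1 - r) * p + r * p' < h" using that r by (intro convex_bound_lt) auto
      moreover have "0 < (1 - r) * p + r * p'" using that r by (smt (verit) mult_nonneg_nonneg mult_pos_pos)
      ultimately show ?thesis by blast
    qed
    ultimately show "(1 - r) *\<^sub>R x + r *\<^sub>R y \<in> Sec" using st unfolding Sec_def by blast
  qed
  have "Sec \<inter> obs S \<noteq> {}" using inP[OF h] unfolding Sec_def by blast
  then obtain Q where Q: "Q \<in> S" "Sec \<subseteq> pinterior Q" using convex_obs(1)[OF cv dj] by blast
  have "u \<in> closure Sec"
  proof -
    have "\<exists>y\<in>Sec. dist y u < r" if r: "r > 0" for r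
    proof -
      obtain m1 where m1: "0 < m1" "m1 * norm ((a - u) + (b - u)) < r"
        using small_scale[of "norm ((a - u) + (b - u))" 0 r] r by auto
      define m where "m = min m1 (h / 2)"
      have m: "0 < m" "m < h" "m \<le> m1" using h m1 by (auto simp: m_def)
      have "u + m *\<^sub>R (a - u) + m *\<^sub>R (b - u) \<in> Sec" using m unfolding Sec_def by blast
      moreover have "u + m *\<^sub>R (a - u) + m *\<^sub>R (b - u) - u = m *\<^sub>R ((a - u) + (b - u))"
        by (simp add: scaleR_add_right)
      then have "dist (u + m *\<^sub>R (a - u) + m *\<^sub>R (b - u)) u = m * norm ((a - u) + (b - u))"
        using m by (simp add: dist_norm)
      moreover have "m * norm ((a - u) + (b - u)) \<le> m1 * norm ((a - u) + (b - u))"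
        using m by (intro mult_right_mono) auto
      ultimately show ?thesis using m1(2) by (intro bexI[of _ "u + m *\<^sub>R (a - u) + m *\<^sub>R (b - u)"]) auto
    qed
    then show ?thesis unfolding closure_approachable by blast
  qed
  then have "u \<in> closure (pinterior Q)" using Q(2) closure_mono by blast
  moreover have "frontier (pinterior Q) \<subseteq> pbound Q"
    unfolding pinterior_def by (intro frontier_inside_subset compact_imp_closed compact_pbound)
  ultimately have "u \<in> pregion Q"
    unfolding pregion_def frontier_def using open_pinterior[of Q] by (auto simp: interior_open)
  moreover have "u \<in> pregion P" using corner_in_pbound c unfolding pregion_def by blast
  ultimately have "Q = P" using disjS P Q by blast
  then show ?thesis using that[OF h] Q(2) unfolding Sec_def by blast
qed

text \<open>The sector contains obstacle points arbitrarily close to \<open>u\<close>. Shift such a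
  point parallel to \<open>w - u\<close> onto the ray towards \<open>v\<close>, and parallel to
  \<open>v - u\<close> onto the ray towards \<open>w\<close>: both targets lie on sight segments, so
  each shift meets the boundary. Near \<open>u\<close> the boundary consists of the two edges at the
  corner, so one edge runs on each side of the obstacle point, and the obstacle fills the angle
  between them.\<close>

lemma wedge_split:
  assumes u: "u \<in> V" and vv: "visible S u v" and vw: "visible S u w"
    and cr: "cross2 (v - u) (w - u) > 0" and ns: "\<not> secfree S u v w"
  obtains P a b where "P \<in> S" "corner_at P u a b \<or> corner_at P u b a" "cross2 (a - u) (b - u) > 0"
    "\<exists>s t. 0 < s \<and> 0 \<le> t \<and> a - u = s *\<^sub>R (v - u) + t *\<^sub>R (w - u)"
    "\<exists>s t. 0 \<le> s \<and> 0 < t \<and> b - u = s *\<^sub>R (v - u) + t *\<^sub>R (w - u)"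
    "eventually (\<lambda>t. u + t *\<^sub>R ((a - u) + (b - u)) \<in> pinterior P) (at_right 0)"
proof -
  have ns': "\<exists>s t. 0 < s \<and> s < e \<and> 0 < t \<and> t < e \<and> u + s *\<^sub>R (v - u) + t *\<^sub>R (w - u) \<in> obs S" if "e > 0" for e
    using ns that unfolding secfree_def by blast
  have uo: "u \<notin> obs S" using vv unfolding visible_iff by auto
  define M where "M = norm (v - u) + norm (w - u) + 1"
  have M: "M > 0" by (simp add: M_def add_nonneg_pos)
  have small: "dist u (u + s *\<^sub>R (v - u) + t *\<^sub>R (w - u)) < e"
    if st: "0 \<le> s" "0 \<le> t" "s \<le> e / (2 * M)" "t \<le> e / (2 * M)" "e > 0" for s t e
  proof -
    have "dist u (u + s *\<^sub>R (v - u) + t *\<^sub>R (w - u)) = norm (s *\<^sub>R (v - u) + t *\<^sub>R (w - u))"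
      by (simp add: dist_norm norm_minus_commute add.commute)
    also have "\<dots> \<le> s * norm (v - u) + t * norm (w - u)"
      using norm_triangle_ineq[of "s *\<^sub>R (v - u)" "t *\<^sub>R (w - u)"] st by simp
    also have "\<dots> \<le> e / (2 * M) * norm (v - u) + e / (2 * M) * norm (w - u)"
      using st by (intro add_mono mult_right_mono) auto
    also have "\<dots> = e / (2 * M) * (norm (v - u) + norm (w - u))" by (simp only: distrib_left)
    also have "\<dots> \<le> e / (2 * M) * M" using st M by (intro mult_left_mono) (auto simp: M_def)
    also have "\<dots> < e" using st M by simp
    finally show ?thesis .
  qed
  have ubd: "u \<in> bd S"
  proof (rule ccontr)
    assume "u \<notin> bd S"
    then obtain e where e: "e > 0" "ball u e \<subseteq> - bd S" using closed_bd by (metis ComplI open_Compl openE)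
    obtain s t where st: "0 < s" "s < e / (2 * M)" "0 < t" "t < e / (2 * M)" "u + s *\<^sub>R (v - u) + t *\<^sub>R (w - u) \<in> obs S"
      using ns'[of "e / (2 * M)"] e M by auto
    then have "u + s *\<^sub>R (v - u) + t *\<^sub>R (w - u) \<in> ball u e" using small[of s t e] e by auto
    then have "ball u e \<subseteq> obs S" using convex_obs(2)[of "ball u e"] e(2) st(5) by blast
    then show False using uo e(1) centre_in_ball by blast
  qed
  then obtain P where P: "P \<in> S" "u \<in> pbound P" unfolding bd_def by blast
  obtain a b where ab: "corner_at P u a b" using V_bd_corner[OF u P] .
  obtain e where e: "e > 0" "ball u e \<inter> bd S \<subseteq> closed_segment u a \<union> closed_segment u b"
    using corner_local[OF P(1) ab] .
  have pt: "\<exists>x \<mu>. (x = a \<or> x = b) \<and> 0 < \<mu> \<and> s *\<^sub>R (v - u) + t *\<^sub>R (w - u) = \<mu> *\<^sub>R (x - u)"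
    if st: "0 \<le> s" "0 \<le> t" "0 < s + t" "s \<le> e / (2 * M)" "t \<le> e / (2 * M)" "u + s *\<^sub>R (v - u) + t *\<^sub>R (w - u) \<in> bd S" for s t
  proof -
    let ?y = "u + s *\<^sub>R (v - u) + t *\<^sub>R (w - u)"
    have "?y \<in> ball u e" using small[of s t e] st e by auto
    then obtain x where x: "x = a \<or> x = b" "?y \<in> closed_segment u x" using e(2) st(6) by blast
    then obtain \<mu> where l: "0 \<le> \<mu>" "?y = (1 - \<mu>) *\<^sub>R u + \<mu> *\<^sub>R x" unfolding in_segment by blast
    have "?y - u = \<mu> *\<^sub>R (x - u)" unfolding l(2) by (simp add: algebra_simps)
    then have eq: "s *\<^sub>R (v - u) + t *\<^sub>R (w - u) = \<mu> *\<^sub>R (x - u)" by simp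
    have "\<mu> \<noteq> 0"
    proof
      assume "\<mu> = 0"
      then have z: "s *\<^sub>R (v - u) + t *\<^sub>R (w - u) = 0" using eq by simp
      have "cross2 (s *\<^sub>R (v - u) + t *\<^sub>R (w - u)) (w - u) = s * cross2 (v - u) (w - u)"
        "cross2 (v - u) (s *\<^sub>R (v - u) + t *\<^sub>R (w - u)) = t * cross2 (v - u) (w - u)"
        by (simp_all only: cross2_simps(1,2,7,8,9) mult_zero_right add_0_left add_0_right)
      then show False using z cr st by (simp add: cross2_simps)
    qed
    then show ?thesis using x eq l(1) by (metis less_eq_real_def)
  qed
  define \<delta> where "\<delta> = min (1/2) (e / (2 * M))"
  have \<delta>: "0 < \<delta>" "\<delta> \<le> 1/2" "\<delta> \<le> e / (2 * M)" using e M by (auto simp: \<delta>_def)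
  obtain s t where st: "0 < s" "s < \<delta>" "0 < t" "t < \<delta>" and zo: "u + s *\<^sub>R (v - u) + t *\<^sub>R (w - u) \<in> obs S"
    using ns'[OF \<delta>(1)] by blast
  let ?z = "u + s *\<^sub>R (v - u) + t *\<^sub>R (w - u)"
  have hit: "\<exists>y\<in>closed_segment ?z y0. y \<in> bd S" if "y0 \<notin> obs S" for y0
  proof (rule ccontr)
    assume "\<not> ?thesis"
    then have "closed_segment ?z y0 \<inter> bd S = {}" by blast
    then have "closed_segment ?z y0 \<subseteq> obs S" using convex_obs(2)[of "closed_segment ?z y0"] zo by auto
    then show False using that by auto
  qed
  have zbd: "?z \<notin> bd S" using zo bd_obs_disjoint by blast
  have "u + s *\<^sub>R (v - u) \<in> closed_segment u v" unfolding in_segment using st \<delta>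
    by (intro exI[of _ s]) (auto simp: algebra_simps)
  then have "u + s *\<^sub>R (v - u) \<notin> obs S" using vv unfolding visible_iff by blast
  then obtain y where y: "y \<in> closed_segment ?z (u + s *\<^sub>R (v - u))" "y \<in> bd S" using hit by blast
  then obtain r where r: "0 \<le> r" "r \<le> 1" "y = (1 - r) *\<^sub>R ?z + r *\<^sub>R (u + s *\<^sub>R (v - u))" unfolding in_segment by blast
  define t' where "t' = (1 - r) * t"
  have y': "y = u + s *\<^sub>R (v - u) + t' *\<^sub>R (w - u)" unfolding r(3) t'_def by (simp add: algebra_simps)
  have "r \<noteq> 0" using y(2) zbd r(3) by auto
  then have t': "0 \<le> t'" "t' < t" using r st by (auto simp: t'_def)
  then obtain a0 la where a0: "a0 = a \<or> a0 = b" "0 < la" "s *\<^sub>R (v - u) + t' *\<^sub>R (w - u) = la *\<^sub>R (a0 - u)"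
    using pt[of s t'] y(2) y' st \<delta> by auto
  have "u + t *\<^sub>R (w - u) \<in> closed_segment u w" unfolding in_segment using st \<delta>
    by (intro exI[of _ t]) (auto simp: algebra_simps)
  then have "u + t *\<^sub>R (w - u) \<notin> obs S" using vw unfolding visible_iff by blast
  then obtain x where x: "x \<in> closed_segment ?z (u + t *\<^sub>R (w - u))" "x \<in> bd S" using hit by blast
  then obtain r' where r': "0 \<le> r'" "r' \<le> 1" "x = (1 - r') *\<^sub>R ?z + r' *\<^sub>R (u + t *\<^sub>R (w - u))" unfolding in_segment by blast
  define s' where "s' = (1 - r') * s"
  have x': "x = u + s' *\<^sub>R (v - u) + t *\<^sub>R (w - u)" unfolding r'(3) s'_def by (simp add: algebra_simps)
  have "r' \<noteq> 0" using x(2) zbd r'(3) by auto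
  then have s': "0 \<le> s'" "s' < s" using r' st by (auto simp: s'_def)
  then obtain b0 lb where b0: "b0 = a \<or> b0 = b" "0 < lb" "s' *\<^sub>R (v - u) + t *\<^sub>R (w - u) = lb *\<^sub>R (b0 - u)"
    using pt[of s' t] x(2) x' st \<delta> by auto
  have aa: "a0 - u = (s / la) *\<^sub>R (v - u) + (t' / la) *\<^sub>R (w - u)"
  proof -
    have "(1 / la) *\<^sub>R (s *\<^sub>R (v - u) + t' *\<^sub>R (w - u)) = a0 - u" unfolding a0(3) using a0(2) by simp
    then show ?thesis by (simp add: scaleR_add_right)
  qed
  have bb: "b0 - u = (s' / lb) *\<^sub>R (v - u) + (t / lb) *\<^sub>R (w - u)"
  proof -
    have "(1 / lb) *\<^sub>R (s' *\<^sub>R (v - u) + t *\<^sub>R (w - u)) = b0 - u" unfolding b0(3) using b0(2) by simp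
    then show ?thesis by (simp add: scaleR_add_right)
  qed
  \<comment> \<open>Up to the scales \<open>la\<close>, \<open>lb\<close>, this is the determinant
    of \<open>a0 - u\<close> and \<open>b0 - u\<close> in the frame \<open>v - u\<close>,
    \<open>w - u\<close>; it is positive because \<open>a0\<close> is on the \<open>v\<close> side
    of \<open>?z\<close> and \<open>b0\<close> on the \<open>w\<close> side.\<close>
  define K where "K = s * t - t' * s'"
  have "t' * s' \<le> t' * s" using s' t' by (intro mult_left_mono) auto
  also have "\<dots> < t * s" using t' st by (intro mult_strict_right_mono) auto
  finally have K: "K > 0" by (simp add: K_def mult.commute)
  have crl: "la * lb * cross2 (a0 - u) (b0 - u) = K * cross2 (v - u) (w - u)"
  proof -
    have "la * lb * cross2 (a0 - u) (b0 - u) = cross2 (la *\<^sub>R (a0 - u)) (lb *\<^sub>R (b0 - u))"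
      by (simp only: cross2_simps(7,8) mult_ac)
    also have "\<dots> = K * cross2 (v - u) (w - u)"
      unfolding a0(3)[symmetric] b0(3)[symmetric] K_def
      by (simp only: cross2_simps(1,2,7,8,9) cross2_commute[of "w - u" "v - u"]) (simp add: algebra_simps)
    finally show ?thesis .
  qed
  have crab: "cross2 (a0 - u) (b0 - u) > 0"
  proof -
    have "la * lb * cross2 (a0 - u) (b0 - u) > 0" using crl K cr by simp
    moreover have "la * lb > 0" using a0(2) b0(2) by simp
    ultimately show ?thesis by (rule zero_less_mult_pos)
  qed
  then have "a0 \<noteq> b0" using cross2_simps(9) by (metis less_irrefl)
  then have c0: "corner_at P u a0 b0 \<or> corner_at P u b0 a0" using a0(1) b0(1) ab by blast
  have zsec: "u + (k * (la * (s * t - t * s') / K)) *\<^sub>R (a0 - u) + (k * (lb * (s * t - s * t') / K)) *\<^sub>R (b0 - u)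
       = u + (k * s) *\<^sub>R (v - u) + (k * t) *\<^sub>R (w - u)" for k
  proof -
    define x where "x = k * (s * t - t * s') / K"
    define y where "y = k * (s * t - s * t') / K"
    have "x * s + y * s' = (k * (s * t - t * s') * s + k * (s * t - s * t') * s') / K"
      by (simp add: x_def y_def add_divide_distrib)
    also have "k * (s * t - t * s') * s + k * (s * t - s * t') * s' = (k * s) * K"
      unfolding K_def by (simp add: algebra_simps)
    finally have k1: "x * s + y * s' = k * s" using K by simp
    have "x * t' + y * t = (k * (s * t - t * s') * t' + k * (s * t - s * t') * t) / K"
      by (simp add: x_def y_def add_divide_distrib)
    also have "k * (s * t - t * s') * t' + k * (s * t - s * t') * t = (k * t) * K"
      unfolding K_def by (simp add: algebra_simps)
    finally have k2: "x * t' + y * t = k * t" using K by simp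
    have "(k * (la * (s * t - t * s') / K)) *\<^sub>R (a0 - u) = x *\<^sub>R (la *\<^sub>R (a0 - u))"
      unfolding x_def scaleR_scaleR by (simp only: times_divide_eq_left times_divide_eq_right mult_ac)
    moreover have "(k * (lb * (s * t - s * t') / K)) *\<^sub>R (b0 - u) = y *\<^sub>R (lb *\<^sub>R (b0 - u))"
      unfolding y_def scaleR_scaleR by (simp only: times_divide_eq_left times_divide_eq_right mult_ac)
    moreover have "x *\<^sub>R (s *\<^sub>R p + t' *\<^sub>R q) + y *\<^sub>R (s' *\<^sub>R p + t *\<^sub>R q) = (x * s + y * s') *\<^sub>R p + (x * t' + y * t) *\<^sub>R q"
      for p q :: pt by (simp add: algebra_simps)
    ultimately show ?thesis unfolding add.assoc a0(3)[symmetric] b0(3)[symmetric] k1 k2 by (simp only:)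
  qed
  have coef: "la * (s * t - t * s') / K > 0" "lb * (s * t - s * t') / K > 0"
  proof -
    have "t * (s - s') > 0" "s * (t - t') > 0" using s' t' st by auto
    then show "la * (s * t - t * s') / K > 0" "lb * (s * t - s * t') / K > 0"
      using K a0(2) b0(2) by (auto simp: algebra_simps intro!: divide_pos_pos mult_pos_pos)
  qed
  have many: "\<exists>p q. 0 < p \<and> p < h \<and> 0 < q \<and> q < h \<and> u + p *\<^sub>R (a0 - u) + q *\<^sub>R (b0 - u) \<in> obs S" if h: "h > 0" for h
  proof -
    let ?x = "la * (s * t - t * s') / K" and ?y = "lb * (s * t - s * t') / K"
    obtain k where k: "0 < k" "k \<le> 1/2" "k * ?x < h" "k * ?y < h"
      using small_scale[of ?x ?y h] coef h by (metis less_imp_le)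
    have pos: "k * ?x > 0" "k * ?y > 0" using mult_pos_pos[OF k(1) coef(1)] mult_pos_pos[OF k(1) coef(2)] by blast+
    have "u + (k * s) *\<^sub>R (v - u) + (k * t) *\<^sub>R (w - u) \<in> obs S"
    proof -
      \<comment> \<open>The segment from \<open>?z\<close> to \<open>u\<close> without
        \<open>u\<close>. It stays off both edges, so shrinking \<open>?z\<close> towards
        \<open>u\<close> keeps it inside the same obstacle.\<close>
      let ?W = "(\<lambda>l. u + l *\<^sub>R (s *\<^sub>R (v - u) + t *\<^sub>R (w - u))) ` {0<..1}"
      have We: "u + l *\<^sub>R (s *\<^sub>R (v - u) + t *\<^sub>R (w - u)) = u + (l * s) *\<^sub>R (v - u) + (l * t) *\<^sub>R (w - u)" for l
        by (simp add: scaleR_add_right)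
      have cW: "connected ?W"
        by (intro connected_continuous_image continuous_intros) auto
      have "?W \<inter> bd S = {}"
      proof (rule ccontr)
        assume "?W \<inter> bd S \<noteq> {}"
        then obtain l where l: "0 < l" "l \<le> 1" "u + (l * s) *\<^sub>R (v - u) + (l * t) *\<^sub>R (w - u) \<in> bd S"
          using We by (smt (verit) disjoint_iff greaterThanAtMost_iff image_iff)
        have "l * s \<le> \<delta>" "l * t \<le> \<delta>" using l st by (smt (verit) mult_left_le_one_le)+
        then obtain x0 \<mu> where x0: "x0 = a \<or> x0 = b" "0 < \<mu>" "(l * s) *\<^sub>R (v - u) + (l * t) *\<^sub>R (w - u) = \<mu> *\<^sub>R (x0 - u)"
          using pt[of "l * s" "l * t"] l st \<delta> by (auto simp: add_pos_pos)
        have c1: "cross2 ((l * s) *\<^sub>R (v - u) + (l * t) *\<^sub>R (w - u)) (s *\<^sub>R (v - u) + t' *\<^sub>R (w - u)) = (l * s * (t' - t)) * cross2 (v - u) (w - u)"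
          by (simp only: cross2_simps(1,2,7,8,9) cross2_commute[of "w - u" "v - u"]) (simp add: algebra_simps)
        have c2: "cross2 ((l * s) *\<^sub>R (v - u) + (l * t) *\<^sub>R (w - u)) (s' *\<^sub>R (v - u) + t *\<^sub>R (w - u)) = (l * t * (s - s')) * cross2 (v - u) (w - u)"
          by (simp only: cross2_simps(1,2,7,8,9) cross2_commute[of "w - u" "v - u"]) (simp add: algebra_simps)
        have "x0 = a0 \<or> x0 = b0" using x0(1) a0(1) b0(1) \<open>a0 \<noteq> b0\<close> by blast
        then show False
        proof
          assume "x0 = a0"
          then have "cross2 ((l * s) *\<^sub>R (v - u) + (l * t) *\<^sub>R (w - u)) (s *\<^sub>R (v - u) + t' *\<^sub>R (w - u)) = 0"
            unfolding x0(3) a0(3) by (simp add: cross2_simps(7,8,9))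
          then show False using c1 l st t' cr by simp
        next
          assume "x0 = b0"
          then have "cross2 ((l * s) *\<^sub>R (v - u) + (l * t) *\<^sub>R (w - u)) (s' *\<^sub>R (v - u) + t *\<^sub>R (w - u)) = 0"
            unfolding x0(3) b0(3) by (simp add: cross2_simps(7,8,9))
          then show False using c2 l st s' cr by simp
        qed
      qed
      then have WQ: "?W \<inter> pbound Q = {}" if "Q \<in> S" for Q using that unfolding bd_def by blast
      have zW: "?z \<in> ?W" using We[of 1] by (intro image_eqI[of _ _ 1]) simp_all
      obtain Q where Q: "Q \<in> S" "?z \<in> pinterior Q" using zo unfolding obs_def by blast
      have "?W \<subseteq> pinterior Q" using pinterior_connected[OF cW WQ[OF Q(1)]] zW Q(2) by blast
      moreover have "u + (k * s) *\<^sub>R (v - u) + (k * t) *\<^sub>R (w - u) \<in> ?W"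
        using We[of k] k(1,2) by (intro image_eqI[of _ _ k]) simp_all
      ultimately have "u + (k * s) *\<^sub>R (v - u) + (k * t) *\<^sub>R (w - u) \<in> pinterior Q" by (rule subsetD)
      then show ?thesis using Q(1) unfolding obs_def by blast
    qed
    then have "u + (k * ?x) *\<^sub>R (a0 - u) + (k * ?y) *\<^sub>R (b0 - u) \<in> obs S" unfolding zsec .
    then show ?thesis using pos k by blast
  qed
  obtain h where h: "h > 0" "\<And>p q. 0 < p \<Longrightarrow> p < h \<Longrightarrow> 0 < q \<Longrightarrow> q < h \<Longrightarrow> u + p *\<^sub>R (a0 - u) + q *\<^sub>R (b0 - u) \<in> pinterior P"
    using sector_pinterior[OF P(1) c0 crab many] by blast
  have "eventually (\<lambda>t. u + t *\<^sub>R ((a0 - u) + (b0 - u)) \<in> pinterior P) (at_right 0)"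
    unfolding eventually_at_right_field using h by (intro exI[of _ h]) (auto simp: scaleR_add_right simp flip: add.assoc)
  moreover have "s / la > 0" "t' / la \<ge> 0" "s' / lb \<ge> 0" "t / lb > 0" using st s' t' a0(2) b0(2) by auto
  ultimately show ?thesis using that[OF P(1) c0 crab] aa bb by blast
qed

text \<open>The definition of a split inspects only the diagonal direction;
  \<open>sector_pinterior\<close> extends it to a whole sector.\<close>

lemma geom_split_sector:
  assumes g: "geom_split S u d a b"
  obtains e where "e > 0" "\<And>s t. 0 < s \<Longrightarrow> s < e \<Longrightarrow> 0 < t \<Longrightarrow> t < e \<Longrightarrow> u + s *\<^sub>R (a - u) + t *\<^sub>R (b - u) \<in> obs S"
proof -
  obtain P where P: "P \<in> S" "corner_at P u a b \<or> corner_at P u b a" "cross2 (a - u) (b - u) > 0"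
      "eventually (\<lambda>t. u + t *\<^sub>R ((a - u) + (b - u)) \<in> pinterior P) (at_right 0)"
    using g unfolding geom_split_def by blast
  obtain h where h: "h > 0" "\<And>t. 0 < t \<Longrightarrow> t < h \<Longrightarrow> u + t *\<^sub>R ((a - u) + (b - u)) \<in> pinterior P"
    using P(4) unfolding eventually_at_right_field by blast
  have m: "\<exists>p q. 0 < p \<and> p < e \<and> 0 < q \<and> q < e \<and> u + p *\<^sub>R (a - u) + q *\<^sub>R (b - u) \<in> obs S" if "e > 0" for e
  proof -
    define m where "m = min h e / 2"
    have "0 < m" "m < h" "m < e" using that h by (auto simp: m_def)
    then have "u + m *\<^sub>R (a - u) + m *\<^sub>R (b - u) \<in> obs S"
      using h(2)[of m] P(1) by (auto simp: obs_def scaleR_add_right add.assoc)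
    then show ?thesis using \<open>0 < m\<close> \<open>m < e\<close> by blast
  qed
  obtain e where "e > 0" "\<And>s t. 0 < s \<Longrightarrow> s < e \<Longrightarrow> 0 < t \<Longrightarrow> t < e \<Longrightarrow> u + s *\<^sub>R (a - u) + t *\<^sub>R (b - u) \<in> pinterior P"
    using sector_pinterior[OF P(1-3) m] by blast
  then show ?thesis using that P(1) unfolding obs_def by blast
qed

text \<open>A vertex is a corner of at most one obstacle, and the sign of the cross product fixes
  the order of the two edges. Allowing different directions \<open>d\<close>, \<open>d'\<close> is
  what later bounds the number of split cones at \<open>u\<close>.\<close>

lemma geom_split_unique:
  assumes "geom_split S u d a b" "geom_split S u d' a' b'"
  shows "a = a'" "b = b'"
proof -
  obtain P where P: "P \<in> S" "corner_at P u a b \<or> corner_at P u b a" "cross2 (a - u) (b - u) > 0"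
    using assms(1) unfolding geom_split_def by blast
  obtain Q where Q: "Q \<in> S" "corner_at Q u a' b' \<or> corner_at Q u b' a'" "cross2 (a' - u) (b' - u) > 0"
    using assms(2) unfolding geom_split_def by blast
  have "a = a' \<and> b = b' \<or> a = b' \<and> b = a'" using P(2) Q(2) corner_unique[OF P(1) Q(1)] by blast
  then show "a = a'" "b = b'" using P(3) Q(3) cross2_commute[of "a - u" "b - u"] by auto
qed

lemma subcone_sub: "X \<in> subcones V S u d \<Longrightarrow> X \<subseteq> visK V S u d"
  unfolding subcones_def side1_def side2_def by (auto split: if_splits)

lemma visKD: "v \<in> visK V S u d \<Longrightarrow> v \<in> V \<and> v \<in> cone u d \<and> visible S u v"
  by (simp add: visK_def)

text \<open>If the sector were blocked near \<open>u\<close>, \<open>wedge_split\<close> would give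
  obstacle edges \<open>a\<close>, \<open>b\<close> between \<open>v\<close> and \<open>w\<close> in
  the same cone. The cone would then be split with \<open>v\<close> and \<open>w\<close> on
  different sides.\<close>

lemma subcone_secfree_aux:
  assumes u: "u \<in> V" and X: "X \<in> subcones V S u d" and vX: "v \<in> X" and wX: "w \<in> X"
    and cr: "cross2 (v - u) (w - u) > 0"
  shows "secfree S u v w"
proof (rule ccontr)
  assume ns: "\<not> secfree S u v w"
  have vK: "v \<in> visK V S u d" and wK: "w \<in> visK V S u d" using subcone_sub[OF X] vX wX by blast+
  note vD = visKD[OF vK] and wD = visKD[OF wK]
  obtain P a b where P: "P \<in> S" "corner_at P u a b \<or> corner_at P u b a" "cross2 (a - u) (b - u) > 0"
    "\<exists>s t. 0 < s \<and> 0 \<le> t \<and> a - u = s *\<^sub>R (v - u) + t *\<^sub>R (w - u)"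
    "\<exists>s t. 0 \<le> s \<and> 0 < t \<and> b - u = s *\<^sub>R (v - u) + t *\<^sub>R (w - u)"
    "eventually (\<lambda>t. u + t *\<^sub>R ((a - u) + (b - u)) \<in> pinterior P) (at_right 0)"
    using wedge_split[OF u conjunct2[OF conjunct2[OF vD]] conjunct2[OF conjunct2[OF wD]] cr ns] by blast
  obtain s t where a: "0 < s" "0 \<le> t" "a - u = s *\<^sub>R (v - u) + t *\<^sub>R (w - u)" using P(4) by blast
  obtain s' t' where b: "0 \<le> s'" "0 < t'" "b - u = s' *\<^sub>R (v - u) + t' *\<^sub>R (w - u)" using P(5) by blast
  have ac: "a \<in> cone u d" using cone_comb[of v u d w s t a] vD wD a by auto
  have bc: "b \<in> cone u d" using cone_comb[of v u d w s' t' b] vD wD b by auto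
  have va: "cross2 (v - u) (a - u) \<ge> 0" unfolding a(3) using a cr
    by (simp add: cross2_simps(2,8,9))
  have bw: "cross2 (b - u) (w - u) \<ge> 0" unfolding b(3) using b cr
    by (simp add: cross2_simps(1,7,9))
  have g: "geom_split S u d a b" unfolding geom_split_def using P ac bc by blast
  have "v \<in> side1 V S u d a" using vK va cross2_commute[of "a - u" "v - u"] by (simp add: side1_def)
  moreover have "w \<in> side2 V S u d b" using wK bw by (simp add: side2_def)
  ultimately have sc: "split_cfg V S u d a b" using g by (auto simp: split_cfg_def)
  then have "is_split V S u d" unfolding is_split_def by blast
  then obtain a' b' where ab': "split_cfg V S u d a' b'" "X = side1 V S u d a' \<or> X = side2 V S u d b'"
    using X unfolding subcones_def by auto
  then have eq: "a' = a" "b' = b" using geom_split_unique g split_cfg_geom by blast+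
  have aw: "cross2 (a - u) (w - u) > 0" using cone_cross_trans[OF ac bc] wD P(3) bw by auto
  have vb: "cross2 (v - u) (b - u) > 0" using cone_cross_trans[of v u d a b] ac bc vD P(3) va by auto
  show False using ab'(2)
  proof
    assume "X = side1 V S u d a'" then show False using wX eq aw by (simp add: side1_def)
  next
    assume "X = side2 V S u d b'" then show False using vX eq vb cross2_commute[of "b - u" "v - u"] by (simp add: side2_def)
  qed
qed

lemma subcone_secfree:
  assumes u: "u \<in> V" and X: "X \<in> subcones V S u d" and vX: "v \<in> X" and wX: "w \<in> X" and "v \<noteq> w"
  shows "secfree S u v w"
proof -
  have "v \<in> V" "w \<in> V" "v \<noteq> u" "w \<noteq> u" using subcone_sub[OF X] vX wX visKD[of v u d] visKD[of w u d] by (auto simp: cone_def)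
  then have "cross2 (v - u) (w - u) \<noteq> 0" using not_collinear u \<open>v \<noteq> w\<close> by metis
  then consider "cross2 (v - u) (w - u) > 0" | "cross2 (w - u) (v - u) > 0"
    using cross2_commute[of "v - u" "w - u"] by linarith
  then show ?thesis
    using subcone_secfree_aux[OF u X] vX wX secfree_commute by cases blast+
qed

text \<open>Otherwise \<open>q\<close> would be seen from \<open>u\<close> along a direction that
  starts inside the obstacle.\<close>

lemma split_not_between:
  assumes g: "geom_split S u d a b" and q: "q \<in> visK V S u d"
  shows "cross2 (a - u) (q - u) \<le> 0 \<or> cross2 (b - u) (q - u) \<ge> 0"
proof (rule ccontr)
  assume "\<not> ?thesis"
  then have c: "cross2 (a - u) (q - u) > 0" "cross2 (b - u) (q - u) < 0" by auto
  have ab: "cross2 (a - u) (b - u) > 0" using g by (auto simp: geom_split_def)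
  let ?D = "cross2 (a - u) (b - u)"
  define x where "x = cross2 (q - u) (b - u) / ?D"
  define y where "y = cross2 (a - u) (q - u) / ?D"
  have "cross2 (q - u) (b - u) > 0" using c(2) cross2_commute[of "q - u" "b - u"] by linarith
  then have xy: "x > 0" "y > 0" unfolding x_def y_def using c(1) ab by (auto intro: divide_pos_pos)
  have qe: "q - u = x *\<^sub>R (a - u) + y *\<^sub>R (b - u)"
    using cross2_basis[of "a - u" "b - u" "q - u"] ab by (simp add: x_def y_def)
  obtain e where e: "e > 0" "\<And>s t. 0 < s \<Longrightarrow> s < e \<Longrightarrow> 0 < t \<Longrightarrow> t < e \<Longrightarrow> u + s *\<^sub>R (a - u) + t *\<^sub>R (b - u) \<in> obs S"
    using geom_split_sector[OF g] by blast
  obtain k where k: "0 < k" "k \<le> 1/2" "k * x < e" "k * y < e"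
    using small_scale[of x y e] xy e(1) by (metis less_imp_le)
  then have "u + (k * x) *\<^sub>R (a - u) + (k * y) *\<^sub>R (b - u) \<in> obs S" using xy by (intro e(2)) auto
  moreover have "u + (k * x) *\<^sub>R (a - u) + (k * y) *\<^sub>R (b - u) = u + k *\<^sub>R (q - u)"
    unfolding qe by (simp add: scaleR_add_right)
  moreover have "u + k *\<^sub>R (q - u) \<in> closed_segment u q" unfolding in_segment using k
    by (intro exI[of _ k]) (auto simp: algebra_simps)
  ultimately show False using visKD[OF q] unfolding visible_iff by auto
qed

lemma subcone_cover:
  assumes "v \<in> visK V S u d" shows "\<exists>X\<in>subcones V S u d. v \<in> X"
proof (cases "is_split V S u d")
  case False then show ?thesis using assms by (auto simp: subcones_def)
next
  case True
  then obtain a b where ab: "split_cfg V S u d a b" by (auto simp: is_split_def)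
  have "v \<in> side1 V S u d a \<or> v \<in> side2 V S u d b"
    using split_not_between[OF split_cfg_geom[OF ab] assms] assms by (auto simp: side1_def side2_def)
  moreover have "side1 V S u d a \<in> subcones V S u d"
    unfolding subcones_def if_P[OF True] using ab by blast
  moreover have "side2 V S u d b \<in> subcones V S u d"
    unfolding subcones_def if_P[OF True] using ab by blast
  ultimately show ?thesis by blast
qed

text \<open>The edges \<open>a\<close>, \<open>b\<close> lie between \<open>v\<close> and
  \<open>q\<close>, so the direction \<open>(a - u) + (b - u)\<close> runs into the obstacle and
  through the free sector at once.\<close>

lemma secfree_no_split:
  assumes g: "geom_split S u d a b" and v: "v \<in> visK V S u d" and q: "q \<in> visK V S u d"
    and sf: "secfree S u v q" and va: "cross2 (v - u) (a - u) \<ge> 0" and bq: "cross2 (b - u) (q - u) \<ge> 0"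
  shows False
proof -
  have ab: "cross2 (a - u) (b - u) > 0" and ac: "a \<in> cone u d" and bc: "b \<in> cone u d"
    using g by (auto simp: geom_split_def)
  have vc: "v \<in> cone u d" and qc: "q \<in> cone u d" using visKD v q by auto
  have vb: "cross2 (v - u) (b - u) > 0" using cone_cross_trans[OF vc ac bc] va ab by simp
  have aq: "cross2 (a - u) (q - u) > 0" using cone_cross_trans[OF ac bc qc] bq ab by simp
  have vq: "cross2 (v - u) (q - u) > 0" using cone_cross_trans[OF vc ac qc] va aq by simp
  let ?D = "cross2 (v - u) (q - u)"
  let ?s = "(a - u) + (b - u)"
  define x where "x = cross2 ?s (q - u) / ?D"
  define y where "y = cross2 (v - u) ?s / ?D"
  have xy: "x > 0" "y > 0" unfolding x_def y_def using aq bq va vb vq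
    by (auto simp: cross2_simps(1,2) intro!: divide_pos_pos)
  have se: "?s = x *\<^sub>R (v - u) + y *\<^sub>R (q - u)"
    using cross2_basis[of "v - u" "q - u" ?s] vq by (simp add: x_def y_def)
  obtain e where e: "e > 0" "\<And>s t. 0 < s \<Longrightarrow> s < e \<Longrightarrow> 0 < t \<Longrightarrow> t < e \<Longrightarrow> u + s *\<^sub>R (a - u) + t *\<^sub>R (b - u) \<in> obs S"
    using geom_split_sector[OF g] by blast
  obtain e' where e': "e' > 0" "\<And>s t. 0 < s \<Longrightarrow> s < e' \<Longrightarrow> 0 < t \<Longrightarrow> t < e' \<Longrightarrow> u + s *\<^sub>R (v - u) + t *\<^sub>R (q - u) \<notin> obs S"
    using sf unfolding secfree_def by blast
  obtain k' where k': "0 < k'" "k' \<le> 1/2" "k' * (x + y) < e'" "k' * 1 < e"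
  proof -
    obtain k1 where k1: "0 < k1" "k1 \<le> 1/2" "k1 * (x + y) < e'" using small_scale[of "x + y" 0 e'] xy e'(1) by auto
    obtain k2 where k2: "0 < k2" "k2 \<le> 1/2" "k2 * 1 < e" using small_scale[of 1 0 e] e(1) by auto
    have "min k1 k2 * (x + y) \<le> k1 * (x + y)" using xy by (intro mult_right_mono) auto
    then show ?thesis using that[of "min k1 k2"] k1 k2 by auto
  qed
  define k where "k = k'"
  have k: "0 < k" "k < e" using k' by (simp_all add: k_def)
  have pos: "k * x > 0" "k * y > 0" using k xy by auto
  moreover have "k * x + k * y < e'" using k'(3) unfolding k_def distrib_left .
  ultimately have "u + (k * x) *\<^sub>R (v - u) + (k * y) *\<^sub>R (q - u) \<notin> obs S" by (intro e'(2)) linarith+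
  moreover have "u + (k * x) *\<^sub>R (v - u) + (k * y) *\<^sub>R (q - u) = u + k *\<^sub>R ?s"
    unfolding se by (simp add: scaleR_add_right)
  moreover have "u + k *\<^sub>R ?s = u + k *\<^sub>R (a - u) + k *\<^sub>R (b - u)" by (simp add: scaleR_add_right)
  ultimately show False using e(2)[of k k] k by simp
qed

text \<open>The converse of \<open>subcone_secfree\<close>: membership in the same subcone is now
  the same as having a locally free sector in between.\<close>

lemma subcone_extend:
  assumes X: "X \<in> subcones V S u d" and v: "v \<in> X" and q: "q \<in> visK V S u d" and sf: "secfree S u v q"
  shows "q \<in> X"
proof (cases "is_split V S u d")
  case False then show ?thesis using X q by (auto simp: subcones_def)
next
  case True
  then obtain a b where ab: "split_cfg V S u d a b" "X = side1 V S u d a \<or> X = side2 V S u d b"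
    using X by (auto simp: subcones_def)
  have vK: "v \<in> visK V S u d" using subcone_sub X v by blast
  note g = split_cfg_geom[OF ab(1)]
  note nb = split_not_between[OF g q]
  show ?thesis using ab(2)
  proof
    assume X1: "X = side1 V S u d a"
    then have "cross2 (v - u) (a - u) \<ge> 0" using v cross2_commute[of "v - u" "a - u"] by (simp add: side1_def)
    then have "\<not> cross2 (b - u) (q - u) \<ge> 0" using secfree_no_split[OF g vK q sf] by blast
    then show ?thesis using nb X1 q by (simp add: side1_def)
  next
    assume X2: "X = side2 V S u d b"
    then have "cross2 (b - u) (v - u) \<ge> 0" using v by (simp add: side2_def)
    moreover have "secfree S u q v" using sf secfree_commute by blast
    ultimately have "\<not> cross2 (q - u) (a - u) \<ge> 0" using secfree_no_split[OF g q vK] by blast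
    then show ?thesis using nb X2 q cross2_commute[of "q - u" "a - u"] by (simp add: side2_def)
  qed
qed

lemma subcone_unique:
  assumes u: "u \<in> V" and "X \<in> subcones V S u d" "Y \<in> subcones V S u d" "z \<in> X" "z \<in> Y"
  shows "X = Y"
proof -
  have "A \<subseteq> B" if "A \<in> subcones V S u d" "B \<in> subcones V S u d" "z \<in> A" "z \<in> B" for A B
  proof
    fix q assume q: "q \<in> A"
    show "q \<in> B"
    proof (cases "q = z")
      case False
      then have "secfree S u z q" using subcone_secfree[OF u that(1)] that q by blast
      then show ?thesis using subcone_extend[OF that(2,4)] subcone_sub[OF that(1)] q by blast
    qed (use that in simp)
  qed
  then show ?thesis using assms by blast
qed

lemma subcones_split_subset:
  assumes "split_cfg V S u d a b"
  shows "subcones V S u d \<subseteq> {side1 V S u d a, side2 V S u d b}"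
proof
  fix X assume "X \<in> subcones V S u d"
  moreover have "is_split V S u d" using assms unfolding is_split_def by blast
  ultimately have "\<exists>a b. split_cfg V S u d a b \<and> (X = side1 V S u d a \<or> X = side2 V S u d b)"
    by (simp add: subcones_def)
  then obtain a' b' where "split_cfg V S u d a' b'" "X = side1 V S u d a' \<or> X = side2 V S u d b'"
    by blast
  then show "X \<in> {side1 V S u d a, side2 V S u d b}" using geom_split_unique assms split_cfg_geom by blast
qed

lemma card_subcones:
  "finite (subcones V S u d)" "card (subcones V S u d) \<le> (if is_split V S u d then 2 else 1)"
proof -
  have "finite (subcones V S u d) \<and> card (subcones V S u d) \<le> (if is_split V S u d then 2 else 1)"
  proof (cases "is_split V S u d")
    case False then show ?thesis by (simp add: subcones_def)
  next
    case True
    then obtain a b where ab: "split_cfg V S u d a b" by (auto simp: is_split_def)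
    have "card {side1 V S u d a, side2 V S u d b} \<le> 2" by (simp add: card_insert_if)
    moreover have "card (subcones V S u d) \<le> card {side1 V S u d a, side2 V S u d b}"
      by (rule card_mono[OF _ subcones_split_subset[OF ab]]) simp
    moreover have "finite (subcones V S u d)"
      by (rule finite_subset[OF subcones_split_subset[OF ab]]) simp
    ultimately show ?thesis using True by simp
  qed
  then show "finite (subcones V S u d)" "card (subcones V S u d) \<le> (if is_split V S u d then 2 else 1)" by auto
qed

text \<open>Both splits come from the same corner with the same edge \<open>a\<close>, which lies in
  both cones.\<close>

lemma is_split_common:
  assumes "is_split V S u d" "is_split V S u d'"
  shows "cone u d \<inter> cone u d' \<noteq> {}"
proof -
  obtain a b a' b' where "geom_split S u d a b" "geom_split S u d' a' b'"
    using assms split_cfg_geom unfolding is_split_def by metis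
  moreover from this have "a = a'" using geom_split_unique by blast
  ultimately show ?thesis unfolding geom_split_def by blast
qed

end

section \<open>Cone coordinates\<close>

definition cc :: "int \<Rightarrow> pt \<Rightarrow> real" where "cc i p = p \<bullet> cdir i"

text \<open>Only distinctness modulo 3 is required, in either orientation, so a lemma for
  \<open>tri i j k\<close> can be reused with \<open>j\<close> and \<open>k\<close> exchanged as its
  own mirror image.\<close>

definition tri :: "int \<Rightarrow> int \<Rightarrow> int \<Rightarrow> bool" where
  "tri i j k \<longleftrightarrow> i mod 3 \<noteq> j mod 3 \<and> i mod 3 \<noteq> k mod 3 \<and> j mod 3 \<noteq> k mod 3"

lemma tri_perm: "tri i j k \<Longrightarrow> tri i k j" "tri i j k \<Longrightarrow> tri j i k" "tri i j k \<Longrightarrow> tri j k i"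
    "tri i j k \<Longrightarrow> tri k i j" "tri i j k \<Longrightarrow> tri k j i"
  by (auto simp: tri_def)

lemma tri_succ: "tri i (i + 1) (i + 2)" "tri i (i + 1) (i - 1)" "tri i (i + 2) (i + 1)" "tri i (i - 1) (i + 1)"
  unfolding tri_def by presburger+

lemma cc_simps: "cc i (p + q) = cc i p + cc i q" "cc i (p - q) = cc i p - cc i q"
    "cc i (t *\<^sub>R p) = t * cc i p" "cc i (- p) = - cc i p" "cc i 0 = 0"
  by (simp_all add: cc_def inner_add_left inner_diff_left)

lemma mod3_cases: "(i::int) mod 3 = 0 \<or> i mod 3 = 1 \<or> i mod 3 = 2" by presburger

lemma cdir_cong: "i mod 3 = j mod 3 \<Longrightarrow> cdir i = cdir j" by (simp add: cdir_def)

lemma cc_cong: "i mod 3 = j mod 3 \<Longrightarrow> cc i = cc j"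
  unfolding cc_def by (metis cdir_cong)

lemma cc_eq: "i mod 3 = 0 \<Longrightarrow> cc i p = snd p"
    "i mod 3 = 1 \<Longrightarrow> cc i p = - sqrt 3 / 2 * fst p - snd p / 2"
    "i mod 3 = 2 \<Longrightarrow> cc i p = sqrt 3 / 2 * fst p - snd p / 2"
  by (simp_all add: cc_def cdir_def inner_prod_def)

lemma tri_cases:
  assumes "tri i j k"
  obtains "i mod 3 = 0" "j mod 3 = 1" "k mod 3 = 2" | "i mod 3 = 0" "j mod 3 = 2" "k mod 3 = 1"
    | "i mod 3 = 1" "j mod 3 = 0" "k mod 3 = 2" | "i mod 3 = 1" "j mod 3 = 2" "k mod 3 = 0"
    | "i mod 3 = 2" "j mod 3 = 0" "k mod 3 = 1" | "i mod 3 = 2" "j mod 3 = 1" "k mod 3 = 0"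
  using assms mod3_cases[of i] mod3_cases[of j] mod3_cases[of k] unfolding tri_def by argo

lemma tri_other: "tri i j k \<Longrightarrow> l mod 3 = i mod 3 \<or> l mod 3 = j mod 3 \<or> l mod 3 = k mod 3"
  unfolding tri_def by presburger

lemma succ3: "(k::int) mod 3 = 0 \<Longrightarrow> (k + 1) mod 3 = 1" "k mod 3 = 1 \<Longrightarrow> (k + 1) mod 3 = 2" "k mod 3 = 2 \<Longrightarrow> (k + 1) mod 3 = 0"
    "k mod 3 = 0 \<Longrightarrow> (k + 2) mod 3 = 2" "k mod 3 = 1 \<Longrightarrow> (k + 2) mod 3 = 0" "k mod 3 = 2 \<Longrightarrow> (k + 2) mod 3 = 1"
    "k mod 3 = 0 \<Longrightarrow> (k - 1) mod 3 = 2" "k mod 3 = 1 \<Longrightarrow> (k - 1) mod 3 = 0" "k mod 3 = 2 \<Longrightarrow> (k - 1) mod 3 = 1"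
  by presburger+

lemma tri_ex:
  assumes "i mod 3 \<noteq> j mod 3" obtains k where "tri i j k"
proof -
  have "tri i j (i + 1) \<or> tri i j (i + 2)"
    using mod3_cases[of i] mod3_cases[of j] assms unfolding tri_def
    by (elim disjE) (simp_all add: succ3)
  then show ?thesis using that by blast
qed

lemma tri_succ_cases:
  assumes "tri i j k" shows "(j + 1) mod 3 = k mod 3 \<or> (k + 1) mod 3 = j mod 3"
  using assms by (rule tri_cases) (simp_all add: succ3)

lemma cc_sum: "tri i j k \<Longrightarrow> cc i p + cc j p + cc k p = 0"
  by (erule tri_cases) (simp_all add: cc_eq)

lemma cc_norm: "tri i j k \<Longrightarrow> (norm p)\<^sup>2 = 4 / 3 * ((cc j p)\<^sup>2 + cc j p * cc k p + (cc k p)\<^sup>2)"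
proof -
  assume t: "tri i j k"
  have s: "sqrt 3 * sqrt 3 = 3" "sqrt 3 * (sqrt 3 * x) = 3 * x" for x :: real by simp_all
  have n: "(norm p)\<^sup>2 = fst p * fst p + snd p * snd p" by (simp add: norm_prod_def power2_eq_square)
  show ?thesis unfolding n using t unfolding power2_eq_square
    by (rule tri_cases) (simp_all add: cc_eq algebra_simps s)
qed

lemma cross2_cc:
  assumes "tri i j k"
  shows "(j + 1) mod 3 = k mod 3 \<Longrightarrow> cross2 p q = 2 / sqrt 3 * (cc j p * cc k q - cc k p * cc j q)"
    "(j + 1) mod 3 \<noteq> k mod 3 \<Longrightarrow> cross2 p q = - (2 / sqrt 3 * (cc j p * cc k q - cc k p * cc j q))"
proof -
  have a: "cross2 p q = 2 / sqrt 3 * (cc m p * cc n q - cc n p * cc m q)"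
    if mn: "(m + 1) mod 3 = n mod 3" for m n
  proof -
    have "m mod 3 = 0 \<and> n mod 3 = 1 \<or> m mod 3 = 1 \<and> n mod 3 = 2 \<or> m mod 3 = 2 \<and> n mod 3 = 0"
      using mn mod3_cases[of m] by (elim disjE) (simp_all add: succ3)
    then have "sqrt 3 * cross2 p q = 2 * (cc m p * cc n q - cc n p * cc m q)"
      by (elim disjE conjE) (simp_all add: cc_eq cross2_def algebra_simps)
    then show ?thesis by (simp add: field_simps)
  qed
  show "cross2 p q = 2 / sqrt 3 * (cc j p * cc k q - cc k p * cc j q)" if "(j + 1) mod 3 = k mod 3"
    using a[OF that] .
  show "cross2 p q = - (2 / sqrt 3 * (cc j p * cc k q - cc k p * cc j q))" if "(j + 1) mod 3 \<noteq> k mod 3"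
  proof -
    have "(k + 1) mod 3 = j mod 3" using that tri_succ_cases[OF assms] by blast
    then have "cross2 p q = 2 / sqrt 3 * (cc k p * cc j q - cc j p * cc k q)" by (rule a)
    also have "\<dots> = - (2 / sqrt 3 * (cc j p * cc k q - cc k p * cc j q))"
      unfolding mult_minus_right[symmetric] minus_diff_eq ..
    finally show ?thesis .
  qed
qed

lemma cross2_cc_ex:
  assumes "tri i j k"
  obtains \<kappa> where "\<kappa> \<noteq> 0" "\<And>p q. cross2 p q = \<kappa> * (cc j p * cc k q - cc k p * cc j q)"
proof (cases "(j + 1) mod 3 = k mod 3")
  case True then show ?thesis using that[of "2 / sqrt 3"] cross2_cc(1)[OF assms] by simp
next
  case False then show ?thesis using that[of "- (2 / sqrt 3)"] cross2_cc(2)[OF assms] by simp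
qed

text \<open>Squaring reduces the inequality to \<open>a * b > 0\<close>, since
  \<open>(a + b)\<^sup>2\<close> exceeds three quarters of \<open>n\<^sup>2\<close> by exactly
  \<open>a * b\<close>.\<close>

lemma cone_aux:
  fixes a b n :: real
  assumes n: "n \<ge> 0" "n\<^sup>2 = 4 / 3 * (a\<^sup>2 + a * b + b\<^sup>2)"
  shows "a + b > sqrt 3 / 2 * n \<longleftrightarrow> a > 0 \<and> b > 0"
proof
  assume h: "a + b > sqrt 3 / 2 * n"
  have p: "sqrt 3 / 2 * n \<ge> 0" using n by simp
  then have "(sqrt 3 / 2 * n)\<^sup>2 < (a + b)\<^sup>2" using h by (intro power_strict_mono) auto
  then have "3 / 4 * n\<^sup>2 < (a + b)\<^sup>2" by (simp add: power_mult_distrib power_divide)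
  then have "a * b > 0" unfolding n(2) by (simp add: power2_eq_square algebra_simps)
  moreover have "a + b > 0" using h p by linarith
  ultimately show "a > 0 \<and> b > 0" by (auto simp: zero_less_mult_iff)
next
  assume ab: "a > 0 \<and> b > 0"
  then have "0 < a * b" by simp
  then have "3 / 4 * n\<^sup>2 < (a + b)\<^sup>2" unfolding n(2) by (simp add: power2_eq_square algebra_simps)
  then have "(sqrt 3 / 2 * n)\<^sup>2 < (a + b)\<^sup>2" by (simp add: power_mult_distrib power_divide)
  then show "a + b > sqrt 3 / 2 * n" using ab power_less_imp_less_base[of "sqrt 3 / 2 * n" 2 "a + b"] by linarith
qed

text \<open>The boundary rays of the cone lie on the lines where coordinate \<open>j\<close> or
  \<open>k\<close> agrees with that of the apex. The projection on the bisector is minus the sum of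
  these two coordinates, so \<open>cone_aux\<close> applies.\<close>

lemma cone_pc:
  assumes t: "tri i j k"
  shows "v \<in> cone u (pc i) \<longleftrightarrow> cc j v < cc j u \<and> cc k v < cc k u"
proof -
  let ?d = "v - u"
  have e: "?d \<bullet> cdir i = - cc j ?d + - cc k ?d" using cc_sum[OF t, of ?d] by (simp add: cc_def)
  have "(norm ?d)\<^sup>2 = 4 / 3 * ((- cc j ?d)\<^sup>2 + - cc j ?d * - cc k ?d + (- cc k ?d)\<^sup>2)" using cc_norm[OF t] by simp
  then have "(- cc j ?d + - cc k ?d > sqrt 3 / 2 * norm ?d) \<longleftrightarrow> (- cc j ?d > 0 \<and> - cc k ?d > 0)"
    by (intro cone_aux) auto
  then show ?thesis unfolding cone_def pc_def mem_Collect_eq e by (auto simp: cc_simps)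
qed

lemma cone_nc:
  assumes t: "tri i j k"
  shows "v \<in> cone u (nc i) \<longleftrightarrow> cc j u < cc j v \<and> cc k u < cc k v"
proof -
  let ?d = "v - u"
  have e: "?d \<bullet> (- cdir i) = cc j ?d + cc k ?d" using cc_sum[OF t, of ?d] by (simp add: cc_def)
  have "(cc j ?d + cc k ?d > sqrt 3 / 2 * norm ?d) \<longleftrightarrow> (cc j ?d > 0 \<and> cc k ?d > 0)"
    using cc_norm[OF t] by (intro cone_aux) auto
  then show ?thesis unfolding cone_def nc_def mem_Collect_eq e by (auto simp: cc_simps)
qed

lemma cone_nc_pc: "v \<in> cone u (nc i) \<longleftrightarrow> u \<in> cone v (pc i)"
  using cone_nc[OF tri_succ(1)] cone_pc[OF tri_succ(1)] by blast

lemma cone_pc_disj: "v \<in> cone u (pc i) \<Longrightarrow> v \<in> cone u (pc j) \<Longrightarrow> i mod 3 = j mod 3"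
proof (rule ccontr)
  assume a: "v \<in> cone u (pc i)" "v \<in> cone u (pc j)" "i mod 3 \<noteq> j mod 3"
  obtain k where t: "tri i j k" using tri_ex[OF a(3)] .
  have "cc j v < cc j u \<and> cc k v < cc k u" using cone_pc[OF t] a(1) by blast
  moreover have "cc i v < cc i u" using cone_pc[OF tri_perm(2)[OF t]] a(2) by blast
  ultimately show False using cc_sum[OF t, of v] cc_sum[OF t, of u] by linarith
qed

lemma cone_nc_disj: "v \<in> cone u (nc i) \<Longrightarrow> v \<in> cone u (nc j) \<Longrightarrow> i mod 3 = j mod 3"
  using cone_pc_disj cone_nc_pc by blast

lemma cone_pc_nc_disj: "v \<in> cone u (pc i) \<Longrightarrow> v \<in> cone u (nc j) \<Longrightarrow> False"
proof -
  assume a: "v \<in> cone u (pc i)" "v \<in> cone u (nc j)"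
  obtain k l where t: "tri i k l" using tri_succ by blast
  obtain k' l' where t': "tri j k' l'" using tri_succ by blast
  have 1: "cc k v < cc k u" "cc l v < cc l u" using a(1) cone_pc[OF t] by auto
  have 2: "cc k' u < cc k' v" "cc l' u < cc l' v" using a(2) cone_nc[OF t'] by auto
  have "(k mod 3 = k' mod 3 \<or> k mod 3 = l' mod 3) \<or> (l mod 3 = k' mod 3 \<or> l mod 3 = l' mod 3)"
    using tri_other[OF t', of k] tri_other[OF t', of l] t unfolding tri_def by auto
  then show False using 1 2 cc_cong by (metis less_asym)
qed

lemma proj_pc: "proj u (pc i) v = cc i v - cc i u"
  by (simp add: proj_def pc_def cc_def inner_diff_left)

lemma proj_nc: "proj u (nc i) v = cc i u - cc i v"
  by (simp add: proj_def nc_def cc_def inner_diff_left)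

lemma cc_hull:
  assumes "p \<in> convex hull {a, b, c}"
  shows "cc i a \<le> m \<Longrightarrow> cc i b \<le> m \<Longrightarrow> cc i c \<le> m \<Longrightarrow> cc i p \<le> m"
    and "cc i a < m \<Longrightarrow> cc i b < m \<Longrightarrow> cc i c < m \<Longrightarrow> cc i p < m"
    and "m \<le> cc i a \<Longrightarrow> m \<le> cc i b \<Longrightarrow> m \<le> cc i c \<Longrightarrow> m \<le> cc i p"
    and "m < cc i a \<Longrightarrow> m < cc i b \<Longrightarrow> m < cc i c \<Longrightarrow> m < cc i p"
proof -
  have lin: "linear (cc i)" by (rule linearI) (simp_all add: cc_simps)
  have cv: "p \<in> T" if "convex T" "a \<in> T" "b \<in> T" "c \<in> T" for T
  proof -
    have "convex hull {a, b, c} \<subseteq> T" using that by (intro hull_minimal) auto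
    then show ?thesis using assms by blast
  qed
  have c: "convex {x. cc i x \<le> m}" "convex {x. cc i x < m}" "convex {x. m \<le> cc i x}" "convex {x. m < cc i x}"
    unfolding cc_def
    by (simp_all add: inner_commute[of _ "cdir i"] convex_halfspace_le convex_halfspace_lt convex_halfspace_ge convex_halfspace_gt)
  show "cc i a \<le> m \<Longrightarrow> cc i b \<le> m \<Longrightarrow> cc i c \<le> m \<Longrightarrow> cc i p \<le> m"
    "cc i a < m \<Longrightarrow> cc i b < m \<Longrightarrow> cc i c < m \<Longrightarrow> cc i p < m"
    "m \<le> cc i a \<Longrightarrow> m \<le> cc i b \<Longrightarrow> m \<le> cc i c \<Longrightarrow> m \<le> cc i p"
    "m < cc i a \<Longrightarrow> m < cc i b \<Longrightarrow> m < cc i c \<Longrightarrow> m < cc i p"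
    using cv[OF c(1)] cv[OF c(2)] cv[OF c(3)] cv[OF c(4)] by blast+
qed

lemma freetri_perm: "freetri V S a b c \<Longrightarrow> freetri V S b a c" "freetri V S a b c \<Longrightarrow> freetri V S a c b"
    "freetri V S a b c \<Longrightarrow> freetri V S b c a" "freetri V S a b c \<Longrightarrow> freetri V S c a b" "freetri V S a b c \<Longrightarrow> freetri V S c b a"
  by (simp_all add: freetri_def insert_commute)

lemma freetri_visible: "freetri V S a b c \<Longrightarrow> visible S a b"
proof -
  assume f: "freetri V S a b c"
  have "closed_segment a b \<subseteq> convex hull {a, b, c}"
    unfolding segment_convex_hull by (intro hull_mono) auto
  then show ?thesis using f unfolding freetri_def visible_iff by blast
qed

lemma freetri_secfree: "freetri V S a b c \<Longrightarrow> secfree S a b c"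
proof -
  assume f: "freetri V S a b c"
  have "a + s *\<^sub>R (b - a) + t *\<^sub>R (c - a) \<notin> obs S" if "0 < s" "s < 1/2" "0 < t" "t < 1/2" for s t
  proof -
    have "s + t \<le> 1" "0 \<le> s" "0 \<le> t" using that by auto
    then have "a + s *\<^sub>R (b - a) + t *\<^sub>R (c - a) \<in> convex hull {a, b, c}" unfolding in_hull3 by blast
    then show ?thesis using f unfolding freetri_def by blast
  qed
  then show ?thesis unfolding secfree_def by (intro exI[of _ "1/2"]) auto
qed

text \<open>Nonnegative combinations of \<open>a - x\<close> and \<open>b - x\<close> span a sector
  inside the given one; the two sums of coefficients being positive keeps both parameters strictly
  positive.\<close>

lemma secfree_mono:
  assumes sf: "secfree S x a b"
    and u: "u - x = \<alpha> *\<^sub>R (a - x) + \<beta> *\<^sub>R (b - x)" and q: "q - x = \<gamma> *\<^sub>R (a - x) + \<delta> *\<^sub>R (b - x)"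
    and nn: "0 \<le> \<alpha>" "0 \<le> \<beta>" "0 \<le> \<gamma>" "0 \<le> \<delta>" "0 < \<alpha> + \<gamma>" "0 < \<beta> + \<delta>"
  shows "secfree S x u q"
proof -
  obtain e where e: "e > 0" "\<And>s t. 0 < s \<Longrightarrow> s < e \<Longrightarrow> 0 < t \<Longrightarrow> t < e \<Longrightarrow> x + s *\<^sub>R (a - x) + t *\<^sub>R (b - x) \<notin> obs S"
    using sf unfolding secfree_def by blast
  obtain k where k: "0 < k" "k * (\<alpha> + \<gamma>) < e" "k * (\<beta> + \<delta>) < e"
    using small_scale[of "\<alpha> + \<gamma>" "\<beta> + \<delta>" e] nn e(1) by (metis less_imp_le)
  have "x + s *\<^sub>R (u - x) + t *\<^sub>R (q - x) \<notin> obs S" if st: "0 < s" "s < k" "0 < t" "t < k" for s t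
  proof -
    have eq: "x + s *\<^sub>R (u - x) + t *\<^sub>R (q - x) = x + (s * \<alpha> + t * \<gamma>) *\<^sub>R (a - x) + (s * \<beta> + t * \<delta>) *\<^sub>R (b - x)"
      unfolding u q by (simp add: algebra_simps)
    have pos: "0 < s * p + t * r \<and> s * p + t * r < e" if h: "0 \<le> p" "0 \<le> r" "0 < p + r" "k * (p + r) < e" for p r
    proof -
      have "s * p \<le> k * p" "t * r \<le> k * r" using st h by (auto intro: mult_right_mono)
      then have "s * p + t * r < e" using h(4) by (simp add: distrib_left)
      moreover have "0 < s * p + t * r" using st h by (smt (verit) mult_nonneg_nonneg mult_pos_pos)
      ultimately show ?thesis by blast
    qed
    show ?thesis unfolding eq using pos[of \<alpha> \<gamma>] pos[of \<beta> \<delta>] nn k e(2) by blast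
  qed
  then show ?thesis unfolding secfree_def using k(1) by blast
qed

text \<open>Orients an edge of \<open>Ginf\<close> from the vertex that selects it in its positive
  cone \<open>i\<close>. The index is any integer read modulo 3, so \<open>i + 1\<close> and
  \<open>i + 2\<close> need no reduction.\<close>

definition Epos :: "pt set \<Rightarrow> pt list set \<Rightarrow> int \<Rightarrow> pt \<Rightarrow> pt \<Rightarrow> bool" where
  "Epos V S i x u \<longleftrightarrow> x \<in> V \<and> (\<exists>X\<in>subcones V S x (pc i). u \<in> X \<and> (\<forall>z\<in>X. proj x (pc i) u \<le> proj x (pc i) z))"

lemma Epos_cong: "i mod 3 = j mod 3 \<Longrightarrow> Epos V S i = Epos V S j"
  unfolding Epos_def pc_def by (simp only: cdir_cong[of i j])

lemma Ginf_iff: "{u, v} \<in> Ginf V S \<longleftrightarrow> (\<exists>i. Epos V S i u v \<or> Epos V S i v u)"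
proof
  assume "{u, v} \<in> Ginf V S"
  then obtain a b i where "{u, v} = {a, b}" "Epos V S i a b" unfolding Ginf_def Epos_def by blast
  then show "\<exists>i. Epos V S i u v \<or> Epos V S i v u" by (auto simp: doubleton_eq_iff)
next
  have m: "{a, b} \<in> Ginf V S" if e: "Epos V S i a b" for i a b
  proof -
    have "Epos V S (i mod 3) a b" using e Epos_cong[of i "i mod 3"] by simp
    then have "a \<in> V \<and> (\<exists>X\<in>subcones V S a (pc (i mod 3)). b \<in> X \<and> (\<forall>z\<in>X. proj a (pc (i mod 3)) b \<le> proj a (pc (i mod 3)) z))"
      unfolding Epos_def .
    moreover have "i mod 3 \<in> {0, 1, 2}" using mod3_cases[of i] by auto
    ultimately have "a \<in> V \<and> (\<exists>i\<in>{0,1,2::int}. \<exists>X\<in>subcones V S a (pc i). b \<in> X \<and> (\<forall>z\<in>X. proj a (pc i) b \<le> proj a (pc i) z))"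
      by (intro conjI bexI[of _ "i mod 3"]) simp_all
    then show ?thesis unfolding Ginf_def by (intro CollectI exI[of _ a] exI[of _ b] conjI refl) simp_all
  qed
  assume "\<exists>i. Epos V S i u v \<or> Epos V S i v u"
  then show "{u, v} \<in> Ginf V S" using m insert_commute by metis
qed

section \<open>Edges of \<open>Ginf\<close>: criteria by free sectors, and planarity\<close>

context setting
begin

abbreviation "vis \<equiv> visible S"
abbreviation "E \<equiv> Epos V S"
abbreviation "FT \<equiv> freetri V S"
abbreviation "SF \<equiv> secfree S"

text \<open>Lines perpendicular to a bisector are parallel to a cone boundary, so general position
  makes every coordinate injective on \<open>V\<close>.\<close>

lemma cc_neq: "p \<in> V \<Longrightarrow> q \<in> V \<Longrightarrow> p \<noteq> q \<Longrightarrow> cc i p \<noteq> cc i q"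
proof -
  assume a: "p \<in> V" "q \<in> V" "p \<noteq> q"
  then have g: "cross2 (q - p) (1, 0) \<noteq> 0" "cross2 (q - p) (1, sqrt 3) \<noteq> 0" "cross2 (q - p) (- 1, sqrt 3) \<noteq> 0"
    using gp by (auto simp: general_position_def)
  show ?thesis using mod3_cases[of i]
  proof (elim disjE)
    assume "i mod 3 = 0" then show ?thesis using g(1) by (simp add: cc_eq cross2_def)
  next
    assume "i mod 3 = 1" then show ?thesis using g(3) by (simp add: cc_eq cross2_def algebra_simps)
  next
    assume "i mod 3 = 2" then show ?thesis using g(2) by (simp add: cc_eq cross2_def algebra_simps)
  qed
qed

lemma E_D:
  assumes "E i x u"
  shows "x \<in> V" "u \<in> V" "x \<noteq> u" "u \<in> cone x (pc i)" "vis x u" "u \<in> visK V S x (pc i)"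
proof -
  obtain X where "X \<in> subcones V S x (pc i)" "u \<in> X" "x \<in> V" using assms unfolding Epos_def by blast
  then show k: "u \<in> visK V S x (pc i)" "x \<in> V" using subcone_sub by blast+
  then show "u \<in> V" "u \<in> cone x (pc i)" "vis x u" "x \<noteq> u" using visKD[OF k(1)] by (auto simp: cone_def)
qed

lemma E_empty:
  assumes e: "E i x u" and q: "q \<in> V" "q \<in> cone x (pc i)" "vis x q" and sf: "SF x u q" and lt: "cc i q < cc i u"
  shows False
proof -
  obtain X where X: "X \<in> subcones V S x (pc i)" "u \<in> X" "\<forall>z\<in>X. proj x (pc i) u \<le> proj x (pc i) z"
    using e unfolding Epos_def by blast
  have "q \<in> visK V S x (pc i)" using q by (simp add: visK_def)
  then have "q \<in> X" using subcone_extend[OF X(1,2) _ sf] by blast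
  then show False using X(3) lt by (auto simp: proj_pc)
qed

text \<open>With \<open>E_empty\<close> this describes the selected vertex by free sectors alone,
  without naming its subcone.\<close>

lemma E_exists:
  assumes "x \<in> V" "u \<in> V" "u \<in> cone x (pc i)" "vis x u"
    and m: "\<And>z. z \<in> V \<Longrightarrow> z \<in> cone x (pc i) \<Longrightarrow> vis x z \<Longrightarrow> z \<noteq> u \<Longrightarrow> SF x u z \<Longrightarrow> cc i z < cc i u \<Longrightarrow> False"
  shows "E i x u"
proof -
  have "u \<in> visK V S x (pc i)" using assms by (simp add: visK_def)
  then obtain X where X: "X \<in> subcones V S x (pc i)" "u \<in> X" using subcone_cover by blast
  have "cc i u \<le> cc i z" if "z \<in> X" for z
  proof (rule ccontr)
    assume lt: "\<not> cc i u \<le> cc i z"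
    then have "z \<noteq> u" by auto
    then have "SF x u z" using subcone_secfree[OF assms(1) X(1,2) that] by blast
    moreover have "z \<in> visK V S x (pc i)" using subcone_sub[OF X(1)] that by blast
    ultimately show False using m[of z] visKD[of z x "pc i"] lt \<open>z \<noteq> u\<close> by auto
  qed
  then show ?thesis unfolding Epos_def using assms(1) X by (auto simp: proj_pc)
qed

lemma visible_empty_triangle:
  assumes V: "x \<in> V" "v \<in> V" "w \<in> V" "x \<noteq> v" "x \<noteq> w" "v \<noteq> w" and vis: "vis x v" "vis x w" and sf: "SF x v w"
  obtains q \<alpha> \<beta> where "q \<in> V" "q \<in> convex hull {x, v, w}" "q \<noteq> x" "q \<noteq> v" "FT x v q"
    "0 \<le> \<alpha>" "\<alpha> < 1" "0 < \<beta>" "q - x = \<alpha> *\<^sub>R (v - x) + \<beta> *\<^sub>R (w - x)"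
proof -
  have nz: "cross2 (v - x) (w - x) \<noteq> 0" using not_collinear V by metis
  have noV: "V \<inter> closed_segment x v \<subseteq> {x, v}" using not_in_segment[OF V(1,2)] by blast
  have wh: "w \<in> convex hull {x, v, w}" by (simp add: hull_inc)
  show ?thesis
    using adjacent_vertex[OF V(2) nz visible_clear[OF V(1,2) vis(1)] visible_clear[OF V(1,3) vis(2)] sf noV V(3) wh]
      V that by metis
qed

lemma segs_distinct:
  assumes V: "a \<in> V" "b \<in> V" "c \<in> V" "d \<in> V" and ne: "{a, b} \<noteq> {c, d}"
    and o: "o' \<in> open_segment a b" "o' \<in> open_segment c d"
  shows "a \<noteq> c" "a \<noteq> d" "b \<noteq> c" "b \<noteq> d" "cross2 (b - a) (d - c) \<noteq> 0"
proof -
  have ab: "a \<noteq> b" "c \<noteq> d" using o by auto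
  obtain s where s: "0 < s" "s < 1" "o' = (1 - s) *\<^sub>R a + s *\<^sub>R b" using o(1) unfolding in_segment by blast
  obtain t where t: "0 < t" "t < 1" "o' = (1 - t) *\<^sub>R c + t *\<^sub>R d" using o(2) unfolding in_segment by blast
  have sh: "{p, q} = {p, r}" if "p \<in> V" "q \<in> V" "r \<in> V" "p \<noteq> q" "p \<noteq> r" "o' \<in> open_segment p q" "o' \<in> open_segment p r" for p q r
  proof (rule ccontr)
    assume "{p, q} \<noteq> {p, r}"
    then have "q \<noteq> r" by auto
    obtain s' where s': "0 < s'" "o' = (1 - s') *\<^sub>R p + s' *\<^sub>R q" using \<open>o' \<in> open_segment p q\<close> unfolding in_segment by blast
    obtain t' where t': "0 < t'" "o' = (1 - t') *\<^sub>R p + t' *\<^sub>R r" using \<open>o' \<in> open_segment p r\<close> unfolding in_segment by blast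
    have "o' - p = s' *\<^sub>R (q - p)" unfolding s'(2) by (simp add: algebra_simps)
    moreover have "o' - p = t' *\<^sub>R (r - p)" unfolding t'(2) by (simp add: algebra_simps)
    ultimately have "s' * t' * cross2 (q - p) (r - p) = 0"
      by (metis cross2_simps(7,8,9) mult.assoc mult.commute)
    then show False using s' t' not_collinear[of p q r] that \<open>q \<noteq> r\<close> by simp
  qed
  show d: "a \<noteq> c" "a \<noteq> d" "b \<noteq> c" "b \<noteq> d"
  proof -
    have o': "o' \<in> open_segment b a" "o' \<in> open_segment d c" using o by (simp_all add: open_segment_commute)
    show "a \<noteq> c" using sh[of a b d] V ab ne o o' by blast
    show "a \<noteq> d" using sh[of a b c] V ab ne o o' by blast
    show "b \<noteq> c" using sh[of b a d] V ab ne o o' by blast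
    show "b \<noteq> d" using sh[of b a c] V ab ne o o' by blast
  qed
  show "cross2 (b - a) (d - c) \<noteq> 0"
  proof
    assume z: "cross2 (b - a) (d - c) = 0"
    have "s *\<^sub>R (b - a) = o' - a" unfolding s(3) by (simp add: algebra_simps)
    moreover have "t *\<^sub>R (d - c) = o' - c" unfolding t(3) by (simp add: algebra_simps)
    ultimately have "c - a = s *\<^sub>R (b - a) - t *\<^sub>R (d - c)" by simp
    then have "cross2 (b - a) (c - a) = 0" using z cross2_simps(4)[of "b - a" "s *\<^sub>R (b - a)" "t *\<^sub>R (d - c)"] cross2_simps(8,9) by simp
    then show False using not_collinear[of a b c] V ab d by auto
  qed
qed

lemma crossing_free:
  assumes V: "a \<in> V" "b \<in> V" "c \<in> V" "d \<in> V" and vis: "vis a b" "vis c d"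
    and o: "o' \<in> open_segment a b" "o' \<in> open_segment c d" and nz: "cross2 (b - a) (d - c) \<noteq> 0"
  shows "SF o' p q"
proof -
  have "o' \<notin> bd S"
  proof
    assume "o' \<in> bd S"
    then obtain P k where P: "P \<in> S" "k < length P" "o' \<in> pedge P k" unfolding bd_def pbound_def by blast
    let ?m = "P ! (Suc k mod length P) - P ! k"
    have z: "cross2 ?m (b - a) = 0" "cross2 ?m (d - c) = 0"
      using visible_clear[OF V(1,2) vis(1)] visible_clear[OF V(3,4) vis(2)] P o unfolding clear_def by blast+
    have "?m = (cross2 ?m (d - c) / cross2 (b - a) (d - c)) *\<^sub>R (b - a) + (cross2 (b - a) ?m / cross2 (b - a) (d - c)) *\<^sub>R (d - c)"
      by (rule cross2_basis[OF nz])
    then have "?m = 0" using z cross2_commute[of "b - a" ?m] by simp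
    then have "P ! (Suc k mod length P) = P ! k" by simp
    moreover have "Suc k mod length P < length P" using P(2) by (intro mod_less_divisor) linarith
    ultimately have "Suc k mod length P = k" using distS[OF P(1)] P(2) nth_eq_iff_index_eq by blast
    then show False using P(2) lenS[OF P(1)] by (cases "Suc k = length P") auto
  qed
  then obtain e where e: "e > 0" "ball o' e \<subseteq> - bd S" using closed_bd by (metis ComplI open_Compl openE)
  have "o' \<notin> obs S" using vis(1) o(1) unfolding visible_iff open_segment_def by blast
  then have fr: "ball o' e \<inter> obs S = {}"
    using convex_obs(2)[of "ball o' e"] e centre_in_ball by blast
  obtain k where k: "0 < k" "k * norm (p - o') < e / 2" "k * norm (q - o') < e / 2"
    using small_scale[of "norm (p - o')" "norm (q - o')" "e / 2"] e(1) by auto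
  have "o' + s *\<^sub>R (p - o') + t *\<^sub>R (q - o') \<in> ball o' e" if st: "0 < s" "s < k" "0 < t" "t < k" for s t
  proof -
    have "dist o' (o' + s *\<^sub>R (p - o') + t *\<^sub>R (q - o')) = norm (s *\<^sub>R (p - o') + t *\<^sub>R (q - o'))"
      by (simp add: dist_norm norm_minus_commute add.commute)
    also have "\<dots> \<le> s * norm (p - o') + t * norm (q - o')"
      using norm_triangle_ineq[of "s *\<^sub>R (p - o')" "t *\<^sub>R (q - o')"] st by simp
    also have "\<dots> \<le> k * norm (p - o') + k * norm (q - o')" using st by (intro add_mono mult_right_mono) auto
    also have "\<dots> < e" using k by linarith
    finally show ?thesis by simp
  qed
  then show ?thesis unfolding secfree_def using k(1) fr by blast
qed

lemma noV_subsegment: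
  assumes "a \<in> V" "b \<in> V" "o' \<in> open_segment a b"
  shows "V \<inter> closed_segment o' a \<subseteq> {o', a}"
proof
  fix p assume p: "p \<in> V \<inter> closed_segment o' a"
  have o: "o' \<in> closed_segment a b" "o' \<noteq> b" using assms(3) by (auto simp: open_segment_def)
  then have "closed_segment o' a \<subseteq> closed_segment a b" by (simp add: subset_closed_segment)
  then have "p = a \<or> p = b" using not_in_segment[OF assms(1,2)] p by blast
  moreover have "p \<noteq> b"
  proof
    assume "p = b"
    then have "b \<in> closed_segment o' a" using p by simp
    then show False using o(1) o(2)
      by (metis closed_segment_commute between_antisym between_mem_segment)
  qed
  ultimately show "p \<in> {o', a}" by blast
qed

text \<open>A vertex of the triangle spanned by an edge, seen from a point of that edge, would be a
  closer neighbour.\<close>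
lemma E_triangle_empty:
  assumes e: "E i u v" and t: "tri i j k" and o: "o' \<in> open_segment u v" and x: "x \<in> V" "x \<noteq> u"
    and nz: "cross2 (u - o') (x - o') \<noteq> 0" and cl: "clear S o' x" and sf: "SF o' u x"
    and T: "cc j x \<le> cc j u" "cc k x \<le> cc k u" "cc i x < cc i v"
  shows False
proof -
  note D = E_D[OF e]
  have uv: "cc j v < cc j u" "cc k v < cc k u" using cone_pc[OF t] D(4) by auto
  have cu: "clear S o' u" using clear_sub[OF visible_clear[OF D(1,2,5)]] o by (auto simp: open_segment_def)
  have xh: "x \<in> convex hull {o', u, x}" by (simp add: hull_inc)
  have xo: "x \<noteq> o'" using nz by (auto simp: cross2_simps(9,11))
  obtain q where q: "q \<in> V" "q \<in> convex hull {o', u, x}" "q \<noteq> o'" "q \<noteq> u" "FT o' u q"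
    using adjacent_vertex[OF D(1) nz cu cl sf noV_subsegment[OF D(1,2) o] x(1) xh xo x(2)] by blast
  obtain s where s: "0 < s" "s < 1" "o' = (1 - s) *\<^sub>R u + s *\<^sub>R v" using o unfolding in_segment by blast
  have ccs: "cc m o' = cc m u + s * (cc m v - cc m u)" for m unfolding s(3) by (simp add: cc_simps algebra_simps)
  have oj: "cc j o' \<le> cc j u" "cc k o' \<le> cc k u" unfolding ccs using uv s(1) by (auto simp: mult_le_0_iff)
  have iuv: "cc i u < cc i v" using uv cc_sum[OF t, of u] cc_sum[OF t, of v] by linarith
  have "s * (cc i v - cc i u) < 1 * (cc i v - cc i u)" using s(2) iuv by (intro mult_strict_right_mono) auto
  then have oi: "cc i o' < cc i v" unfolding ccs by simp
  have "cc j q \<le> cc j u" "cc k q \<le> cc k u" "cc i q < cc i v" using cc_hull[OF q(2)] oj oi T iuv by auto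
  then have qc: "cc j q < cc j u" "cc k q < cc k u" "cc i q < cc i v"
    using cc_neq[OF q(1) D(1) q(4)] by (auto simp: less_le)
  have qcone: "q \<in> cone u (pc i)" using cone_pc[OF t] qc by blast
  have "vis u q" using freetri_visible[OF freetri_perm(3)[OF q(5)]] .
  moreover have "SF u o' q" using freetri_secfree[OF freetri_perm(1)[OF q(5)]] .
  then have "SF u v q"
  proof (rule secfree_mono[where \<alpha> = "1 / s" and \<beta> = 0 and \<gamma> = 0 and \<delta> = 1])
    have "o' - u = s *\<^sub>R (v - u)" unfolding s(3) by (simp add: algebra_simps)
    then show "v - u = (1 / s) *\<^sub>R (o' - u) + 0 *\<^sub>R (q - u)" using s(1) by simp
  qed (use s in auto)
  ultimately show False using E_empty[OF e q(1) qcone] qc(3) by blast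
qed

text \<open>Each edge spans the triangle of points whose coordinates respect the bounds
  \<open>t\<close>, respectively \<open>s\<close>. By \<open>E_triangle_empty\<close> at the
  crossing point, no end of one edge lies in the triangle of the other, so each of the four ends
  violates a bound in some coordinate. These coordinates are pairwise different: a common one for
  both ends of an edge would push \<open>o'\<close> out of the other triangle, and a common one for
  ends of different edges would make \<open>t\<close> and \<open>s\<close> exceed each other. But
  there are only three coordinates.\<close>

lemma Ginf_plane:
  assumes e: "E i u v" and e': "E i' x y" and o: "o' \<in> open_segment u v" "o' \<in> open_segment x y"
  shows "{u, v} = {x, y}"
proof (rule ccontr)
  assume ne: "{u, v} \<noteq> {x, y}"
  note D = E_D[OF e] and D' = E_D[OF e']
  note dist = segs_distinct[OF D(1,2) D'(1,2) ne o]
  have xu: "cc m p \<noteq> cc m q" if "p \<in> {u, v}" "q \<in> {x, y}" for m p q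
    using that cc_neq D(1,2) D'(1,2) dist by (metis insertE singletonD)
  have out: "\<exists>m\<in>{0,1,2}. cc m p > (if m mod 3 = i0 mod 3 then cc m v0 else cc m u0)"
    if e0: "E i0 u0 v0" and e1: "E i1 u1 v1" and ne0: "{u0, v0} \<noteq> {u1, v1}" and o0: "o' \<in> open_segment u0 v0" "o' \<in> open_segment u1 v1"
      and p: "p = u1 \<or> p = v1" for i0 u0 v0 i1 u1 v1 p
  proof (rule ccontr)
    assume n: "\<not> ?thesis"
    note D0 = E_D[OF e0] and D1 = E_D[OF e1]
    note dist0 = segs_distinct[OF D0(1,2) D1(1,2) ne0 o0]
    define a where "a = i0 mod 3"
    have am: "a \<in> {0,1,2}" using mod3_cases[of i0] by (auto simp: a_def)
    have all: "cc m p \<le> (if m mod 3 = i0 mod 3 then cc m v0 else cc m u0)" for m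
    proof -
      have "m mod 3 \<in> {0,1,2}" using mod3_cases[of m] by auto
      then have "cc (m mod 3) p \<le> (if m mod 3 = i0 mod 3 then cc (m mod 3) v0 else cc (m mod 3) u0)" using n by (metis mod_mod_trivial not_le)
      moreover have "cc (m mod 3) = cc m" by (rule cc_cong) simp
      ultimately show ?thesis by metis
    qed
    have t: "tri i0 (i0 + 1) (i0 + 2)" by (rule tri_succ)
    have c1: "cc (i0 + 1) p \<le> cc (i0 + 1) u0" "cc (i0 + 2) p \<le> cc (i0 + 2) u0"
      using all[of "i0 + 1"] all[of "i0 + 2"] t by (auto simp: tri_def)
    have pV: "p \<in> V" "p \<noteq> v0" "p \<noteq> u0" using p D1 dist0 by auto
    have c2: "cc i0 p < cc i0 v0" using all[of i0] cc_neq[OF pV(1) D0(2) pV(2), of i0] by simp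
    obtain s where s: "0 < s" "s < 1" "o' = (1 - s) *\<^sub>R u0 + s *\<^sub>R v0" using o0(1) unfolding in_segment by blast
    obtain r where r: "0 < r" "r < 1" "o' = (1 - r) *\<^sub>R u1 + r *\<^sub>R v1" using o0(2) unfolding in_segment by blast
    have uo: "u0 - o' = (- s) *\<^sub>R (v0 - u0)" unfolding s(3) by (simp add: algebra_simps)
    have po: "\<exists>r'. r' \<noteq> 0 \<and> p - o' = r' *\<^sub>R (v1 - u1)"
    proof -
      have "u1 - o' = (- r) *\<^sub>R (v1 - u1)" "v1 - o' = (1 - r) *\<^sub>R (v1 - u1)" unfolding r(3) by (simp_all add: algebra_simps)
      then show ?thesis using p r(1,2) by (metis diff_gt_0_iff_gt less_irrefl neg_equal_0_iff_equal)
    qed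
    then have nz: "cross2 (u0 - o') (p - o') \<noteq> 0" unfolding uo using s(1) dist0(5) by (auto simp: cross2_simps(5,7,8))
    have "o' \<in> closed_segment u1 v1" "p \<in> closed_segment u1 v1" using o0(2) p by (auto simp: open_segment_def)
    then have cl: "clear S o' p" by (rule clear_sub[OF visible_clear[OF D1(1,2,5)]])
    show False
      using E_triangle_empty[OF e0 t o0(1) pV(1,3) nz cl crossing_free[OF D0(1,2) D1(1,2) D0(5) D1(5) o0 dist0(5)] c1 c2] .
  qed
  \<comment> \<open>The head of an edge bounds coordinate \<open>i\<close>, its tail bounds the
    other two.\<close>
  define t where "t m = (if m mod 3 = i mod 3 then cc m v else cc m u)" for m :: int
  define s where "s m = (if m mod 3 = i' mod 3 then cc m y else cc m x)" for m :: int
  have le: "cc m u0 \<le> (if m mod 3 = i0 mod 3 then cc m v0 else cc m u0) \<and> cc m v0 \<le> (if m mod 3 = i0 mod 3 then cc m v0 else cc m u0)"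
    if e0: "E i0 u0 v0" for m i0 u0 v0
  proof -
    have tr: "tri i0 (i0 + 1) (i0 + 2)" by (rule tri_succ)
    have 1: "cc (i0 + 1) v0 < cc (i0 + 1) u0" "cc (i0 + 2) v0 < cc (i0 + 2) u0" using cone_pc[OF tr] E_D(4)[OF e0] by auto
    then have 2: "cc i0 u0 < cc i0 v0" using cc_sum[OF tr, of u0] cc_sum[OF tr, of v0] by linarith
    show ?thesis using tri_other[OF tr, of m] 1 2 cc_cong[of m i0] cc_cong[of m "i0 + 1"] cc_cong[of m "i0 + 2"] by auto
  qed
  have seg: "cc m o' \<le> b" if "cc m p \<le> b" "cc m q \<le> b" "o' \<in> open_segment p q" for m b p q
    using cc_hull(1)[of o' p q q m b] that by (auto simp: open_segment_def segment_convex_hull)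
  have seg2: "b < cc m o'" if "b < cc m p" "b < cc m q" "o' \<in> open_segment p q" for m b p q
    using cc_hull(4)[of o' p q q b m] that by (auto simp: open_segment_def segment_convex_hull)
  have lt: "cc m u \<le> t m" "cc m v \<le> t m" "cc m x \<le> s m" "cc m y \<le> s m" for m
    using le[OF e, of m] le[OF e', of m] by (auto simp: t_def s_def)
  have ot: "cc m o' \<le> t m" "cc m o' \<le> s m" for m using seg lt o by blast+
  obtain k1 k2 k3 k4 where k: "k1 \<in> {0,1,2}" "cc k1 x > t k1" "k2 \<in> {0,1,2}" "cc k2 y > t k2"
      "k3 \<in> {0,1,2}" "cc k3 u > s k3" "k4 \<in> {0,1,2}" "cc k4 v > s k4"
    using out[OF e e' ne o, of x] out[OF e e' ne o, of y] out[OF e' e ne[symmetric] o(2,1), of u] out[OF e' e ne[symmetric] o(2,1), of v]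
    unfolding t_def s_def by blast
  have "k1 \<noteq> k2" using seg2[of "t k1" k1 x y] k ot(1)[of k1] o(2) by force
  moreover have "k3 \<noteq> k4" using seg2[of "s k3" k3 u v] k ot(2)[of k3] o(1) by force
  moreover have "k1 \<noteq> k3" "k1 \<noteq> k4" "k2 \<noteq> k3" "k2 \<noteq> k4"
    using k lt by (metis leD less_le_trans order.strict_trans)+
  ultimately show False using k(1,3,5,7) by auto
qed

end

section \<open>Canonical paths\<close>

text \<open>The cross product up to a nonzero factor whose sign depends on the orientation of
  \<open>j\<close>, \<open>k\<close>. Arguments phrased with \<open>crs\<close> therefore hold for
  both orientations.\<close>

definition crs :: "int \<Rightarrow> int \<Rightarrow> pt \<Rightarrow> pt \<Rightarrow> real" where
  "crs j k a b = cc j a * cc k b - cc k a * cc j b"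

lemma crs_swap: "crs k j b a = crs j k a b" by (simp add: crs_def algebra_simps)

lemma crs_anti: "crs j k b a = - crs j k a b" by (simp add: crs_def algebra_simps)

lemma crs_simps: "crs j k (a + b) c = crs j k a c + crs j k b c" "crs j k a (b + c) = crs j k a b + crs j k a c"
    "crs j k (t *\<^sub>R a) c = t * crs j k a c" "crs j k a (t *\<^sub>R c) = t * crs j k a c"
    "crs j k (a - b) c = crs j k a c - crs j k b c" "crs j k a (b - c) = crs j k a b - crs j k a c" "crs j k a a = 0"
  by (simp_all add: crs_def cc_simps algebra_simps)

lemma crs_zero_iff: "tri i j k \<Longrightarrow> crs j k a b = 0 \<longleftrightarrow> cross2 a b = 0"
  using cross2_cc_ex[of i j k] unfolding crs_def by (metis mult_eq_0_iff)

lemma crs_basis: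
  assumes "tri i j k" "crs j k a b \<noteq> 0"
  shows "p = (crs j k p b / crs j k a b) *\<^sub>R a + (crs j k a p / crs j k a b) *\<^sub>R b"
proof -
  obtain \<kappa> where \<kappa>: "\<kappa> \<noteq> 0" "\<And>p q. cross2 p q = \<kappa> * crs j k p q"
    using cross2_cc_ex[OF assms(1)] unfolding crs_def by metis
  have "cross2 a b \<noteq> 0" using assms(2) \<kappa> by simp
  from cross2_basis[OF this, of p] show ?thesis using \<kappa>(1) unfolding \<kappa>(2) by simp
qed

text \<open>Transitivity of the angular order in the half plane \<open>a + b > 0\<close>: the
  direction \<open>(a, b)\<close> precedes \<open>(X1, X2)\<close>, which precedes
  \<open>(Q1, Q2)\<close>.\<close>

lemma angle_trans:
  fixes a b :: real
  assumes "a + b > 0" "X1 > 0" "X2 > 0" "Q1 > 0" "Q2 > 0" "a * X2 > b * X1" "X1 * Q2 > X2 * Q1"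
  shows "a > 0" "a * Q2 > b * Q1"
proof -
  show a: "a > 0"
  proof (rule ccontr)
    assume "\<not> a > 0"
    then have "a \<le> 0" "b > 0" using assms by auto
    then have "a * X2 \<le> 0" "b * X1 > 0" using assms by (auto simp: mult_le_0_iff)
    then show False using assms by linarith
  qed
  show "a * Q2 > b * Q1"
  proof (cases "b \<le> 0")
    case True
    then have "b * Q1 \<le> 0" using assms by (simp add: mult_le_0_iff)
    moreover have "a * Q2 > 0" using a assms by simp
    ultimately show ?thesis by linarith
  next
    case False
    have "(b * X1) * (X2 * Q1) < (a * X2) * (X1 * Q2)"
      using assms False by (intro mult_strict_mono[of "b * X1" "a * X2" "X2 * Q1" "X1 * Q2"]) (auto intro: mult_pos_pos less_trans[of 0 "b * X1"])
    then have "(X1 * X2) * (b * Q1) < (X1 * X2) * (a * Q2)" by (simp add: mult_ac)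
    then show ?thesis using assms by simp
  qed
qed

context setting
begin

lemma crs_nz: "tri i j k \<Longrightarrow> a \<in> V \<Longrightarrow> b \<in> V \<Longrightarrow> u \<in> V \<Longrightarrow> a \<noteq> b \<Longrightarrow> a \<noteq> u \<Longrightarrow> b \<noteq> u \<Longrightarrow> crs j k (a - u) (b - u) \<noteq> 0"
  using crs_zero_iff not_collinear[of u a b] by metis

lemma cseq_iff:
  assumes "u \<in> V" "X \<in> subcones V S u (nc i)"
  shows "x \<in> cseq V S u X \<longleftrightarrow> x \<in> X \<and> E i x u"
proof
  assume "x \<in> cseq V S u X"
  then have x: "x \<in> X" "{u, x} \<in> Ginf V S" by (auto simp: cseq_def Nb_def)
  have xc: "x \<in> cone u (nc i)" using subcone_sub[OF assms(2)] x(1) visKD by blast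
  obtain i' where "E i' u x \<or> E i' x u" using x(2) Ginf_iff by blast
  then show "x \<in> X \<and> E i x u"
  proof
    assume "E i' u x" then show ?thesis using E_D(4) cone_pc_nc_disj xc by blast
  next
    assume e: "E i' x u"
    then have "x \<in> cone u (nc i')" using E_D(4) cone_nc_pc by blast
    then have "i' mod 3 = i mod 3" using cone_nc_disj xc by blast
    then show ?thesis using e Epos_cong x(1) by metis
  qed
next
  assume "x \<in> X \<and> E i x u"
  then show "x \<in> cseq V S u X" using Ginf_iff[of u x V S] by (auto simp: cseq_def Nb_def)
qed

lemma E_subcone:
  assumes "E i x u"
  obtains X where "X \<in> subcones V S u (nc i)" "x \<in> X"
proof -
  have "x \<in> visK V S u (nc i)" using E_D[OF assms] cone_nc_pc visible_commute[of S x u] by (auto simp: visK_def)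
  then show ?thesis using subcone_cover that by blast
qed

text \<open>The empty triangle at the side \<open>u v\<close> towards \<open>w\<close> has a third
  vertex \<open>q\<close> with smaller \<open>j\<close> and \<open>k\<close> coordinates than
  \<open>v\<close> and a smaller \<open>i\<close> coordinate than \<open>u\<close>. It is visible
  from \<open>v\<close> with a free sector next to \<open>u\<close>, so \<open>v\<close> would
  prefer it to \<open>u\<close>.\<close>

lemma E_no_visible:
  assumes e: "E i v u" and t: "tri i j k" and w: "w \<in> V" "w \<noteq> v" "w \<noteq> u" "vis u w" "SF u v w"
    and c: "cc j w \<le> cc j v" "cc k w \<le> cc k v" "cc i w < cc i u"
  shows False
proof -
  note D = E_D[OF e]
  have vu: "cc j u < cc j v" "cc k u < cc k v" using cone_pc[OF t] D(4) by auto
  then have iu: "cc i v < cc i u" using cc_sum[OF t, of u] cc_sum[OF t, of v] by linarith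
  obtain q where q: "q \<in> V" "q \<in> convex hull {u, v, w}" "q \<noteq> u" "q \<noteq> v" "FT u v q"
    using visible_empty_triangle[OF D(2,1) w(1) D(3)[symmetric] w(3)[symmetric] w(2)[symmetric] _ w(4,5)] D(5) visible_commute[of S v u] by blast
  have "cc j q \<le> cc j v" "cc k q \<le> cc k v" "cc i q \<le> cc i u"
    using cc_hull(1)[OF q(2)] vu iu c by auto
  then have "cc j q < cc j v" "cc k q < cc k v" "cc i q < cc i u"
    using cc_neq[OF q(1) D(1) q(4)] cc_neq[OF q(1) D(2) q(3)] by (auto simp: less_le)
  then show False
    using E_empty[OF e q(1)] cone_pc[OF t] freetri_visible[OF freetri_perm(3)[OF q(5)]]
      freetri_secfree[OF freetri_perm(1)[OF q(5)]] by blast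
qed

text \<open>If both coordinates of \<open>a\<close> were smaller than those of \<open>b\<close>,
  then \<open>a\<close> would be a visible vertex excluded by \<open>E_no_visible\<close> for the
  edge from \<open>b\<close> to \<open>u\<close>. Hence along a canonical path one coordinate rises
  while the other falls.\<close>

lemma canon_incomparable:
  assumes t: "tri i j k" and u: "u \<in> V" and X: "X \<in> subcones V S u (nc i)"
    and x: "x \<in> X" "E i x u" and v: "v \<in> X" "E i v u" and ne: "x \<noteq> v"
  shows "cc j x < cc j v \<longleftrightarrow> cc k v < cc k x"
proof -
  have V: "x \<in> V" "v \<in> V" using E_D x v by blast+
  have no: "\<not> (cc j a < cc j b \<and> cc k a < cc k b)"
    if a: "a \<in> X" "E i a u" and b: "b \<in> X" "E i b u" and ab: "a \<noteq> b" for a b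
  proof
    assume h: "cc j a < cc j b \<and> cc k a < cc k b"
    have "cc j u < cc j a \<and> cc k u < cc k a" using E_D(4)[OF a(2)] cone_pc[OF t] by blast
    then have "cc i a < cc i u" using cc_sum[OF t, of a] cc_sum[OF t, of u] by linarith
    moreover have "SF u b a" using subcone_secfree[OF u X b(1) a(1)] ab by blast
    moreover have "vis u a" "a \<noteq> u" "a \<in> V" using E_D[OF a(2)] visible_commute by blast+
    ultimately show False using E_no_visible[OF b(2) t, of a] h ab by auto
  qed
  show ?thesis using no[OF x v ne] no[OF v x ne[symmetric]] cc_neq[OF V ne, of j] cc_neq[OF V ne, of k] by linarith
qed

text \<open>\<open>x\<close> and \<open>v\<close> are consecutive on a canonical path. Counterclockwise order corresponds to one of the two orders of
  \<open>j\<close>, \<open>k\<close>; leaving the order open makes every argument serve its mirror image too.\<close>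
definition cons :: "int \<Rightarrow> int \<Rightarrow> int \<Rightarrow> pt \<Rightarrow> pt set \<Rightarrow> pt \<Rightarrow> pt \<Rightarrow> bool" where
  "cons i j k u X x v \<longleftrightarrow> tri i j k \<and> u \<in> V \<and> X \<in> subcones V S u (nc i) \<and> x \<in> X \<and> E i x u \<and> v \<in> X \<and> E i v u \<and>
     cc j v < cc j x \<and> cc k x < cc k v \<and> (\<forall>z\<in>X. E i z u \<longrightarrow> \<not> (cc k x < cc k z \<and> cc k z < cc k v))"

lemma cons_D:
  assumes "cons i j k u X x v"
  shows "tri i j k" "u \<in> V" "X \<in> subcones V S u (nc i)" "x \<in> X" "E i x u" "v \<in> X" "E i v u"
     "cc j v < cc j x" "cc k x < cc k v" "\<And>z. z \<in> X \<Longrightarrow> E i z u \<Longrightarrow> \<not> (cc k x < cc k z \<and> cc k z < cc k v)"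
     "x \<in> V" "v \<in> V" "x \<noteq> v" "x \<noteq> u" "v \<noteq> u"
proof -
  show a: "tri i j k" "u \<in> V" "X \<in> subcones V S u (nc i)" "x \<in> X" "E i x u" "v \<in> X" "E i v u"
     "cc j v < cc j x" "cc k x < cc k v" "\<And>z. z \<in> X \<Longrightarrow> E i z u \<Longrightarrow> \<not> (cc k x < cc k z \<and> cc k z < cc k v)"
    using assms unfolding cons_def by blast+
  show "x \<in> V" "v \<in> V" "x \<noteq> u" "v \<noteq> u" using E_D(1,3) a(5,7) by blast+
  show "x \<noteq> v" using a(8) by auto
qed

lemma cons_swap:
  assumes "cons i j k u X x v" shows "cons i k j u X v x"
proof -
  note D = cons_D[OF assms]
  have "\<not> (cc j v < cc j z \<and> cc j z < cc j x)" if z: "z \<in> X" "E i z u" for z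
  proof
    assume h: "cc j v < cc j z \<and> cc j z < cc j x"
    then have "z \<noteq> v" "z \<noteq> x" by auto
    then have "cc k x < cc k z" "cc k z < cc k v"
      using canon_incomparable[OF D(1-3) z D(4,5)] canon_incomparable[OF D(1-3) D(6,7) z] h by auto
    then show False using D(10)[OF z] by blast
  qed
  then show ?thesis unfolding cons_def using D tri_perm(1) by blast
qed

text \<open>As the two coordinates move in opposite directions along the sequence, a single one
  already decides the angular order.\<close>

lemma ccw_iff:
  assumes u: "u \<in> V" and X: "X \<in> subcones V S u (nc i)" and x: "x \<in> X" "E i x u" and v: "v \<in> X" "E i v u"
  shows "ccw_before u x v \<longleftrightarrow> cc (i + 2) x < cc (i + 2) v"
proof -
  let ?j = "i + 1" and ?k = "i + 2"
  have t: "tri i ?j ?k" by (rule tri_succ)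
  have m: "(?j + 1) mod 3 = ?k mod 3" by (simp add: add.assoc)
  have pos: "cc ?j (x - u) > 0" "cc ?k (x - u) > 0" "cc ?j (v - u) > 0" "cc ?k (v - u) > 0"
    using cone_pc[OF t] E_D(4)[OF x(2)] E_D(4)[OF v(2)] by (auto simp: cc_simps)
  have c: "ccw_before u x v \<longleftrightarrow> cc ?k (x - u) * cc ?j (v - u) < cc ?j (x - u) * cc ?k (v - u)"
  proof -
    have "(0::real) < 2 / sqrt 3" by simp
    then have r: "0 < 2 / sqrt 3 * r \<longleftrightarrow> 0 < r" for r using mult_less_cancel_left_pos[of "2 / sqrt 3" 0 r] by simp
    show ?thesis unfolding ccw_before_def cross2_cc(1)[OF t m] r by (simp only: diff_gt_0_iff_gt)
  qed
  show ?thesis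
  proof (cases "x = v")
    case True then show ?thesis using c by (simp add: mult.commute)
  next
    case False
    note inc = canon_incomparable[OF t u X x v False] canon_incomparable[OF t u X v x False[symmetric]]
    have ne: "cc ?k x \<noteq> cc ?k v" "cc ?j x \<noteq> cc ?j v" using cc_neq False E_D(1) x(2) v(2) by blast+
    show ?thesis
    proof
      assume "cc ?k x < cc ?k v"
      then have "cc ?k (x - u) < cc ?k (v - u)" "cc ?j (v - u) < cc ?j (x - u)" using inc ne by (auto simp: cc_simps)
      then have "cc ?k (x - u) * cc ?j (v - u) < cc ?k (v - u) * cc ?j (x - u)"
        using pos by (intro mult_strict_mono) auto
      then show "ccw_before u x v" using c by (simp add: mult.commute)
    next
      assume cw: "ccw_before u x v"
      show "cc ?k x < cc ?k v"
      proof (rule ccontr)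
        assume "\<not> cc ?k x < cc ?k v"
        then have "cc ?k (v - u) < cc ?k (x - u)" "cc ?j (x - u) < cc ?j (v - u)" using inc ne by (auto simp: cc_simps)
        then have "cc ?k (v - u) * cc ?j (x - u) < cc ?k (x - u) * cc ?j (v - u)"
          using pos by (intro mult_strict_mono) auto
        then show False using c cw by (simp add: mult.commute)
      qed
    qed
  qed
qed

lemma cnext_cons:
  assumes u: "u \<in> V" and X: "X \<in> subcones V S u (nc i)"
  shows "cnext u (cseq V S u X) x v \<longleftrightarrow> cons i (i + 1) (i + 2) u X x v"
proof -
  have t: "tri i (i + 1) (i + 2)" by (rule tri_succ)
  note inc = canon_incomparable[OF t u X]
  have "cnext u (cseq V S u X) x v \<longleftrightarrow> x \<in> X \<and> E i x u \<and> v \<in> X \<and> E i v u \<and> cc (i + 2) x < cc (i + 2) v \<and>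
     (\<forall>z\<in>X. E i z u \<longrightarrow> \<not> (cc (i + 2) x < cc (i + 2) z \<and> cc (i + 2) z < cc (i + 2) v))"
    unfolding cnext_def cseq_iff[OF u X] Bex_def using ccw_iff[OF u X] by (metis (no_types, lifting))
  also have "\<dots> \<longleftrightarrow> cons i (i + 1) (i + 2) u X x v"
  proof -
    have "cc (i + 1) v < cc (i + 1) x" if "x \<in> X" "E i x u" "v \<in> X" "E i v u" "cc (i + 2) x < cc (i + 2) v"
      using inc[of v x] that by auto
    then show ?thesis unfolding cons_def using t u X by blast
  qed
  finally show ?thesis .
qed

text \<open>A rival \<open>z\<close> of \<open>u\<close> at \<open>q\<close> cannot lie beyond the
  ray from \<open>u\<close> through \<open>x\<close>: the free triangle \<open>q u z\<close> would
  contain the directions between \<open>x\<close> and \<open>z\<close> near \<open>u\<close>, and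
  \<open>z\<close> would be a vertex that \<open>E_no_visible\<close> excludes for the edge from
  \<open>x\<close> to \<open>u\<close>.\<close>

lemma insert_half:
  assumes t: "tri i j k" and x: "E i x u" and q: "q \<in> V" "q \<in> cone u (nc i)"
    and xq: "crs j k (x - u) (q - u) > 0" "cc j q < cc j x"
    and z: "z \<in> V" "FT q u z" "z \<in> cone q (pc i)" "cc i z < cc i u" "crs j k (x - u) (z - u) \<le> 0" "z \<noteq> u"
  shows False
proof -
  note D = E_D[OF x]
  have X: "cc j (x - u) > 0" "cc k (x - u) > 0" using cone_pc[OF t] D(4) by (auto simp: cc_simps)
  have Q: "cc j (q - u) > 0" "cc k (q - u) > 0" using cone_nc[OF t] q(2) by (auto simp: cc_simps)
  have zq: "cc j z < cc j q" "cc k z < cc k q" using cone_pc[OF t] z(3) by auto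
  have zx: "z \<noteq> x" using zq xq by auto
  have "crs j k (x - u) (z - u) \<noteq> 0" using crs_nz[OF t D(1) z(1) D(2)] zx z(6) D(3) by auto
  then have cz: "crs j k (z - u) (x - u) > 0" using z(5) crs_anti[of j k "z - u" "x - u"] by linarith
  have sum: "cc j (z - u) + cc k (z - u) > 0"
    using z(4) cc_sum[OF t, of z] cc_sum[OF t, of u] by (simp add: cc_simps)
  have ineq: "cc j (z - u) * cc k (x - u) > cc k (z - u) * cc j (x - u)"
     "cc j (x - u) * cc k (q - u) > cc k (x - u) * cc j (q - u)"
    using cz xq(1) unfolding crs_def by simp_all
  note at = angle_trans[OF sum X Q ineq]
  have ck: "cc k z \<le> cc k x"
  proof (rule ccontr)
    assume "\<not> cc k z \<le> cc k x"
    then have "cc k (x - u) \<le> cc k (z - u)" by (simp add: cc_simps)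
    then have "cc k (x - u) * cc j (x - u) \<le> cc k (z - u) * cc j (x - u)" using X by (intro mult_right_mono) auto
    moreover have "cc j (z - u) * cc k (x - u) \<le> cc j (x - u) * cc k (x - u)"
      using zq xq(2) X by (intro mult_right_mono) (auto simp: cc_simps)
    ultimately show False using ineq(1) by (simp add: mult.commute)
  qed
  have qz: "crs j k (q - u) (z - u) < 0" using at(2) unfolding crs_def by (simp add: mult.commute)
  have "SF u q z" using freetri_secfree[OF freetri_perm(1)[OF z(2)]] .
  then have "SF u x z"
  proof (rule secfree_mono)
    show "x - u = (crs j k (x - u) (z - u) / crs j k (q - u) (z - u)) *\<^sub>R (q - u) + (crs j k (q - u) (x - u) / crs j k (q - u) (z - u)) *\<^sub>R (z - u)"
      using crs_basis[OF t, of "q - u" "z - u" "x - u"] qz by simp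
    show "z - u = 0 *\<^sub>R (q - u) + 1 *\<^sub>R (z - u)" by simp
    have a: "crs j k (x - u) (z - u) < 0" "crs j k (q - u) (x - u) < 0"
      using cz xq(1) crs_anti[of j k "z - u" "x - u"] crs_anti[of j k "q - u" "x - u"] by linarith+
    have p: "crs j k (x - u) (z - u) / crs j k (q - u) (z - u) > 0" "crs j k (q - u) (x - u) / crs j k (q - u) (z - u) > 0"
      using a qz by (auto intro: divide_neg_neg)
    show "0 \<le> crs j k (x - u) (z - u) / crs j k (q - u) (z - u)" "0 \<le> crs j k (q - u) (x - u) / crs j k (q - u) (z - u)"
      "0 < crs j k (x - u) (z - u) / crs j k (q - u) (z - u) + 0" "0 < crs j k (q - u) (x - u) / crs j k (q - u) (z - u) + 1"
      using p by linarith+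
  qed auto
  moreover have "vis u z" using freetri_visible[OF freetri_perm(3)[OF z(2)]] .
  ultimately show False using E_no_visible[OF x t z(1) zx z(6)] zq(1) xq(2) ck z(4) by auto
qed

text \<open>Shows that an extra vertex \<open>q\<close> belongs to the canonical sequence between
  \<open>x\<close> and \<open>v\<close>. A rival of \<open>u\<close> at \<open>q\<close> produces an
  empty triangle \<open>q u z\<close>; by \<open>insert_half\<close> on both sides, \<open>z\<close>
  lies between the rays through \<open>x\<close> and \<open>v\<close>, so the hypothesis
  \<open>no\<close> has to exclude only such \<open>z\<close>.\<close>

lemma insert_vertex:
  assumes t: "tri i j k" and u: "u \<in> V" and x: "E i x u" and v: "E i v u" and q: "q \<in> visK V S u (nc i)"
    and xq: "crs j k (x - u) (q - u) > 0" "cc j q < cc j x" and qv: "crs j k (q - u) (v - u) > 0" "cc k q < cc k v"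
    and no: "\<And>z. z \<in> V \<Longrightarrow> z \<in> cone q (pc i) \<Longrightarrow> FT q u z \<Longrightarrow> z \<noteq> u \<Longrightarrow> cc i z < cc i u \<Longrightarrow> crs j k (x - u) (z - u) > 0 \<Longrightarrow> crs j k (z - u) (v - u) > 0 \<Longrightarrow> False"
  shows "E i q u"
proof -
  note qD = visKD[OF q]
  have quc: "u \<in> cone q (pc i)" using qD cone_nc_pc by blast
  have qne: "q \<noteq> u" using qD by (auto simp: cone_def)
  have qu: "cc j u < cc j q" "cc k u < cc k q" using cone_pc[OF t] quc by auto
  have qi: "cc i q < cc i u" using qu cc_sum[OF t, of q] cc_sum[OF t, of u] by linarith
  have vqu: "vis q u" using qD visible_commute by blast
  show ?thesis
  proof (rule E_exists[OF _ u quc vqu])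
    show "q \<in> V" using qD by blast
    fix z assume z: "z \<in> V" "z \<in> cone q (pc i)" "vis q z" "z \<noteq> u" "SF q u z" "cc i z < cc i u"
    have zc: "cc j z < cc j q" "cc k z < cc k q" using cone_pc[OF t] z(2) by auto
    have zq: "z \<noteq> q" using zc by auto
    obtain y where y: "y \<in> V" "y \<in> convex hull {q, u, z}" "y \<noteq> q" "y \<noteq> u" "FT q u y"
      using visible_empty_triangle[of q u z] qD u z qne zq vqu by metis
    have "cc j y \<le> cc j q" "cc k y \<le> cc k q" "cc i y \<le> cc i u" using cc_hull(1)[OF y(2)] zc qu qi z(6) by auto
    then have yc: "cc j y < cc j q" "cc k y < cc k q" "cc i y < cc i u"
      using cc_neq[OF y(1) _ y(3)] cc_neq[OF y(1) u y(4)] qD by (auto simp: less_le)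
    then have ycone: "y \<in> cone q (pc i)" using cone_pc[OF t] by blast
    have 1: "crs j k (x - u) (y - u) > 0"
      using insert_half[OF t x _ _ xq y(1,5) ycone yc(3) _ y(4)] qD by fastforce
    have 2: "crs j k (y - u) (v - u) > 0"
    proof (rule ccontr)
      assume n: "\<not> ?thesis"
      show False
        by (rule insert_half[OF tri_perm(1)[OF t] v _ _ _ qv(2) y(1,5) ycone yc(3) _ y(4)])
          (use qD qv(1) n in \<open>auto simp: crs_swap[of k j]\<close>)
    qed
    show False using no[OF y(1) ycone y(5,4) yc(3) 1 2] .
  qed
qed

section \<open>The triangle spanned by the apex and two consecutive vertices, and its third
  side\<close>

lemma cons_crs: "cons i j k u X x v \<Longrightarrow> crs j k (x - u) (v - u) > 0"
proof -
  assume c: "cons i j k u X x v"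
  note D = cons_D[OF c]
  have pos: "cc j (x - u) > 0" "cc k (x - u) > 0" "cc j (v - u) > 0" "cc k (v - u) > 0"
    using cone_pc[OF D(1)] E_D(4)[OF D(5)] E_D(4)[OF D(7)] by (auto simp: cc_simps)
  have "cc k (x - u) * cc j (v - u) < cc k (v - u) * cc j (x - u)"
    using pos D(8,9) by (intro mult_strict_mono) (auto simp: cc_simps)
  then show ?thesis by (simp add: crs_def mult.commute)
qed

lemma crs_coord:
  assumes t: "tri i j k" and D: "crs j k (x - u) (v - u) > 0"
  shows "p - u = (crs j k (p - u) (v - u) / crs j k (x - u) (v - u)) *\<^sub>R (x - u) + (crs j k (x - u) (p - u) / crs j k (x - u) (v - u)) *\<^sub>R (v - u)"
  using crs_basis[OF t, of "x - u" "v - u" "p - u"] D by simp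

text \<open>The sum of the two barycentric numerators of \<open>p\<close>. For consecutive
  \<open>x\<close>, \<open>v\<close> both factors on the right are positive, so it grows with either
  coordinate of \<open>p\<close>.\<close>

lemma crs_side:
  "crs j k (p - u) (v - u) + crs j k (x - u) (p - u) = cc j (p - u) * (cc k v - cc k x) + cc k (p - u) * (cc j x - cc j v)"
  by (simp add: crs_def cc_simps algebra_simps)

lemma in_hull_crs:
  assumes t: "tri i j k" and D: "crs j k (x - u) (v - u) > 0"
    and p: "crs j k (p - u) (v - u) \<ge> 0" "crs j k (x - u) (p - u) \<ge> 0"
      "crs j k (p - u) (v - u) + crs j k (x - u) (p - u) \<le> crs j k (x - u) (v - u)"
  shows "p \<in> convex hull {u, x, v}"
proof -
  let ?a = "crs j k (p - u) (v - u) / crs j k (x - u) (v - u)" and ?b = "crs j k (x - u) (p - u) / crs j k (x - u) (v - u)"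
  have "p = u + ?a *\<^sub>R (x - u) + ?b *\<^sub>R (v - u)" using crs_coord[OF t D, of p] by (simp add: algebra_simps)
  moreover have "0 \<le> ?a" "0 \<le> ?b" using D p by auto
  moreover have "?a + ?b \<le> 1" using D p by (simp add: add_divide_distrib[symmetric])
  ultimately show ?thesis unfolding in_hull3 by blast
qed

text \<open>Among further vertices of the subcone in the triangle, take \<open>q\<close> with the
  largest \<open>i\<close> coordinate. A rival of \<open>u\<close> at \<open>q\<close> would be
  another such vertex with a larger coordinate, so \<open>q\<close> selects \<open>u\<close> and
  stands between \<open>x\<close> and \<open>v\<close> in the sequence, a contradiction. Hence there
  are none, and the first vertex met when turning about \<open>x\<close> is \<open>v\<close>
  itself.\<close>

lemma cons_freetri:
  assumes c: "cons i j k u X x v" shows "FT u x v"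
proof -
  note D = cons_D[OF c]
  note t = D(1)
  note Dp = cons_crs[OF c]
  have vis: "vis u x" "vis u v" using E_D(5)[OF D(5)] E_D(5)[OF D(7)] visible_commute by blast+
  have sf: "SF u x v" using subcone_secfree[OF D(2,3,4,6,13)] .
  have xc: "cc j u < cc j x" "cc k u < cc k x" "cc j u < cc j v" "cc k u < cc k v"
    using cone_pc[OF t] E_D(4)[OF D(5)] E_D(4)[OF D(7)] by auto
  define K where "K = {q \<in> V \<inter> convex hull {u, x, v}. q \<in> X \<and> q \<noteq> x \<and> q \<noteq> v}"
  have "K = {}"
  proof (rule ccontr)
    assume "K \<noteq> {}"
    have fK: "finite K" using finV by (auto simp: K_def)
    define q where "q = arg_min_on (\<lambda>q. - cc i q) K"
    have qK: "q \<in> K" and qmax: "\<And>z. z \<in> K \<Longrightarrow> cc i z \<le> cc i q"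
      unfolding q_def using arg_min_if_finite[OF fK \<open>K \<noteq> {}\<close>, of "\<lambda>q. - cc i q"] arg_min_least[OF fK \<open>K \<noteq> {}\<close>, of _ "\<lambda>q. - cc i q"] by auto
    have q: "q \<in> V" "q \<in> convex hull {u, x, v}" "q \<in> X" "q \<noteq> x" "q \<noteq> v" using qK by (auto simp: K_def)
    have qvk: "q \<in> visK V S u (nc i)" using subcone_sub[OF D(3)] q(3) by blast
    have qu: "q \<noteq> u" using visKD[OF qvk] by (auto simp: cone_def)
    obtain \<alpha> \<beta> where ab: "0 \<le> \<alpha>" "0 \<le> \<beta>" "\<alpha> + \<beta> \<le> 1" "q = u + \<alpha> *\<^sub>R (x - u) + \<beta> *\<^sub>R (v - u)"
      using q(2) unfolding in_hull3 by blast
    have qmu: "q - u = \<alpha> *\<^sub>R (x - u) + \<beta> *\<^sub>R (v - u)" using ab(4) by simp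
    have cr: "crs j k (x - u) (q - u) = \<beta> * crs j k (x - u) (v - u)" "crs j k (q - u) (v - u) = \<alpha> * crs j k (x - u) (v - u)"
      unfolding qmu by (simp_all only: crs_simps(1-4,7) mult_zero_right add_0_left add_0_right)
    have "crs j k (x - u) (q - u) \<noteq> 0" "crs j k (q - u) (v - u) \<noteq> 0" using crs_nz[OF t] D q qu by metis+
    then have ab0: "\<alpha> > 0" "\<beta> > 0" using cr ab by auto
    have c1: "crs j k (x - u) (q - u) > 0" "crs j k (q - u) (v - u) > 0" using cr ab0 Dp by auto
    have "cc j q \<le> cc j x" "cc k q \<le> cc k v" using cc_hull(1)[OF q(2)] xc D(8,9) by auto
    then have c2: "cc j q < cc j x" "cc k q < cc k v"
      using cc_neq[OF q(1) D(11) q(4)] cc_neq[OF q(1) D(12) q(5)] by (auto simp: less_le)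
    have "E i q u"
    proof (rule insert_vertex[OF t D(2,5,7) qvk c1(1) c2(1) c1(2) c2(2)])
      fix z assume z: "z \<in> V" "z \<in> cone q (pc i)" "FT q u z" "z \<noteq> u" "cc i z < cc i u" "crs j k (x - u) (z - u) > 0" "crs j k (z - u) (v - u) > 0"
      have zq: "cc j z < cc j q" "cc k z < cc k q" using cone_pc[OF t] z(2) by auto
      have "cc j (z - u) * (cc k v - cc k x) < cc j (q - u) * (cc k v - cc k x)"
        "cc k (z - u) * (cc j x - cc j v) < cc k (q - u) * (cc j x - cc j v)"
        using zq D(8,9) by (auto intro!: mult_strict_right_mono simp: cc_simps)
      then have "crs j k (z - u) (v - u) + crs j k (x - u) (z - u) < crs j k (q - u) (v - u) + crs j k (x - u) (q - u)"
        unfolding crs_side by linarith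
      also have "\<dots> = (\<alpha> + \<beta>) * crs j k (x - u) (v - u)" unfolding cr by (simp add: algebra_simps)
      also have "\<dots> \<le> 1 * crs j k (x - u) (v - u)" using ab Dp by (intro mult_right_mono) auto
      finally have zh: "z \<in> convex hull {u, x, v}" using in_hull_crs[OF t Dp] z by auto
      have vz: "vis u z" using freetri_visible[OF freetri_perm(3)[OF z(3)]] .
      have "cc j u \<le> cc j z" "cc k u \<le> cc k z" using cc_hull(3)[OF zh] xc by auto
      then have "z \<in> cone u (nc i)" 
        using cone_nc[OF t, of z u] cc_neq[OF z(1) D(2) z(4), of j] cc_neq[OF z(1) D(2) z(4), of k] by linarith
      then have "z \<in> visK V S u (nc i)" using z(1) vz by (simp add: visK_def)
      then have zX: "z \<in> X" using subcone_extend[OF D(3) q(3)] freetri_secfree[OF freetri_perm(1)[OF z(3)]] by blast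
      have "z \<noteq> x" "z \<noteq> v" using zq c2 by auto
      then have "z \<in> K" using z(1) zh zX by (simp add: K_def)
      then have "cc i z \<le> cc i q" using qmax by blast
      then show False using zq cc_sum[OF t, of z] cc_sum[OF t, of q] by linarith
    qed
    moreover have "cc k x < cc k q"
      using canon_incomparable[OF t D(2,3) q(3) \<open>E i q u\<close> D(4,5) q(4)] c2(1) by blast
    ultimately show False using D(10)[OF q(3)] c2(2) by blast
  qed
  obtain q where q: "q \<in> V" "q \<in> convex hull {u, x, v}" "q \<noteq> u" "q \<noteq> x" "FT u x q"
    using visible_empty_triangle[OF D(2,11,12) D(14,15)[symmetric] D(13) vis sf] by blast
  have vz: "vis u q" using freetri_visible[OF freetri_perm(2)[OF q(5)]] .
  have "cc j u \<le> cc j q" "cc k u \<le> cc k q" using cc_hull(3)[OF q(2)] xc by auto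
  then have "q \<in> cone u (nc i)" 
    using cone_nc[OF t, of q u] cc_neq[OF q(1) D(2) q(3), of j] cc_neq[OF q(1) D(2) q(3), of k] by linarith
  then have "q \<in> visK V S u (nc i)" using q(1) vz by (simp add: visK_def)
  then have "q \<in> X" using subcone_extend[OF D(3,4)] freetri_secfree[OF q(5)] by blast
  then have "q = v" using \<open>K = {}\<close> q unfolding K_def by blast
  then show ?thesis using q(5) by simp
qed


text \<open>The position of \<open>p\<close> relative to the line through \<open>x\<close> and
  \<open>v\<close>. At \<open>p = u\<close> the value is \<open>crs j k (x - u) (v - u)\<close>, so
  for consecutive vertices the side of \<open>u\<close> is the positive one.\<close>

lemma crs_side_shift:
  "crs j k (v - x) (p - x) = crs j k (x - u) (v - u) - crs j k (p - u) (v - u) - crs j k (x - u) (p - u)"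
  by (simp add: crs_def cc_simps algebra_simps)

text \<open>\<open>p\<close> is on the side of \<open>u\<close> but outside the free triangle
  \<open>u x v\<close>, hence beyond the line \<open>u v\<close>. There \<open>v\<close> sees it
  with a free sector next to \<open>u\<close>, and it is closer to \<open>v\<close> than
  \<open>u\<close> is.\<close>

lemma cons_E_above:
  assumes c: "cons i j k u X x v" and p: "p \<in> V" "p \<noteq> x" "p \<noteq> v" "FT x v p"
    "cc i p < cc i x" "cc j p < cc j x" "cc k p < cc k v" and s: "crs j k (v - x) (p - x) > 0"
  shows False
proof -
  note D = cons_D[OF c]
  note t = D(1)
  note Dp = cons_crs[OF c]
  let ?D = "crs j k (x - u) (v - u)"
  define \<alpha> where "\<alpha> = crs j k (p - u) (v - u) / ?D"
  define \<beta> where "\<beta> = crs j k (x - u) (p - u) / ?D"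
  have pu: "p - u = \<alpha> *\<^sub>R (x - u) + \<beta> *\<^sub>R (v - u)" using crs_coord[OF t Dp, of p] by (simp add: \<alpha>_def \<beta>_def)
  have X: "cc j (x - u) > 0" "cc k (x - u) > 0" "cc j (v - u) > 0" "cc k (v - u) > 0"
    using cone_pc[OF t] E_D(4)[OF D(5)] E_D(4)[OF D(7)] by (auto simp: cc_simps)
  have ix: "cc i x < cc i u" using X cc_sum[OF t, of x] cc_sum[OF t, of u] by (simp add: cc_simps)
  have pne: "p \<noteq> u" using p(5) ix by auto
  have s': "crs j k (p - u) (v - u) + crs j k (x - u) (p - u) < ?D"
    using s unfolding crs_side_shift[of j k v x p u] by linarith
  have b: "crs j k (x - u) (p - u) > 0"
  proof -
    have "cc k (p - u) > cc k (x - u)"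
      using p(5,6) cc_sum[OF t, of p] cc_sum[OF t, of x] by (simp add: cc_simps)
    then have "cc j (x - u) * cc k (p - u) > cc j (x - u) * cc k (x - u)" using X by simp
    moreover have "cc k (x - u) * cc j (p - u) < cc k (x - u) * cc j (x - u)" using p(6) X by (simp add: cc_simps)
    ultimately show ?thesis unfolding crs_def by (simp add: mult.commute)
  qed
  have a: "crs j k (p - u) (v - u) < 0"
  proof (rule ccontr)
    assume "\<not> ?thesis"
    then have "p \<in> convex hull {u, x, v}" using in_hull_crs[OF t Dp, of p] b s' by auto
    then show False using cons_freetri[OF c] p(1-3) pne unfolding freetri_def by blast
  qed
  have al: "\<alpha> < 0" using a Dp by (simp add: \<alpha>_def divide_neg_pos)
  have ab1: "1 - \<alpha> - \<beta> > 0"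
  proof -
    have "\<alpha> + \<beta> = (crs j k (p - u) (v - u) + crs j k (x - u) (p - u)) / ?D" by (simp add: \<alpha>_def \<beta>_def add_divide_distrib)
    also have "\<dots> < 1" using s' Dp by simp
    finally show ?thesis by simp
  qed
  define m where "m = 1 - \<alpha> - \<beta>"
  have m0: "m > 0" using ab1 by (simp add: m_def)
  have "m *\<^sub>R (u - v) = (- \<alpha>) *\<^sub>R (x - v) + (p - v)"
  proof -
    have "p = u + \<alpha> *\<^sub>R (x - u) + \<beta> *\<^sub>R (v - u)" using pu by (simp add: algebra_simps)
    then show ?thesis unfolding m_def by (simp add: algebra_simps)
  qed
  then have "(1 / m) *\<^sub>R (m *\<^sub>R (u - v)) = (1 / m) *\<^sub>R ((- \<alpha>) *\<^sub>R (x - v) + (p - v))" by simp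
  then have uv: "u - v = (- \<alpha> / m) *\<^sub>R (x - v) + (1 / m) *\<^sub>R (p - v)" using m0 by (simp add: scaleR_add_right scaleR_diff_right)
  have pm: "- \<alpha> / m > 0" "1 / m > 0" using divide_pos_pos[of "- \<alpha>" m] divide_pos_pos[of 1 m] al m0 by linarith+
  have "SF v x p" using freetri_secfree[OF freetri_perm(1)[OF p(4)]] .
  then have "SF v u p"
    by (rule secfree_mono[where \<gamma> = 0 and \<delta> = 1, OF _ uv]) ((use pm in linarith) | simp)+
  moreover have "vis v p" using freetri_visible[OF freetri_perm(3)[OF p(4)]] .
  moreover have "cc j p < cc j v"
  proof (rule ccontr)
    assume "\<not> cc j p < cc j v"
    then have "cc k (v - u) * cc j (v - u) \<le> cc k (v - u) * cc j (p - u)" using X by (intro mult_left_mono) (auto simp: cc_simps)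
    moreover have "cc k (p - u) * cc j (v - u) < cc k (v - u) * cc j (v - u)" using X p(7) by (simp add: cc_simps)
    ultimately show False using a unfolding crs_def by (simp add: mult.commute)
  qed
  ultimately show False
    using E_empty[OF D(7) p(1)] cone_pc[OF t] p(5,7) ix by auto
qed

text \<open>\<open>p\<close> lies beyond \<open>x v\<close> as seen from \<open>u\<close>, inside
  the angle at \<open>u\<close>. The free triangles \<open>u x v\<close> and \<open>x v p\<close>
  make it visible from \<open>u\<close>, and any rival of \<open>u\<close> at \<open>p\<close> would
  lie in one of them, so \<open>p\<close> would enter the canonical sequence between
  \<open>x\<close> and \<open>v\<close>.\<close>

lemma cons_E_below:
  assumes c: "cons i j k u X x v" and p: "p \<in> V" "p \<noteq> x" "p \<noteq> v" "FT x v p"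
    "cc j p < cc j x" "cc k p < cc k v" and s: "crs j k (v - x) (p - x) < 0"
  shows False
proof -
  note D = cons_D[OF c]
  note t = D(1)
  note Dp = cons_crs[OF c]
  let ?D = "crs j k (x - u) (v - u)"
  have X: "cc j (x - u) > 0" "cc k (x - u) > 0" "cc j (v - u) > 0" "cc k (v - u) > 0"
    using cone_pc[OF t] E_D(4)[OF D(5)] E_D(4)[OF D(7)] by (auto simp: cc_simps)
  have s0: "(cc j v - cc j x) * (cc k p - cc k x) < (cc k v - cc k x) * (cc j p - cc j x)"
    using s unfolding crs_def by (simp add: cc_simps)
  have pk: "cc k x < cc k p"
  proof (rule ccontr)
    assume "\<not> cc k x < cc k p"
    then have "(cc j v - cc j x) * (cc k p - cc k x) \<ge> 0" using D(8) by (simp add: mult_nonpos_nonpos)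
    moreover have "(cc k v - cc k x) * (cc j p - cc j x) < 0" using D(9) p(5) by (simp add: mult_pos_neg)
    ultimately show False using s0 by linarith
  qed
  have s1: "(cc j v - cc j x) * (cc k p - cc k v) < (cc k v - cc k x) * (cc j p - cc j v)"
    using s0 by (simp add: algebra_simps)
  have pj: "cc j v < cc j p"
  proof (rule ccontr)
    assume "\<not> cc j v < cc j p"
    then have "(cc k v - cc k x) * (cc j p - cc j v) \<le> 0" using D(9) by (simp add: mult_nonneg_nonpos)
    moreover have "(cc j v - cc j x) * (cc k p - cc k v) > 0" using D(8) p(6) by (simp add: mult_neg_neg)
    ultimately show False using s1 by linarith
  qed
  have P: "cc j (p - u) > 0" "cc k (p - u) > 0" using pk pj X by (auto simp: cc_simps)
  have a: "crs j k (p - u) (v - u) > 0"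
  proof -
    have "cc k (p - u) * cc j (v - u) < cc k (v - u) * cc j (p - u)"
      using X P pj p(6) by (intro mult_strict_mono) (auto simp: cc_simps)
    then show ?thesis unfolding crs_def by (simp add: mult.commute)
  qed
  have b: "crs j k (x - u) (p - u) > 0"
  proof -
    have "cc k (x - u) * cc j (p - u) < cc k (p - u) * cc j (x - u)"
      using X P pk p(5) by (intro mult_strict_mono) (auto simp: cc_simps)
    then show ?thesis unfolding crs_def by (simp add: mult.commute)
  qed
  have pne: "p \<noteq> u" using P by (auto simp: cc_simps)
  have s': "?D < crs j k (p - u) (v - u) + crs j k (x - u) (p - u)"
    using s unfolding crs_side_shift[of j k v x p u] by linarith
  define \<alpha> where "\<alpha> = crs j k (p - u) (v - u) / ?D"
  define \<beta> where "\<beta> = crs j k (x - u) (p - u) / ?D"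
  have pu: "p - u = \<alpha> *\<^sub>R (x - u) + \<beta> *\<^sub>R (v - u)" using crs_coord[OF t Dp, of p] by (simp add: \<alpha>_def \<beta>_def)
  have ab: "\<alpha> > 0" "\<beta> > 0" using a b Dp by (auto simp: \<alpha>_def \<beta>_def)
  have ab1: "\<alpha> + \<beta> > 1"
  proof -
    have "\<alpha> + \<beta> = (crs j k (p - u) (v - u) + crs j k (x - u) (p - u)) / ?D" by (simp add: \<alpha>_def \<beta>_def add_divide_distrib)
    also have "\<dots> > 1" using s' Dp by simp
    finally show ?thesis by simp
  qed
  \<comment> \<open>The point where the segment from \<open>u\<close> to \<open>p\<close> crosses
    \<open>x v\<close>, passing from one free triangle into the other.\<close>
  define m where "m = u + (1 / (\<alpha> + \<beta>)) *\<^sub>R (p - u)"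
  have m1: "m = u + (\<alpha> / (\<alpha> + \<beta>)) *\<^sub>R (x - u) + (\<beta> / (\<alpha> + \<beta>)) *\<^sub>R (v - u)"
    unfolding m_def pu by (simp add: scaleR_add_right)
  have sum1: "\<alpha> / (\<alpha> + \<beta>) + \<beta> / (\<alpha> + \<beta>) = 1" using ab by (simp add: add_divide_distrib[symmetric])
  have mh: "m \<in> convex hull {u, x, v}"
    unfolding in_hull3 m1 using ab sum1 by (intro exI[of _ "\<alpha> / (\<alpha> + \<beta>)"] exI[of _ "\<beta> / (\<alpha> + \<beta>)"]) auto
  have m2: "m = x + (\<beta> / (\<alpha> + \<beta>)) *\<^sub>R (v - x)"
  proof -
    have "\<alpha> / (\<alpha> + \<beta>) = 1 - \<beta> / (\<alpha> + \<beta>)" using sum1 by linarith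
    then show ?thesis unfolding m1 by (simp only:) (simp add: algebra_simps)
  qed
  have mh2: "m \<in> convex hull {x, v, p}"
    unfolding in_hull3 using m2 ab sum1 by (intro exI[of _ "\<beta> / (\<alpha> + \<beta>)"] exI[of _ 0]) auto
  have seg: "closed_segment u p = closed_segment u m \<union> closed_segment m p"
  proof -
    have "m \<in> closed_segment u p" unfolding in_segment m_def using ab1
      by (intro exI[of _ "1 / (\<alpha> + \<beta>)"]) (auto simp: algebra_simps)
    then show ?thesis by (rule Un_closed_segment[symmetric])
  qed
  have um: "closed_segment u m \<subseteq> convex hull {u, x, v}"
    by (rule closed_segment_subset[OF hull_inc mh convex_convex_hull]) auto
  have mp: "closed_segment m p \<subseteq> convex hull {x, v, p}"
    by (rule closed_segment_subset[OF mh2 hull_inc convex_convex_hull]) auto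
  have vp: "vis u p" unfolding visible_iff seg using um mp cons_freetri[OF c] p(4) unfolding freetri_def by blast
  have pk': "p \<in> visK V S u (nc i)" using vp p(1) cone_nc[OF t] P by (auto simp: visK_def cc_simps)
  have "SF u x v" using freetri_secfree[OF cons_freetri[OF c]] .
  then have "SF u x p" by (rule secfree_mono[where \<alpha> = 1 and \<beta> = 0, OF _ _ pu]) (use ab in auto)
  then have pX: "p \<in> X" using subcone_extend[OF D(3,4) pk'] by blast
  have "E i p u"
  proof (rule insert_vertex[OF t D(2,5,7) pk' b p(5) a p(6)])
    fix z assume z: "z \<in> V" "z \<in> cone p (pc i)" "FT p u z" "z \<noteq> u" "cc i z < cc i u" "crs j k (x - u) (z - u) > 0" "crs j k (z - u) (v - u) > 0"
    have zp: "cc j z < cc j p" "cc k z < cc k p" using cone_pc[OF t] z(2) by auto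
    have zne: "z \<noteq> x" "z \<noteq> v" "z \<noteq> p" using zp p(5,6) by auto
    show False
    proof (cases "crs j k (z - u) (v - u) + crs j k (x - u) (z - u) \<le> ?D")
      case True
      then have "z \<in> convex hull {u, x, v}" using in_hull_crs[OF t Dp, of z] z by auto
      then show False using cons_freetri[OF c] z(1,4) zne unfolding freetri_def by blast
    next
      case False
      then have hex_size: "crs j k (v - x) (z - x) < 0" unfolding crs_side_shift[of j k v x z u] by linarith
      have D': "crs j k (v - p) (x - p) > 0"
        using s unfolding crs_side_shift[of j k v x p u] by (simp add: crs_def cc_simps algebra_simps)
      have g1: "crs j k (z - p) (x - p) \<ge> 0"
      proof -
        have "(cc j z - cc j p) * (cc k x - cc k p) > 0" using zp pk by (simp add: mult_neg_neg)
        moreover have "(cc k z - cc k p) * (cc j x - cc j p) < 0" using zp p(5) by (simp add: mult_neg_pos)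
        ultimately show ?thesis unfolding crs_def cc_simps by linarith
      qed
      have g2: "crs j k (v - p) (z - p) \<ge> 0"
      proof -
        have "(cc j v - cc j p) * (cc k z - cc k p) > 0" using zp pj by (simp add: mult_neg_neg)
        moreover have "(cc k v - cc k p) * (cc j z - cc j p) < 0" using zp p(6) by (simp add: mult_pos_neg)
        ultimately show ?thesis unfolding crs_def cc_simps by linarith
      qed
      have g3: "crs j k (z - p) (x - p) + crs j k (v - p) (z - p) \<le> crs j k (v - p) (x - p)"
        using hex_size by (simp add: crs_def cc_simps algebra_simps)
      have "z \<in> convex hull {p, v, x}" by (rule in_hull_crs[OF t D' g1 g2 g3])
      then have "z \<in> convex hull {x, v, p}" by (simp add: insert_commute)
      then show False using p(4) z(1) zne unfolding freetri_def by blast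
    qed
  qed
  then show False using D(10)[OF pX] pk p(6) by blast
qed

text \<open>The vertex with the larger \<open>i\<close> coordinate selects the other. A rival of
  \<open>v\<close> at \<open>x\<close> gives an empty triangle \<open>x v p\<close>, and
  \<open>p\<close> is excluded on the side of \<open>u\<close> by \<open>cons_E_above\<close>, on
  the other side by \<open>cons_E_below\<close>.\<close>

lemma cons_E:
  assumes c: "cons i j k u X x v" and lt: "cc i v < cc i x" shows "E k x v"
proof -
  note D = cons_D[OF c]
  note t = D(1)
  have t': "tri k i j" using t tri_perm by blast
  have ft: "FT u x v" by (rule cons_freetri[OF c])
  have vxv: "vis x v" using freetri_visible[OF freetri_perm(3)[OF ft]] .
  have vcone: "v \<in> cone x (pc k)" using cone_pc[OF t'] lt D(8) by blast
  show ?thesis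
  proof (rule E_exists[OF D(11,12) vcone vxv])
    fix z assume z: "z \<in> V" "z \<in> cone x (pc k)" "vis x z" "z \<noteq> v" "SF x v z" "cc k z < cc k v"
    have zc: "cc i z < cc i x" "cc j z < cc j x" using cone_pc[OF t'] z(2) by auto
    have zx: "z \<noteq> x" using zc by auto
    obtain p where p: "p \<in> V" "p \<in> convex hull {x, v, z}" "p \<noteq> x" "p \<noteq> v" "FT x v p"
      using visible_empty_triangle[OF D(11,12) z(1) D(13) zx[symmetric] z(4)[symmetric] vxv z(3,5)] by blast
    have "cc i p \<le> cc i x" "cc j p \<le> cc j x" "cc k p \<le> cc k v" using cc_hull(1)[OF p(2)] zc lt D(8,9) z(6) by auto
    then have pc: "cc i p < cc i x" "cc j p < cc j x" "cc k p < cc k v"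
      using cc_neq[OF p(1) D(11) p(3)] cc_neq[OF p(1) D(12) p(4)] by (auto simp: less_le)
    have "crs j k (v - x) (p - x) \<noteq> 0" using crs_nz[OF t D(12) p(1) D(11)] p D(13) by auto
    then show False
      using cons_E_above[OF c p(1,3,4,5) pc] cons_E_below[OF c p(1,3,4,5) pc(2,3)] by linarith
  qed
qed

lemma cons_E_cases:
  assumes c: "cons i j k u X x v"
  shows "cc i v < cc i x \<and> E k x v \<and> v \<in> cone x (pc k) \<or> cc i x < cc i v \<and> E j v x \<and> v \<in> cone x (nc j)"
proof -
  note D = cons_D[OF c]
  have "cc i v \<noteq> cc i x" using cc_neq[OF D(12,11) D(13)[symmetric]] .
  then consider "cc i v < cc i x" | "cc i x < cc i v" by linarith
  then show ?thesis
  proof cases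
    case 1 then show ?thesis using cons_E[OF c] E_D(4) by blast
  next
    case 2 then show ?thesis using cons_E[OF cons_swap[OF c]] E_D(4) cone_nc_pc by blast
  qed
qed

section \<open>Faces\<close>

definition adj :: "pt \<Rightarrow> pt \<Rightarrow> bool" where "adj a b \<longleftrightarrow> {a, b} \<in> Ginf V S"

lemma adj_iff: "adj a b \<longleftrightarrow> (\<exists>i. E i a b \<or> E i b a)" by (simp add: adj_def Ginf_iff)

lemma adj_sym: "adj a b \<longleftrightarrow> adj b a" by (auto simp: adj_iff)

lemma adj_E: "E i a b \<Longrightarrow> adj a b" "E i a b \<Longrightarrow> adj b a" by (auto simp: adj_iff)

lemma adj_D: "adj a b \<Longrightarrow> a \<in> V \<and> b \<in> V \<and> a \<noteq> b \<and> vis a b"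
  unfolding adj_iff using E_D(1,2,3,5) visible_commute by blast

lemma adj_plane:
  assumes "adj a b" "adj c d" "o' \<in> open_segment a b" "o' \<in> open_segment c d" shows "{a, b} = {c, d}"
proof -
  have *: "\<exists>i a' b'. E i a' b' \<and> {a', b'} = {a, b} \<and> open_segment a' b' = open_segment a b" if "adj a b" for a b
    using that unfolding adj_iff by (metis insert_commute open_segment_commute)
  show ?thesis using *[OF assms(1)] *[OF assms(2)] Ginf_plane assms(3,4) by metis
qed

lemma cons_adj: "cons i j k u X x v \<Longrightarrow> adj x v \<and> adj u x \<and> adj u v"
  using cons_E_cases[of i j k u X x v] adj_E cons_D(5,7) by blast

text \<open>An edge from \<open>c\<close> into the angle of the empty triangle at \<open>c\<close>
  either ends inside the triangle or crosses the opposite side \<open>a b\<close>, against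
  planarity.\<close>

lemma face:
  assumes ft: "FT a b c" and V: "a \<in> V" "b \<in> V" "c \<in> V" and ab: "adj a b" and cq: "adj c q" and ne: "q \<noteq> a" "q \<noteq> b"
    and q: "q - c = \<alpha> *\<^sub>R (a - c) + \<beta> *\<^sub>R (b - c)" "\<alpha> > 0" "\<beta> > 0"
  shows False
proof (cases "\<alpha> + \<beta> \<le> 1")
  case True
  have "q = c + \<alpha> *\<^sub>R (a - c) + \<beta> *\<^sub>R (b - c)" using q(1) by (simp add: algebra_simps)
  then have "q \<in> convex hull {c, a, b}" unfolding in_hull3 using True q by (intro exI[of _ \<alpha>] exI[of _ \<beta>]) auto
  then have "q \<in> convex hull {a, b, c}" by (simp add: insert_commute)
  then show False using ft adj_D[OF cq] ne unfolding freetri_def by blast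
next
  case False
  define s where "s = \<alpha> + \<beta>"
  have s: "s > 1" using False by (simp add: s_def)
  define m where "m = c + (1 / s) *\<^sub>R (q - c)"
  have "m \<in> open_segment c q" unfolding in_segment m_def using s adj_D[OF cq]
    by (intro conjI exI[of _ "1 / s"]) (auto simp: algebra_simps)
  moreover have "m \<in> open_segment a b"
  proof -
    have e: "\<alpha> / s = 1 - \<beta> / s" using s by (simp add: s_def field_simps)
    have "m = c + (\<alpha> / s) *\<^sub>R (a - c) + (\<beta> / s) *\<^sub>R (b - c)" unfolding m_def q(1) by (simp add: scaleR_add_right)
    then have "m = (1 - \<beta> / s) *\<^sub>R a + (\<beta> / s) *\<^sub>R b" unfolding e by (simp add: algebra_simps)
    moreover have "0 < \<beta> / s" "\<beta> / s < 1" using q s by (auto simp: s_def)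
    ultimately show ?thesis unfolding in_segment using adj_D[OF ab] by blast
  qed
  ultimately have "{c, q} = {a, b}" using adj_plane[OF cq ab] by blast
  then show False using ne by (auto simp: doubleton_eq_iff)
qed

text \<open>With \<open>d\<close> on the side of \<open>c\<close>, either \<open>d\<close> lies in
  the angle of the triangle \<open>a b c\<close> at \<open>a\<close> or at \<open>b\<close>, which
  \<open>face\<close> excludes, or \<open>c\<close> lies in the triangle \<open>a b d\<close>, which
  is empty.\<close>

lemma face_unique:
  assumes ft: "FT a b c" "FT a b d" and V: "a \<in> V" "b \<in> V" "c \<in> V" "d \<in> V" and ne: "c \<noteq> d" "a \<noteq> b"
    and adj: "adj a c" "adj b c" "adj a d" "adj b d"
    and side: "cross2 (b - a) (c - a) * cross2 (b - a) (d - a) > 0"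
  shows False
proof -
  let ?C = "cross2 (b - a) (c - a)"
  have C: "?C \<noteq> 0" using side by auto
  have cne: "c \<noteq> a" "c \<noteq> b" "d \<noteq> a" "d \<noteq> b" using adj adj_D by blast+
  define \<beta> where "\<beta> = cross2 (d - a) (c - a) / ?C"
  define \<alpha> where "\<alpha> = cross2 (b - a) (d - a) / ?C"
  have d: "d - a = \<beta> *\<^sub>R (b - a) + \<alpha> *\<^sub>R (c - a)" using cross2_basis[OF C, of "d - a"] by (simp add: \<alpha>_def \<beta>_def)
  have al: "\<alpha> > 0" using side C by (auto simp: \<alpha>_def zero_less_mult_iff zero_less_divide_iff)
  have nb: "\<beta> \<noteq> 0" using not_collinear[of a d c] V ne cne C by (auto simp: \<beta>_def)
  have db: "d - b = \<alpha> *\<^sub>R (c - b) + (1 - \<alpha> - \<beta>) *\<^sub>R (a - b)"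
  proof -
    have "d = a + \<beta> *\<^sub>R (b - a) + \<alpha> *\<^sub>R (c - a)" using d by (simp add: algebra_simps)
    then show ?thesis by (simp add: algebra_simps)
  qed
  have n1: "1 - \<alpha> - \<beta> \<noteq> 0"
  proof
    assume "1 - \<alpha> - \<beta> = 0"
    then have "d - b = \<alpha> *\<^sub>R (c - b)" using db by simp
    then have "cross2 (d - b) (c - b) = 0" by (simp only: cross2_simps(7,9) mult_zero_right)
    then show False using not_collinear[of b d c] V ne cne by auto
  qed
  consider "\<beta> > 0" | "1 - \<alpha> - \<beta> > 0" | "\<beta> < 0" "1 - \<alpha> - \<beta> < 0" using nb n1 by linarith
  then show False
  proof cases
    case 1
    then show False using face[OF freetri_perm(3)[OF ft(1)] V(2,3,1) adj(2,3) cne(4) ne(1)[symmetric] d] al by blast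
  next
    case 2
    show False using face[OF freetri_perm(4)[OF ft(1)] V(3,1,2) _ adj(4) ne(1)[symmetric] cne(3) db al 2] adj(1) adj_sym by blast
  next
    case 3
    have a1: "\<alpha> > 1" using 3 by linarith
    have "\<alpha> *\<^sub>R (c - a) = (- \<beta>) *\<^sub>R (b - a) + (d - a)" using d by simp
    then have "(1 / \<alpha>) *\<^sub>R (\<alpha> *\<^sub>R (c - a)) = (1 / \<alpha>) *\<^sub>R ((- \<beta>) *\<^sub>R (b - a) + (d - a))" by simp
    then have "c - a = (- \<beta> / \<alpha>) *\<^sub>R (b - a) + (1 / \<alpha>) *\<^sub>R (d - a)" using al by (simp add: scaleR_add_right scaleR_diff_right)
    then have "c = a + (- \<beta> / \<alpha>) *\<^sub>R (b - a) + (1 / \<alpha>) *\<^sub>R (d - a)" by (simp add: algebra_simps)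
    moreover have "- \<beta> / \<alpha> \<ge> 0" "1 / \<alpha> \<ge> 0" "- \<beta> / \<alpha> + 1 / \<alpha> \<le> 1" using 3 al by (auto simp: field_simps divide_nonpos_pos)
    ultimately have "c \<in> convex hull {a, b, d}" unfolding in_hull3 by blast
    then show False using ft(2) V(3) cne ne unfolding freetri_def by blast
  qed
qed

end

section \<open>The transformation\<close>

lemma nc_cong: "i mod 3 = j mod 3 \<Longrightarrow> nc i = nc j" unfolding nc_def by (metis cdir_cong)

lemma pc_cong: "i mod 3 = j mod 3 \<Longrightarrow> pc i = pc j" unfolding pc_def by (metis cdir_cong)

lemma mod3_minus1: "(i - 1) mod 3 = (i + 2) mod (3::int)" by presburger

context setting
begin

definition clo :: "int \<Rightarrow> pt \<Rightarrow> pt \<Rightarrow> bool" where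
  "clo i u w \<longleftrightarrow> (\<exists>X\<in>subcones V S u (nc i). closestN V S u (nc i) X w)"

definition nx :: "int \<Rightarrow> pt \<Rightarrow> pt set \<Rightarrow> pt \<Rightarrow> pt \<Rightarrow> bool" where
  "nx i u X x v \<longleftrightarrow> cons i (i + 1) (i + 2) u X x v"

text \<open>The cone conditions on \<open>x\<close> and \<open>y\<close> are expressed by oriented
  edges, with \<open>i + 2\<close> in place of \<open>i - 1\<close>; \<open>g7_config_iff\<close>
  gives the agreement.\<close>

definition cfg :: "int \<Rightarrow> pt \<Rightarrow> pt set \<Rightarrow> pt \<Rightarrow> pt \<Rightarrow> pt \<Rightarrow> bool" where
  "cfg i u X v x y \<longleftrightarrow> nx i u X x v \<and> nx i u X v y \<and> E (i + 2) x v \<and> E (i + 1) y v \<and>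
     \<not> is_split V S v (pc i) \<and> \<not> clo (i + 2) v x \<and> \<not> clo (i + 1) v y"

lemma clo_cong: "i mod 3 = j mod 3 \<Longrightarrow> clo i = clo j"
  unfolding clo_def using nc_cong[of i j] by simp

lemma cons_cong:
  assumes "i mod 3 = i' mod 3" "j mod 3 = j' mod 3" "k mod 3 = k' mod 3"
  shows "cons i j k = cons i' j' k'"
  unfolding cons_def tri_def
  using assms nc_cong[OF assms(1)] cc_cong[OF assms(2)] cc_cong[OF assms(3)] Epos_cong[OF assms(1)] by presburger

lemma nx_cong: "i mod 3 = j mod 3 \<Longrightarrow> nx i = nx j"
proof -
  assume a: "i mod 3 = j mod 3"
  have "cons i (i + 1) (i + 2) = cons j (j + 1) (j + 2)"
    by (rule cons_cong[OF a mod_add_cong[OF a refl] mod_add_cong[OF a refl]])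
  then show ?thesis unfolding nx_def by simp
qed

lemma cfg_cong:
  assumes "i mod 3 = j mod 3" shows "cfg i = cfg j"
proof -
  have 1: "(i + 1) mod 3 = (j + 1) mod 3" "(i + 2) mod 3 = (j + 2) mod 3" using assms by (metis mod_add_cong)+
  show ?thesis unfolding cfg_def
    using nx_cong[OF assms] pc_cong[OF assms] clo_cong[OF 1(1)] clo_cong[OF 1(2)] Epos_cong[OF 1(1)] Epos_cong[OF 1(2)]
    by presburger
qed

lemma closestN_iff:
  assumes "u \<in> V" "X \<in> subcones V S u (nc i)"
  shows "closestN V S u (nc i) X w \<longleftrightarrow> w \<in> X \<and> E i w u \<and> (\<forall>z\<in>X. E i z u \<longrightarrow> cc i z \<le> cc i w)"
proof -
  have "closestN V S u (nc i) X w \<longleftrightarrow> w \<in> cseq V S u X \<and> (\<forall>z\<in>cseq V S u X. cc i z \<le> cc i w)"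
    unfolding closestN_def cseq_def proj_nc by auto
  then show ?thesis using cseq_iff[OF assms] by auto
qed

lemma clo_iff:
  assumes "u \<in> V" "X \<in> subcones V S u (nc i)" "w \<in> X"
  shows "clo i u w \<longleftrightarrow> E i w u \<and> (\<forall>z\<in>X. E i z u \<longrightarrow> cc i z \<le> cc i w)"
proof
  assume "clo i u w"
  then obtain Y where Y: "Y \<in> subcones V S u (nc i)" "closestN V S u (nc i) Y w" unfolding clo_def by blast
  then have "w \<in> Y" using closestN_iff[OF assms(1)] by blast
  then have "Y = X" using subcone_unique[OF assms(1) Y(1) assms(2)] assms(3) by blast
  then show "E i w u \<and> (\<forall>z\<in>X. E i z u \<longrightarrow> cc i z \<le> cc i w)" using Y closestN_iff[OF assms(1)] by blast
next
  assume "E i w u \<and> (\<forall>z\<in>X. E i z u \<longrightarrow> cc i z \<le> cc i w)"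
  then show "clo i u w" unfolding clo_def using closestN_iff[OF assms(1,2)] assms by blast
qed

lemma clo_D:
  assumes "clo i u w" "u \<in> V"
  obtains X where "X \<in> subcones V S u (nc i)" "w \<in> X" "E i w u" "\<And>z. z \<in> X \<Longrightarrow> E i z u \<Longrightarrow> cc i z \<le> cc i w"
  using assms closestN_iff[OF assms(2)] unfolding clo_def by blast

lemma clo_E: "clo i u w \<Longrightarrow> u \<in> V \<Longrightarrow> E i w u"
  using clo_D by blast

lemma adj_cone:
  assumes "adj x w"
  shows "w \<in> cone x (nc i) \<Longrightarrow> E i w x" "w \<in> cone x (pc i) \<Longrightarrow> E i x w"
proof -
  obtain i' where e: "E i' x w \<or> E i' w x" using assms adj_iff by blast
  show "E i w x" if w: "w \<in> cone x (nc i)" using e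
  proof
    assume "E i' x w" then show ?thesis using E_D(4) cone_pc_nc_disj w by blast
  next
    assume e: "E i' w x"
    then have "i' mod 3 = i mod 3" using E_D(4) cone_nc_pc cone_nc_disj w by blast
    then show ?thesis using e Epos_cong by metis
  qed
  show "E i x w" if w: "w \<in> cone x (pc i)" using e
  proof
    assume e: "E i' x w"
    then have "i' mod 3 = i mod 3" using E_D(4) cone_pc_disj w by blast
    then show ?thesis using e Epos_cong by metis
  next
    assume "E i' w x" then show ?thesis using E_D(4) cone_nc_pc cone_pc_nc_disj w by blast
  qed
qed

lemma E_conflict: "E i a b \<Longrightarrow> E j b a \<Longrightarrow> False"
  using E_D(4) cone_nc_pc cone_pc_nc_disj by blast

lemma E_index: "E i a b \<Longrightarrow> E j a b \<Longrightarrow> i mod 3 = j mod 3"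
  using E_D(4) cone_pc_disj by blast

lemma g7_config_iff: "g7_config V S u i X v x y \<longleftrightarrow> i \<in> {0, 1, 2} \<and> cfg i u X v x y"
proof
  assume g: "g7_config V S u i X v x y"
  have m: "nc (i - 1) = nc (i + 2)" by (rule nc_cong[OF mod3_minus1])
  have u: "u \<in> V" "X \<in> subcones V S u (nc i)" and i: "i \<in> {0, 1, 2}" using g unfolding g7_config_def by blast+
  have n: "nx i u X x v" "nx i u X v y" using g cnext_cons[OF u] unfolding g7_config_def nx_def by blast+
  have xc: "x \<in> cone v (nc (i + 2))" and yc: "y \<in> cone v (nc (i + 1))" using g unfolding g7_config_def m by blast+
  have ex: "E (i + 2) x v"
    using adj_cone(1)[OF _ xc] cons_adj n(1) adj_sym unfolding nx_def by blast
  have ey: "E (i + 1) y v"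
    using adj_cone(1)[OF _ yc] cons_adj n(2) unfolding nx_def by blast
  have v: "v \<in> V" using n cons_D(12) unfolding nx_def by blast
  have nn: "\<forall>X\<in>subcones V S v (nc (i + 2)). x \<in> X \<longrightarrow> \<not> closestN V S v (nc (i + 2)) X x"
    "\<forall>X\<in>subcones V S v (nc (i + 1)). y \<in> X \<longrightarrow> \<not> closestN V S v (nc (i + 1)) X y"
    using g unfolding g7_config_def m by blast+
  have "\<not> clo (i + 2) v x" using nn(1) closestN_iff[OF v] unfolding clo_def by blast
  moreover have "\<not> clo (i + 1) v y" using nn(2) closestN_iff[OF v] unfolding clo_def by blast
  ultimately show "i \<in> {0, 1, 2} \<and> cfg i u X v x y" using n i ex ey g unfolding cfg_def g7_config_def by blast
next
  assume h: "i \<in> {0, 1, 2} \<and> cfg i u X v x y"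
  have m: "nc (i - 1) = nc (i + 2)" by (rule nc_cong[OF mod3_minus1])
  have c: "nx i u X x v" "nx i u X v y" "E (i + 2) x v" "E (i + 1) y v"
     "\<not> is_split V S v (pc i)" "\<not> clo (i + 2) v x" "\<not> clo (i + 1) v y"
    using h unfolding cfg_def by blast+
  note D = cons_D[OF c(1)[unfolded nx_def]]
  have "v \<in> cseq V S u X" using cseq_iff[OF D(2,3)] D by blast
  moreover have "cnext u (cseq V S u X) x v" "cnext u (cseq V S u X) v y"
    using cnext_cons[OF D(2,3)] c unfolding nx_def by blast+
  moreover have "x \<in> cone v (nc (i - 1))" "y \<in> cone v (nc (i + 1))"
    using c(3,4) E_D(4) cone_nc_pc unfolding m by blast+
  ultimately show "g7_config V S u i X v x y"
    unfolding g7_config_def using h D c(5-7) unfolding m clo_def by blast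
qed

section \<open>The graph definitions as relations on pairs of vertices\<close>

definition removed_vy :: "pt \<Rightarrow> pt \<Rightarrow> bool" where "removed_vy v y \<longleftrightarrow> (\<exists>i u X x. cfg i u X v x y)"

definition removed_xw :: "pt \<Rightarrow> pt \<Rightarrow> bool" where
  "removed_xw x w \<longleftrightarrow> (\<exists>i u X v y X'. cfg i u X v x y \<and> X' \<in> subcones V S v (nc (i + 2)) \<and> x \<in> X' \<and>
     (nx (i + 2) v X' x w \<or> nx (i + 2) v X' w x) \<and> E i w x \<and> \<not> clo i x w)"

definition removed :: "pt \<Rightarrow> pt \<Rightarrow> bool" where "removed a b \<longleftrightarrow> removed_vy a b \<or> removed_vy b a \<or> removed_xw a b \<or> removed_xw b a"

definition added :: "pt \<Rightarrow> pt \<Rightarrow> bool" where "added a b \<longleftrightarrow> (\<exists>i u X v. cfg i u X v a b \<or> cfg i u X v b a)"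

definition g10 :: "pt \<Rightarrow> pt \<Rightarrow> bool" where
  "g10 a b \<longleftrightarrow> (\<exists>i. a \<in> V \<and> clo i a b \<or> b \<in> V \<and> clo i b a) \<or> (\<exists>i u X. nx i u X a b \<or> nx i u X b a)"

definition g7 :: "pt \<Rightarrow> pt \<Rightarrow> bool" where "g7 a b \<longleftrightarrow> g10 a b \<and> \<not> removed a b \<or> added a b"

lemma mod3_in: "(i::int) mod 3 \<in> {0, 1, 2}" using mod3_cases[of i] by auto

lemma G10_iff: "{a, b} \<in> G10 V S \<longleftrightarrow> g10 a b"
proof -
  have 1: "{a, b} \<in> {{u, w} | u w. u \<in> V \<and> (\<exists>i\<in>{0,1,2::int}. \<exists>X\<in>subcones V S u (nc i). closestN V S u (nc i) X w)}
     \<longleftrightarrow> (\<exists>i. a \<in> V \<and> clo i a b \<or> b \<in> V \<and> clo i b a)" (is "?L \<longleftrightarrow> ?R")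
  proof
    assume ?L
    then obtain u w i where "{a, b} = {u, w}" "u \<in> V" "clo i u w" unfolding clo_def by blast
    then show ?R unfolding doubleton_eq_iff by blast
  next
    have m: "{u, w} \<in> {{u, w} | u w. u \<in> V \<and> (\<exists>i\<in>{0,1,2::int}. \<exists>X\<in>subcones V S u (nc i). closestN V S u (nc i) X w)}"
      if "u \<in> V" "clo i u w" for u w i
    proof -
      have "clo (i mod 3) u w" using that clo_cong[of i "i mod 3"] by simp
      then have "u \<in> V \<and> (\<exists>i\<in>{0,1,2::int}. \<exists>X\<in>subcones V S u (nc i). closestN V S u (nc i) X w)"
        using that(1) bexI[OF _ mod3_in[of i]] unfolding clo_def by (intro conjI)
      then show ?thesis by blast
    qed
    assume ?R
    then obtain i where "a \<in> V \<and> clo i a b \<or> b \<in> V \<and> clo i b a" by blast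
    then show ?L
    proof
      assume h: "a \<in> V \<and> clo i a b" show ?thesis by (rule m[OF conjunct1[OF h] conjunct2[OF h]])
    next
      assume h: "b \<in> V \<and> clo i b a" show ?thesis unfolding insert_commute[of a b] by (rule m[OF conjunct1[OF h] conjunct2[OF h]])
    qed
  qed
  have 2: "{a, b} \<in> {e. \<exists>u\<in>V. \<exists>i\<in>{0,1,2::int}. \<exists>X\<in>subcones V S u (nc i). e \<in> cpath_edges V S u X}
     \<longleftrightarrow> (\<exists>i u X. nx i u X a b \<or> nx i u X b a)" (is "?L \<longleftrightarrow> ?R")
  proof
    assume ?L
    then obtain u i X v w where h: "u \<in> V" "X \<in> subcones V S u (nc i)" "{a, b} = {v, w}" "cnext u (cseq V S u X) v w"
      unfolding cpath_edges_def by blast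
    then have "nx i u X v w" using cnext_cons unfolding nx_def by blast
    then show ?R using h(3) unfolding doubleton_eq_iff by blast
  next
    have m: "\<exists>u\<in>V. \<exists>i\<in>{0,1,2::int}. \<exists>X\<in>subcones V S u (nc i). {v, w} \<in> cpath_edges V S u X"
      if "nx i u X v w" for i u X v w
    proof -
      have n: "nx (i mod 3) u X v w" using that nx_cong[of i "i mod 3"] by simp
      note D = cons_D(2,3)[OF n[unfolded nx_def]]
      have "{v, w} \<in> cpath_edges V S u X" using cnext_cons[OF D] n unfolding nx_def cpath_edges_def by blast
      then show ?thesis by (intro bexI[OF _ D(1)] bexI[OF _ mod3_in[of i]] bexI[OF _ D(2)])
    qed
    assume ?R
    then obtain i u X where "nx i u X a b \<or> nx i u X b a" by blast
    then have "\<exists>u\<in>V. \<exists>i\<in>{0,1,2::int}. \<exists>X\<in>subcones V S u (nc i). {a, b} \<in> cpath_edges V S u X"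
    proof
      assume "nx i u X a b" then show ?thesis by (rule m)
    next
      assume "nx i u X b a" then show ?thesis unfolding insert_commute[of a b] by (rule m)
    qed
    then show ?L by (rule CollectI)
  qed
  show ?thesis unfolding G10_def Un_iff 1 2 g10_def ..
qed

lemma added_iff: "{a, b} \<in> g7_added V S \<longleftrightarrow> added a b"
proof
  assume "{a, b} \<in> g7_added V S"
  then obtain x y u i X v where "{a, b} = {x, y}" "g7_config V S u i X v x y" unfolding g7_added_def by blast
  then show "added a b" unfolding added_def g7_config_iff doubleton_eq_iff by blast
next
  have m: "{x, y} \<in> g7_added V S" if "cfg i u X v x y" for i u X v x y
  proof -
    have "cfg (i mod 3) u X v x y" using that cfg_cong[of i "i mod 3"] by simp
    then have "g7_config V S u (i mod 3) X v x y" using g7_config_iff mod3_in by blast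
    then show ?thesis unfolding g7_added_def by blast
  qed
  assume "added a b"
  then show "{a, b} \<in> g7_added V S" unfolding added_def using m by (metis insert_commute)
qed

lemma removed_iff: "{a, b} \<in> g7_removed V S \<longleftrightarrow> removed a b"
proof
  assume h: "{a, b} \<in> g7_removed V S"
  show "removed a b" using h unfolding g7_removed_def
  proof (elim UnE CollectE exE conjE)
    fix v y u i X x assume 1: "{a, b} = {v, y}" "g7_config V S u i X v x y"
    then have "removed_vy v y" using g7_config_iff unfolding removed_vy_def by blast
    then show ?thesis using 1(1) unfolding removed_def doubleton_eq_iff by blast
  next
    fix x w u i X v y X'
    assume 2: "{a, b} = {x, w}" "g7_config V S u i X v x y" "X' \<in> subcones V S v (nc (i - 1))" "x \<in> X'"
        "cnext v (cseq V S v X') x w \<or> cnext v (cseq V S v X') w x" "w \<in> cone x (nc i)"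
        "\<forall>W\<in>subcones V S x (nc i). w \<in> W \<longrightarrow> \<not> closestN V S x (nc i) W w"
    have c: "cfg i u X v x y" using 2(2) g7_config_iff by blast
    have m: "nc (i - 1) = nc (i + 2)" by (rule nc_cong[OF mod3_minus1])
    have X': "X' \<in> subcones V S v (nc (i + 2))" using 2(3) m by simp
    have v: "v \<in> V" "x \<in> V" using c cons_D(11,12) unfolding cfg_def nx_def by blast+
    have n: "nx (i + 2) v X' x w \<or> nx (i + 2) v X' w x" using 2(5) cnext_cons[OF v(1) X'] unfolding nx_def by blast
    then have "adj x w" using cons_adj adj_sym unfolding nx_def by blast
    then have e: "E i w x" using adj_cone(1) 2(6) by blast
    have "\<not> clo i x w" unfolding clo_def using 2(7) closestN_iff[OF v(2)] by blast
    then have "removed_xw x w" unfolding removed_xw_def using c X' 2(4) n e by blast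
    then show ?thesis using 2(1) unfolding removed_def doubleton_eq_iff by blast
  qed
next
  have m1: "{v, y} \<in> g7_removed V S" if r: "removed_vy v y" for v y
  proof -
    obtain i u X x where c: "cfg i u X v x y" using r unfolding removed_vy_def by blast
    then have "cfg (i mod 3) u X v x y" using cfg_cong[of i "i mod 3"] by simp
    then have gc: "g7_config V S u (i mod 3) X v x y" using g7_config_iff mod3_in by blast
    show ?thesis unfolding g7_removed_def by (intro UnI1 CollectI exI conjI, rule refl, rule gc)
  qed
  have m2: "{x, w} \<in> g7_removed V S" if r: "removed_xw x w" for x w
  proof -
    obtain i0 u X v y X' where r0: "cfg i0 u X v x y" "X' \<in> subcones V S v (nc (i0 + 2))" "x \<in> X'"
      "nx (i0 + 2) v X' x w \<or> nx (i0 + 2) v X' w x" "E i0 w x" "\<not> clo i0 x w"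
      using r unfolding removed_xw_def by blast
    define i where "i = i0 mod 3"
    have ii: "i0 mod 3 = i mod 3" by (simp add: i_def)
    have i2: "(i0 + 2) mod 3 = (i + 2) mod 3" using ii by (metis mod_add_cong)
    have c: "cfg i u X v x y" "X' \<in> subcones V S v (nc (i + 2))"
      "nx (i + 2) v X' x w \<or> nx (i + 2) v X' w x" "E i w x" "\<not> clo i x w"
      using r0 cfg_cong[OF ii] nc_cong[OF i2] nx_cong[OF i2] Epos_cong[OF ii] clo_cong[OF ii] by metis+
    have v: "v \<in> V" "x \<in> V" using c(1) cons_D(11,12) unfolding cfg_def nx_def by blast+
    have g: "g7_config V S u i X v x y" using g7_config_iff c(1) mod3_in i_def by blast
    have m: "nc (i - 1) = nc (i + 2)" by (rule nc_cong[OF mod3_minus1])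
    have cn: "cnext v (cseq V S v X') x w \<or> cnext v (cseq V S v X') w x"
      using c(3) cnext_cons[OF v(1) c(2)] unfolding nx_def by blast
    have wc: "w \<in> cone x (nc i)" using E_D(4)[OF c(4)] cone_nc_pc by blast
    have ncl: "\<forall>W\<in>subcones V S x (nc i). w \<in> W \<longrightarrow> \<not> closestN V S x (nc i) W w"
      using c(5) unfolding clo_def by blast
    have ex: "\<exists>u i X v y X'. g7_config V S u i X v x y \<and>
          X' \<in> subcones V S v (nc (i - 1)) \<and> x \<in> X' \<and>
          (cnext v (cseq V S v X') x w \<or> cnext v (cseq V S v X') w x) \<and>
          w \<in> cone x (nc i) \<and>
          (\<forall>W\<in>subcones V S x (nc i). w \<in> W \<longrightarrow> \<not> closestN V S x (nc i) W w)"
      using g c(2) m r0(3) cn wc ncl by (intro exI conjI) (assumption | simp)+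
    show ?thesis unfolding g7_removed_def
      by (rule UnI2, rule CollectI, rule exI[of _ x], rule exI[of _ w], rule conjI, rule refl, rule ex)
  qed
  assume "removed a b"
  then show "{a, b} \<in> g7_removed V S" unfolding removed_def using m1 m2 by (metis insert_commute)
qed

lemma G7_iff: "{a, b} \<in> G7 V S \<longleftrightarrow> g7 a b"
  unfolding G7_def g7_def Un_iff Diff_iff G10_iff removed_iff added_iff ..

text \<open>The neighbour of a vertex on a canonical path is an end of the canonical sequence it belongs to,
  because the triangle spanned with the apex is an empty face.\<close>
lemma path_end:
  assumes c: "cons i j k u X x v" and e: "E k x v" and Y: "Y \<in> subcones V S v (nc k)" "x \<in> Y" "z \<in> Y" "E k z v"
  shows "cc i z \<le> cc i x"
proof (rule ccontr)
  assume h: "\<not> cc i z \<le> cc i x"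
  note D = cons_D[OF c]
  have tk: "tri k i j" using D(1) tri_perm by blast
  have zx: "z \<noteq> x" using h by auto
  have zj: "cc j z < cc j x"
    using canon_incomparable[OF tk D(12) Y(1,2) e Y(3,4) zx[symmetric]] h by auto
  have xv: "cc i (x - v) > 0" "cc j (x - v) > 0" using cone_pc[OF tk] E_D(4)[OF e] by (auto simp: cc_simps)
  have zv: "cc i (z - v) > 0" "cc j (z - v) > 0" using cone_pc[OF tk] E_D(4)[OF Y(4)] by (auto simp: cc_simps)
  have uv: "cc j (u - v) < 0" "cc k (u - v) < 0" using cone_pc[OF D(1)] E_D(4)[OF D(7)] by (auto simp: cc_simps)
  then have ui: "cc i (u - v) > 0" using cc_sum[OF D(1), of "u - v"] by linarith
  have d1: "crs i j (u - v) (x - v) > 0" "crs i j (u - v) (z - v) > 0"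
    unfolding crs_def using ui uv xv zv mult_pos_pos[of "cc i (u - v)" "cc j (x - v)"] mult_pos_pos[of "cc i (u - v)" "cc j (z - v)"]
      mult_neg_pos[of "cc j (u - v)" "cc i (x - v)"] mult_neg_pos[of "cc j (u - v)" "cc i (z - v)"] by linarith+
  have d2: "crs i j (z - v) (x - v) > 0"
  proof -
    have "cc j (z - v) * cc i (x - v) < cc j (x - v) * cc i (z - v)"
      using zj h xv zv by (intro mult_strict_mono) (auto simp: cc_simps)
    then show ?thesis unfolding crs_def by (simp add: mult.commute)
  qed
  have zq: "z - v = (crs i j (z - v) (x - v) / crs i j (u - v) (x - v)) *\<^sub>R (u - v) + (crs i j (u - v) (z - v) / crs i j (u - v) (x - v)) *\<^sub>R (x - v)"
    using crs_coord[OF tk d1(1)] .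
  have "adj v z" using adj_E Y(4) by blast
  moreover have "z \<noteq> u" using zv uv by auto
  moreover have "adj u x" using cons_adj[OF c] by blast
  ultimately show False
    using face[OF cons_freetri[OF c] D(2,11,12) _ _ _ zx zq] d1 d2 by auto
qed

text \<open>By incomparability, a member that is extreme in both coordinates is the only one, so it
  is trivially closest.\<close>

lemma both_ends:
  assumes t: "tri k i j" and v: "v \<in> V" and Y: "Y \<in> subcones V S v (nc k)" "x \<in> Y" "E k x v"
    and i: "\<And>z. z \<in> Y \<Longrightarrow> E k z v \<Longrightarrow> cc i z \<le> cc i x" and j: "\<And>z. z \<in> Y \<Longrightarrow> E k z v \<Longrightarrow> cc j z \<le> cc j x"
  shows "clo k v x"
proof -
  have "z = x" if z: "z \<in> Y" "E k z v" for z
  proof (rule ccontr)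
    assume "z \<noteq> x"
    then show False using canon_incomparable[OF t v Y(1) z Y(2,3)] i[OF z] j[OF z]
      cc_neq[of z x i] cc_neq[of z x j] E_D(1)[OF z(2)] E_D(1)[OF Y(3)] by force
  qed
  then show ?thesis using clo_iff[OF v Y(1,2)] Y(3) by blast
qed

lemma cons_unique:
  assumes "cons i j k u X x v" "cons i j k u X x' v" shows "x = x'"
proof (rule ccontr)
  assume ne: "x \<noteq> x'"
  note D = cons_D[OF assms(1)] and D' = cons_D[OF assms(2)]
  have "cc k x \<noteq> cc k x'" using cc_neq[OF D(11) D'(11) ne] .
  then show False using D(10)[OF D'(4,5)] D'(10)[OF D(4,5)] D(9) D'(9) by linarith
qed

lemma cons_same_subcone:
  assumes "cons i j k u X x v" "cons i j' k' u X' x' v" shows "X = X'"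
  using subcone_unique[of u X "nc i" X' v] cons_D(2,3,6)[OF assms(1)] cons_D(3,6)[OF assms(2)] by blast


section \<open>Degree\<close>

text \<open>\<open>v\<close> selects both the apex \<open>u\<close> and its neighbour
  \<open>t\<close> on the path. The negative cone \<open>k\<close> of \<open>v\<close> lies between
  the positive cones containing \<open>u\<close> and \<open>t\<close>, and near \<open>v\<close> it
  is covered by the empty face \<open>u t v\<close>.\<close>

definition wedge :: "int \<Rightarrow> int \<Rightarrow> int \<Rightarrow> pt \<Rightarrow> pt \<Rightarrow> pt \<Rightarrow> bool" where
  "wedge i j k v u t \<longleftrightarrow> tri i j k \<and> (\<exists>X. cons i j k u X t v) \<and> E j v t"

lemma wedge_D:
  assumes "wedge i j k v u t"
  shows "tri i j k" "E i v u" "E j v t" "E i t u" "FT u t v" "adj u t" "adj v u" "adj v t" "u \<in> V" "t \<in> V" "v \<in> V"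
proof -
  obtain X where c: "cons i j k u X t v" using assms unfolding wedge_def by blast
  note D = cons_D[OF c]
  show "tri i j k" "E i v u" "E i t u" "u \<in> V" "t \<in> V" "v \<in> V" using D by blast+
  show "E j v t" using assms unfolding wedge_def by blast
  show "FT u t v" by (rule cons_freetri[OF c])
  show "adj u t" "adj v u" "adj v t" using cons_adj[OF c] adj_sym by blast+
qed

lemma opposite_pos_cones:
  assumes t: "tri i j k" and u: "u \<in> cone v (pc i)" and w: "w \<in> cone v (pc j)"
  shows "crs i j (u - v) (w - v) > 0" "cc i (u - v) > 0" "cc j (u - v) < 0" "cc i (w - v) < 0" "cc j (w - v) > 0"
proof -
  have 1: "cc j (u - v) < 0" "cc k (u - v) < 0" using cone_pc[OF t] u by (auto simp: cc_simps)
  have 2: "cc i (w - v) < 0" "cc k (w - v) < 0" using cone_pc[OF tri_perm(2)[OF t]] w by (auto simp: cc_simps)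
  have 3: "cc i (u - v) > - cc j (u - v)" "cc j (w - v) > - cc i (w - v)"
    using 1 2 cc_sum[OF t, of "u - v"] cc_sum[OF t, of "w - v"] by linarith+
  show "cc i (u - v) > 0" "cc j (u - v) < 0" "cc i (w - v) < 0" "cc j (w - v) > 0" using 1 2 3 by linarith+
  have "(- cc j (u - v)) * (- cc i (w - v)) < cc i (u - v) * cc j (w - v)"
    using 1 2 3 by (intro mult_strict_mono) auto
  then show "crs i j (u - v) (w - v) > 0" unfolding crs_def by simp
qed

text \<open>An edge from \<open>v\<close> to a vertex strictly between \<open>u\<close> and
  \<open>t\<close> would enter the face \<open>u t v\<close>, against \<open>face\<close>.\<close>

lemma wedge_first_unique:
  assumes w: "wedge i j k v u t" and v: "FT u' t' v" "adj u' t'" "E i v u'" "E j v t'"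
  shows "\<not> crs i j (u - v) (u' - v) > 0 \<or> u' = u"
proof (rule ccontr)
  assume n: "\<not> ?thesis"
  note D = wedge_D[OF w]
  have tj: "tri k i j" using D(1) tri_perm by blast
  have d: "crs i j (u - v) (t - v) > 0" using opposite_pos_cones(1)[OF D(1)] E_D(4) D(2,3) by blast
  have d': "crs i j (u' - v) (t - v) > 0" using opposite_pos_cones(1)[OF D(1)] E_D(4) v(3) D(3) by blast
  have e: "u' - v = (crs i j (u' - v) (t - v) / crs i j (u - v) (t - v)) *\<^sub>R (u - v) + (crs i j (u - v) (u' - v) / crs i j (u - v) (t - v)) *\<^sub>R (t - v)"
    using crs_coord[OF tj d] .
  have "u' \<noteq> t" using E_index[OF v(3)] D(1,3) unfolding tri_def by blast
  then show False using face[OF D(5) D(9,10,11) D(6) _ _ _ e] n d d' v(3) adj_E by auto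
qed

lemma wedge_unique:
  assumes w: "wedge i j k v u t" and w': "wedge i j k v u' t'" shows "u = u'" "t = t'"
proof -
  note D = wedge_D[OF w] and D' = wedge_D[OF w']
  have tj: "tri k i j" "tri j i k" using D(1) tri_perm by blast+
  show u: "u = u'"
  proof (rule ccontr)
    assume ne: "u \<noteq> u'"
    have "u \<noteq> v" "u' \<noteq> v" using E_D(3) D(2) D'(2) by blast+
    then have "crs i j (u - v) (u' - v) \<noteq> 0" using crs_nz[OF tj(1) D(9) D'(9) D(11)] ne by blast
    then show False
      using wedge_first_unique[OF w D'(5,6,2,3)] wedge_first_unique[OF w' D(5,6,2,3)] ne crs_anti[of i j "u - v" "u' - v"] by force
  qed
  show "t = t'"
  proof (rule ccontr)
    assume ne: "t \<noteq> t'"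
    have "t \<noteq> v" "t' \<noteq> v" using E_D(3) D(3) D'(3) by blast+
    then have nz: "crs i j (t - v) (t' - v) \<noteq> 0" using crs_nz[OF tj(1) D(10) D'(10) D(11)] ne by blast
    have key: False
      if dd: "FT u s v" "adj u s" "s \<in> V" "E j v s" "E j v s'" "s \<noteq> s'" "crs i j (s' - v) (s - v) > 0" for s s'
    proof -
      have d: "crs i j (u - v) (s - v) > 0" "crs i j (u - v) (s' - v) > 0"
        using opposite_pos_cones(1)[OF D(1)] E_D(4) D(2) dd by blast+
      have e: "s' - v = (crs i j (s' - v) (s - v) / crs i j (u - v) (s - v)) *\<^sub>R (u - v) + (crs i j (u - v) (s' - v) / crs i j (u - v) (s - v)) *\<^sub>R (s - v)"
        using crs_coord[OF tj(1) d(1)] .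
      have "s' \<noteq> u" using E_index[OF D(2)] dd(5) D(1) unfolding tri_def by blast
      then show False using face[OF dd(1) D(9) dd(3) D(11) dd(2) _ _ _ e] d dd(5,6,7) adj_E by auto
    qed
    show False
      using key[OF D(5,6,10,3) D'(3) ne] key[OF D'(5)[folded u] D'(6)[folded u] D'(10,3) D(3) ne[symmetric]] nz
        crs_anti[of i j "t - v" "t' - v"] by force
  qed
qed

lemma wedge_swap_conflict: "wedge i j k v u t \<Longrightarrow> wedge j i k v t u \<Longrightarrow> False"
  using wedge_D(4) E_conflict by blast

lemma in_neg_cone_coord:
  assumes t: "tri i j k" and u: "u \<in> cone v (pc i)" and w: "w \<in> cone v (pc j)" and s: "cc i (s - v) > 0" "cc j (s - v) > 0"
  shows "s - v = (crs i j (s - v) (w - v) / crs i j (u - v) (w - v)) *\<^sub>R (u - v) + (crs i j (u - v) (s - v) / crs i j (u - v) (w - v)) *\<^sub>R (w - v)"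
    "crs i j (s - v) (w - v) / crs i j (u - v) (w - v) > 0" "crs i j (u - v) (s - v) / crs i j (u - v) (w - v) > 0"
proof -
  note o = opposite_pos_cones[OF t u w]
  show "s - v = (crs i j (s - v) (w - v) / crs i j (u - v) (w - v)) *\<^sub>R (u - v) + (crs i j (u - v) (s - v) / crs i j (u - v) (w - v)) *\<^sub>R (w - v)"
    using crs_coord[OF tri_perm(4)[OF t] o(1)] .
  have "crs i j (s - v) (w - v) > 0" "crs i j (u - v) (s - v) > 0"
    unfolding crs_def using s o(2-5) mult_pos_pos[OF s(1) o(5)] mult_pos_neg[OF s(2) o(4)] mult_pos_pos[OF o(2) s(2)] mult_neg_pos[OF o(3) s(1)]
    by linarith+
  then show "crs i j (s - v) (w - v) / crs i j (u - v) (w - v) > 0" "crs i j (u - v) (s - v) / crs i j (u - v) (w - v) > 0"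
    using o(1) by auto
qed

lemma free_direction:
  assumes ft: "FT u t v" and s: "s = \<alpha> *\<^sub>R (u - v) + \<beta> *\<^sub>R (t - v)" "0 \<le> \<alpha>" "0 \<le> \<beta>"
  obtains e where "e > 0" "\<And>r. 0 < r \<Longrightarrow> r < e \<Longrightarrow> v + r *\<^sub>R s \<notin> obs S"
proof -
  obtain k where k: "0 < k" "k * (\<alpha> + \<beta>) < 1" using small_scale[of "\<alpha> + \<beta>" 0 1] s by auto
  have "v + r *\<^sub>R s \<notin> obs S" if r: "0 < r" "r < k" for r
  proof -
    have "r * (\<alpha> + \<beta>) \<le> k * (\<alpha> + \<beta>)" using r s by (intro mult_right_mono) auto
    then have "r * \<alpha> + r * \<beta> \<le> 1" using k by (simp add: distrib_left)
    moreover have "v + r *\<^sub>R s = v + (r * \<alpha>) *\<^sub>R (u - v) + (r * \<beta>) *\<^sub>R (t - v)" unfolding s(1) by (simp add: scaleR_add_right)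
    moreover have "0 \<le> r * \<alpha>" "0 \<le> r * \<beta>" using r s by auto
    ultimately have "v + r *\<^sub>R s \<in> convex hull {v, u, t}" unfolding in_hull3 by blast
    then have "v + r *\<^sub>R s \<in> convex hull {u, t, v}" by (simp add: insert_commute)
    then show ?thesis using ft unfolding freetri_def by blast
  qed
  then show ?thesis using that k(1) by blast
qed

lemma split_direction:
  assumes "is_split V S v d"
  obtains s e where "v + s \<in> cone v d" "e > 0" "\<And>r. 0 < r \<Longrightarrow> r < e \<Longrightarrow> v + r *\<^sub>R s \<in> obs S"
proof -
  obtain a b where g: "geom_split S v d a b" using assms split_cfg_geom unfolding is_split_def by blast
  obtain e where e: "e > 0" "\<And>s t. 0 < s \<Longrightarrow> s < e \<Longrightarrow> 0 < t \<Longrightarrow> t < e \<Longrightarrow> v + s *\<^sub>R (a - v) + t *\<^sub>R (b - v) \<in> obs S"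
    using geom_split_sector[OF g] by blast
  have ab: "a \<in> cone v d" "b \<in> cone v d" using g unfolding geom_split_def by blast+
  have "v + ((a - v) + (b - v)) \<in> cone v d" by (rule cone_comb[OF ab, of 1 1]) auto
  moreover have "v + r *\<^sub>R ((a - v) + (b - v)) \<in> obs S" if "0 < r" "r < e" for r
    using e(2)[of r r] that by (simp add: scaleR_add_right add.assoc)
  ultimately show ?thesis using that e(1) by blast
qed

lemma free_vs_split:
  assumes "\<And>r. 0 < r \<Longrightarrow> r < e \<Longrightarrow> v + r *\<^sub>R s \<notin> obs S" "\<And>r. 0 < r \<Longrightarrow> r < e' \<Longrightarrow> v + r *\<^sub>R s \<in> obs S" "e > 0" "e' > 0"
  shows False
proof -
  have "0 < min e e' / 2" "min e e' / 2 < e" "min e e' / 2 < e'" using assms(3,4) by (auto simp: min_def)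
  then show False using assms(1,2) by blast
qed

text \<open>Every direction in this negative cone is a positive combination of the directions to
  \<open>u\<close> and \<open>t\<close>, so it starts inside the empty face: no obstacle splits the
  cone there and no edge arrives through it.\<close>

lemma wedge_empty:
  assumes w: "wedge i j k v u t"
  shows "\<not> is_split V S v (nc k)" "\<not> E k z v"
proof -
  note D = wedge_D[OF w]
  have uc: "u \<in> cone v (pc i)" and tc: "t \<in> cone v (pc j)" using D(2,3) E_D(4) by blast+
  have tk: "tri k i j" using D(1) tri_perm by blast
  show "\<not> is_split V S v (nc k)"
  proof
    assume "is_split V S v (nc k)"
    then obtain s e where s: "v + s \<in> cone v (nc k)" "e > 0" "\<And>r. 0 < r \<Longrightarrow> r < e \<Longrightarrow> v + r *\<^sub>R s \<in> obs S"
      using split_direction by blast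
    have p: "cc i ((v + s) - v) > 0" "cc j ((v + s) - v) > 0" using cone_nc[OF tk] s(1) by (auto simp: cc_simps)
    note c = in_neg_cone_coord[OF D(1) uc tc p]
    obtain e' where "e' > 0" "\<And>r. 0 < r \<Longrightarrow> r < e' \<Longrightarrow> v + r *\<^sub>R s \<notin> obs S"
      using free_direction[OF D(5), of s] c by (metis add_diff_cancel_left' less_imp_le)
    then show False using free_vs_split s(2,3) by blast
  qed
  show "\<not> E k z v"
  proof
    assume e: "E k z v"
    have p: "cc i (z - v) > 0" "cc j (z - v) > 0" using cone_pc[OF tk] E_D(4)[OF e] by (auto simp: cc_simps)
    note c = in_neg_cone_coord[OF D(1) uc tc p]
    have "z \<noteq> u" "z \<noteq> t" using p opposite_pos_cones(3,4)[OF D(1) uc tc] by auto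
    then show False using face[OF D(5) D(9,10,11,6) _ _ _ c] adj_E e by blast
  qed
qed

lemma E_unique:
  assumes "E i v u" "E i v u'" "Z \<in> subcones V S v (pc i)" "u \<in> Z" "u' \<in> Z"
  shows "u = u'"
proof (rule ccontr)
  assume ne: "u \<noteq> u'"
  have v: "v \<in> V" using E_D assms by blast
  have m: "\<forall>z\<in>Z. cc i w \<le> cc i z" if e: "E i v w" "w \<in> Z" for w
  proof -
    obtain X where X: "X \<in> subcones V S v (pc i)" "w \<in> X" "\<forall>z\<in>X. proj v (pc i) w \<le> proj v (pc i) z"
      using e unfolding Epos_def by blast
    then have "X = Z" using subcone_unique[OF v X(1) assms(3)] e by blast
    then show ?thesis using X(3) by (simp add: proj_pc)
  qed
  then have "cc i u = cc i u'" using m[OF assms(1,4)] m[OF assms(2,5)] assms(4,5) by force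
  then show False using cc_neq ne E_D(2) assms(1,2) by blast
qed

text \<open>The faces \<open>u t v\<close> and \<open>u t' v\<close> lie on the two sides of
  \<open>u v\<close> and together cover the positive cone \<open>i\<close> near
  \<open>v\<close>.\<close>

lemma not_split_two_sided:
  assumes c: "cons i j k u X t v" "E k t v" and c': "cons i k j u X t' v" "E j t' v"
  shows "\<not> is_split V S v (pc i)"
proof
  assume "is_split V S v (pc i)"
  then obtain s e where s: "v + s \<in> cone v (pc i)" "e > 0" "\<And>r. 0 < r \<Longrightarrow> r < e \<Longrightarrow> v + r *\<^sub>R s \<in> obs S"
    using split_direction by blast
  note D = cons_D[OF c(1)] and D' = cons_D[OF c'(1)]
  have key: False
    if tt: "tri i j k" and cc': "cons i j k u X t v" "E k t v" and sg: "crs i j (u - v) s \<ge> 0" for j k t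
  proof -
    note C = cons_D[OF cc'(1)]
    have tk: "tri k i j" using tt tri_perm by blast
    have u: "cc j (u - v) < 0" "cc k (u - v) < 0" using cone_pc[OF tt] E_D(4)[OF C(7)] by (auto simp: cc_simps)
    then have ui: "cc i (u - v) > 0" using cc_sum[OF tt, of "u - v"] by linarith
    have p: "cc i (t - v) > 0" "cc j (t - v) > 0" using cone_pc[OF tk] E_D(4)[OF cc'(2)] by (auto simp: cc_simps)
    have sj: "cc j s < 0" "cc k s < 0" using cone_pc[OF tt] s(1) by (auto simp: cc_simps)
    then have si: "cc i s > 0" using cc_sum[OF tt, of s] by linarith
    have d: "crs i j (u - v) (t - v) > 0"
      unfolding crs_def using mult_pos_pos[OF ui p(2)] mult_neg_pos[OF u(1) p(1)] by linarith
    have d2: "crs i j s (t - v) > 0"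
      unfolding crs_def using mult_pos_pos[OF si p(2)] mult_neg_pos[OF sj(1) p(1)] by linarith
    have e1: "s = (crs i j s (t - v) / crs i j (u - v) (t - v)) *\<^sub>R (u - v) + (crs i j (u - v) s / crs i j (u - v) (t - v)) *\<^sub>R (t - v)"
      using crs_basis[OF tk, of "u - v" "t - v" s] d by simp
    have n1: "crs i j s (t - v) / crs i j (u - v) (t - v) \<ge> 0" "crs i j (u - v) s / crs i j (u - v) (t - v) \<ge> 0" using d d2 sg by auto
    obtain e' where e': "e' > 0" "\<And>r. 0 < r \<Longrightarrow> r < e' \<Longrightarrow> v + r *\<^sub>R s \<notin> obs S"
      using free_direction[OF cons_freetri[OF cc'(1)] e1 n1] by blast
    show False using free_vs_split[of e' v s e] e' s(2,3) by blast
  qed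
  have "crs i k (u - v) s = - crs i j (u - v) s"
  proof -
    have h: "cc k s = - cc i s - cc j s" "cc k (u - v) = - cc i (u - v) - cc j (u - v)"
      using cc_sum[OF D(1), of s] cc_sum[OF D(1), of "u - v"] by linarith+
    show ?thesis unfolding crs_def h by (simp add: algebra_simps)
  qed
  then show False using key[OF D(1) c] key[OF D'(1) c'] by linarith
qed

section \<open>Charging edges to subcones\<close>

definition slots :: "pt \<Rightarrow> (pt \<times> pt set) set" where
  "slots v = (SIGMA d:{pc 0, pc 1, pc 2, nc 0, nc 1, nc 2}. subcones V S v d)"

text \<open>Seven is six cones plus one extra subcone: cones of different direction are disjoint, so
  \<open>is_split_common\<close> allows at most one split.\<close>

lemma card_slots: "finite (slots v)" "card (slots v) \<le> 7"
proof -
  let ?D = "{pc 0, pc 1, pc 2, nc 0, nc 1, nc 2}"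
  show "finite (slots v)" unfolding slots_def using card_subcones by auto
  have disj: "d = d'" if dn: "d \<in> ?D" "d' \<in> ?D" "cone v d \<inter> cone v d' \<noteq> {}" for d d'
  proof -
    obtain w where w: "w \<in> cone v d" "w \<in> cone v d'" using dn(3) by blast
    have pp: "pc i = pc j" if "w \<in> cone v (pc i)" "w \<in> cone v (pc j)" for i j using cone_pc_disj[OF that] pc_cong by blast
    have nn: "nc i = nc j" if "w \<in> cone v (nc i)" "w \<in> cone v (nc j)" for i j using cone_nc_disj[OF that] nc_cong by blast
    have pn: False if "w \<in> cone v (pc i)" "w \<in> cone v (nc j)" for i j using cone_pc_nc_disj[OF that] .
    have dd: "(\<exists>i. d = pc i) \<or> (\<exists>i. d = nc i)" "(\<exists>i. d' = pc i) \<or> (\<exists>i. d' = nc i)" using dn(1,2) by blast+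
    then show ?thesis using pp nn pn w by metis
  qed
  have one: "card {d \<in> ?D. is_split V S v d} \<le> 1"
  proof -
    have "d = d'" if h: "d \<in> {d \<in> ?D. is_split V S v d}" "d' \<in> {d \<in> ?D. is_split V S v d}" for d d'
    proof (rule disj)
      show "d \<in> ?D" "d' \<in> ?D" using h by blast+
      have "is_split V S v d" "is_split V S v d'" using h by blast+
      then show "cone v d \<inter> cone v d' \<noteq> {}" using is_split_common by blast
    qed
    moreover have "finite {d \<in> ?D. is_split V S v d}" by simp
    ultimately show ?thesis by (metis (no_types, lifting) One_nat_def card_le_Suc0_iff_eq)
  qed
  have "card (slots v) = (\<Sum>d\<in>?D. card (subcones V S v d))" unfolding slots_def
    by (rule card_SigmaI) (auto simp: card_subcones)
  also have "\<dots> \<le> (\<Sum>d\<in>?D. if is_split V S v d then 2 else 1)" by (intro sum_mono card_subcones(2))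
  also have "\<dots> = (\<Sum>d\<in>?D. 1 + (if is_split V S v d then 1 else 0))" by (intro sum.cong) auto
  also have "\<dots> = card ?D + card {d \<in> ?D. is_split V S v d}"
    by (simp only: sum.distrib) (simp add: sum.If_cases Collect_conj_eq[symmetric] Int_def)
  also have "\<dots> \<le> 6 + 1"
  proof -
    have "card ?D \<le> 6" using card_length[of "[pc 0, pc 1, pc 2, nc 0, nc 1, nc 2]"] by simp
    then show ?thesis using one by linarith
  qed
  finally show "card (slots v) \<le> 7" by simp
qed

lemma slot_pc: "X \<in> subcones V S v (pc i) \<Longrightarrow> (pc i, X) \<in> slots v"
  using mod3_cases[of i] pc_cong[of i 0] pc_cong[of i 1] pc_cong[of i 2] unfolding slots_def by auto

lemma slot_nc: "X \<in> subcones V S v (nc i) \<Longrightarrow> (nc i, X) \<in> slots v"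
  using mod3_cases[of i] nc_cong[of i 0] nc_cong[of i 1] nc_cong[of i 2] unfolding slots_def by auto

text \<open>The edge \<open>vt\<close> is charged to the negative subcone containing \<open>t\<close> if \<open>t\<close> is closest there, or to the
  negative cone between \<open>t\<close> and the apex of a common canonical path, where \<open>v\<close> has no neighbour in \<open>G\<^sub>\<infinity>\<close>.\<close>
definition ch_neg :: "pt \<Rightarrow> int \<Rightarrow> pt set \<Rightarrow> pt \<Rightarrow> bool" where
  "ch_neg v k X t \<longleftrightarrow> X \<in> subcones V S v (nc k) \<and>
     (t \<in> X \<and> clo k v t
    \<or> (\<exists>i j u. wedge i j k v u t \<and> \<not> removed v t)
    \<or> (\<exists>i u X0 v0. cfg i u X0 v0 t v \<and> (i + 2) mod 3 = k mod 3))"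

text \<open>A positive subcone with selected vertex \<open>u\<close> receives the edge to
  \<open>u\<close> if \<open>v\<close> is closest there, a path edge on the path of \<open>u\<close>
  that arrives at \<open>v\<close> without being closest, or an added edge \<open>v t\<close> of a
  configuration whose middle vertex is \<open>u\<close> and whose first vertex is
  \<open>v\<close>.\<close>

definition ch_pos :: "pt \<Rightarrow> int \<Rightarrow> pt set \<Rightarrow> pt \<Rightarrow> bool" where
  "ch_pos v i X t \<longleftrightarrow> X \<in> subcones V S v (pc i) \<and> (\<exists>u\<in>X. E i v u \<and>
     ((t = u \<and> clo i u v)
    \<or> (\<exists>j k X0. cons i j k u X0 t v \<and> E k t v \<and> \<not> clo k v t \<and> \<not> removed v t)
    \<or> (\<exists>i' u' X0. cfg i' u' X0 u v t \<and> (i' + 2) mod 3 = i mod 3)))"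

definition charge :: "pt \<Rightarrow> pt \<times> pt set \<Rightarrow> pt \<Rightarrow> bool" where
  "charge v s t \<longleftrightarrow> (\<exists>k X. s = (nc k, X) \<and> ch_neg v k X t) \<or> (\<exists>i X. s = (pc i, X) \<and> ch_pos v i X t)"

lemma subcones_unsplit: "\<not> is_split V S v d \<Longrightarrow> visK V S v d \<in> subcones V S v d"
  by (simp add: subcones_def)

lemma cfg_D:
  assumes "cfg i u X v x y"
  shows "cons i (i + 1) (i + 2) u X x v" "cons i (i + 1) (i + 2) u X v y" "E (i + 2) x v" "E (i + 1) y v"
     "\<not> is_split V S v (pc i)" "\<not> clo (i + 2) v x" "\<not> clo (i + 1) v y"
  using assms unfolding cfg_def nx_def by blast+

lemma cfg_wedge: "cfg i u X v x y \<Longrightarrow> wedge i (i + 1) (i + 2) y u v"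
  unfolding wedge_def using cfg_D(2,4) cons_D(1) by blast

lemma E_pos_subcone:
  assumes "E i v u" obtains Z where "Z \<in> subcones V S v (pc i)" "u \<in> Z"
  using E_D(6)[OF assms] subcone_cover by blast

lemma charge_exists:
  assumes g: "g7 v t" shows "\<exists>s\<in>slots v. charge v s t"
proof -
  have neg: "\<exists>s\<in>slots v. charge v s t" if "ch_neg v k X t" for k X
  proof (rule bexI)
    show "charge v (nc k, X) t" using that unfolding charge_def by blast
    show "(nc k, X) \<in> slots v" using that slot_nc unfolding ch_neg_def by blast
  qed
  have pos: "\<exists>s\<in>slots v. charge v s t" if "ch_pos v i X t" for i X
  proof (rule bexI)
    show "charge v (pc i, X) t" using that unfolding charge_def by blast
    show "(pc i, X) \<in> slots v" using that slot_pc unfolding ch_pos_def by blast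
  qed
  consider "added v t" | "g10 v t" "\<not> removed v t" using g unfolding g7_def by blast
  then show ?thesis
  proof cases
    case 1
    then obtain i u X0 v0 where "cfg i u X0 v0 t v \<or> cfg i u X0 v0 v t" unfolding added_def by blast
    then show ?thesis
    proof
      assume c: "cfg i u X0 v0 t v"
      have "visK V S v (nc (i + 2)) \<in> subcones V S v (nc (i + 2))"
        using subcones_unsplit wedge_empty(1)[OF cfg_wedge[OF c]] by blast
      then have "ch_neg v (i + 2) (visK V S v (nc (i + 2))) t" unfolding ch_neg_def using c by blast
      then show ?thesis using neg by blast
    next
      assume c: "cfg i u X0 v0 v t"
      have e: "E (i + 2) v v0" using cfg_D(3)[OF c] .
      then obtain Z where "Z \<in> subcones V S v (pc (i + 2))" "v0 \<in> Z" using E_pos_subcone by blast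
      then have "ch_pos v (i + 2) Z t" unfolding ch_pos_def using e c by blast
      then show ?thesis using pos by blast
    qed
  next
    case 2
    consider (a) i where "v \<in> V" "clo i v t" | (b) i where "t \<in> V" "clo i t v" | (c) i j k u X where "cons i j k u X t v"
    proof -
      have sw: "\<exists>i j k u X. cons i j k u X t v" if "nx i u X v t" for i u X
        using cons_swap that unfolding nx_def by blast
      show ?thesis using 2(1) that sw unfolding g10_def nx_def by blast
    qed
    then show ?thesis
    proof cases
      case a
      then obtain X where "X \<in> subcones V S v (nc i)" "t \<in> X" using clo_D by blast
      then have "ch_neg v i X t" unfolding ch_neg_def using a by blast
      then show ?thesis using neg by blast
    next
      case b
      then have e: "E i v t" using clo_E by blast
      then obtain Z where "Z \<in> subcones V S v (pc i)" "t \<in> Z" using E_pos_subcone by blast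
      then have "ch_pos v i Z t" unfolding ch_pos_def using e b by blast
      then show ?thesis using pos by blast
    next
      case c
      note D = cons_D[OF c]
      have "E k t v \<or> E j v t" using cons_E_cases[OF c] by blast
      then show ?thesis
      proof
        assume e: "E k t v"
        show ?thesis
        proof (cases "clo k v t")
          case True
          then obtain X where "X \<in> subcones V S v (nc k)" "t \<in> X" using clo_D D(12) by blast
          then have "ch_neg v k X t" unfolding ch_neg_def using True by blast
          then show ?thesis using neg by blast
        next
          case False
          obtain Z where "Z \<in> subcones V S v (pc i)" "u \<in> Z" using E_pos_subcone D(7) by blast
          then have "ch_pos v i Z t" unfolding ch_pos_def using D(7) c e False 2(2) by blast
          then show ?thesis using pos by blast
        qed
      next
        assume e: "E j v t"
        then have w: "wedge i j k v u t" unfolding wedge_def using c D(1) by blast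
        have "visK V S v (nc k) \<in> subcones V S v (nc k)" using subcones_unsplit wedge_empty(1)[OF w] by blast
        then have "ch_neg v k (visK V S v (nc k)) t" unfolding ch_neg_def using w 2(2) by blast
        then show ?thesis using neg by blast
      qed
    qed
  qed
qed

lemma wedge_cong:
  assumes "i mod 3 = i' mod 3" "j mod 3 = j' mod 3" "k mod 3 = k' mod 3"
  shows "wedge i j k = wedge i' j' k'"
  unfolding wedge_def tri_def using assms cons_cong[OF assms] Epos_cong[OF assms(2)] by presburger

text \<open>The two positive cones beside the negative cone \<open>k\<close> may be named in either
  order. In the opposite order both wedges would use the same face with \<open>u\<close> and
  \<open>t\<close> exchanged, but \<open>t\<close> selects \<open>u\<close> and not
  conversely.\<close>

lemma wedge_unique_gen:
  assumes w: "wedge i j k v u t" and w': "wedge i' j' k v u' t'"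
  shows "u = u' \<and> t = t' \<and> i mod 3 = i' mod 3 \<and> j mod 3 = j' mod 3"
proof -
  have T: "tri i j k" "tri i' j' k" using wedge_D(1) w w' by blast+
  then consider "i mod 3 = i' mod 3" "j mod 3 = j' mod 3" | "i mod 3 = j' mod 3" "j mod 3 = i' mod 3"
    using tri_other[OF T(2), of i] tri_other[OF T(2), of j] unfolding tri_def by argo
  then show ?thesis
  proof cases
    case 1
    then have "wedge i j k v u' t'" using w' wedge_cong[OF 1 refl[of "k mod 3"]] by simp
    then show ?thesis using wedge_unique[OF w] 1 by blast
  next
    case 2
    have w2: "wedge j i k v u' t'" using w' wedge_cong[OF 2(2) 2(1) refl[of "k mod 3"]] by simp
    note D = wedge_D[OF w] and D' = wedge_D[OF w2]
    have T': "tri j i k" using T(1) tri_perm by blast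
    have tk: "tri k i j" using T(1) tri_perm by blast
    have "u = t'"
    proof (rule ccontr)
      assume ne: "u \<noteq> t'"
      have "u \<noteq> v" "t' \<noteq> v" using E_D(3) D(2) D'(3) by blast+
      then have nz: "crs i j (u - v) (t' - v) \<noteq> 0" using crs_nz[OF tk D(9) D'(10) D(11)] ne by blast
      have ft: "FT t' u' v" using D'(5) freetri_perm(1) by blast
      have "\<not> crs i j (u - v) (t' - v) > 0"
        using wedge_first_unique[OF w ft _ D'(3,2)] D'(6) adj_sym ne by blast
      then have lt: "crs i j (t' - v) (u - v) > 0" using nz crs_anti[of i j "u - v" "t' - v"] by linarith
      have d: "crs i j (t' - v) (u' - v) > 0" "crs i j (u - v) (u' - v) > 0"
        using opposite_pos_cones(1)[OF T(1)] E_D(4) D(2) D'(2,3) by blast+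
      have e: "u - v = (crs i j (u - v) (u' - v) / crs i j (t' - v) (u' - v)) *\<^sub>R (t' - v) + (crs i j (t' - v) (u - v) / crs i j (t' - v) (u' - v)) *\<^sub>R (u' - v)"
        using crs_coord[OF tk d(1)] .
      have "u \<noteq> u'" using E_index[OF D(2)] D'(2) T(1) unfolding tri_def by metis
      then show False using face[OF ft D'(10,9,11) _ _ ne _ e] D'(6) adj_sym d lt D(7) by auto
    qed
    moreover have "t = u'"
    proof (rule ccontr)
      assume ne: "t \<noteq> u'"
      have "t \<noteq> v" "u' \<noteq> v" using E_D(3) D(3) D'(2) by blast+
      then have nz: "crs j i (u' - v) (t - v) \<noteq> 0" using crs_nz[OF tri_perm(1)[OF tk] D'(9) D(10) D(11)] ne by auto
      have ft: "FT t u v" using D(5) freetri_perm(1) by blast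
      have "\<not> crs j i (u' - v) (t - v) > 0"
        using wedge_first_unique[OF w2 ft _ D(3,2)] D(6) adj_sym ne by blast
      then have lt: "crs j i (t - v) (u' - v) > 0" using nz crs_anti[of j i "u' - v" "t - v"] by linarith
      have d: "crs j i (t - v) (u - v) > 0" "crs j i (u' - v) (u - v) > 0"
        using opposite_pos_cones(1)[OF T'] E_D(4) D(2,3) D'(2) by blast+
      have e: "u' - v = (crs j i (u' - v) (u - v) / crs j i (t - v) (u - v)) *\<^sub>R (t - v) + (crs j i (t - v) (u' - v) / crs j i (t - v) (u - v)) *\<^sub>R (u - v)"
        using crs_coord[OF tri_perm(1)[OF tk] d(1)] .
      have "u' \<noteq> u" using E_index[OF D(2)] D'(2) T(1) unfolding tri_def by metis
      then show False using face[OF ft D(10,9,11) _ _ ne[symmetric] _ e] D(6) adj_sym d lt D'(7) by auto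
    qed
    ultimately have "wedge j i k v t u" using w2 by simp
    then show ?thesis using wedge_swap_conflict[OF w] by blast
  qed
qed

text \<open>If some vertex is closest in the slot, \<open>wedge_empty\<close> excludes the other two
  kinds of edges. Otherwise the wedge at the slot is unique, with path neighbour \<open>w\<close>;
  the edge \<open>v w\<close> is either kept, or removed by a configuration whose added edge takes
  its place.\<close>

lemma ch_neg_unique:
  assumes "ch_neg v k X t" "ch_neg v k X t'" and v: "v \<in> V" shows "t = t'"
proof -
  have X: "X \<in> subcones V S v (nc k)" using assms unfolding ch_neg_def by blast
  have wd: "\<exists>i j u w. wedge i j k v u w \<and> (w = t \<and> \<not> removed v t \<or> (\<exists>X0. cfg i u X0 w t v))"
    if h: "ch_neg v k X t" "\<not> (t \<in> X \<and> clo k v t)" for t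
  proof -
    consider i j u where "wedge i j k v u t" "\<not> removed v t" | i u X0 v0 where "cfg i u X0 v0 t v" "(i + 2) mod 3 = k mod 3"
      using h unfolding ch_neg_def by blast
    then show ?thesis
    proof cases
      case 1 then show ?thesis by blast
    next
      case 2
      have "wedge i (i + 1) k v u v0" using cfg_wedge[OF 2(1)] wedge_cong[OF refl refl 2(2)] by simp
      then show ?thesis using 2(1) by blast
    qed
  qed
  show ?thesis
  proof (cases "(t \<in> X \<and> clo k v t) \<or> (t' \<in> X \<and> clo k v t')")
    case True
    then obtain w where w: "w \<in> X" "clo k v w" by blast
    have e: "E k w v" using w(2) v by (rule clo_E)
    have t1: "t \<in> X \<and> clo k v t" using wd[OF assms(1)] wedge_empty(2) e by blast
    have t2: "t' \<in> X \<and> clo k v t'" using wd[OF assms(2)] wedge_empty(2) e by blast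
    have 1: "E k t v" "E k t' v" using clo_E v t1 t2 by blast+
    have "cc k t' \<le> cc k t" "cc k t \<le> cc k t'" using clo_iff[OF v X, of t] clo_iff[OF v X, of t'] t1 t2 1 by blast+
    then have "cc k t = cc k t'" "E k t v" "E k t' v" using 1 by auto
    then show ?thesis using cc_neq E_D(1) by metis
  next
    case False
    obtain i j u w where 1: "wedge i j k v u w" "w = t \<and> \<not> removed v t \<or> (\<exists>X0. cfg i u X0 w t v)" using wd assms(1) False by blast
    obtain i' j' u' w' where 2: "wedge i' j' k v u' w'" "w' = t' \<and> \<not> removed v t' \<or> (\<exists>X0. cfg i' u' X0 w' t' v)" using wd assms(2) False by blast
    have eq: "u = u'" "w = w'" "i mod 3 = i' mod 3" using wedge_unique_gen[OF 1(1) 2(1)] by blast+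
    have r: "removed v w" if "cfg i0 u0 X0 w s v" for i0 u0 X0 s using that unfolding removed_def removed_vy_def by blast
    show ?thesis
    proof (cases "\<exists>X0. cfg i u X0 w t v")
      case True
      then obtain X0 where c: "cfg i u X0 w t v" by blast
      then have "\<exists>X0. cfg i' u' X0 w' t' v" using 2(2) r eq by blast
      then obtain X1 where "cfg i u X1 w t' v" using eq cfg_cong[OF eq(3)] by auto
      then have c2: "cons i (i + 1) (i + 2) u X1 t' w" using cfg_D(1) by blast
      have c1: "cons i (i + 1) (i + 2) u X0 t w" using cfg_D(1) c by blast
      then show ?thesis using cons_unique cons_same_subcone[OF c1 c2] c2 by blast
    next
      case False
      then have "w = t" "\<not> removed v t" using 1(2) by blast+
      then show ?thesis using 2(2) r eq by blast
    qed
  qed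
qed

text \<open>The slot determines the selected \<open>u\<close>. It remains to exclude clashes between
  the kinds of edges, and of two edges of one kind; the removals of the transformation are what
  excludes those left open in \<open>G10\<close>.\<close>

lemma ch_pos_unique:
  assumes "ch_pos v i X t" "ch_pos v i X t'" shows "t = t'"
proof -
  have X: "X \<in> subcones V S v (pc i)" using assms unfolding ch_pos_def by blast
  obtain u where u: "u \<in> X" "E i v u" "(t = u \<and> clo i u v)
    \<or> (\<exists>j k X0. cons i j k u X0 t v \<and> E k t v \<and> \<not> clo k v t \<and> \<not> removed v t)
    \<or> (\<exists>i' u' X0. cfg i' u' X0 u v t \<and> (i' + 2) mod 3 = i mod 3)" using assms(1) unfolding ch_pos_def by blast
  obtain u2 where u2: "u2 \<in> X" "E i v u2" "(t' = u2 \<and> clo i u2 v)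
    \<or> (\<exists>j k X0. cons i j k u2 X0 t' v \<and> E k t' v \<and> \<not> clo k v t' \<and> \<not> removed v t')
    \<or> (\<exists>i' u' X0. cfg i' u' X0 u2 v t' \<and> (i' + 2) mod 3 = i mod 3)" using assms(2) unfolding ch_pos_def by blast
  have "u2 = u" using E_unique[OF u2(2) u(2) X u2(1) u(1)] .
  note u2 = u2[unfolded this]
  have V: "u \<in> V" "v \<in> V" using E_D u(2) by blast+
  \<comment> \<open>If \<open>v\<close> is closest to \<open>u\<close>, no other member of the
    sequence has a larger \<open>i\<close> coordinate, but a path neighbour selecting
    \<open>v\<close> has one.\<close>
  have cb: False if b: "clo i u v" "cons i j k u X0 s v" "E k s v" for j k X0 s
  proof -
    note D = cons_D[OF b(2)]
    have "cc i s \<le> cc i v" using clo_iff[OF V(1) D(3,6)] b(1) D(4,5) by blast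
    moreover have "cc i v < cc i s" using cons_E_cases[OF b(2)] E_conflict b(3) by blast
    ultimately show False by simp
  qed
  have cd: False if b: "clo i u v" "cfg i' u' X0 u v s" "(i' + 2) mod 3 = i mod 3" for i' u' X0 s
    using cfg_D(6)[OF b(2)] clo_cong[OF b(3)] b(1) by simp
  \<comment> \<open>An added edge at \<open>v\<close> makes \<open>v\<close> the first vertex on the
    path of \<open>u\<close> by \<open>path_end\<close>. So \<open>v s\<close> is the first edge of
    that path and is deleted as an edge of the form \<open>x w\<close>.\<close>
  have bd: False if b: "cons i j k u X0 s v" "E k s v" "\<not> clo k v s" "\<not> removed v s" and c: "cfg i' u' X1 u v s'" "(i' + 2) mod 3 = i mod 3"
    for j k X0 s i' u' X1 s'
  proof -
    note D = cons_D[OF b(1)]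
    note c1 = cfg_D(1)[OF c(1)]
    have X0: "X0 \<in> subcones V S u (nc (i' + 2))" using D(3) nc_cong[OF c(2)] by simp
    have es: "E (i' + 2) s u" using D(5) Epos_cong[OF c(2)] by simp
    have le: "cc i' s \<le> cc i' v" using path_end[OF c1 cfg_D(3)[OF c(1)] X0 D(6) D(4) es] .
    have "i' mod 3 = j mod 3 \<or> i' mod 3 = k mod 3"
    proof -
      have "(i' + 2) mod 3 \<noteq> i' mod 3" using tri_succ(1)[of i'] unfolding tri_def by auto
      then show ?thesis using tri_other[OF D(1), of i'] c(2) by auto
    qed
    then have ik: "i' mod 3 = k mod 3" using le D(8) cc_cong by (metis not_less)
    have e2: "E i' s v" "\<not> clo i' v s" using b(2,3) Epos_cong[OF ik] clo_cong[OF ik] by auto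
    have "nx (i' + 2) u X0 v s \<or> nx (i' + 2) u X0 s v"
    proof -
      have ij: "(i' + 2) mod 3 = i mod 3" by (rule c(2))
      have t1: "tri i (i + 1) (i + 2)" by (rule tri_succ)
      have "(j mod 3 = (i + 1) mod 3 \<and> k mod 3 = (i + 2) mod 3) \<or> (k mod 3 = (i + 1) mod 3 \<and> j mod 3 = (i + 2) mod 3)"
        using tri_other[OF t1, of j] tri_other[OF t1, of k] D(1) unfolding tri_def by argo
      then have "nx i u X0 s v \<or> nx i u X0 v s"
        unfolding nx_def using b(1) cons_swap[OF b(1)] cons_cong[OF refl, of j "i + 1" k "i + 2"] cons_cong[OF refl, of k "i + 1" j "i + 2"] by metis
      then show ?thesis using nx_cong[OF ij] by auto
    qed
    then have "removed_xw v s" unfolding removed_xw_def using c(1) X0 D(6) e2 by blast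
    then show False using b(4) unfolding removed_def by blast
  qed
  \<comment> \<open>Two such path edges on the same side of \<open>v\<close> coincide. On different
    sides, the positive cone is not split, so both neighbours form a configuration and one of the
    edges was removed.\<close>
  have bb: "s = s'" if b: "cons i j k u X0 s v" "E k s v" "\<not> clo k v s" "\<not> removed v s"
      and b': "cons i j' k' u X0' s' v" "E k' s' v" "\<not> clo k' v s'" "\<not> removed v s'" for j k X0 s j' k' X0' s'
  proof -
    have XX: "X0' = X0" using cons_same_subcone[OF b'(1) b(1)] .
    note D = cons_D[OF b(1)] and D' = cons_D[OF b'(1)]
    consider "j mod 3 = j' mod 3" "k mod 3 = k' mod 3" | "j mod 3 = k' mod 3" "k mod 3 = j' mod 3"
      using tri_other[OF D'(1), of j] tri_other[OF D'(1), of k] D(1) unfolding tri_def by argo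
    then show ?thesis
    proof cases
      case 1
      then show ?thesis using cons_unique b(1) b'(1) cons_cong[OF refl 1] XX by metis
    next
      case 2
      have c': "cons i k j u X0 s' v" "E j s' v" "\<not> clo j v s'"
        using b' XX cons_cong[OF refl[of "i mod 3"] 2(2) 2(1)] Epos_cong[OF 2(1)] clo_cong[OF 2(1)] by auto
      have nsp: "\<not> is_split V S v (pc i)" by (rule not_split_two_sided[OF b(1,2) c'(1,2)])
      have key: False if a: "cons i j k u X0 s v" "E k s v" "\<not> clo k v s" "cons i k j u X0 s' v" "E j s' v" "\<not> clo j v s'" "\<not> removed v s'"
        and m: "j mod 3 = (i + 1) mod 3" "k mod 3 = (i + 2) mod 3" for j k s s'
      proof -
        have "nx i u X0 s v" unfolding nx_def using a(1) cons_cong[OF refl m] by metis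
        moreover have "nx i u X0 v s'" unfolding nx_def using cons_swap[OF a(4)] cons_cong[OF refl m] by metis
        moreover have "E (i + 2) s v" "\<not> clo (i + 2) v s" using a(2,3) Epos_cong[OF m(2)] clo_cong[OF m(2)] by auto
        moreover have "E (i + 1) s' v" "\<not> clo (i + 1) v s'" using a(5,6) Epos_cong[OF m(1)] clo_cong[OF m(1)] by auto
        ultimately have "cfg i u X0 v s s'" unfolding cfg_def using nsp by blast
        then show False using a(7) unfolding removed_def removed_vy_def by blast
      qed
      have t1: "tri i (i + 1) (i + 2)" by (rule tri_succ)
      have "(j mod 3 = (i + 1) mod 3 \<and> k mod 3 = (i + 2) mod 3) \<or> (k mod 3 = (i + 1) mod 3 \<and> j mod 3 = (i + 2) mod 3)"
        using tri_other[OF t1, of j] tri_other[OF t1, of k] D(1) unfolding tri_def by argo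
      then show ?thesis using key[OF b(1-3) c' b'(4)] key[OF c' b(1-3) b(4)] by blast
    qed
  qed
  \<comment> \<open>Both configurations give a face on the same side of \<open>u v\<close>, so their
    apexes agree, and then so do their last vertices.\<close>
  have dd: "s = s'" if c: "cfg i1 u1 X1 u v s" "(i1 + 2) mod 3 = i mod 3" and c': "cfg i2 u2 X2 u v s'" "(i2 + 2) mod 3 = i mod 3"
    for i1 u1 X1 s i2 u2 X2 s'
  proof -
    have ii: "i2 mod 3 = i1 mod 3"
    proof -
      have "(i1 + 2 + 1) mod 3 = (i2 + 2 + 1) mod 3" using c(2) c'(2) by (metis mod_add_cong)
      then show ?thesis by (simp add: add.assoc)
    qed
    have c2: "cfg i1 u2 X2 u v s'" using c'(1) cfg_cong[OF ii] by simp
    note a = cfg_D[OF c(1)] and a' = cfg_D[OF c2]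
    note D = cons_D[OF a(1)] and D' = cons_D[OF a'(1)]
    have "u1 = u2"
    proof (rule ccontr)
      assume ne: "u1 \<noteq> u2"
      have t: "tri i1 (i1 + 2) (i1 + 1)" by (rule tri_succ)
      have uc: "u \<in> cone v (pc (i1 + 2))" using E_D(4)[OF a(3)] .
      have 1: "crs i1 (i1 + 2) (u1 - v) (u - v) > 0" "crs i1 (i1 + 2) (u2 - v) (u - v) > 0"
        using opposite_pos_cones(1)[OF t _ uc] E_D(4) D(5) D'(5) by blast+
      obtain \<kappa> where k: "\<kappa> \<noteq> 0" "\<And>p q. cross2 p q = \<kappa> * crs i1 (i1 + 2) p q"
        using cross2_cc_ex[OF tri_perm(3)[OF tri_perm(3)[OF t]]] unfolding crs_def by metis
      have "cross2 (u - v) (u1 - v) * cross2 (u - v) (u2 - v) = (\<kappa> * \<kappa>) * (crs i1 (i1 + 2) (u1 - v) (u - v) * crs i1 (i1 + 2) (u2 - v) (u - v))"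
        unfolding k(2) using crs_anti[of i1 "i1 + 2" "u1 - v" "u - v"] crs_anti[of i1 "i1 + 2" "u2 - v" "u - v"] by simp
      also have "\<dots> > 0" using mult_pos_pos[OF 1] k(1) by (metis mult_pos_pos not_real_square_gt_zero)
      finally have side: "cross2 (u - v) (u1 - v) * cross2 (u - v) (u2 - v) > 0" .
      have ft: "FT v u u1" "FT v u u2" using cons_freetri[OF a(1)] cons_freetri[OF a'(1)] freetri_perm(3) by blast+
      have ad: "adj v u1" "adj u u1" "adj v u2" "adj u u2" using cons_adj[OF a(1)] cons_adj[OF a'(1)] adj_sym by blast+
      show False using face_unique[OF ft V(2,1) D(2) D'(2) ne _ ad side] E_D(3)[OF a(3)] by blast
    qed
    then have "cons i1 (i1 + 1) (i1 + 2) u1 X2 u s'" using a'(2) by simp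
    moreover have "X2 = X1" using cons_same_subcone[OF a'(1)] a(1) \<open>u1 = u2\<close> by blast
    ultimately show ?thesis using cons_unique[OF cons_swap[OF a(2)]] cons_swap by blast
  qed
  show ?thesis using u(3) u2(3) cb cd bd bb dd by metis
qed

lemma charge_unique:
  assumes "charge v s t" "charge v s t'" "v \<in> V" shows "t = t'"
proof -
  have inj_pc: "i mod 3 = j mod 3" if "pc i = pc j" for i j
  proof -
    have "v + pc i \<in> cone v (pc i)"
      using cone_pc[OF tri_succ(1)[of i], of "v + pc i" v] mod3_cases[of i]
      by (elim disjE) (simp_all add: cc_simps pc_def cdir_def cc_eq succ3)
    then show ?thesis using that cone_pc_disj by metis
  qed
  have inj_nc: "i mod 3 = j mod 3" if "nc i = nc j" for i j
    using inj_pc[of i j] that unfolding nc_def pc_def by simp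
  have pn: "pc i \<noteq> nc j" for i j
    using mod3_cases[of i] mod3_cases[of j] unfolding pc_def nc_def cdir_def by (elim disjE) auto
  have cn: "ch_neg v k X w" if "ch_neg v k' X w" "k mod 3 = k' mod 3" for k k' X w
    using that nc_cong[OF that(2)] clo_cong[OF that(2)] wedge_cong[OF refl refl that(2)] unfolding ch_neg_def by metis
  have cp: "ch_pos v k X w" if "ch_pos v k' X w" "k mod 3 = k' mod 3" for k k' X w
    using that pc_cong[OF that(2)] clo_cong[OF that(2)] Epos_cong[OF that(2)] cons_cong[OF that(2) refl refl] unfolding ch_pos_def by metis
  show ?thesis using assms(1,2) inj_pc inj_nc pn cn cp ch_neg_unique[OF _ _ assms(3)] ch_pos_unique unfolding charge_def by (metis prod.inject)
qed

lemma G7_degree: "v \<in> V \<Longrightarrow> vdegree (G7 V S) v \<le> 7"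
proof -
  assume v: "v \<in> V"
  let ?N = "{t. {v, t} \<in> G7 V S}"
  have N: "?N = {t. g7 v t}" by (simp add: G7_iff)
  define f where "f t = (SOME s. s \<in> slots v \<and> charge v s t)" for t
  have f: "f t \<in> slots v \<and> charge v (f t) t" if "t \<in> ?N" for t
    unfolding f_def using charge_exists[of v t] that unfolding N by (metis (mono_tags, lifting) mem_Collect_eq someI_ex)
  have "inj_on f ?N" using f charge_unique v by (intro inj_onI) metis
  moreover have "f ` ?N \<subseteq> slots v" using f by blast
  ultimately have "card ?N \<le> card (slots v)" using card_inj_on_le card_slots(1) by blast
  then show ?thesis unfolding vdegree_def using card_slots(2)[of v] by linarith
qed


section \<open>Planarity\<close>

definition in_triangle :: "pt \<Rightarrow> pt \<Rightarrow> pt \<Rightarrow> pt \<Rightarrow> bool" where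
  "in_triangle a b c p \<longleftrightarrow> (\<exists>\<alpha> \<beta>. \<alpha> > 0 \<and> \<beta> > 0 \<and> \<alpha> + \<beta> < 1 \<and> p - a = \<alpha> *\<^sub>R (b - a) + \<beta> *\<^sub>R (c - a))"

lemma in_triangle_hull: "in_triangle a b c p \<Longrightarrow> p \<in> convex hull {a, b, c}"
proof -
  assume "in_triangle a b c p"
  then obtain \<alpha> \<beta> where "\<alpha> > 0" "\<beta> > 0" "\<alpha> + \<beta> < 1" "p - a = \<alpha> *\<^sub>R (b - a) + \<beta> *\<^sub>R (c - a)" unfolding in_triangle_def by blast
  moreover from this have "p = a + \<alpha> *\<^sub>R (b - a) + \<beta> *\<^sub>R (c - a)" by (simp add: algebra_simps)
  ultimately show ?thesis unfolding in_hull3 by (intro exI[of _ \<alpha>] exI[of _ \<beta>]) auto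
qed

lemma leave_triangle:
  assumes nz: "cross2 (b - a) (c - a) \<noteq> 0" and m: "in_triangle a b c m" and p: "\<not> in_triangle a b c p"
  obtains e where "e \<in> closed_segment m p" "e \<noteq> m" "e \<in> closed_segment a b \<union> closed_segment b c \<union> closed_segment a c"
proof -
  let ?D = "cross2 (b - a) (c - a)"
  define A where "A p = cross2 (p - a) (c - a) / ?D" for p
  define B where "B p = cross2 (b - a) (p - a) / ?D" for p
  have rep: "p - a = A p *\<^sub>R (b - a) + B p *\<^sub>R (c - a)" for p
    using cross2_basis[OF nz, of "p - a"] by (simp add: A_def B_def)
  have lin: "A (x + t *\<^sub>R (y - x)) = A x + t * (A y - A x)" "B (x + t *\<^sub>R (y - x)) = B x + t * (B y - B x)" for x y t
    by (simp_all add: A_def B_def cross2_simps algebra_simps add_divide_distrib diff_divide_distrib)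
  define C where "C p = 1 - A p - B p" for p
  have linC: "C (x + t *\<^sub>R (y - x)) = C x + t * (C y - C x)" for x y t
    unfolding C_def lin by (simp add: algebra_simps)
  obtain \<alpha> \<beta> where ab: "\<alpha> > 0" "\<beta> > 0" "\<alpha> + \<beta> < 1" "m - a = \<alpha> *\<^sub>R (b - a) + \<beta> *\<^sub>R (c - a)" using m unfolding in_triangle_def by blast
  have Am: "A m = \<alpha>" "B m = \<beta>"
    unfolding A_def B_def ab(4) using nz by (simp_all only: cross2_simps(1,2,7,8,9)) simp_all
  have mp: "A m > 0" "B m > 0" "C m > 0" using ab Am by (auto simp: C_def)
  have "A p \<le> 0 \<or> B p \<le> 0 \<or> C p \<le> 0"
  proof (rule ccontr)
    assume "\<not> ?thesis"
    then have "in_triangle a b c p" unfolding in_triangle_def using rep[of p] by (intro exI[of _ "A p"] exI[of _ "B p"]) (auto simp: C_def)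
    then show False using p by blast
  qed
  then obtain t where t: "0 < t" "t \<le> 1" "A m + t * (A p - A m) \<ge> 0" "B m + t * (B p - B m) \<ge> 0" "C m + t * (C p - C m) \<ge> 0"
      "A m + t * (A p - A m) = 0 \<or> B m + t * (B p - B m) = 0 \<or> C m + t * (C p - C m) = 0"
    using min3_first_zero[OF mp] by blast
  define e where "e = m + t *\<^sub>R (p - m)"
  have ec: "A e \<ge> 0" "B e \<ge> 0" "C e \<ge> 0" "A e = 0 \<or> B e = 0 \<or> C e = 0" using t by (auto simp: e_def lin linC)
  have e1: "e \<in> closed_segment m p" using t(1,2) unfolding e_def in_segment
    by (intro exI[of _ t]) (auto simp: algebra_simps)
  have e2: "e \<noteq> m" using ec(4) mp by auto
  have ee: "e = a + A e *\<^sub>R (b - a) + B e *\<^sub>R (c - a)" using rep[of e] by (simp add: algebra_simps)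
  have "e \<in> closed_segment a b \<union> closed_segment b c \<union> closed_segment a c"
  proof -
    consider "B e = 0" | "A e = 0" | "A e = 1 - B e" using ec(4) by (auto simp: C_def)
    then show ?thesis
    proof cases
      case 1
      then have "e = (1 - A e) *\<^sub>R a + A e *\<^sub>R b" using ee by (simp add: algebra_simps)
      moreover have "A e \<le> 1" using ec(3) 1 by (simp add: C_def)
      ultimately have "e \<in> closed_segment a b" unfolding in_segment using ec(1) by blast
      then show ?thesis by blast
    next
      case 2
      then have "e = (1 - B e) *\<^sub>R a + B e *\<^sub>R c" using ee by (simp add: algebra_simps)
      moreover have "B e \<le> 1" using ec(3) 2 by (simp add: C_def)
      ultimately have "e \<in> closed_segment a c" unfolding in_segment using ec(2) by blast
      then show ?thesis by blast
    next
      case 3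
      have "e = (1 - B e) *\<^sub>R b + B e *\<^sub>R c" using ee unfolding 3 by (simp add: algebra_simps)
      moreover have "B e \<le> 1" using ec(1) 3 by simp
      ultimately have "e \<in> closed_segment b c" unfolding in_segment using ec(2) by blast
      then show ?thesis by blast
    qed
  qed
  then show ?thesis using that e1 e2 by blast
qed

lemma in_triangle_not_side:
  assumes nz: "cross2 (b - a) (c - a) \<noteq> 0" and m: "in_triangle a b c m"
  shows "m \<notin> closed_segment a b" "m \<notin> closed_segment b c" "m \<notin> closed_segment a c"
proof -
  obtain \<alpha> \<beta> where ab: "\<alpha> > 0" "\<beta> > 0" "\<alpha> + \<beta> < 1" "m - a = \<alpha> *\<^sub>R (b - a) + \<beta> *\<^sub>R (c - a)" using m unfolding in_triangle_def by blast
  have c1: "cross2 (b - a) (m - a) = \<beta> * cross2 (b - a) (c - a)" "cross2 (m - a) (c - a) = \<alpha> * cross2 (b - a) (c - a)"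
    unfolding ab(4) by (simp_all only: cross2_simps(1,2,7,8,9) mult_zero_right add_0_left add_0_right)
  show "m \<notin> closed_segment a b"
  proof
    assume "m \<in> closed_segment a b"
    then obtain t where "m = (1 - t) *\<^sub>R a + t *\<^sub>R b" unfolding in_segment by blast
    then have "m - a = t *\<^sub>R (b - a)" by (simp only:) (simp add: algebra_simps)
    then have "cross2 (b - a) (m - a) = 0" by (simp only: cross2_simps(8,9) mult_zero_right)
    then show False using c1(1) ab(2) nz by simp
  qed
  show "m \<notin> closed_segment a c"
  proof
    assume "m \<in> closed_segment a c"
    then obtain t where "m = (1 - t) *\<^sub>R a + t *\<^sub>R c" unfolding in_segment by blast
    then have "m - a = t *\<^sub>R (c - a)" by (simp only:) (simp add: algebra_simps)
    then have "cross2 (m - a) (c - a) = 0" by (simp only: cross2_simps(7,9) mult_zero_right)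
    then show False using c1(2) ab(1) nz by simp
  qed
  show "m \<notin> closed_segment b c"
  proof
    assume "m \<in> closed_segment b c"
    then obtain t where "m = (1 - t) *\<^sub>R b + t *\<^sub>R c" unfolding in_segment by blast
    then have e: "m - a = (1 - t) *\<^sub>R (b - a) + t *\<^sub>R (c - a)" by (simp only:) (simp add: algebra_simps)
    have "cross2 (b - a) (m - a) = t * cross2 (b - a) (c - a)" "cross2 (m - a) (c - a) = (1 - t) * cross2 (b - a) (c - a)"
      unfolding e by (simp_all only: cross2_simps(1,2,7,8,9) mult_zero_right add_0_left add_0_right)
    then have "\<beta> = t" "\<alpha> = 1 - t" using c1 nz by auto
    then show False using ab(3) by simp
  qed
qed

text \<open>From \<open>m\<close> the edge has to leave the face towards each of its ends. It can do
  so only at a corner, since no vertex lies inside and crossing a side contradicts planarity. Hence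
  both ends are corners and the edge is a side, which does not contain \<open>m\<close>.\<close>

lemma face_no_edge:
  assumes ft: "FT a b c" and s: "adj a b" "adj b c" "adj a c" and e: "adj p q" and m: "m \<in> open_segment p q" "in_triangle a b c m"
  shows False
proof -
  have V: "a \<in> V" "b \<in> V" "c \<in> V" "p \<in> V" "q \<in> V" "p \<noteq> q" "a \<noteq> b" "b \<noteq> c" "a \<noteq> c" using s e adj_D by blast+
  have nz: "cross2 (b - a) (c - a) \<noteq> 0" using not_collinear V by metis
  have nint: "\<not> in_triangle a b c r" if r: "r \<in> V" for r
  proof
    assume i: "in_triangle a b c r"
    then have "r \<in> {a, b, c}" using in_triangle_hull ft r unfolding freetri_def by blast
    then show False using in_triangle_not_side[OF nz i] by auto
  qed
  have corner: "r \<in> {a, b, c}" if r: "r = p \<or> r = q" for r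
  proof -
    obtain x where x: "x \<in> closed_segment m r" "x \<noteq> m" "x \<in> closed_segment a b \<union> closed_segment b c \<union> closed_segment a c"
      using leave_triangle[OF nz m(2) nint] r V by blast
    have mpq: "m \<in> closed_segment p q" "m \<noteq> p" "m \<noteq> q" using m(1) by (auto simp: open_segment_def)
    have "closed_segment m r \<subseteq> closed_segment p q" using mpq(1) r by (auto simp: subset_closed_segment)
    then have xpq: "x \<in> closed_segment p q" using x(1) by blast
    have side: "r \<in> {a', b'}" if ab: "adj a' b'" "x \<in> closed_segment a' b'" "m \<notin> closed_segment a' b'" for a' b'
    proof -
      have V': "a' \<in> V" "b' \<in> V" using ab adj_D by blast+
      have vx: "x = r" if xV: "x \<in> V"
      proof -
        have h1: "x = p \<or> x = q" using not_in_segment[OF V(4,5) xV xpq] .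
        show ?thesis
        proof (rule ccontr)
          assume h2: "x \<noteq> r"
          with h1 have cs: "closed_segment x r = closed_segment p q" using r closed_segment_commute[of p q] by metis
          have mm: "m \<in> closed_segment x r" unfolding cs by (rule mpq(1))
          then show False using x(1,2) by (metis between_antisym between_mem_segment closed_segment_commute)
        qed
      qed
      show ?thesis
      proof (cases "x = a' \<or> x = b'")
        case True then show ?thesis using vx V' by blast
      next
        case False
        then have xo: "x \<in> open_segment a' b'" using ab(2) by (simp add: open_segment_def)
        have "x \<notin> V" using not_in_segment[OF V'] ab(2) False by blast
        then have "x \<in> open_segment p q" using xpq V by (auto simp: open_segment_def)
        then have "{a', b'} = {p, q}" using adj_plane[OF ab(1) e xo] by blast
        then have "closed_segment a' b' = closed_segment p q" by (auto simp: doubleton_eq_iff closed_segment_commute)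
        then show ?thesis using ab(3) mpq(1) by blast
      qed
    qed
    note ns = in_triangle_not_side[OF nz m(2)]
    show ?thesis using x(3) side[OF s(1) _ ns(1)] side[OF s(2) _ ns(2)] side[OF s(3) _ ns(3)] by blast
  qed
  have "m \<in> closed_segment p q" using m(1) by (simp add: open_segment_def)
  then show False using corner[of p] corner[of q] V(6) in_triangle_not_side[OF nz m(2)] by (auto simp: closed_segment_commute)
qed

text \<open>Otherwise the segment from \<open>m\<close> to \<open>a'\<close> leaves the first
  triangle at a point \<open>x\<close> of one of its sides while still inside the second face, which
  no edge may enter.\<close>

lemma same_face_corner:
  assumes ft: "FT a b c" "FT a' b' c'" and s: "adj a b" "adj b c" "adj a c" and s': "adj a' b'" "adj b' c'" "adj a' c'"
    and m: "in_triangle a b c m" "in_triangle a' b' c' m"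
  shows "a' \<in> {a, b, c}"
proof (rule ccontr)
  assume n: "a' \<notin> {a, b, c}"
  have V: "a \<in> V" "b \<in> V" "c \<in> V" "a' \<in> V" "b' \<in> V" "c' \<in> V" "a \<noteq> b" "b \<noteq> c" "a \<noteq> c" "a' \<noteq> b'" "b' \<noteq> c'" "a' \<noteq> c'" using s s' adj_D by blast+
  have nz: "cross2 (b - a) (c - a) \<noteq> 0" and nz': "cross2 (b' - a') (c' - a') \<noteq> 0" using not_collinear V by metis+
  have "\<not> in_triangle a b c a'" using in_triangle_hull ft(1) V(4) n unfolding freetri_def by blast
  then obtain x where x: "x \<in> closed_segment m a'" "x \<noteq> m" "x \<in> closed_segment a b \<union> closed_segment b c \<union> closed_segment a c"
    using leave_triangle[OF nz m(1)] by blast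
  have xa: "x \<noteq> a'" using x(3) n not_in_segment[OF V(1,2,4)] not_in_segment[OF V(2,3,4)] not_in_segment[OF V(1,3,4)] by blast
  obtain \<alpha> \<beta> where ab: "\<alpha> > 0" "\<beta> > 0" "\<alpha> + \<beta> < 1" "m - a' = \<alpha> *\<^sub>R (b' - a') + \<beta> *\<^sub>R (c' - a')" using m(2) unfolding in_triangle_def by blast
  obtain t where t: "0 \<le> t" "t \<le> 1" "x = (1 - t) *\<^sub>R m + t *\<^sub>R a'" using x(1) unfolding in_segment by blast
  have t1: "t \<noteq> 1" using xa t(3) by auto
  have xm: "x - a' = (1 - t) *\<^sub>R (m - a')" unfolding t(3) by (simp add: algebra_simps)
  have ix: "in_triangle a' b' c' x"
    unfolding in_triangle_def
  proof (intro exI conjI)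
    show "x - a' = ((1 - t) * \<alpha>) *\<^sub>R (b' - a') + ((1 - t) * \<beta>) *\<^sub>R (c' - a')" unfolding xm ab(4) by (simp add: scaleR_add_right)
    show "(1 - t) * \<alpha> > 0" "(1 - t) * \<beta> > 0" using t t1 ab by auto
    have "(1 - t) * (\<alpha> + \<beta>) \<le> 1 * (\<alpha> + \<beta>)" using t ab by (intro mult_right_mono) auto
    then show "(1 - t) * \<alpha> + (1 - t) * \<beta> < 1" using ab(3) by (simp add: distrib_left)
  qed
  have side: False if pq: "adj p q" "x \<in> closed_segment p q" for p q
  proof -
    have Vp: "p \<in> V" "q \<in> V" using pq adj_D by blast+
    show False
    proof (cases "x = p \<or> x = q")
      case True
      then have "x \<in> V" using Vp by blast
      then have "x \<in> {a', b', c'}" using in_triangle_hull[OF ix] ft(2) unfolding freetri_def by blast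
      then show False using in_triangle_not_side[OF nz' ix] by auto
    next
      case False
      then have "x \<in> open_segment p q" using pq(2) by (simp add: open_segment_def)
      then show False using face_no_edge[OF ft(2) s' pq(1) _ ix] by blast
    qed
  qed
  show False using x(3) side s by blast
qed

lemma in_triangle_rot: "in_triangle a b c m \<Longrightarrow> in_triangle b c a m"
proof -
  assume "in_triangle a b c m"
  then obtain \<alpha> \<beta> where ab: "\<alpha> > 0" "\<beta> > 0" "\<alpha> + \<beta> < 1" "m - a = \<alpha> *\<^sub>R (b - a) + \<beta> *\<^sub>R (c - a)" unfolding in_triangle_def by blast
  have "m = a + \<alpha> *\<^sub>R (b - a) + \<beta> *\<^sub>R (c - a)" using ab(4) by (simp add: algebra_simps)
  then have "m - b = \<beta> *\<^sub>R (c - b) + (1 - \<alpha> - \<beta>) *\<^sub>R (a - b)" by (simp add: algebra_simps)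
  then show ?thesis unfolding in_triangle_def using ab by (intro exI[of _ \<beta>] exI[of _ "1 - \<alpha> - \<beta>"]) auto
qed

lemma same_face:
  assumes ft: "FT a b c" "FT a' b' c'" and s: "adj a b" "adj b c" "adj a c" and s': "adj a' b'" "adj b' c'" "adj a' c'"
    and m: "in_triangle a b c m" "in_triangle a' b' c' m"
  shows "{a', b', c'} = {a, b, c}"
proof -
  have s'': "adj b' a'" "adj c' a'" "adj c' b'" using s' adj_sym by blast+
  have sub: "{a', b', c'} \<subseteq> {a, b, c}"
    using same_face_corner[OF ft s s' m] same_face_corner[OF ft(1) freetri_perm(3)[OF ft(2)] s s'(2) s''(2,1) m(1) in_triangle_rot[OF m(2)]]
      same_face_corner[OF ft(1) freetri_perm(4)[OF ft(2)] s s''(2) s'(1) s''(3) m(1) in_triangle_rot[OF in_triangle_rot[OF m(2)]]] by blast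
  have "a \<noteq> b" "b \<noteq> c" "a \<noteq> c" "a' \<noteq> b'" "b' \<noteq> c'" "a' \<noteq> c'" using s s' adj_D by blast+
  then have "card {a, b, c} = 3" "card {a', b', c'} = 3" by (simp_all add: card_insert_if)
  then show ?thesis using sub by (metis card_subset_eq finite.emptyI finite_insert)
qed

text \<open>The diagonal \<open>x y\<close> of the quadrilateral \<open>u x v y\<close> passes
  between \<open>u\<close> and \<open>v\<close>. The sign condition picks the half on the side of
  \<open>x\<close>; the other half follows by exchanging \<open>j\<close> and
  \<open>k\<close>.\<close>

lemma added_region_half:
  assumes c: "cons i j k u X x v" and c': "cons i j k u X v y" and e: "E k x v" and e': "E j y v"
    and o: "o' \<in> open_segment x y" and sg: "crs j k (o' - u) (v - u) \<ge> 0"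
  shows "in_triangle u x v o' \<or> o' \<in> open_segment u v"
proof -
  note D = cons_D[OF c] and D' = cons_D[OF c']
  note t = D(1)
  obtain s where s: "0 < s" "s < 1" "o' = (1 - s) *\<^sub>R x + s *\<^sub>R y" using o unfolding in_segment by blast
  note Dp = cons_crs[OF c]
  let ?D = "crs j k (x - u) (v - u)"
  have X: "cc j (x - u) > 0" "cc k (x - u) > 0" "cc j (y - u) > 0" "cc k (y - u) > 0"
    using cone_pc[OF t] E_D(4)[OF D(5)] E_D(4)[OF D'(7)] by (auto simp: cc_simps)
  have xy: "crs j k (x - u) (y - u) > 0"
  proof -
    have "cc k (x - u) * cc j (y - u) < cc k (y - u) * cc j (x - u)"
      using X D(8,9) D'(8,9) by (intro mult_strict_mono) (auto simp: cc_simps)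
    then show ?thesis unfolding crs_def by (simp add: mult.commute)
  qed
  have ou: "o' - u = (1 - s) *\<^sub>R (x - u) + s *\<^sub>R (y - u)" unfolding s(3) by (simp add: algebra_simps)
  have b: "crs j k (x - u) (o' - u) > 0"
  proof -
    have "crs j k (x - u) (o' - u) = s * crs j k (x - u) (y - u)"
      unfolding ou by (simp only: crs_simps(2,4,7) mult_zero_right add_0_left)
    then show ?thesis using s xy by simp
  qed
  \<comment> \<open>Both \<open>x\<close> and \<open>y\<close> select \<open>v\<close>, so their
    \<open>i\<close> coordinates exceed that of \<open>v\<close>; this makes the quadrilateral
    convex at \<open>v\<close>.\<close>
  have cv: "crs j k (v - x) (y - x) > 0"
  proof -
    have "tri k i j" "tri j i k" using t tri_perm by blast+
    then have 1: "cc i v < cc i x" "cc i v < cc i y"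
      using cone_pc[of k i j] cone_pc[of j i k] E_D(4)[OF e] E_D(4)[OF e'] by auto
    have 2: "cc k v - cc k x > cc j x - cc j v" "cc j v - cc j y > cc k y - cc k v"
      using 1 cc_sum[OF t, of v] cc_sum[OF t, of x] cc_sum[OF t, of y] by linarith+
    have "(cc j x - cc j v) * (cc k y - cc k v) < (cc k v - cc k x) * (cc j v - cc j y)"
      using 2 D(8) D'(9) by (intro mult_strict_mono) auto
    then show ?thesis unfolding crs_def cc_simps by (simp add: algebra_simps)
  qed
  have c3: "crs j k (v - x) (o' - x) > 0"
  proof -
    have "o' - x = s *\<^sub>R (y - x)" unfolding s(3) by (simp add: algebra_simps)
    then show ?thesis using s cv by (simp add: crs_simps(4))
  qed
  define \<alpha> where "\<alpha> = crs j k (o' - u) (v - u) / ?D"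
  define \<beta> where "\<beta> = crs j k (x - u) (o' - u) / ?D"
  have co: "o' - u = \<alpha> *\<^sub>R (x - u) + \<beta> *\<^sub>R (v - u)" using crs_coord[OF t Dp, of o'] by (simp add: \<alpha>_def \<beta>_def)
  have be: "\<beta> > 0" using b Dp by (simp add: \<beta>_def)
  have al: "\<alpha> \<ge> 0" using sg Dp by (simp add: \<alpha>_def)
  have "crs j k (o' - u) (v - u) + crs j k (x - u) (o' - u) < ?D" using c3 unfolding crs_side_shift[of j k v x o' u] by linarith
  then have sum: "\<alpha> + \<beta> < 1" using Dp by (simp add: \<alpha>_def \<beta>_def add_divide_distrib[symmetric])
  show ?thesis
  proof (cases "\<alpha> = 0")
    case True
    have "o' = (1 - \<beta>) *\<^sub>R u + \<beta> *\<^sub>R v" using co True by (simp add: algebra_simps)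
    then have "o' \<in> open_segment u v" unfolding in_segment using be sum True D(15) by auto
    then show ?thesis by blast
  next
    case False
    then show ?thesis unfolding in_triangle_def using co be al sum by (metis less_eq_real_def)
  qed
qed

lemma added_region:
  assumes c: "cfg i u X v x y" and o: "o' \<in> open_segment x y"
  shows "in_triangle u x v o' \<or> o' \<in> open_segment u v \<or> in_triangle u y v o'"
proof -
  note a = cfg_D[OF c]
  have "crs (i + 2) (i + 1) (o' - u) (v - u) = - crs (i + 1) (i + 2) (o' - u) (v - u)" by (simp add: crs_def)
  then consider "crs (i + 1) (i + 2) (o' - u) (v - u) \<ge> 0" | "crs (i + 2) (i + 1) (o' - u) (v - u) \<ge> 0" by linarith
  then show ?thesis
  proof cases
    case 1 then show ?thesis using added_region_half[OF a(1-4) o] by blast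
  next
    case 2
    have "o' \<in> open_segment y x" using o by (simp add: open_segment_commute)
    then show ?thesis using added_region_half[OF cons_swap[OF a(2)] cons_swap[OF a(1)] a(4,3) _ 2] by blast
  qed
qed

lemma g10_adj: "g10 a b \<Longrightarrow> adj a b"
  unfolding g10_def nx_def using clo_E adj_E cons_adj adj_sym by blast

lemma cfg_V:
  assumes "cfg i u X v x y" shows "u \<in> V" "v \<in> V" "x \<in> V" "y \<in> V" "x \<noteq> y"
  using cons_D(2,8,11,12)[OF cfg_D(1)[OF assms]] cons_D(8,12)[OF cfg_D(2)[OF assms]] by (blast+, fastforce)

lemma cfg_faces:
  assumes c: "cfg i u X v x y"
  shows "FT u x v" "FT u y v" "adj u x" "adj x v" "adj u v" "adj u y" "adj y v"
  using cons_freetri[OF cfg_D(1)[OF c]] cons_freetri[OF cfg_D(2)[OF c]] freetri_perm(2) cons_adj[OF cfg_D(1)[OF c]] cons_adj[OF cfg_D(2)[OF c]] adj_sym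
  by blast+

text \<open>\<open>v\<close> is not closest to \<open>u\<close>, because \<open>x\<close> has a
  larger \<open>i\<close> coordinate. If \<open>u v\<close> were an edge of a canonical path with
  apex \<open>z\<close>, then by \<open>face_unique\<close> \<open>z\<close> would be
  \<open>x\<close> or \<open>y\<close>; but these select \<open>u\<close>, whereas \<open>u\<close>
  would select \<open>z\<close>.\<close>

lemma cfg_diagonal:
  assumes c: "cfg i u X v x y" shows "\<not> g10 u v"
proof
  assume g: "g10 u v"
  note a = cfg_D[OF c]
  note D = cons_D[OF a(1)] and D' = cons_D[OF a(2)]
  have cons_case: False if cz: "cons i' j' k' z Z u v" for i' j' k' z Z
  proof -
    note Z = cons_D[OF cz]
    have zx: "z \<noteq> x" using E_conflict[OF Z(5)] D(5) by blast
    have zy: "z \<noteq> y" using E_conflict[OF Z(5)] D'(7) by blast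
    have ft: "FT u v z" using cons_freetri[OF cz] freetri_perm(3) by blast
    have az: "adj u z" "adj v z" using cons_adj[OF cz] adj_sym by blast+
    have fx: "FT u v x" "FT u v y" using cfg_faces[OF c] freetri_perm(2) by blast+
    have ax: "adj u x" "adj v x" "adj u y" "adj v y" using cfg_faces[OF c] adj_sym by blast+
    obtain \<kappa> where k: "\<kappa> \<noteq> 0" "\<And>p q. cross2 p q = \<kappa> * crs (i + 1) (i + 2) p q"
      using cross2_cc_ex[OF D(1)] unfolding crs_def by metis
    let ?f = "\<lambda>p. crs (i + 1) (i + 2) (v - u) (p - u)"
    have fxy: "?f x < 0" "?f y > 0" using cons_crs[OF a(1)] cons_crs[OF a(2)] crs_anti[of "i + 1" "i + 2" "x - u" "v - u"] by linarith+
    have fz: "?f z \<noteq> 0" using crs_nz[OF D(1) D(12) Z(2) D(2)] Z(14,15) D(15) by auto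
    have pr: "cross2 (v - u) (p - u) * cross2 (v - u) (z - u) = (\<kappa> * \<kappa>) * (?f p * ?f z)" for p unfolding k(2) by simp
    have kk: "\<kappa> * \<kappa> > 0" using k(1) not_real_square_gt_zero by blast
    show False
    proof (cases "?f z > 0")
      case True
      then have "cross2 (v - u) (y - u) * cross2 (v - u) (z - u) > 0" unfolding pr using fxy kk by simp
      then show False using face_unique[OF fx(2) ft D(2,12) D'(12) Z(2) zy[symmetric] _ ax(3,4) az] D(15) by auto
    next
      case False
      then have "?f x * ?f z > 0" using fz fxy(1) by (simp add: mult_neg_neg)
      then have "cross2 (v - u) (x - u) * cross2 (v - u) (z - u) > 0" unfolding pr using kk by simp
      then show False using face_unique[OF fx(1) ft D(2,12) D(11) Z(2) zx[symmetric] _ ax(1,2) az] D(15) by auto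
    qed
  qed
  have clo_case: False if h: "clo i' u v" for i'
  proof -
    have "E i' v u" using clo_E[OF h D(2)] .
    then have "i' mod 3 = i mod 3" using E_index D(7) by blast
    then have "clo i u v" using h clo_cong by metis
    then have "cc i x \<le> cc i v" using clo_iff[OF D(2,3,6)] D(4,5) by blast
    moreover have "cc i v < cc i x" using cons_E_cases[OF a(1)] E_conflict a(3) by blast
    ultimately show False by simp
  qed
  have clo_case2: False if h: "clo i' v u" for i' using clo_E[OF h D(12)] E_conflict D(7) by blast
  show False using g clo_case clo_case2 cons_case cons_swap unfolding g10_def nx_def by blast
qed

lemma cfg_unique:
  assumes c: "cfg i u X v x y" and c': "cfg i' u X' v x' y'" shows "x = x'" "y = y'"
proof -
  note a = cfg_D[OF c] and a' = cfg_D[OF c']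
  have "i' mod 3 = i mod 3" using E_index cons_D(7)[OF a(1)] cons_D(7)[OF a'(1)] by blast
  then have "cfg i u X' v x' y'" using c' cfg_cong by metis
  note b = cfg_D[OF this]
  have XX: "X' = X" using cons_same_subcone[OF b(1) a(1)] .
  show "x = x'" using cons_unique[OF a(1)] b(1) XX by blast
  show "y = y'" using cons_unique[OF cons_swap[OF a(2)]] cons_swap[OF b(2)] XX by blast
qed

text \<open>The crossing point lies on a diagonal or inside a face of each configuration. A diagonal
  cannot run inside a face or cross another diagonal, so the configurations share a diagonal or a
  face; either way they have the same apex and middle vertex.\<close>

lemma added_added:
  assumes c: "cfg i u X v x y" and c': "cfg i' u' X' v' x' y'" and o: "o' \<in> open_segment x y" "o' \<in> open_segment x' y'"
  shows "{x, y} = {x', y'}"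
proof -
  have concl: "{x, y} = {x', y'}" if "u = u'" "v = v'" using cfg_unique[OF c] c' that by blast
  note F = cfg_faces[OF c] and F' = cfg_faces[OF c']
  note a = cfg_D[OF c] and a' = cfg_D[OF c']
  have e: "E i v u" "E i x u" "E i y u" "E i' v' u'" "E i' x' u'" "E i' y' u'"
    using cons_D(5,7)[OF a(1)] cons_D(7)[OF a(2)] cons_D(5,7)[OF a'(1)] cons_D(7)[OF a'(2)] by blast+
  consider "o' \<in> open_segment u v" | w where "w = x \<or> w = y" "in_triangle u w v o'" using added_region[OF c o(1)] by blast
  then show ?thesis
  proof cases
    case 1
    consider "o' \<in> open_segment u' v'" | w where "w = x' \<or> w = y'" "in_triangle u' w v' o'" using added_region[OF c' o(2)] by blast
    then show ?thesis
    proof cases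
      case 1
      then have "{u, v} = {u', v'}" using adj_plane[OF F(5) F'(5) \<open>o' \<in> open_segment u v\<close>] by blast
      then show ?thesis using concl E_conflict[OF e(1)] e(4) unfolding doubleton_eq_iff[of u v] by blast
    next
      case 2
      then show ?thesis using face_no_edge[OF F'(1) F'(3,4,5) F(5) 1] face_no_edge[OF F'(2) F'(6,7,5) F(5) 1] by blast
    qed
  next
    case w: 2
    have fw: "FT u w v" "adj u w" "adj w v" using w(1) F by blast+
    have ew: "E i w u" "\<exists>m. E m w v" using w(1) e a(3,4) by blast+
    consider "o' \<in> open_segment u' v'" | w' where "w' = x' \<or> w' = y'" "in_triangle u' w' v' o'" using added_region[OF c' o(2)] by blast
    then show ?thesis
    proof cases
      case 1
      then show ?thesis using face_no_edge[OF fw(1) fw(2,3) F(5) F'(5) 1 w(2)] by blast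
    next
      case w': 2
      have fw': "FT u' w' v'" "adj u' w'" "adj w' v'" using w'(1) F' by blast+
      have ew': "E i' w' u'" "\<exists>m. E m w' v'" using w'(1) e a'(3,4) by blast+
      have eq: "{u', w', v'} = {u, w, v}" by (rule same_face[OF fw(1) fw'(1) fw(2,3) F(5) fw'(2,3) F'(5) w(2) w'(2)])
      have ne: "u \<noteq> v" "w \<noteq> u" "w \<noteq> v" using fw F(5) adj_D by blast+
      have ne': "u' \<noteq> v'" "w' \<noteq> u'" "w' \<noteq> v'" using fw' F'(5) adj_D by blast+
      \<comment> \<open>In each face the apex is selected by the other two vertices, and the middle
        vertex by the third. These orientations recover the roles of the three corners.\<close>
      have no_out: "\<not> E m u' s" if s: "s \<in> {u', w', v'}" for m s
      proof
        assume em: "E m u' s"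
        show False using s E_D(3)[OF em] E_conflict[OF em] ew'(1) e(4) by blast
      qed
      have uin: "u \<in> {u', w', v'}" unfolding eq by blast
      have "u' \<noteq> v" "u' \<noteq> w" using no_out[OF uin] e(1) ew(1) by metis+
      moreover have "u' \<in> {u, w, v}" unfolding eq[symmetric] by blast
      ultimately have uu: "u = u'" by blast
      have "v' \<noteq> w"
      proof
        assume vw: "v' = w"
        then have "w' = v" using eq uu ne ne' by blast
        then show False using vw ew(2) ew'(2) E_conflict by blast
      qed
      moreover have "v' \<in> {u, w, v}" unfolding eq[symmetric] by blast
      ultimately have "v = v'" using uu ne'(1) by blast
      then show ?thesis using concl uu by blast
    qed
  qed
qed

lemma added_adj_cross:
  assumes c: "cfg i u X v x y" and g: "g10 p q" and o: "o' \<in> open_segment x y" "o' \<in> open_segment p q"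
  shows False
proof -
  have pq: "adj p q" using g g10_adj by blast
  note F = cfg_faces[OF c]
  consider "o' \<in> open_segment u v" | "in_triangle u x v o'" | "in_triangle u y v o'" using added_region[OF c o(1)] by blast
  then show False
  proof cases
    case 1
    then have "{u, v} = {p, q}" using adj_plane[OF F(5) pq _ o(2)] by blast
    moreover have "g10 q p" using g unfolding g10_def by blast
    ultimately show False using cfg_diagonal[OF c] g by (auto simp: doubleton_eq_iff)
  next
    case 2 then show False using face_no_edge[OF F(1) F(3,4,5) pq o(2)] by blast
  next
    case 3 then show False using face_no_edge[OF F(2) F(6,7,5) pq o(2)] by blast
  qed
qed

lemma added_cfg: "added a b \<Longrightarrow> \<exists>i u X v x y. cfg i u X v x y \<and> {a, b} = {x, y} \<and> open_segment a b = open_segment x y"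
  unfolding added_def by (metis insert_commute open_segment_commute)

lemma G7_plane: "is_plane (G7 V S)"
  unfolding is_plane_def
proof (intro allI impI, rule ccontr)
  fix a b c d
  assume e: "{a, b} \<in> G7 V S" "{c, d} \<in> G7 V S" "{a, b} \<noteq> {c, d}" and "open_segment a b \<inter> open_segment c d \<noteq> {}"
  then obtain o' where o: "o' \<in> open_segment a b" "o' \<in> open_segment c d" by blast
  have ab: "added a b \<or> g10 a b" "added c d \<or> g10 c d" using e(1,2) unfolding G7_iff g7_def by blast+
  consider "added a b" "added c d" | "added a b" "g10 c d" | "g10 a b" "added c d" | "g10 a b" "g10 c d" using ab by blast
  then show False
  proof cases
    case 1
    then obtain i u X v x y i' u' X' v' x' y' where "cfg i u X v x y" "{a, b} = {x, y}" "open_segment a b = open_segment x y"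
      "cfg i' u' X' v' x' y'" "{c, d} = {x', y'}" "open_segment c d = open_segment x' y'" using added_cfg by metis
    then show False using added_added o e(3) by metis
  next
    case 2
    then show False using added_cfg added_adj_cross o by metis
  next
    case 3
    then show False using added_cfg added_adj_cross o by metis
  next
    case 4
    then show False using adj_plane g10_adj o e(3) by blast
  qed
qed

lemma added_visible:
  assumes c: "cfg i u X v x y" shows "vis x y"
  unfolding visible_iff
proof (rule ccontr)
  assume "closed_segment x y \<inter> obs S \<noteq> {}"
  then obtain p where p: "p \<in> closed_segment x y" "p \<in> obs S" by blast
  note F = cfg_faces[OF c]
  have sub: "closed_segment u v \<subseteq> convex hull {u, x, v}" unfolding segment_convex_hull by (intro hull_mono) auto
  have "p \<in> convex hull {u, x, v} \<or> p \<in> convex hull {u, y, v}"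
  proof (cases "p = x \<or> p = y")
    case True then show ?thesis by (auto simp: hull_inc)
  next
    case False
    then have "p \<in> open_segment x y" using p(1) by (simp add: open_segment_def)
    then consider "in_triangle u x v p" | "p \<in> open_segment u v" | "in_triangle u y v p" using added_region[OF c] by blast
    then show ?thesis
    proof cases
      case 2
      then have "p \<in> closed_segment u v" by (simp add: open_segment_def)
      then show ?thesis using sub by blast
    qed (use in_triangle_hull in blast)+
  qed
  then show False using F(1,2) p(2) unfolding freetri_def by blast
qed

lemma g7_vis: "g7 a b \<Longrightarrow> a \<in> V \<and> b \<in> V \<and> a \<noteq> b \<and> vis a b"
proof -
  assume "g7 a b"
  then consider "g10 a b" | "added a b" unfolding g7_def by blast
  then show ?thesis
  proof cases
    case 1 then show ?thesis using g10_adj adj_D by blast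
  next
    case 2
    then obtain i u X v where "cfg i u X v a b \<or> cfg i u X v b a" unfolding added_def by blast
    then show ?thesis
    proof
      assume c: "cfg i u X v a b"
      show ?thesis using cfg_V[OF c] added_visible[OF c] by blast
    next
      assume c: "cfg i u X v b a"
      show ?thesis using cfg_V[OF c] added_visible[OF c] visible_commute[of S a b] by blast
    qed
  qed
qed

lemma G7_subset_Vis: "G7 V S \<subseteq> Vis V S"
proof
  fix e assume e: "e \<in> G7 V S"
  then have "\<exists>a b. e = {a, b}"
    unfolding G7_def G10_def g7_added_def cpath_edges_def by blast
  then obtain a b where ab: "e = {a, b}" by blast
  then have "g7 a b" using e G7_iff by blast
  then show "e \<in> Vis V S" unfolding Vis_def ab using g7_vis by blast
qed

end

section \<open>Stretch of G7 over Ginf\<close>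

text \<open>The length is an upper bound, so that bounds can be weakened at any step.\<close>
inductive walk :: "pt set set \<Rightarrow> pt \<Rightarrow> pt \<Rightarrow> real \<Rightarrow> bool" for G where
  walk_refl: "0 \<le> L \<Longrightarrow> walk G a a L"
| walk_step: "walk G a b L \<Longrightarrow> {b, c} \<in> G \<Longrightarrow> L + dist b c \<le> M \<Longrightarrow> walk G a c M"

lemma walk_mono: "walk G a b L \<Longrightarrow> L \<le> M \<Longrightarrow> walk G a b M"
proof (erule walk.cases)
  fix L' a' assume "L \<le> M" "a = a'" "b = a'" "L = L'" "0 \<le> L'"
  then show ?thesis using walk_refl[of M G a] by simp
next
  fix a' b' L' c M' assume "L \<le> M" "a = a'" "b = c" "L = M'" "walk G a' b' L'" "{b', c} \<in> G" "L' + dist b' c \<le> M'"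
  then show ?thesis using walk_step[of G a b' L' b M] by simp
qed

lemma walk_edge: "{a, b} \<in> G \<Longrightarrow> dist a b \<le> L \<Longrightarrow> walk G a b L"
  using walk_step[OF walk_refl[of 0 G a]] by simp

lemma walk_trans: "walk G b c M \<Longrightarrow> walk G a b L \<Longrightarrow> walk G a c (L + M)"
proof (induction rule: walk.induct)
  case (walk_refl M b) then show ?case using walk_mono[of G a b L "L + M"] by simp
next
  case (walk_step b d M' c M)
  then have "walk G a d (L + M')" by blast
  then show ?case by (rule walk.walk_step[OF _ walk_step.hyps(2)]) (use walk_step.hyps(3) in linarith)
qed

lemma walk_sym: "walk G a b L \<Longrightarrow> walk G b a L"
proof (induction rule: walk.induct)
  case (walk_refl L a) then show ?case by (rule walk.walk_refl)
next
  case (walk_step a b L c M)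
  have "walk G c b (dist b c)" using walk_step.hyps(2) by (intro walk_edge) (auto simp: insert_commute dist_commute)
  then have "walk G c a (dist b c + L)" using walk_trans[OF walk_step.IH] by blast
  then show ?case using walk_mono walk_step.hyps(3) by (metis add.commute)
qed

lemma is_path_snoc: "is_path G p a b \<Longrightarrow> {b, c} \<in> G \<Longrightarrow> is_path G (p @ [c]) a c"
  unfolding is_path_def
  by (auto simp: nth_append last_conv_nth less_Suc_eq)
    (metis One_nat_def diff_Suc_1 diff_Suc_Suc insert_commute length_greater_0_conv less_antisym Suc_lessI Suc_inject)+

lemma path_len_snoc: "p \<noteq> [] \<Longrightarrow> path_len (p @ [c]) = path_len p + dist (last p) c"
proof -
  assume p: "p \<noteq> []"
  obtain n where n: "length p = Suc n" using p by (cases p) auto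
  have "path_len (p @ [c]) = (\<Sum>k<Suc n. dist ((p @ [c]) ! k) ((p @ [c]) ! Suc k))" unfolding path_len_def using n by simp
  also have "\<dots> = (\<Sum>k<n. dist ((p @ [c]) ! k) ((p @ [c]) ! Suc k)) + dist ((p @ [c]) ! n) ((p @ [c]) ! Suc n)" by simp
  also have "(\<Sum>k<n. dist ((p @ [c]) ! k) ((p @ [c]) ! Suc k)) = (\<Sum>k<n. dist (p ! k) (p ! Suc k))"
    using n by (intro sum.cong) (auto simp: nth_append)
  also have "\<dots> = path_len p" unfolding path_len_def using n by simp
  also have "(p @ [c]) ! n = last p" using n p by (simp add: nth_append last_conv_nth)
  also have "(p @ [c]) ! Suc n = c" using n by (simp add: nth_append)
  finally show ?thesis .
qed

lemma walk_path: "walk G a b L \<Longrightarrow> \<exists>p. is_path G p a b \<and> path_len p \<le> L"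
proof (induction rule: walk.induct)
  case (walk_refl L a)
  then have "is_path G [a] a a \<and> path_len [a] \<le> L" by (simp add: is_path_def path_len_def)
  then show ?case by blast
next
  case (walk_step a b L c M)
  then obtain p where p: "is_path G p a b" "path_len p \<le> L" by blast
  then have "p \<noteq> []" "last p = b" unfolding is_path_def by auto
  then have "path_len (p @ [c]) \<le> M" using p(2) walk_step.hyps(3) path_len_snoc[of p c] by simp
  then show ?case using is_path_snoc[OF p(1) walk_step.hyps(2)] by blast
qed

lemma path_walk: "is_path G p a b \<Longrightarrow> (\<And>x y. {x, y} \<in> G \<Longrightarrow> walk H x y (t * dist x y)) \<Longrightarrow> walk H a b (t * path_len p)"
proof (induction p arbitrary: b rule: rev_induct)
  case Nil then show ?case by (simp add: is_path_def)
next
  case (snoc c p)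
  have cb: "c = b" using snoc.prems(1) by (simp add: is_path_def)
  show ?case
  proof (cases "p = []")
    case True
    then have "a = b" using snoc.prems(1) cb by (simp add: is_path_def)
    then show ?thesis using True by (simp add: path_len_def walk_refl)
  next
    case False
    obtain n where n: "length p = Suc n" using False by (cases p) auto
    have ip: "is_path G p a (last p)"
      unfolding is_path_def
    proof (intro conjI allI impI)
      show "p \<noteq> []" "last p = last p" using False by auto
      show "hd p = a" using snoc.prems(1) False by (simp add: is_path_def)
      fix k assume k: "Suc k < length p"
      then have "Suc k < length (p @ [c])" by simp
      then have "{(p @ [c]) ! k, (p @ [c]) ! Suc k} \<in> G" using snoc.prems(1) unfolding is_path_def by blast
      then show "{p ! k, p ! Suc k} \<in> G" using k by (simp add: nth_append)
    qed
    have "Suc n < length (p @ [c])" using n by simp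
    then have "{(p @ [c]) ! n, (p @ [c]) ! Suc n} \<in> G" using snoc.prems(1) unfolding is_path_def by blast
    then have "{last p, b} \<in> G" using n False cb by (simp add: nth_append last_conv_nth)
    then have "walk H (last p) b (t * dist (last p) b)" using snoc.prems(2) by blast
    moreover have "walk H a (last p) (t * path_len p)" using snoc.IH[OF ip] snoc.prems(2) by blast
    ultimately have "walk H a b (t * path_len p + t * dist (last p) b)" using walk_trans by blast
    then show ?thesis using path_len_snoc[OF False, of c] cb by (simp add: distrib_left)
  qed
qed

lemma walk_walk:
  assumes "walk G a b L" "\<And>x y. {x, y} \<in> G \<Longrightarrow> walk H x y (t * dist x y)" "t \<ge> 0"
  shows "walk H a b (t * L)"
  using assms(1)
proof (induction rule: walk.induct)
  case (walk_refl L a) then show ?case using assms(3) by (simp add: walk.walk_refl)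
next
  case (walk_step a b L c M)
  have "walk H a c (t * L + t * dist b c)" using walk_trans[OF assms(2)[OF walk_step.hyps(2)] walk_step.IH] .
  moreover have "t * L + t * dist b c \<le> t * M" using walk_step.hyps(3) assms(3) by (metis distrib_left mult_left_mono)
  ultimately show ?case using walk_mono by blast
qed

lemma spanner_of_walks:
  assumes sub: "H \<subseteq> G" and t: "t > 0" and w: "\<And>x y. {x, y} \<in> G \<Longrightarrow> walk H x y (t * dist x y)"
  shows "is_spanner V G H t"
  unfolding is_spanner_def
proof (intro conjI ballI sub)
  fix x y
  have le: "gdist H x y \<le> ereal (t * path_len p)" if p: "is_path G p x y" for p
  proof -
    obtain q where q: "is_path H q x y" "path_len q \<le> t * path_len p" using walk_path[OF path_walk[OF p w]] by blast
    have "gdist H x y \<le> ereal (path_len q)" unfolding gdist_def using q(1) by (intro INF_lower) auto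
    also have "\<dots> \<le> ereal (t * path_len p)" using q(2) by simp
    finally show ?thesis .
  qed
  have "gdist H x y / ereal t \<le> gdist G x y"
    unfolding gdist_def[of G]
  proof (rule INF_greatest)
    fix p assume "p \<in> {p. is_path G p x y}"
    then show "gdist H x y / ereal t \<le> ereal (path_len p)" using le[of p] t by (simp add: ereal_divide_le_pos)
  qed
  then show "gdist H x y \<le> ereal t * gdist G x y" using t by (simp add: ereal_divide_le_pos)
qed

text \<open>A step along a line of constant \<open>j\<close> or \<open>k\<close> coordinate has
  length \<open>2 / sqrt 3\<close> times the change of the other one, the side of an equilateral
  triangle of height 1. The displacement is a sum of two such steps.\<close>

lemma norm_le_coord:
  assumes t: "tri i j k" shows "norm d \<le> 2 / sqrt 3 * (\<bar>cc j d\<bar> + \<bar>cc k d\<bar>)"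
proof (rule power2_le_imp_le)
  show "0 \<le> 2 / sqrt 3 * (\<bar>cc j d\<bar> + \<bar>cc k d\<bar>)" by simp
  have "(2 / sqrt 3 * (\<bar>cc j d\<bar> + \<bar>cc k d\<bar>))\<^sup>2 = 4 / 3 * (\<bar>cc j d\<bar> + \<bar>cc k d\<bar>)\<^sup>2"
    unfolding power_mult_distrib power_divide by simp
  moreover have "(\<bar>cc j d\<bar> + \<bar>cc k d\<bar>)\<^sup>2 = (cc j d)\<^sup>2 + 2 * \<bar>cc j d * cc k d\<bar> + (cc k d)\<^sup>2"
    by (simp add: power2_sum abs_mult)
  moreover have "cc j d * cc k d \<le> 2 * \<bar>cc j d * cc k d\<bar>" by (cases "cc j d * cc k d \<ge> 0") auto
  ultimately show "(norm d)\<^sup>2 \<le> (2 / sqrt 3 * (\<bar>cc j d\<bar> + \<bar>cc k d\<bar>))\<^sup>2" unfolding cc_norm[OF t] by simp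
qed

text \<open>The origin of the factor 3: \<open>(a + 3 * b)\<^sup>2\<close> is at most
  \<open>9 * (a\<^sup>2 + a * b + b\<^sup>2)\<close> for nonnegative \<open>a\<close>,
  \<open>b\<close>.\<close>

lemma three_norm:
  assumes t: "tri i j k" and p: "cc j d \<ge> 0" "cc k d \<ge> 0"
  shows "2 / sqrt 3 * (cc j d + 3 * cc k d) \<le> 3 * norm d"
proof (rule power2_le_imp_le)
  show "0 \<le> 3 * norm d" by simp
  have "(2 / sqrt 3 * (cc j d + 3 * cc k d))\<^sup>2 = 4 / 3 * (cc j d + 3 * cc k d)\<^sup>2" unfolding power_mult_distrib power_divide by simp
  also have "\<dots> = 4 / 3 * ((cc j d)\<^sup>2 + 6 * (cc j d * cc k d) + 9 * (cc k d)\<^sup>2)" by (simp add: power2_eq_square algebra_simps)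
  also have "\<dots> \<le> 4 / 3 * (9 * ((cc j d)\<^sup>2 + cc j d * cc k d + (cc k d)\<^sup>2))"
  proof -
    have "0 \<le> cc j d * cc k d" using p by simp
    then show ?thesis by (simp add: distrib_left) 
  qed
  also have "\<dots> = (3 * norm d)\<^sup>2" using cc_norm[OF t, of d] by (simp add: power_mult_distrib)
  finally show "(2 / sqrt 3 * (cc j d + 3 * cc k d))\<^sup>2 \<le> (3 * norm d)\<^sup>2" .
qed

section \<open>Which edges \<open>G7\<close> keeps, and detours along canonical paths\<close>

context setting
begin

abbreviation "W7 \<equiv> walk (G7 V S)"

lemma W7_edge: "g7 a b \<Longrightarrow> dist a b \<le> L \<Longrightarrow> W7 a b L"
  using walk_edge G7_iff by blast

text \<open>If the edge served canonical paths in two different cones, \<open>path_end\<close> would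
  make \<open>y\<close> extreme in both coordinates of its sequence at \<open>v\<close>, hence
  closest. Two apexes in the same cone would give two faces on one side of \<open>y v\<close>,
  against \<open>face_unique\<close>.\<close>

lemma unique_apex:
  assumes ey: "E m y v" and nc: "\<not> clo m v y" and c: "cons i a b u X y v" and c': "cons i' a' b' u' X' y v"
  shows "u = u'" "i mod 3 = i' mod 3" "X = X'"
proof -
  note D = cons_D[OF c] and D' = cons_D[OF c']
  have e: "E b y v" "E b' y v" using cons_E_cases[OF c] cons_E_cases[OF c'] ey E_conflict by blast+
  have bm: "b mod 3 = m mod 3" "b' mod 3 = m mod 3" using E_index e ey by blast+
  obtain Y where Y: "Y \<in> subcones V S v (nc m)" "y \<in> Y" using E_subcone[OF ey] .
  have Yb: "Y \<in> subcones V S v (nc b)" "Y \<in> subcones V S v (nc b')" using Y(1) nc_cong bm by metis+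
  have pe: "cc i z \<le> cc i y" "cc i' z \<le> cc i' y" if z: "z \<in> Y" "E m z v" for z
  proof -
    have "E b z v" "E b' z v" using z(2) Epos_cong bm by metis+
    then show "cc i z \<le> cc i y" "cc i' z \<le> cc i' y" using path_end[OF c e(1) Yb(1) Y(2) z(1)] path_end[OF c' e(2) Yb(2) Y(2) z(1)] by blast+
  qed
  show ii: "i mod 3 = i' mod 3"
  proof (rule ccontr)
    assume ne: "i mod 3 \<noteq> i' mod 3"
    have "tri m i i'" using ne D(1) D'(1) bm unfolding tri_def by argo
    then have "clo m v y" using both_ends[OF _ D(12) Y ey] pe by blast
    then show False using nc by blast
  qed
  show uu: "u = u'"
  proof (rule ccontr)
    assume ne: "u \<noteq> u'"
    have t: "tri i a b" by (rule D(1))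
    have tk: "tri b i a" using t tri_perm by blast
    have pos: "crs i a (w - v) (y - v) > 0" if "E i v w" for w
    proof -
      have 1: "cc a (w - v) < 0" "cc b (w - v) < 0" using cone_pc[OF t] E_D(4)[OF that] by (auto simp: cc_simps)
      then have 2: "cc i (w - v) > 0" using cc_sum[OF t, of "w - v"] by linarith
      have 3: "cc i (y - v) > 0" "cc a (y - v) > 0" using cone_pc[OF tk] E_D(4)[OF e(1)] by (auto simp: cc_simps)
      show ?thesis unfolding crs_def using mult_pos_pos[OF 2 3(2)] mult_neg_pos[OF 1(1) 3(1)] by linarith
    qed
    have ev: "E i v u" "E i v u'" using D(7) D'(7) Epos_cong[OF ii] by auto
    obtain \<kappa> where k: "\<kappa> \<noteq> 0" "\<And>p q. cross2 p q = \<kappa> * crs i a p q" using cross2_cc_ex[OF tk] unfolding crs_def by metis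
    have "cross2 (y - v) (u - v) * cross2 (y - v) (u' - v) = (\<kappa> * \<kappa>) * (crs i a (u - v) (y - v) * crs i a (u' - v) (y - v))"
      unfolding k(2) crs_anti[of i a "y - v"] by simp
    also have "\<dots> > 0" using mult_pos_pos[OF pos[OF ev(1)] pos[OF ev(2)]] k(1) by (metis mult_pos_pos not_real_square_gt_zero)
    finally have side: "cross2 (y - v) (u - v) * cross2 (y - v) (u' - v) > 0" .
    have ft: "FT v y u" "FT v y u'" using cons_freetri[OF c] cons_freetri[OF c'] freetri_perm(5) by blast+
    have ad: "adj v u" "adj y u" "adj v u'" "adj y u'" using cons_adj[OF c] cons_adj[OF c'] adj_sym by blast+
    show False using face_unique[OF ft D(12,11,2) D'(2) ne D(13)[symmetric] ad side] .
  qed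
  have "X' \<in> subcones V S u (nc i)" using D'(3) uu nc_cong[OF ii] by simp
  then show "X = X'" using subcone_unique[OF D(2,3)] D(4) D'(4) by blast
qed

text \<open>A removal only provides some configuration; \<open>unique_apex\<close> shows that it
  belongs to the canonical path at hand.\<close>

lemma removed_vy_apex:
  assumes r: "removed_vy v y" and c: "nx i u X v y \<or> nx i u X y v"
  obtains x where "cfg i u X v x y"
proof -
  obtain i' u' X' x where f: "cfg i' u' X' v x y" using r unfolding removed_vy_def by blast
  note a = cfg_D[OF f]
  obtain p q where cc: "cons i p q u X y v" using c cons_swap unfolding nx_def by blast
  note ua = unique_apex[OF a(4) a(7) cc cons_swap[OF a(2)]]
  have "cfg i u X v x y" using f ua(1,3) cfg_cong[OF ua(2)] by simp
  then show ?thesis using that by blast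
qed

lemma removed_xw_apex:
  assumes r: "removed_xw x w" and c: "nx i u X x w \<or> nx i u X w x"
  obtains i1 u1 X1 y where "cfg i1 u1 X1 u x y" "(i1 + 2) mod 3 = i mod 3"
proof -
  obtain i1 u1 X1 v y X' where f: "cfg i1 u1 X1 v x y" "nx (i1 + 2) v X' x w \<or> nx (i1 + 2) v X' w x" "E i1 w x" "\<not> clo i1 x w"
    using r unfolding removed_xw_def by blast
  obtain p q where cc: "cons i p q u X w x" using c cons_swap unfolding nx_def by blast
  obtain p' q' where cc': "cons (i1 + 2) p' q' v X' w x" using f(2) cons_swap unfolding nx_def by blast
  note ua = unique_apex[OF f(3,4) cc' cc]
  show ?thesis using that f(1) ua(1,2) by blast
qed

text \<open>\<open>path_end\<close> makes \<open>x\<close> the first vertex of its canonical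
  sequence at \<open>u\<close>, and the configuration says that it is not closest there. So the
  second kind of removal only affects the first edge of a canonical path.\<close>

lemma removed_xw_first:
  assumes f: "cfg i1 u1 X1 u x y" "(i1 + 2) mod 3 = i mod 3" and X: "X \<in> subcones V S u (nc i)" "x \<in> X" "z \<in> X" "E i z u"
  shows "cc (i + 1) z \<le> cc (i + 1) x" "\<not> clo i u x"
proof -
  note a = cfg_D[OF f(1)]
  have m: "i1 mod 3 = (i + 1) mod 3"
  proof -
    have "(i1 + 2 + 1) mod 3 = (i + 1) mod 3" using f(2) by (metis mod_add_cong)
    then show ?thesis by (simp add: add.assoc)
  qed
  have "X \<in> subcones V S u (nc (i1 + 2))" "E (i1 + 2) z u" using X(1,4) nc_cong[OF f(2)] Epos_cong[OF f(2)] by auto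
  then have "cc i1 z \<le> cc i1 x" using path_end[OF a(1,3) _ X(2,3)] by blast
  then show "cc (i + 1) z \<le> cc (i + 1) x" using cc_cong[OF m] by simp
  show "\<not> clo i u x" using a(6) clo_cong[OF f(2)] by simp
qed

text \<open>Each removal concerns an edge whose selecting end is not closest at the selected one,
  whereas \<open>c\<close> selects \<open>u\<close> and is closest there.\<close>

lemma clo_g7: assumes "clo i u c" "u \<in> V" shows "g7 u c"
proof -
  have e: "E i c u" using clo_E assms by blast
  have "\<not> removed u c"
  proof
    assume "removed u c"
    then consider "removed_vy u c" | "removed_vy c u" | "removed_xw u c" | "removed_xw c u" unfolding removed_def by blast
    then show False
    proof cases
      case 1
      then obtain i' u' X' x where "cfg i' u' X' u x c" unfolding removed_vy_def by blast
      note a = cfg_D[OF this]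
      have "(i' + 1) mod 3 = i mod 3" using E_index a(4) e by blast
      then show False using a(7) assms(1) clo_cong by metis
    next
      case 2 then show False using cfg_D(4) E_conflict e unfolding removed_vy_def by blast
    next
      case 3
      then obtain i' where "E i' c u" "\<not> clo i' u c" unfolding removed_xw_def by blast
      then show False using E_index e assms(1) clo_cong by metis
    next
      case 4 then show False using E_conflict e unfolding removed_xw_def by blast
    qed
  qed
  then show ?thesis using assms unfolding g7_def g10_def by blast
qed

text \<open>Other configurations might delete \<open>v x\<close>. As an edge of the form
  \<open>v y\<close> it would have \<open>x\<close> in the other negative cone of \<open>v\<close>;
  as an edge of the form \<open>x w\<close> it would make \<open>v\<close> the first vertex of the
  path, but \<open>x\<close> precedes \<open>v\<close>.\<close>

lemma kept_edge: assumes f: "cfg i u X v x y" shows "g7 v x"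
proof -
  note a = cfg_D[OF f]
  have s12: "(i + 1) mod 3 \<noteq> (i + 2) mod 3" "i mod 3 \<noteq> (i + 1) mod 3" using tri_succ(1)[of i] unfolding tri_def by auto
  have nn: "nx i u X x v" using a(1) unfolding nx_def .
  have "\<not> removed v x"
  proof
    assume "removed v x"
    then consider "removed_vy v x" | "removed_vy x v" | "removed_xw v x" | "removed_xw x v" unfolding removed_def by blast
    then show False
    proof cases
      case 1
      obtain x0 where "cfg i u X v x0 x" using removed_vy_apex[OF 1] nn by blast
      then have "E (i + 1) x v" using cfg_D(4) by blast
      then show False using E_index[OF a(3)] s12(1) by metis
    next
      case 2 then show False using cfg_D(4) E_conflict a(3) unfolding removed_vy_def by blast
    next
      case 3
      obtain i1 u1 X1 y1 where g: "cfg i1 u1 X1 u v y1" "(i1 + 2) mod 3 = i mod 3" using removed_xw_apex[OF 3] nn by blast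
      have "cc (i + 1) x \<le> cc (i + 1) v" using removed_xw_first(1)[OF g] cons_D(3-7)[OF a(1)] by blast
      then show False using cons_D(8)[OF a(1)] by simp
    next
      case 4 then show False using E_conflict a(3) unfolding removed_xw_def by blast
    qed
  qed
  then show ?thesis using nn unfolding g7_def g10_def by blast
qed

lemma pred_exists:
  assumes t: "tri i j k" and u: "u \<in> V" and X: "X \<in> subcones V S u (nc i)" and c: "c \<in> X" "E i c u" and p: "p \<in> X" "E i p u"
    and lt: "cc k c < cc k p"
  obtains x where "cons i j k u X x p" "cc k c \<le> cc k x"
proof -
  let ?Z = "{z \<in> X. E i z u \<and> cc k z < cc k p}"
  have "X \<subseteq> V" using subcone_sub[OF X] visKD by blast
  then have fin: "finite ?Z" using finV finite_subset by (metis (no_types, lifting) mem_Collect_eq subsetI subset_trans)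
  have ne: "?Z \<noteq> {}" using c lt by blast
  define x where "x = arg_min_on (\<lambda>z. - cc k z) ?Z"
  have x: "x \<in> ?Z" and mx: "\<And>z. z \<in> ?Z \<Longrightarrow> cc k z \<le> cc k x"
    unfolding x_def using arg_min_if_finite[OF fin ne, of "\<lambda>z. - cc k z"] arg_min_least[OF fin ne, of _ "\<lambda>z. - cc k z"] by auto
  have xp: "x \<noteq> p" using x by auto
  have "cc j p < cc j x" using canon_incomparable[OF t u X p _ _ xp[symmetric]] x by blast
  moreover have "\<not> (cc k x < cc k z \<and> cc k z < cc k p)" if "z \<in> X" "E i z u" for z using mx[of z] that by force
  ultimately have "cons i j k u X x p" unfolding cons_def using t u X x p by blast
  moreover have "cc k c \<le> cc k x" using mx c lt by blast
  ultimately show ?thesis using that by blast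
qed

text \<open>A potential bounding the length of a canonical path, which is monotone in both coordinates.\<close>
definition path_pot :: "int \<Rightarrow> pt \<Rightarrow> real" where "path_pot i p = 2 / sqrt 3 * (cc (i + 2) p - cc (i + 1) p)"

lemma dist_path_pot:
  assumes "cc (i + 1) y < cc (i + 1) x" "cc (i + 2) x < cc (i + 2) y"
  shows "dist x y \<le> path_pot i y - path_pot i x"
proof -
  have "norm (y - x) \<le> 2 / sqrt 3 * (\<bar>cc (i + 1) (y - x)\<bar> + \<bar>cc (i + 2) (y - x)\<bar>)" by (rule norm_le_coord[OF tri_succ(1)])
  also have "\<bar>cc (i + 1) (y - x)\<bar> + \<bar>cc (i + 2) (y - x)\<bar> = (cc (i + 2) y - cc (i + 1) y) - (cc (i + 2) x - cc (i + 1) x)"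
    using assms by (simp add: cc_simps)
  also have "2 / sqrt 3 * \<dots> = path_pot i y - path_pot i x" unfolding path_pot_def by (rule right_diff_distrib)
  finally show ?thesis by (simp add: dist_norm norm_minus_commute)
qed

text \<open>Induction outwards from the closest vertex \<open>c\<close>. A missing edge
  \<open>x t\<close> can only be the one removed by a configuration with middle vertex
  \<open>x\<close>; the added edge then leads to \<open>t\<close> directly from the predecessor
  \<open>x0\<close>, and \<open>c\<close> is not skipped because \<open>x0\<close> has a larger
  \<open>i\<close> coordinate than \<open>x\<close>. A removal of the second kind would force
  \<open>c\<close> to be the first vertex, which is then not closest.\<close>

lemma walk_right:
  assumes u: "u \<in> V" and X: "X \<in> subcones V S u (nc i)" and c: "c \<in> X" "E i c u" "clo i u c"
  shows "t \<in> X \<Longrightarrow> E i t u \<Longrightarrow> cc (i + 2) c \<le> cc (i + 2) t \<Longrightarrow> W7 c t (path_pot i t - path_pot i c)"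
proof (induction "card {z \<in> V. cc (i + 2) z < cc (i + 2) t}" arbitrary: t rule: less_induct)
  case less
  let ?j = "i + 1" and ?k = "i + 2"
  have tr: "tri i ?j ?k" by (rule tri_succ)
  note inc = canon_incomparable[OF tr u X]
  show ?case
  proof (cases "t = c")
    case True then show ?thesis by (simp add: walk_refl)
  next
    case False
    have tV: "t \<in> V" "c \<in> V" using E_D(1) less.prems c by blast+
    then have lt: "cc ?k c < cc ?k t" using less.prems(3) cc_neq[OF tV False, of ?k] by simp
    obtain x where x: "cons i ?j ?k u X x t" "cc ?k c \<le> cc ?k x" using pred_exists[OF tr u X c(1,2) less.prems(1,2) lt] .
    note D = cons_D[OF x(1)]
    have nn: "nx i u X x t" using x(1) unfolding nx_def .
    have IH: "W7 c s (path_pot i s - path_pot i c)" if s: "s \<in> X" "E i s u" "cc ?k c \<le> cc ?k s" "cc ?k s < cc ?k t" for s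
    proof (rule less.hyps[OF _ s(1-3)])
      have "s \<in> V" using E_D(1) s by blast
      then have "{z \<in> V. cc ?k z < cc ?k s} \<subset> {z \<in> V. cc ?k z < cc ?k t}" using s(4) by force
      then show "card {z \<in> V. cc ?k z < cc ?k s} < card {z \<in> V. cc ?k z < cc ?k t}" using finV by (intro psubset_card_mono) auto
    qed
    have step: "W7 c t (path_pot i t - path_pot i c)" if s: "s \<in> X" "E i s u" "cc ?k c \<le> cc ?k s" "cc ?k s < cc ?k t" "cc ?j t < cc ?j s" "g7 s t" for s
      using walk_trans[OF W7_edge[OF s(6) dist_path_pot[OF s(5,4)]] IH[OF s(1-4)]] by simp
    show ?thesis
    proof (cases "removed x t")
      case False
      then have "g7 x t" unfolding g7_def g10_def using nn by blast
      then show ?thesis using step[OF D(4,5) x(2) D(9,8)] by blast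
    next
      case True
      then consider "removed_vy x t" | "removed_vy t x" | "removed_xw x t" | "removed_xw t x" unfolding removed_def by blast
      then show ?thesis
      proof cases
        case 1
        obtain x0 where f: "cfg i u X x x0 t" using removed_vy_apex[OF 1] nn by blast
        note a = cfg_D[OF f]
        note D0 = cons_D[OF a(1)]
        have "cc i x < cc i x0" using cons_E_cases[OF a(1)] E_conflict a(3) by blast
        moreover have "cc i x0 \<le> cc i c" using clo_iff[OF u X c(1)] c(3) D0(4,5) by blast
        ultimately have "c \<noteq> x" by auto
        then have "cc ?k c < cc ?k x" using x(2) cc_neq[of c x ?k] tV D(11) by force
        then have "cc ?k c \<le> cc ?k x0" using D0(10)[OF c(1,2)] by force
        moreover have "g7 x0 t" unfolding g7_def added_def using f by blast
        ultimately show ?thesis using step[OF D0(4,5)] D0(8,9) D(8,9) by force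
      next
        case 2
        obtain x0 where f: "cfg i u X t x0 x" using removed_vy_apex[OF 2] nn by blast
        then have "cc ?k t < cc ?k x" using cons_D(9)[OF cfg_D(2)[OF f]] by blast
        then show ?thesis using D(9) by simp
      next
        case 3
        obtain i1 u1 X1 y where f: "cfg i1 u1 X1 u x y" "(i1 + 2) mod 3 = i mod 3" using removed_xw_apex[OF 3] nn by blast
        have "cc ?j c \<le> cc ?j x" using removed_xw_first(1)[OF f X D(4) c(1,2)] .
        then have "c = x" using inc[OF c(1,2) D(4,5)] x(2) cc_neq[of c x ?j] cc_neq[of c x ?k] tV D(11) by force
        then show ?thesis using removed_xw_first(2)[OF f X D(4) c(1,2)] c(3) by blast
      next
        case 4
        obtain i1 u1 X1 y where f: "cfg i1 u1 X1 u t y" "(i1 + 2) mod 3 = i mod 3" using removed_xw_apex[OF 4] nn by blast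
        have "cc ?j x \<le> cc ?j t" using removed_xw_first(1)[OF f X less.prems(1) D(4,5)] .
        then show ?thesis using D(8) by simp
      qed
    qed
  qed
qed

text \<open>In this direction the walk may fail to reach \<open>t\<close>. In the first alternative
  \<open>u t\<close> is itself a kept edge of a configuration with middle vertex \<open>u\<close>.
  In the second, \<open>t\<close> is a middle vertex whose edge \<open>t y\<close> was removed, and
  only \<open>y\<close> is reached; the added edge still lets the walk continue beyond
  \<open>t\<close>, which keeps the induction going.\<close>

lemma walk_left:
  assumes u: "u \<in> V" and X: "X \<in> subcones V S u (nc i)" and c: "c \<in> X" "E i c u" "clo i u c"
  shows "t \<in> X \<Longrightarrow> E i t u \<Longrightarrow> cc (i + 2) t \<le> cc (i + 2) c \<Longrightarrow>
     (\<exists>i1 u1 X1 y1. cfg i1 u1 X1 u t y1 \<and> (i1 + 2) mod 3 = i mod 3) \<or>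
     (\<exists>x y. cfg i u X t x y \<and> cc (i + 2) y \<le> cc (i + 2) c \<and> W7 c y (path_pot i c - path_pot i y)) \<or>
     W7 c t (path_pot i c - path_pot i t)"
proof (induction "card {z \<in> V. cc (i + 2) t < cc (i + 2) z}" arbitrary: t rule: less_induct)
  case less
  let ?j = "i + 1" and ?k = "i + 2"
  have tr: "tri i ?j ?k" by (rule tri_succ)
  note inc = canon_incomparable[OF tr u X]
  show ?case
  proof (cases "t = c")
    case True then show ?thesis by (simp add: walk_refl)
  next
    case False
    have tV: "t \<in> V" "c \<in> V" using E_D(1) less.prems c by blast+
    then have lt: "cc ?k t < cc ?k c" using less.prems(3) cc_neq[OF tV False, of ?k] by simp
    have ltj: "cc ?j c < cc ?j t" using inc[OF c(1,2) less.prems(1,2)] False lt by blast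
    obtain y where y0: "cons i ?k ?j u X y t" "cc ?j c \<le> cc ?j y"
      using pred_exists[OF tri_perm(1)[OF tr] u X c(1,2) less.prems(1,2) ltj] .
    have y: "cons i ?j ?k u X t y" using cons_swap[OF y0(1)] .
    note D = cons_D[OF y]
    have yk: "cc ?k y \<le> cc ?k c"
    proof (cases "y = c")
      case False
      then have "cc ?j c < cc ?j y" using y0(2) cc_neq[of c y ?j] tV D(12) by force
      then show ?thesis using inc[OF c(1,2) D(6,7)] False by force
    qed simp
    have nn: "nx i u X t y" using y unfolding nx_def .
    have "{z \<in> V. cc ?k y < cc ?k z} \<subset> {z \<in> V. cc ?k t < cc ?k z}" using D(9,12) by force
    then have "card {z \<in> V. cc ?k y < cc ?k z} < card {z \<in> V. cc ?k t < cc ?k z}" using finV by (intro psubset_card_mono) auto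
    note IH = less.hyps[OF this D(6,7) yk]
    have ey: "\<not> (\<exists>i1 u1 X1 y1. cfg i1 u1 X1 u y y1 \<and> (i1 + 2) mod 3 = i mod 3)"
      using removed_xw_first(1)[OF _ _ X D(6) D(4,5)] D(8) by force
    have edge: "dist s t \<le> path_pot i s - path_pot i t" if "cc ?j s < cc ?j t" "cc ?k t < cc ?k s" for s
      using dist_path_pot[OF that] by (simp add: dist_commute)
    consider (B) x2 y2 where "cfg i u X y x2 y2" "W7 c y2 (path_pot i c - path_pot i y2)" | (C) "W7 c y (path_pot i c - path_pot i y)" using IH ey by blast
    then show ?thesis
    proof cases
      case B
      note a = cfg_D[OF B(1)]
      have "x2 = t" using cons_unique[OF a(1) y] .
      then have "g7 y2 t" unfolding g7_def added_def using B(1) by blast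
      moreover have "cc ?j y2 < cc ?j t" "cc ?k t < cc ?k y2" using cons_D(8,9)[OF a(2)] D(8,9) by auto
      ultimately have "W7 y2 t (path_pot i y2 - path_pot i t)" using W7_edge edge by blast
      then have "W7 c t (path_pot i c - path_pot i t)" using walk_trans[OF _ B(2)] by fastforce
      then show ?thesis by blast
    next
      case C
      show ?thesis
      proof (cases "removed t y")
        case False
        then have "g7 y t" unfolding g7_def g10_def removed_def using nn by blast
        then have "W7 y t (path_pot i y - path_pot i t)" using W7_edge edge[OF D(8,9)] by blast
        then have "W7 c t (path_pot i c - path_pot i t)" using walk_trans[OF _ C] by fastforce
        then show ?thesis by blast
      next
        case True
        then consider "removed_vy t y" | "removed_vy y t" | "removed_xw t y" | "removed_xw y t" unfolding removed_def by blast
        then show ?thesis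
        proof cases
          case 1
          obtain x0 where "cfg i u X t x0 y" using removed_vy_apex[OF 1] nn by blast
          then show ?thesis using C yk by blast
        next
          case 2
          obtain x0 where f: "cfg i u X y x0 t" using removed_vy_apex[OF 2] nn by blast
          then have "cc ?k y < cc ?k t" using cons_D(9)[OF cfg_D(2)[OF f]] by blast
          then show ?thesis using D(9) by simp
        next
          case 3
          obtain i1 u1 X1 y1 where "cfg i1 u1 X1 u t y1" "(i1 + 2) mod 3 = i mod 3" using removed_xw_apex[OF 3] nn by blast
          then show ?thesis by blast
        next
          case 4
          obtain i1 u1 X1 y1 where "cfg i1 u1 X1 u y y1" "(i1 + 2) mod 3 = i mod 3" using removed_xw_apex[OF 4] nn by blast
          then show ?thesis using ey by blast
        qed
      qed
    qed
  qed
qed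

lemma closest_exists:
  assumes u: "u \<in> V" and X: "X \<in> subcones V S u (nc i)" and t: "t \<in> X" "E i t u"
  obtains c where "c \<in> X" "E i c u" "clo i u c"
proof -
  let ?Z = "{z \<in> X. E i z u}"
  have "X \<subseteq> V" using subcone_sub[OF X] visKD by blast
  then have fin: "finite ?Z" using finV finite_subset by (metis (no_types, lifting) mem_Collect_eq subsetI subset_trans)
  have ne: "?Z \<noteq> {}" using t by blast
  define c where "c = arg_min_on (\<lambda>z. - cc i z) ?Z"
  have c: "c \<in> ?Z" and mx: "\<And>z. z \<in> ?Z \<Longrightarrow> cc i z \<le> cc i c"
    unfolding c_def using arg_min_if_finite[OF fin ne, of "\<lambda>z. - cc i z"] arg_min_least[OF fin ne, of _ "\<lambda>z. - cc i z"] by auto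
  then show ?thesis using that[of c] clo_iff[OF u X, of c] by blast
qed

lemma E_rel_pos: "E i t u \<Longrightarrow> cc (i + 1) (t - u) > 0 \<and> cc (i + 2) (t - u) > 0"
  using cone_pc[OF tri_succ(1)] E_D(4) by (auto simp: cc_simps)

lemma dist_apex:
  assumes "E i c u" shows "dist u c \<le> 2 / sqrt 3 * (cc (i + 1) (c - u) + cc (i + 2) (c - u))"
  using norm_le_coord[OF tri_succ(1)[of i], of "c - u"] E_rel_pos[OF assms] by (simp add: dist_norm norm_minus_commute)

text \<open>In coordinates relative to \<open>u\<close>, with subscripts 1 and 2 for
  \<open>i + 1\<close> and \<open>i + 2\<close>, the walk has length at most
  \<open>2 c1 + t2 - t1\<close>, and \<open>c1 + c2 <= t1 + t2\<close> as \<open>c\<close> is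
  closest. The bound is not yet turned into a norm because it is added to another detour in
  \<open>G7_three_spanner\<close>.\<close>

lemma walk_apex_right:
  assumes u: "u \<in> V" and X: "X \<in> subcones V S u (nc i)" and c: "c \<in> X" "E i c u" "clo i u c"
    and t: "t \<in> X" "E i t u" "cc (i + 2) c \<le> cc (i + 2) t"
  shows "W7 u t (2 / sqrt 3 * (cc (i + 1) (t - u) + 3 * cc (i + 2) (t - u)))"
proof -
  have "W7 u c (dist u c)" using W7_edge clo_g7[OF c(3) u] by simp
  then have "W7 u t (dist u c + (path_pot i t - path_pot i c))" using walk_trans[OF walk_right[OF u X c t]] by blast
  moreover have "dist u c + (path_pot i t - path_pot i c) \<le> 2 / sqrt 3 * (cc (i + 1) (t - u) + 3 * cc (i + 2) (t - u))"
  proof -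
    have ci: "cc i t \<le> cc i c" using clo_iff[OF u X c(1)] c(3) t by blast
    have pc: "cc (i + 2) (c - u) > 0" using E_rel_pos[OF c(2)] by blast
    have s: "cc (i + 1) (c - u) + cc (i + 2) (c - u) \<le> cc (i + 1) (t - u) + cc (i + 2) (t - u)"
      using ci cc_sum[OF tri_succ(1)[of i], of c] cc_sum[OF tri_succ(1)[of i], of t] by (simp add: cc_simps)
    have "dist u c + (path_pot i t - path_pot i c) \<le> 2 / sqrt 3 * (cc (i + 1) (c - u) + cc (i + 2) (c - u)) + (path_pot i t - path_pot i c)"
      using dist_apex[OF c(2)] by simp
    also have "\<dots> = 2 / sqrt 3 * ((cc (i + 1) (c - u) + cc (i + 2) (c - u)) + ((cc (i + 2) t - cc (i + 1) t) - (cc (i + 2) c - cc (i + 1) c)))"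
      unfolding path_pot_def by (simp only: distrib_left right_diff_distrib)
    also have "\<dots> \<le> 2 / sqrt 3 * (cc (i + 1) (t - u) + 3 * cc (i + 2) (t - u))"
      using s pc by (intro mult_left_mono) (auto simp: cc_simps)
    finally show ?thesis .
  qed
  ultimately show ?thesis using walk_mono by blast
qed

lemma G7_three_spanner:
  assumes e: "E i t u" shows "W7 u t (3 * dist u t)"
proof -
  have u: "u \<in> V" "t \<in> V" using E_D[OF e] by blast+
  obtain X where X: "X \<in> subcones V S u (nc i)" "t \<in> X" using E_subcone[OF e] .
  obtain c where c: "c \<in> X" "E i c u" "clo i u c" using closest_exists[OF u(1) X e] .
  note tp = E_rel_pos[OF e]
  have d: "3 * norm (t - u) = 3 * dist u t" by (simp add: dist_norm norm_minus_commute)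
  have right: "2 / sqrt 3 * (cc (i + 1) (t - u) + 3 * cc (i + 2) (t - u)) \<le> 3 * dist u t"
    using three_norm[OF tri_succ(1)[of i], of "t - u"] tp d by simp
  have left: "2 / sqrt 3 * (3 * cc (i + 1) (t - u) + cc (i + 2) (t - u)) \<le> 3 * dist u t"
    using three_norm[OF tri_succ(3)[of i], of "t - u"] tp d by (simp add: add.commute)
  have ci: "cc i z \<le> cc i c" if "z \<in> X" "E i z u" for z using clo_iff[OF u(1) X(1) c(1)] c(3) that by blast
  have sums: "cc (i + 1) (c - u) + cc (i + 2) (c - u) \<le> cc (i + 1) (z - u) + cc (i + 2) (z - u)" if "z \<in> X" "E i z u" for z
    using ci[OF that] cc_sum[OF tri_succ(1)[of i], of c] cc_sum[OF tri_succ(1)[of i], of z] by (simp add: cc_simps)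
  have uc: "W7 u c (dist u c)" using W7_edge clo_g7[OF c(3) u(1)] by simp
  have pc: "cc (i + 1) (c - u) > 0" using E_rel_pos[OF c(2)] by blast
  have lft: "dist u c + (path_pot i c - path_pot i z) \<le> 2 / sqrt 3 * (3 * cc (i + 1) (z - u) + cc (i + 2) (z - u))" if z: "z \<in> X" "E i z u" for z
  proof -
    have "dist u c + (path_pot i c - path_pot i z) \<le> 2 / sqrt 3 * (cc (i + 1) (c - u) + cc (i + 2) (c - u)) + (path_pot i c - path_pot i z)"
      using dist_apex[OF c(2)] by simp
    also have "\<dots> = 2 / sqrt 3 * ((cc (i + 1) (c - u) + cc (i + 2) (c - u)) + ((cc (i + 2) c - cc (i + 1) c) - (cc (i + 2) z - cc (i + 1) z)))"
      unfolding path_pot_def by (simp only: distrib_left right_diff_distrib)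
    also have "\<dots> \<le> 2 / sqrt 3 * (3 * cc (i + 1) (z - u) + cc (i + 2) (z - u))"
      using sums[OF z] pc by (intro mult_left_mono) (auto simp: cc_simps)
    finally show ?thesis .
  qed
  show ?thesis
  proof (cases "cc (i + 2) c \<le> cc (i + 2) t")
    case True
    then show ?thesis using walk_apex_right[OF u(1) X(1) c X(2) e] right walk_mono by blast
  next
    case False
    then have "cc (i + 2) t \<le> cc (i + 2) c" by simp
    then consider (A) i1 u1 X1 y1 where "cfg i1 u1 X1 u t y1"
      | (B) x y where "cfg i u X t x y" "cc (i + 2) y \<le> cc (i + 2) c" "W7 c y (path_pot i c - path_pot i y)" | (C) "W7 c t (path_pot i c - path_pot i t)"
      using walk_left[OF u(1) X(1) c X(2) e] by blast
    then show ?thesis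
    proof cases
      case A
      then have "g7 u t" using kept_edge by blast
      then show ?thesis by (rule W7_edge) simp
    next
      case C
      have "W7 u t (dist u c + (path_pot i c - path_pot i t))" using walk_trans[OF C uc] .
      then show ?thesis using lft[OF X(2) e] left walk_mono by (meson order_trans)
    next
      case B
      note a = cfg_D[OF B(1)]
      note D = cons_D[OF a(2)]
      have w1: "W7 u y (2 / sqrt 3 * (3 * cc (i + 1) (y - u) + cc (i + 2) (y - u)))"
        using walk_mono[OF walk_trans[OF B(3) uc]] lft[OF D(6,7)] by blast
      \<comment> \<open>The removed edge \<open>t y\<close> is replaced by a detour at
        \<open>t\<close>: \<open>y\<close> selects \<open>t\<close> in the next cone and is an end
        of its sequence there, so the closest vertex \<open>c'\<close> lies on the side that
        \<open>walk_apex_right\<close> handles.\<close>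
      let ?m = "i + 1"
      have ey: "E ?m y t" by (rule a(4))
      obtain Y where Y: "Y \<in> subcones V S t (nc ?m)" "y \<in> Y" using E_subcone[OF ey] .
      obtain c' where c': "c' \<in> Y" "E ?m c' t" "clo ?m t c'" using closest_exists[OF u(2) Y ey] .
      have "cc i c' \<le> cc i y" using path_end[OF cons_swap[OF a(2)] ey Y c'(1,2)] .
      moreover have mi: "cc (?m + 2) = cc i" by (rule cc_cong) (simp add: add.assoc)
      moreover have mk: "cc (?m + 1) = cc (i + 2)" by (rule cc_cong) (simp add: add.assoc)
      ultimately have "W7 t y (2 / sqrt 3 * (cc (i + 2) (y - t) + 3 * cc i (y - t)))"
        using walk_apex_right[OF u(2) Y(1) c' Y(2) ey] by simp
      then have w2: "W7 y t (2 / sqrt 3 * (cc (i + 2) (y - t) + 3 * cc i (y - t)))" by (rule walk_sym)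
      have "W7 u t (2 / sqrt 3 * (3 * cc (i + 1) (y - u) + cc (i + 2) (y - u)) + 2 / sqrt 3 * (cc (i + 2) (y - t) + 3 * cc i (y - t)))"
        using walk_trans[OF w2 w1] .
      moreover have "2 / sqrt 3 * (3 * cc (i + 1) (y - u) + cc (i + 2) (y - u)) + 2 / sqrt 3 * (cc (i + 2) (y - t) + 3 * cc i (y - t))
          \<le> 2 / sqrt 3 * (3 * cc (i + 1) (t - u) + cc (i + 2) (t - u))"
      proof -
        \<comment> \<open>Writing \<open>d = y - t\<close>, the two bounds add up to the one for
          \<open>t\<close> minus coordinate \<open>i + 2\<close> of \<open>d\<close>, which is
          positive.\<close>
        have s: "cc i (y - t) = - cc (i + 1) (y - t) - cc (i + 2) (y - t)" using cc_sum[OF tri_succ(1)[of i], of "y - t"] by linarith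
        have "(3 * cc (i + 1) (y - u) + cc (i + 2) (y - u)) + (cc (i + 2) (y - t) + 3 * cc i (y - t))
          \<le> 3 * cc (i + 1) (t - u) + cc (i + 2) (t - u)"
          unfolding s using D(9) by (simp add: cc_simps)
        then have "2 / sqrt 3 * ((3 * cc (i + 1) (y - u) + cc (i + 2) (y - u)) + (cc (i + 2) (y - t) + 3 * cc i (y - t)))
          \<le> 2 / sqrt 3 * (3 * cc (i + 1) (t - u) + cc (i + 2) (t - u))" by (intro mult_left_mono) auto
        then show ?thesis by (simp only: distrib_left)
      qed
      ultimately show ?thesis using left walk_mono by (meson order_trans)
    qed
  qed
qed

lemma G7_three_spanner_adj: "{a, b} \<in> Ginf V S \<Longrightarrow> W7 a b (3 * dist a b)"
  using G7_three_spanner walk_sym unfolding Ginf_iff by (metis dist_commute)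

end

section \<open>Stretch of Ginf over the visibility graph\<close>

text \<open>From the frame \<open>p - u\<close>, \<open>w - u\<close> to the frame
  \<open>q - p\<close>, \<open>w - u\<close>, stated without dividing by
  \<open>1 - \<alpha>\<close>.\<close>

lemma frame_change:
  fixes u p q w z :: pt
  assumes zr: "z - u = a *\<^sub>R (p - u) + b *\<^sub>R (w - u)" and qr: "q - u = \<alpha> *\<^sub>R (p - u) + \<beta> *\<^sub>R (w - u)"
    and s: "s * (1 - \<alpha>) = \<alpha> - a" and t: "t = b - \<beta> - s * \<beta>"
  shows "z - q = s *\<^sub>R (q - p) + t *\<^sub>R (w - u)"
proof -
  have e: "z - q = (z - u) - (q - u)" "q - p = (q - u) - (p - u)" by simp_all
  have "z - q = (a - \<alpha>) *\<^sub>R (p - u) + (b - \<beta>) *\<^sub>R (w - u)"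
    unfolding e(1) zr qr by (simp only: scaleR_left_diff_distrib) simp
  moreover have "s *\<^sub>R (q - p) + t *\<^sub>R (w - u) = (s * \<alpha> - s) *\<^sub>R (p - u) + (s * \<beta> + t) *\<^sub>R (w - u)"
    unfolding e(2) qr by (simp only: scaleR_right_distrib scaleR_right_diff_distrib scaleR_left_distrib scaleR_left_diff_distrib scaleR_scaleR) simp
  moreover have "a - \<alpha> = s * \<alpha> - s" "b - \<beta> = s * \<beta> + t" using s t by (simp_all add: algebra_simps)
  ultimately show ?thesis by simp
qed

context setting
begin

lemma visible_empty_triangle_min:
  assumes V: "x \<in> V" "v \<in> V" "w \<in> V" "x \<noteq> v" "x \<noteq> w" "v \<noteq> w" and vis: "vis x v" "vis x w" and sf: "SF x v w"
  obtains q \<alpha> \<beta> where "q \<in> V" "q \<in> convex hull {x, v, w}" "q \<noteq> x" "q \<noteq> v" "FT x v q"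
    "0 \<le> \<alpha>" "\<alpha> < 1" "0 < \<beta>" "\<alpha> + \<beta> \<le> 1" "q - x = \<alpha> *\<^sub>R (v - x) + \<beta> *\<^sub>R (w - x)"
    "\<forall>a b. 0 \<le> a \<longrightarrow> 0 \<le> b \<longrightarrow> a + b \<le> 1 \<longrightarrow> x + a *\<^sub>R (v - x) + b *\<^sub>R (w - x) \<in> V - {x, v} \<longrightarrow> \<beta> * (1 - a) \<le> b * (1 - \<alpha>)"
proof -
  have nz: "cross2 (v - x) (w - x) \<noteq> 0" using not_collinear V by metis
  have noV: "V \<inter> closed_segment x v \<subseteq> {x, v}" using not_in_segment[OF V(1,2)] by blast
  have wh: "w \<in> convex hull {x, v, w}" by (simp add: hull_inc)
  obtain q where q: "q \<in> V" "q \<in> convex hull {x, v, w}" "q \<noteq> x" "q \<noteq> v" "FT x v q"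
    and ex: "\<exists>\<alpha> \<beta>. 0 \<le> \<alpha> \<and> \<alpha> < 1 \<and> 0 < \<beta> \<and> q - x = \<alpha> *\<^sub>R (v - x) + \<beta> *\<^sub>R (w - x) \<and>
       (\<forall>a b. 0 \<le> a \<longrightarrow> 0 \<le> b \<longrightarrow> a + b \<le> 1 \<longrightarrow> x + a *\<^sub>R (v - x) + b *\<^sub>R (w - x) \<in> V - {x, v} \<longrightarrow> \<beta> * (1 - a) \<le> b * (1 - \<alpha>))"
    by (rule adjacent_vertex_min[OF V(2) nz visible_clear[OF V(1,2) vis(1)] visible_clear[OF V(1,3) vis(2)] sf noV V(3) wh V(5)[symmetric] V(6)[symmetric]])
  obtain \<alpha> \<beta> where ab: "0 \<le> \<alpha>" "\<alpha> < 1" "0 < \<beta>" "q - x = \<alpha> *\<^sub>R (v - x) + \<beta> *\<^sub>R (w - x)"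
    and mn: "\<forall>a b. 0 \<le> a \<longrightarrow> 0 \<le> b \<longrightarrow> a + b \<le> 1 \<longrightarrow> x + a *\<^sub>R (v - x) + b *\<^sub>R (w - x) \<in> V - {x, v} \<longrightarrow> \<beta> * (1 - a) \<le> b * (1 - \<alpha>)"
    using ex by blast
  obtain a b where h: "0 \<le> a" "0 \<le> b" "a + b \<le> 1" "q = x + a *\<^sub>R (v - x) + b *\<^sub>R (w - x)" using q(2) unfolding in_hull3 by blast
  have h4: "q - x = a *\<^sub>R (v - x) + b *\<^sub>R (w - x)" using h(4) by (simp add: add.assoc)
  have "a * cross2 (v - x) (w - x) = \<alpha> * cross2 (v - x) (w - x)" "b * cross2 (v - x) (w - x) = \<beta> * cross2 (v - x) (w - x)"
    using arg_cong[OF h4, of "\<lambda>p. cross2 p (w - x)"] arg_cong[OF ab(4), of "\<lambda>p. cross2 p (w - x)"]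
      arg_cong[OF h4, of "\<lambda>p. cross2 (v - x) p"] arg_cong[OF ab(4), of "\<lambda>p. cross2 (v - x) p"]
    by (simp_all only: cross2_simps(1,2,7,8,9) mult_zero_right add_0_right add_0_left)
  then have "a = \<alpha>" "b = \<beta>" using nz by simp_all
  then show ?thesis using that[OF q ab(1-3) _ ab(4) mn] h(3) by blast
qed

text \<open>The chain is the gift wrapping of the vertices in the triangle \<open>u p w\<close>. Each step has direction in the cone spanned by
  the previous step and \<open>w - u\<close>, so a sublinear bound on the steps adds up to the same bound for a two-segment path.\<close>
lemma chain_walk:
  fixes \<Phi> :: "pt \<Rightarrow> real"
  assumes t: "tri i j k" and V: "u \<in> V" "w \<in> V" and uw: "vis u w" "w \<in> cone u (pc i)"
    and sub: "\<And>s t x y. 0 \<le> s \<Longrightarrow> 0 \<le> t \<Longrightarrow> \<Phi> (s *\<^sub>R x + t *\<^sub>R y) \<le> s * \<Phi> x + t * \<Phi> y"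
    and edge: "\<And>p q. p \<in> V \<Longrightarrow> q \<in> V \<Longrightarrow> FT u p q \<Longrightarrow> p \<in> cone u (pc i) \<Longrightarrow> q \<in> cone u (pc i) \<Longrightarrow>
       cc i p < cc i q \<Longrightarrow> cc j q < cc j p \<Longrightarrow> cc i q \<le> cc i w \<Longrightarrow> cc j w \<le> cc j q \<Longrightarrow>
       crs j k (q - u) (p - u) > 0 \<Longrightarrow> crs j k (w - u) (p - u) > 0 \<Longrightarrow> q = w \<or> crs j k (w - u) (q - u) > 0 \<Longrightarrow>
       (\<And>z. z \<in> V \<Longrightarrow> z \<in> convex hull {u, q, w} \<Longrightarrow> z \<noteq> u \<Longrightarrow> cc i q \<le> cc i z) \<Longrightarrow> walk G p q (\<Phi> (q - p))"
  shows "p \<in> V \<Longrightarrow> p \<noteq> w \<Longrightarrow> vis u p \<Longrightarrow> SF u p w \<Longrightarrow> p \<in> cone u (pc i) \<Longrightarrow> crs j k (w - u) (p - u) > 0 \<Longrightarrow>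
    0 \<le> cc i e \<Longrightarrow> cc j e < 0 \<Longrightarrow>
    (\<And>z. z \<in> V \<Longrightarrow> z \<in> convex hull {u, p, w} \<Longrightarrow> z \<noteq> u \<Longrightarrow> \<exists>s t. 0 \<le> s \<and> 0 \<le> t \<and> z - p = s *\<^sub>R e + t *\<^sub>R (w - u)) \<Longrightarrow>
    \<exists>s t. 0 \<le> s \<and> 0 \<le> t \<and> w - p = s *\<^sub>R e + t *\<^sub>R (w - u) \<and> walk G p w (s * \<Phi> e + t * \<Phi> (w - u))"
proof (induction "card (V \<inter> convex hull {u, p, w})" arbitrary: p e rule: less_induct)
  case less
  note p = less.prems(1-6) and e = less.prems(7,8) and inv = less.prems(9)
  have f: "cc j (w - u) < 0" "cc k (w - u) < 0" using cone_pc[OF t] uw(2) by (simp_all add: cc_simps)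
  then have fi: "cc i (w - u) > 0" using cc_sum[OF t, of "w - u"] by linarith
  have ne: "u \<noteq> p" "u \<noteq> w" using p(6) f by (auto simp: crs_simps cc_simps)
  obtain q \<alpha> \<beta> where q: "q \<in> V" "q \<in> convex hull {u, p, w}" "q \<noteq> u" "q \<noteq> p" "FT u p q"
    and ab: "0 \<le> \<alpha>" "\<alpha> < 1" "0 < \<beta>" "\<alpha> + \<beta> \<le> 1" "q - u = \<alpha> *\<^sub>R (p - u) + \<beta> *\<^sub>R (w - u)"
    and mn: "\<forall>a b. 0 \<le> a \<longrightarrow> 0 \<le> b \<longrightarrow> a + b \<le> 1 \<longrightarrow> u + a *\<^sub>R (p - u) + b *\<^sub>R (w - u) \<in> V - {u, p} \<longrightarrow> \<beta> * (1 - a) \<le> b * (1 - \<alpha>)"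
    by (rule visible_empty_triangle_min[OF V(1) p(1) V(2) ne p(2,3) uw(1) p(4)])
  obtain s0 t0 where st0: "0 \<le> s0" "0 \<le> t0" "q - p = s0 *\<^sub>R e + t0 *\<^sub>R (w - u)" using inv[OF q(1,2,3)] by blast
  let ?e = "q - p"
  have ee: "cc i ?e = s0 * cc i e + t0 * cc i (w - u)" "cc j ?e = s0 * cc j e + t0 * cc j (w - u)"
    using st0(3) by (simp_all only: cc_simps(1,3))
  have "0 \<le> cc i ?e" "cc j ?e \<le> 0" unfolding ee
    using st0(1,2) e fi f(1) by (simp_all add: mult_nonneg_nonpos add_nonpos_nonpos)
  then have pq: "cc i p < cc i q" "cc j q < cc j p"
    using cc_neq[OF p(1) q(1), of i] cc_neq[OF p(1) q(1), of j] q(4) by (auto simp: cc_simps)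
  have cr: "crs j k (q - u) (p - u) > 0" "crs j k (w - u) (q - u) = \<alpha> * crs j k (w - u) (p - u)"
    unfolding ab(5) crs_simps(1-4,7) using mult_pos_pos[OF ab(3) p(6)] by simp_all
  have qc: "q \<in> cone u (pc i)" using cone_comb[OF p(5) uw(2) ab(1) less_imp_le[OF ab(3)] _ ab(5)] ab(1,3) by linarith
  have sub_hull: "convex hull {u, q, w} \<subseteq> convex hull {u, p, w}"
    by (rule hull_minimal) (use q(2) in \<open>auto simp: hull_inc\<close>)
  have rep: "\<exists>x y. 0 \<le> x \<and> 0 \<le> y \<and> x + y \<le> 1 \<and> z - u = (x * \<alpha>) *\<^sub>R (p - u) + (x * \<beta> + y) *\<^sub>R (w - u)"
    if z: "z \<in> convex hull {u, q, w}" for z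
  proof -
    obtain x y where xy: "0 \<le> x" "0 \<le> y" "x + y \<le> 1" "z = u + x *\<^sub>R (q - u) + y *\<^sub>R (w - u)" using z unfolding in_hull3 by blast
    have "z - u = x *\<^sub>R (q - u) + y *\<^sub>R (w - u)" using xy(4) by (simp add: add.assoc)
    also have "\<dots> = (x * \<alpha>) *\<^sub>R (p - u) + (x * \<beta> + y) *\<^sub>R (w - u)"
      unfolding ab(5) by (simp only: scaleR_right_distrib scaleR_left_distrib scaleR_scaleR add.assoc)
    finally show ?thesis using xy(1-3) by blast
  qed
  have pnot: "p \<notin> convex hull {u, q, w}"
  proof
    assume "p \<in> convex hull {u, q, w}"
    then obtain x y where xy: "0 \<le> x" "0 \<le> y" "x + y \<le> 1" "p - u = (x * \<alpha>) *\<^sub>R (p - u) + (x * \<beta> + y) *\<^sub>R (w - u)" using rep by blast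
    have "crs j k (w - u) (p - u) = (x * \<alpha>) * crs j k (w - u) (p - u)"
      using arg_cong[OF xy(4), of "crs j k (w - u)"] by (simp only: crs_simps(1-4,7) mult_zero_right add_0_right)
    then have "x * \<alpha> = 1" using p(6) by simp
    moreover have "x * \<alpha> \<le> 1 * \<alpha>" using xy ab(1) by (intro mult_right_mono) auto
    ultimately show False using ab(2) by simp
  qed
  \<comment> \<open>The minimality of \<open>q\<close> says that no remaining vertex lies on the
    \<open>u\<close> side of the line through \<open>p\<close> and \<open>q\<close>; in the new
    frame this is the nonnegativity of the coefficient of \<open>w - u\<close>.\<close>
  have invq: "\<exists>s t. 0 \<le> s \<and> 0 \<le> t \<and> z - q = s *\<^sub>R ?e + t *\<^sub>R (w - u)"
    if z: "z \<in> V" "z \<in> convex hull {u, q, w}" "z \<noteq> u" for z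
  proof -
    obtain x y where xy: "0 \<le> x" "0 \<le> y" "x + y \<le> 1" "z - u = (x * \<alpha>) *\<^sub>R (p - u) + (x * \<beta> + y) *\<^sub>R (w - u)" using rep z(2) by blast
    let ?a = "x * \<alpha>" and ?b = "x * \<beta> + y"
    have a: "0 \<le> ?a" "?a \<le> \<alpha>" "0 \<le> ?b"
      using xy ab(1,3) mult_right_mono[of x 1 \<alpha>] by simp_all
    have "x * (\<alpha> + \<beta>) \<le> x * 1" using xy(1) ab(4) by (intro mult_left_mono) auto
    then have sum1: "?a + ?b \<le> 1" using xy(3) by (simp add: distrib_left)
    have "u + ?a *\<^sub>R (p - u) + ?b *\<^sub>R (w - u) = z" unfolding add.assoc xy(4)[symmetric] by simp
    moreover have "z \<noteq> p" using z(2) pnot by blast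
    ultimately have m: "\<beta> * (1 - ?a) \<le> ?b * (1 - \<alpha>)" using mn[rule_format, OF a(1,3) sum1] z(1,3) by simp
    define s where "s = (\<alpha> - ?a) / (1 - \<alpha>)"
    have s: "0 \<le> s" "s * (1 - \<alpha>) = \<alpha> - ?a" using a(2) ab(2) by (simp_all add: s_def)
    define r where "r = ?b - \<beta> - s * \<beta>"
    have "r * (1 - \<alpha>) = ?b * (1 - \<alpha>) - \<beta> * (1 - \<alpha>) - \<beta> * (s * (1 - \<alpha>))" unfolding r_def by (simp only: left_diff_distrib) (simp add: mult.commute mult.left_commute)
    also have "\<dots> = ?b * (1 - \<alpha>) - \<beta> * (1 - ?a)" unfolding s(2) by (simp add: right_diff_distrib)
    finally have "0 \<le> r * (1 - \<alpha>)" using m by linarith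
    then have "0 \<le> r" using ab(2) by (simp add: zero_le_mult_iff)
    then show ?thesis using frame_change[OF xy(4) ab(5) s(2) r_def] s(1) by blast
  qed
  have ccinv: "cc i q \<le> cc i z \<and> cc j z \<le> cc j q" if z: "z \<in> V" "z \<in> convex hull {u, q, w}" "z \<noteq> u" for z
  proof -
    obtain s r where sr: "0 \<le> s" "0 \<le> r" "z - q = s *\<^sub>R ?e + r *\<^sub>R (w - u)" using invq[OF z] by blast
    have "cc i (z - q) = s * cc i ?e + r * cc i (w - u)" "cc j (z - q) = s * cc j ?e + r * cc j (w - u)"
      unfolding sr(3) by (simp_all only: cc_simps(1,3))
    moreover have "0 \<le> s * cc i ?e" "0 \<le> r * cc i (w - u)" "s * cc j ?e \<le> 0" "r * cc j (w - u) \<le> 0"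
      using sr(1,2) pq fi f(1) by (simp_all add: mult_nonneg_nonpos cc_simps(2))
    ultimately have "0 \<le> cc i (z - q)" "cc j (z - q) \<le> 0" by linarith+
    then show ?thesis by (simp add: cc_simps)
  qed
  have wh: "w \<in> convex hull {u, q, w}" by (simp add: hull_inc)
  have wq: "cc i q \<le> cc i w" "cc j w \<le> cc j q" using ccinv[OF V(2) wh] ne(2) by blast+
  have ap: "\<alpha> > 0" if "q \<noteq> w"
  proof (rule ccontr)
    assume "\<not> \<alpha> > 0"
    then have "crs j k (w - u) (q - u) = 0" using ab(1) cr(2) by simp
    then show False using crs_nz[OF t V(2) q(1) V(1)] that ne q(3) by blast
  qed
  have qw: "q = w \<or> crs j k (w - u) (q - u) > 0"
  proof (cases "q = w")
    case False then show ?thesis using mult_pos_pos[OF ap[OF False] p(6)] cr(2) by simp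
  qed simp
  have wk: "walk G p q (\<Phi> ?e)"
    by (rule edge[OF p(1) q(1,5) p(5) qc pq wq cr(1) p(6) qw]) (use ccinv in blast)
  have Pe: "\<Phi> ?e \<le> s0 * \<Phi> e + t0 * \<Phi> (w - u)" unfolding st0(3) using sub st0(1,2) by blast
  show ?case
  proof (cases "q = w")
    case True
    then show ?thesis using st0 wk walk_mono[OF wk Pe] by (intro exI[of _ s0] exI[of _ t0]) simp
  next
    case False
    have vq: "vis u q" using freetri_visible freetri_perm(2) q(5) by blast
    have wr: "w - u = 0 *\<^sub>R (p - u) + 1 *\<^sub>R (w - u)" by simp
    have sfq: "SF u q w" using secfree_mono[OF p(4) ab(5) wr ab(1)] ab(3) ap[OF False] by simp
    have "V \<inter> convex hull {u, q, w} \<subset> V \<inter> convex hull {u, p, w}"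
    proof
      show "V \<inter> convex hull {u, q, w} \<subseteq> V \<inter> convex hull {u, p, w}" using sub_hull by blast
      have "p \<in> convex hull {u, p, w}" by (simp add: hull_inc)
      then show "V \<inter> convex hull {u, q, w} \<noteq> V \<inter> convex hull {u, p, w}" using pnot p(1) by blast
    qed
    then have lt: "card (V \<inter> convex hull {u, q, w}) < card (V \<inter> convex hull {u, p, w})" using finV by (intro psubset_card_mono) auto
    have cwq: "crs j k (w - u) (q - u) > 0" using qw False by blast
    have e': "0 \<le> cc i ?e" "cc j ?e < 0" using pq by (simp_all add: cc_simps)
    obtain s1 t1 where 1: "0 \<le> s1" "0 \<le> t1" "w - q = s1 *\<^sub>R ?e + t1 *\<^sub>R (w - u)" "walk G q w (s1 * \<Phi> ?e + t1 * \<Phi> (w - u))"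
      using less.hyps[OF lt q(1) False vq sfq qc cwq e' invq] by blast
    have "w - p = ?e + (w - q)" by simp
    also have "\<dots> = (1 + s1) *\<^sub>R ?e + t1 *\<^sub>R (w - u)" unfolding 1(3) by (simp only: scaleR_left_distrib scaleR_one add.assoc)
    also have "\<dots> = ((1 + s1) * s0) *\<^sub>R e + ((1 + s1) * t0 + t1) *\<^sub>R (w - u)"
      unfolding st0(3) by (simp only: scaleR_right_distrib scaleR_left_distrib[of "(1 + s1) * t0"] scaleR_scaleR add.assoc)
    finally have rp: "w - p = ((1 + s1) * s0) *\<^sub>R e + ((1 + s1) * t0 + t1) *\<^sub>R (w - u)" .
    have "(1 + s1) * \<Phi> ?e \<le> (1 + s1) * (s0 * \<Phi> e + t0 * \<Phi> (w - u))" using Pe 1(1) by (intro mult_left_mono) auto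
    then have "\<Phi> ?e + (s1 * \<Phi> ?e + t1 * \<Phi> (w - u)) \<le> ((1 + s1) * s0) * \<Phi> e + ((1 + s1) * t0 + t1) * \<Phi> (w - u)"
      by (simp add: algebra_simps)
    then have "walk G p w (((1 + s1) * s0) * \<Phi> e + ((1 + s1) * t0 + t1) * \<Phi> (w - u))"
      using walk_mono[OF walk_trans[OF 1(4) wk]] by blast
    then show ?thesis using rp st0(1,2) 1(1,2)
      by (intro exI[of _ "(1 + s1) * s0"] exI[of _ "(1 + s1) * t0 + t1"]) simp
  qed
qed

text \<open>The edge \<open>u v\<close> is followed by the chain from \<open>v\<close> to
  \<open>w\<close>, bounded by a level step \<open>e\<close> from \<open>v\<close> to the segment
  \<open>u w\<close> and the rest of that segment. With \<open>a\<close>, \<open>b\<close> for minus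
  the \<open>j\<close>, \<open>k\<close> coordinates, scaled by \<open>2 / sqrt 3\<close>, the edge
  and the level step cost at most \<open>b\<close> of \<open>v - u\<close> plus \<tau> times
  \<open>a\<close> of \<open>w - u\<close>. As \<open>v\<close> is level with the fraction \<tau> of
  \<open>u w\<close>, this is at most \<tau> times \<open>2 * a + b\<close> of \<open>w - u\<close>,
  which \<open>low\<close> bounds.\<close>

lemma cone_walk:
  fixes \<Phi> :: "pt \<Rightarrow> real"
  assumes t: "tri i j k" and V: "u \<in> V" "w \<in> V" and uw: "vis u w" "w \<in> cone u (pc i)"
    and sub: "\<And>s t x y. 0 \<le> s \<Longrightarrow> 0 \<le> t \<Longrightarrow> \<Phi> (s *\<^sub>R x + t *\<^sub>R y) \<le> s * \<Phi> x + t * \<Phi> y"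
    and edge: "\<And>p q. p \<in> V \<Longrightarrow> q \<in> V \<Longrightarrow> FT u p q \<Longrightarrow> p \<in> cone u (pc i) \<Longrightarrow> q \<in> cone u (pc i) \<Longrightarrow>
       cc i p < cc i q \<Longrightarrow> cc j q < cc j p \<Longrightarrow> cc i q \<le> cc i w \<Longrightarrow> cc j w \<le> cc j q \<Longrightarrow>
       crs j k (q - u) (p - u) > 0 \<Longrightarrow> crs j k (w - u) (p - u) > 0 \<Longrightarrow> q = w \<or> crs j k (w - u) (q - u) > 0 \<Longrightarrow>
       (\<And>z. z \<in> V \<Longrightarrow> z \<in> convex hull {u, q, w} \<Longrightarrow> z \<noteq> u \<Longrightarrow> cc i q \<le> cc i z) \<Longrightarrow> walk (Ginf V S) p q (\<Phi> (q - p))"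
    and hor: "\<And>e. cc i e = 0 \<Longrightarrow> cc j e < 0 \<Longrightarrow> \<Phi> e \<le> - (2 / sqrt 3 * cc j e)"
    and low: "2 / sqrt 3 * (- 2 * cc j (w - u) - cc k (w - u)) \<le> \<Phi> (w - u)"
    and v: "E i u v" "v \<noteq> w" "SF u v w" "cc i v < cc i w" "crs j k (w - u) (v - u) > 0"
  shows "walk (Ginf V S) u w (\<Phi> (w - u))"
proof -
  let ?c = "2 / sqrt 3 :: real"
  let ?F = "w - u" and ?P = "v - u"
  note D = E_D[OF v(1)]
  have f: "cc j ?F < 0" "cc k ?F < 0" using cone_pc[OF t] uw(2) by (simp_all add: cc_simps)
  have g: "cc j ?P < 0" "cc k ?P < 0" using cone_pc[OF t] D(4) by (simp_all add: cc_simps)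
  have iF: "cc i ?F = - cc j ?F - cc k ?F" and iP: "cc i ?P = - cc j ?P - cc k ?P" using cc_sum[OF t, of ?F] cc_sum[OF t, of ?P] by linarith+
  have fi: "cc i ?F > 0" "cc i ?P > 0" using f g iF iP by linarith+
  have ne: "u \<noteq> v" "u \<noteq> w" using D(3) f by (auto simp: cc_simps)
  define \<tau> where "\<tau> = cc i ?P / cc i ?F"
  have ta: "0 < \<tau>" "\<tau> < 1" "cc i ?P = \<tau> * cc i ?F" using fi v(4) by (simp_all add: \<tau>_def cc_simps)
  \<comment> \<open>The point of \<open>u w\<close> with the same \<open>i\<close> coordinate as
    \<open>v\<close>.\<close>
  define o' where "o' = u + \<tau> *\<^sub>R ?F"
  have ou: "o' - u = \<tau> *\<^sub>R ?F" by (simp add: o'_def)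
  let ?e = "o' - v"
  have eP: "?e = \<tau> *\<^sub>R ?F - ?P" by (simp add: o'_def)
  have ei: "cc i ?e = 0" unfolding eP using ta(3) by (simp only: cc_simps(2,3))
  have ej0: "cc j ?e = \<tau> * cc j ?F - cc j ?P" unfolding eP by (simp only: cc_simps(2,3))
  have ej: "cc j ?e < 0"
  proof -
    have "cc j ?P * cc k ?F < cc j ?F * cc k ?P" using v(5) unfolding crs_def by (simp add: mult.commute)
    then have "cc j ?F * cc i ?P < cc j ?P * cc i ?F" unfolding iF iP by (simp add: right_diff_distrib mult.commute)
    moreover have "(\<tau> * cc j ?F - cc j ?P) * cc i ?F = cc j ?F * (\<tau> * cc i ?F) - cc j ?P * cc i ?F" by (simp add: algebra_simps)
    ultimately have "(\<tau> * cc j ?F - cc j ?P) * cc i ?F < 0" unfolding ta(3) by linarith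
    then show ?thesis unfolding ej0 using fi(1) by (simp add: mult_less_0_iff)
  qed
  have oseg: "o' \<in> closed_segment u w"
    unfolding in_segment using ta by (intro exI[of _ \<tau>]) (simp add: o'_def algebra_simps)
  have inv: "\<exists>s r. 0 \<le> s \<and> 0 \<le> r \<and> z - v = s *\<^sub>R ?e + r *\<^sub>R ?F"
    if z: "z \<in> V" "z \<in> convex hull {u, v, w}" "z \<noteq> u" for z
  proof -
    obtain x y where xy: "0 \<le> x" "0 \<le> y" "x + y \<le> 1" "z = u + x *\<^sub>R ?P + y *\<^sub>R ?F" using z(2) unfolding in_hull3 by blast
    have zu: "z - u = x *\<^sub>R ?P + y *\<^sub>R ?F" using xy(4) by (simp add: add.assoc)
    \<comment> \<open>No vertex of the triangle lies on the \<open>u\<close> side of the level line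
      through \<open>v\<close>: it would lead to an empty triangle at \<open>u v\<close> whose third
      vertex is closer to \<open>u\<close> than \<open>v\<close>.\<close>
    have "0 \<le> y - (1 - x) * \<tau>"
    proof (rule ccontr)
      assume n: "\<not> ?thesis"
      have yt: "y = (y / \<tau>) * \<tau>" using ta by simp
      have yt1: "x + y / \<tau> < 1" using n ta(1) by (simp add: field_simps)
      have zo: "z = u + x *\<^sub>R ?P + (y / \<tau>) *\<^sub>R (o' - u)" unfolding ou using xy(4) ta(1) by simp
      have zh: "z \<in> convex hull {u, v, o'}" unfolding in_hull3
        using xy(1,2) ta(1) yt1 zo by (intro exI[of _ x] exI[of _ "y / \<tau>"]) simp
      have nz0: "cross2 ?P ?F \<noteq> 0" using not_collinear[OF V(1) D(2) V(2)] ne v(2) by blast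
      have nz: "cross2 ?P (o' - u) \<noteq> 0" unfolding ou using nz0 ta(1) by (simp add: cross2_simps)
      have cl: "clear S u o'" by (rule clear_sub[OF visible_clear[OF V uw(1)] _ oseg]) simp
      have sfo: "SF u v o'"
        by (rule secfree_mono[OF v(3), of _ 1 0 _ 0 \<tau>]) (use ta ou in auto)
      have noV: "V \<inter> closed_segment u v \<subseteq> {u, v}" using not_in_segment[OF V(1) D(2)] by blast
      have zv: "z \<noteq> v"
      proof
        assume "z = v"
        then have "cc i ?P = x * cc i ?P + y * cc i ?F" using arg_cong[OF zu, of "cc i"] by (simp only: cc_simps(1,3))
        also have "\<dots> = (x + y / \<tau>) * cc i ?P" using ta by (simp add: distrib_right)
        also have "\<dots> < 1 * cc i ?P" using yt1 fi(2) by (intro mult_strict_right_mono)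
        finally show False by simp
      qed
      obtain q where q: "q \<in> V" "q \<in> convex hull {u, v, o'}" "q \<noteq> u" "q \<noteq> v" "FT u v q"
        and ex: "\<exists>\<alpha> \<beta>. 0 \<le> \<alpha> \<and> \<alpha> < 1 \<and> 0 < \<beta> \<and> q - u = \<alpha> *\<^sub>R (v - u) + \<beta> *\<^sub>R (o' - u)"
        by (rule adjacent_vertex[OF D(2) nz visible_clear[OF V(1) D(2,5)] cl sfo noV z(1) zh z(3) zv])
      have io: "cc i o' = cc i v" "cc j o' < cc j u" "cc k o' < cc k u"
      proof -
        show "cc i o' = cc i v" using ei by (simp add: cc_simps)
        have "cc j (o' - u) < 0" "cc k (o' - u) < 0" unfolding ou cc_simps(3) using ta(1) f by (simp_all add: mult_pos_neg)
        then show "cc j o' < cc j u" "cc k o' < cc k u" by (simp_all add: cc_simps)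
      qed
      have oc: "o' \<in> cone u (pc i)" using cone_pc[OF t] io(2,3) by blast
      obtain \<alpha> \<beta> where ab: "0 \<le> \<alpha>" "\<alpha> < 1" "0 < \<beta>" "q - u = \<alpha> *\<^sub>R (v - u) + \<beta> *\<^sub>R (o' - u)" using ex by blast
      have qc: "q \<in> cone u (pc i)" using cone_comb[OF D(4) oc ab(1) less_imp_le[OF ab(3)] _ ab(4)] ab(1,3) by linarith
      have "cc i q \<le> cc i v" using cc_hull(1)[OF q(2), of i "cc i v"] io(1) fi(2) by (simp add: cc_simps)
      then have "cc i q < cc i v" using cc_neq[OF q(1) D(2) q(4), of i] by simp
      then show False
        using E_empty[OF v(1) q(1) qc freetri_visible[OF freetri_perm(2)[OF q(5)]] freetri_secfree[OF q(5)]] by blast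
    qed
    moreover have "z - v = (1 - x) *\<^sub>R ?e + (y - (1 - x) * \<tau>) *\<^sub>R ?F"
    proof -
      have "z - v = (z - u) - ?P" by simp
      also have "\<dots> = (x - 1) *\<^sub>R ?P + y *\<^sub>R ?F" unfolding zu by (simp only: scaleR_left_diff_distrib) simp
      also have "\<dots> = (1 - x) *\<^sub>R ?e + (y - (1 - x) * \<tau>) *\<^sub>R ?F"
        unfolding eP by (simp only: scaleR_left_diff_distrib scaleR_right_diff_distrib scaleR_scaleR left_diff_distrib) simp
      finally show ?thesis .
    qed
    moreover have "0 \<le> 1 - x" using xy by linarith
    ultimately show ?thesis by blast
  qed
  obtain s r where sr: "0 \<le> s" "0 \<le> r" "w - v = s *\<^sub>R ?e + r *\<^sub>R ?F" "walk (Ginf V S) v w (s * \<Phi> ?e + r * \<Phi> ?F)"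
    using chain_walk[OF t V uw sub edge D(2) v(2) D(5) v(3) D(4) v(5) eq_refl[OF ei[symmetric]] ej inv] by blast
  have wv: "w - v = ?e + (1 - \<tau>) *\<^sub>R ?F" unfolding eP by (simp add: scaleR_left_diff_distrib)
  have "r * cc i ?F = (1 - \<tau>) * cc i ?F"
    using arg_cong[OF sr(3), of "cc i"] arg_cong[OF wv, of "cc i"] ei by (simp only: cc_simps(1,3) mult_zero_right add_0_left)
  then have r: "r = 1 - \<tau>" using fi(1) by simp
  have "s * cc j ?e + r * cc j ?F = cc j ?e + (1 - \<tau>) * cc j ?F"
    using arg_cong[OF sr(3), of "cc j"] arg_cong[OF wv, of "cc j"] by (simp only: cc_simps(1,3))
  then have s: "s = 1" unfolding r using ej by simp
  have "dist u v \<le> ?c * (- cc j ?P - cc k ?P)"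
    using norm_le_coord[OF t, of ?P] g by (simp add: dist_norm norm_minus_commute)
  moreover have "{u, v} \<in> Ginf V S" using v(1) Ginf_iff by blast
  ultimately have w1: "walk (Ginf V S) u v (?c * (- cc j ?P - cc k ?P))" using walk_edge by blast
  have w2: "walk (Ginf V S) u w (?c * (- cc j ?P - cc k ?P) + (\<Phi> ?e + (1 - \<tau>) * \<Phi> ?F))"
    using walk_trans[OF sr(4) w1] unfolding s r by simp
  have "?c * (- cc j ?P - cc k ?P) + \<Phi> ?e \<le> ?c * (- cc j ?P - cc k ?P) + ?c * (- cc j ?e)" using hor[OF ei ej] by simp
  also have "\<dots> = ?c * (\<tau> * cc i ?F - \<tau> * cc j ?F + cc j ?P)"
    unfolding distrib_left[symmetric] ej0 ta(3)[symmetric] iP by (simp add: algebra_simps)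
  also have "\<dots> \<le> ?c * (\<tau> * cc i ?F - \<tau> * cc j ?F)" using g(1) by (intro mult_left_mono) auto
  also have "\<dots> = \<tau> * (?c * (- 2 * cc j ?F - cc k ?F))" unfolding iF by (simp add: algebra_simps)
  also have "\<dots> \<le> \<tau> * \<Phi> ?F" using low ta(1) by (intro mult_left_mono) auto
  finally have "?c * (- cc j ?P - cc k ?P) + (\<Phi> ?e + (1 - \<tau>) * \<Phi> ?F) \<le> \<Phi> ?F" by (simp add: algebra_simps)
  then show ?thesis using walk_mono[OF w2] by blast
qed

lemma closest_toward:
  assumes "u \<in> V" "w \<in> V" "vis u w" "w \<in> cone u (pc i)"
  obtains v where "E i u v" "v = w \<or> v \<noteq> w \<and> SF u v w \<and> cc i v < cc i w"
proof -
  have "w \<in> visK V S u (pc i)" using assms by (simp add: visK_def)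
  then obtain X where X: "X \<in> subcones V S u (pc i)" "w \<in> X" using subcone_cover by blast
  have XV: "X \<subseteq> V" using subcone_sub[OF X(1)] visKD by blast
  then have fin: "finite X" using finV finite_subset by blast
  have ne: "X \<noteq> {}" using X(2) by blast
  define v where "v = arg_min_on (cc i) X"
  have v: "v \<in> X" "\<And>z. z \<in> X \<Longrightarrow> cc i v \<le> cc i z"
    unfolding v_def using arg_min_if_finite[OF fin ne, of "cc i"] arg_min_least[OF fin ne, of _ "cc i"] by auto
  have e: "E i u v" unfolding Epos_def proj_pc using assms(1) X(1) v by auto
  have "v = w \<or> v \<noteq> w \<and> SF u v w \<and> cc i v < cc i w"
  proof (cases "v = w")
    case False
    then have "cc i v < cc i w" using v(2)[OF X(2)] cc_neq[of v w i] v(1) XV assms(2) by fastforce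
    then show ?thesis using subcone_secfree[OF assms(1) X(1) v(1) X(2) False] False by blast
  qed simp
  then show ?thesis using that e by blast
qed

text \<open>The side is fixed by the order of \<open>j\<close> and \<open>k\<close>. If it is empty,
  the closest vertex used in \<open>cone_walk\<close> is on the other side, and then
  \<open>left_len\<close> suffices.\<close>

definition right_empty :: "int \<Rightarrow> int \<Rightarrow> int \<Rightarrow> pt \<Rightarrow> pt \<Rightarrow> bool" where
  "right_empty i j k u w \<longleftrightarrow> (\<forall>z\<in>V. vis u z \<longrightarrow> z \<in> cone u (pc i) \<longrightarrow> cc i z < cc i w \<longrightarrow> \<not> crs j k (z - u) (w - u) > 0)"

text \<open>For a chain step that turns out of cone \<open>i\<close>, read backwards from
  \<open>q\<close> to \<open>p\<close> in cone \<open>j\<close>. The empty triangle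
  \<open>u p q\<close> lies on its right, and a closer vertex on that side would be inside this
  triangle.\<close>

lemma right_empty_across:
  assumes t: "tri i j k" and V: "u \<in> V" "p \<in> V" "q \<in> V" and ft: "FT u p q"
    and p: "p \<in> cone u (pc i)" and q: "q \<in> cone u (pc i)"
    and pq: "cc i p < cc i q" "cc j q < cc j p" "cc k p < cc k q"
  shows "right_empty j i k q p"
  unfolding right_empty_def
proof (intro ballI impI notI)
  fix z assume z: "z \<in> V" "z \<in> cone q (pc j)" "cc j z < cc j p" and r: "crs i k (z - q) (p - q) > 0"
  define x y where "x = - cc j (z - u)" and "y = - cc k (z - u)"
  define a b where "a = - cc j (p - u)" and "b = - cc k (p - u)"
  define c d where "c = - cc j (q - u)" and "d = - cc k (q - u)"
  note df = x_def y_def a_def b_def c_def d_def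
  have pp: "a > 0" "b > 0" "c > 0" "d > 0" using cone_pc[OF t] p q unfolding df by (simp_all add: cc_simps)
  have zq: "cc k z < cc k q" using cone_pc[OF tri_perm(2)[OF t]] z(2) by blast
  have o: "a < c" "d < b" "a < x" "d < y" using pq z(3) zq unfolding df by (simp_all add: cc_simps)
  have s: "cc i (z - q) = - cc j (z - q) - cc k (z - q)" "cc i (p - q) = - cc j (p - q) - cc k (p - q)"
    using cc_sum[OF t, of "z - q"] cc_sum[OF t, of "p - q"] by linarith+
  have "cc j (z - q) = c - x" "cc k (z - q) = d - y" "cc j (p - q) = c - a" "cc k (p - q) = d - b" unfolding df by (simp_all add: cc_simps)
  then have below: "(c - x) * (d - b) < (d - y) * (c - a)"
    using r unfolding crs_def s by (simp add: left_diff_distrib right_diff_distrib mult.commute)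
  have xc: "x < c"
  proof (rule ccontr)
    assume "\<not> x < c"
    then have "0 \<le> (c - x) * (d - b)" using o(2) by (intro mult_nonpos_nonpos) auto
    moreover have "(d - y) * (c - a) < 0" using o by (intro mult_neg_pos) auto
    ultimately show False using below by linarith
  qed
  have yb: "y < b"
  proof (rule ccontr)
    assume "\<not> y < b"
    then have "(b - d) * (c - a) \<le> (y - d) * (c - a)" using o by (intro mult_right_mono) auto
    moreover have "(c - x) * (b - d) < (c - a) * (b - d)" using o by (intro mult_strict_right_mono) auto
    moreover have "(c - x) * (d - b) = - ((c - x) * (b - d))" "(d - y) * (c - a) = - ((y - d) * (c - a))"
      by (simp_all add: algebra_simps)
    ultimately show False using below by (simp add: mult.commute)
  qed
  have ce: "crs j k (q - u) (p - u) = c * b - d * a" "crs j k (z - u) (p - u) = x * b - y * a" "crs j k (q - u) (z - u) = c * y - d * x"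
    unfolding crs_def df by simp_all
  have 1: "d * a < c * b" using o pp by (intro mult_strict_mono[of d b a c, THEN order_less_le_trans]) (auto simp: mult.commute)
  have 2: "y * a \<le> x * b" using mult_mono[of y b a x] o pp yb by (simp add: mult.commute)
  have 3: "d * x \<le> c * y" using mult_mono[of d y x c] o pp xc by (simp add: mult.commute)
  have 4: "(x * b - y * a) + (c * y - d * x) \<le> c * b - d * a" using below by (simp add: algebra_simps)
  have "z \<in> convex hull {u, q, p}" by (rule in_hull_crs[OF t]) (use 1 2 3 4 in \<open>simp_all add: ce\<close>)
  then have "z \<in> convex hull {u, p, q}" by (simp add: insert_commute)
  then have "z = u \<or> z = p \<or> z = q" using ft z(1) unfolding freetri_def by blast
  moreover have "z \<noteq> u" using o(3) pp(1) unfolding df by (auto simp: cc_simps)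
  moreover have "z \<noteq> p" using z(3) by blast
  moreover have "z \<noteq> q" using zq by blast
  ultimately show False by blast
qed

text \<open>Suppose \<open>p\<close> sees a closer vertex \<open>z\<close> to the right. It is
  outside the empty triangle \<open>u p q\<close>, and \<open>inv\<close> keeps it out of the
  triangle \<open>u q w\<close>, so \<open>p z\<close> crosses \<open>u w\<close> at some
  \<open>o'\<close>. The empty triangle at the side \<open>o' u\<close> towards \<open>z\<close>
  then has a third vertex that is visible from \<open>u\<close> on the right of \<open>u w\<close>
  and closer than \<open>w\<close>.\<close>

lemma right_empty_along:
  assumes t: "tri i j k" and V: "u \<in> V" "w \<in> V" "p \<in> V" "q \<in> V" and uw: "vis u w" "w \<in> cone u (pc i)" and ft: "FT u p q"
    and p: "p \<in> cone u (pc i)" and q: "q \<in> cone u (pc i)"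
    and pq: "cc i p < cc i q" "cc j q < cc j p" "cc k q < cc k p" and qw: "cc i q \<le> cc i w"
    and cr: "crs j k (q - u) (p - u) > 0" "crs j k (w - u) (p - u) > 0" "q = w \<or> crs j k (w - u) (q - u) > 0"
    and inv: "\<And>z. z \<in> V \<Longrightarrow> z \<in> convex hull {u, q, w} \<Longrightarrow> z \<noteq> u \<Longrightarrow> cc i q \<le> cc i z"
    and re: "right_empty i j k u w"
  shows "right_empty i j k p q"
  unfolding right_empty_def
proof (intro ballI impI notI)
  fix z assume z: "z \<in> V" "vis p z" "z \<in> cone p (pc i)" "cc i z < cc i q" and r: "crs j k (z - p) (q - p) > 0"
  define a b where "a = - cc j (p - u)" and "b = - cc k (p - u)"
  define x y where "x = - cc j (z - p)" and "y = - cc k (z - p)"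
  define c d where "c = - cc j (q - p)" and "d = - cc k (q - p)"
  note df = x_def y_def a_def b_def c_def d_def
  have pos: "a > 0" "b > 0" "x > 0" "y > 0" "c > 0" "d > 0"
    using cone_pc[OF t] p z(3) pq(2,3) unfolding df by (simp_all add: cc_simps)
  have r': "y * c < x * d" using r unfolding crs_def df by simp
  have cr': "d * a < c * b"
  proof -
    have "crs j k (q - u) (p - u) = crs j k (q - p) (p - u)" by (simp add: crs_def cc_simps algebra_simps)
    then show ?thesis using cr(1) unfolding crs_def df by simp
  qed
  have zp: "y * a < x * b"
  proof -
    have "(y * c) * (d * a) < (x * d) * (c * b)" 
      by (rule mult_strict_mono[OF r' cr' mult_pos_pos[OF pos(3,6)] less_imp_le[OF mult_pos_pos[OF pos(6,1)]]])
    then have "(c * d) * (y * a) < (c * d) * (x * b)" by (simp add: ac_simps)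
    then show ?thesis using pos by simp
  qed
  have zpu: "crs j k (z - u) (p - u) > 0"
  proof -
    have "crs j k (z - u) (p - u) = x * b - y * a" unfolding crs_def df by (simp add: cc_simps algebra_simps)
    then show ?thesis using zp by simp
  qed
  have zu: "cc j z < cc j u" "cc k z < cc k u" using pos unfolding df by (simp_all add: cc_simps)
  then have zc: "z \<in> cone u (pc i)" and zne: "z \<noteq> u" using cone_pc[OF t] by auto
  have zpn: "z \<noteq> p" using pos(3) unfolding df by (auto simp: cc_simps)
  have zqn: "z \<noteq> q" using z(4) by blast
  have zq: "crs j k (z - u) (q - u) > 0"
  proof (rule ccontr)
    assume n: "\<not> ?thesis"
    have "z \<in> convex hull {u, q, p}"
    proof (rule in_hull_crs[OF t cr(1)])
      show "crs j k (z - u) (p - u) \<ge> 0" using zpu by simp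
      show "crs j k (q - u) (z - u) \<ge> 0" using n crs_anti[of j k "z - u" "q - u"] by linarith
      have "crs j k (z - p) (q - p) = crs j k (q - u) (p - u) - crs j k (z - u) (p - u) - crs j k (q - u) (z - u)"
        by (simp add: crs_def cc_simps algebra_simps)
      then show "crs j k (z - u) (p - u) + crs j k (q - u) (z - u) \<le> crs j k (q - u) (p - u)" using r by linarith
    qed
    then have "z \<in> convex hull {u, p, q}" by (simp add: insert_commute)
    then show False using ft z(1) zne zpn zqn unfolding freetri_def by blast
  qed
  have cj: "cc j p < cc j u" "cc k p < cc k u" "cc j q < cc j u" "cc k q < cc k u" "cc j w < cc j u" "cc k w < cc k u"
    using cone_pc[OF t] p q uw(2) by blast+
  have ul: "cc i u < cc i p" "cc i u < cc i q" "cc i u < cc i w" "cc i u < cc i z"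
    using cj zu cc_sum[OF t, of u] cc_sum[OF t, of p] cc_sum[OF t, of q] cc_sum[OF t, of w] cc_sum[OF t, of z] by linarith+
  have zw: "crs j k (z - u) (w - u) > 0"
  proof (cases "q = w")
    case True then show ?thesis using zq by simp
  next
    case False
    then have wq: "crs j k (w - u) (q - u) > 0" using cr(3) by blast
    show ?thesis
    proof (rule ccontr)
      assume n: "\<not> ?thesis"
      let ?D = "crs j k (w - u) (q - u)" and ?x = "crs j k (z - u) (q - u)" and ?y = "crs j k (w - u) (z - u)"
      have y0: "?y \<ge> 0" using n crs_anti[of j k "z - u" "w - u"] by linarith
      have zr: "z - u = (?x / ?D) *\<^sub>R (w - u) + (?y / ?D) *\<^sub>R (q - u)" by (rule crs_coord[OF t wq])
      have "cc i (z - u) = (?x / ?D) * cc i (w - u) + (?y / ?D) * cc i (q - u)"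
        using arg_cong[OF zr, of "cc i"] by (simp only: cc_simps(1,3))
      then have "?D * cc i (z - u) = ?x * cc i (w - u) + ?y * cc i (q - u)" using wq by (simp add: field_simps)
      moreover have "?x * cc i (q - u) \<le> ?x * cc i (w - u)" using zq qw by (intro mult_left_mono) (auto simp: cc_simps)
      moreover have "?D * cc i (z - u) < ?D * cc i (q - u)" using wq z(4) by (intro mult_strict_left_mono) (auto simp: cc_simps)
      ultimately have "(?x + ?y) * cc i (q - u) < ?D * cc i (q - u)" unfolding distrib_right by linarith
      then have "?x + ?y < ?D" using ul(2) by (simp add: cc_simps)
      then have "z \<in> convex hull {u, w, q}" using in_hull_crs[OF t wq] zq y0 by simp
      then have "z \<in> convex hull {u, q, w}" by (simp add: insert_commute)
      then show False using inv[OF z(1) _ zne] z(4) by simp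
    qed
  qed
  let ?A = "crs j k (w - u) (p - u)" and ?B = "crs j k (z - u) (w - u)"
  define \<sigma> where "\<sigma> = ?A / (?A + ?B)"
  have sg: "0 < \<sigma>" "\<sigma> < 1" "\<sigma> * (?A + ?B) = ?A" using cr(2) zw by (simp_all add: \<sigma>_def)
  \<comment> \<open>The crossing point of \<open>p z\<close> with \<open>u w\<close>; \<sigma> is
    chosen to annihilate \<open>crs j k (o' - u) (w - u)\<close>.\<close>
  define o' where "o' = p + \<sigma> *\<^sub>R (z - p)"
  have ou: "o' - u = (1 - \<sigma>) *\<^sub>R (p - u) + \<sigma> *\<^sub>R (z - u)" by (simp add: o'_def algebra_simps)
  have oz: "crs j k (o' - u) (w - u) = 0"
  proof -
    have "crs j k (o' - u) (w - u) = (1 - \<sigma>) * crs j k (p - u) (w - u) + \<sigma> * ?B" unfolding ou by (simp only: crs_simps(1-4,7))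
    also have "\<dots> = \<sigma> * (?A + ?B) - ?A" using crs_anti[of j k "p - u" "w - u"] by (simp add: algebra_simps)
    finally show ?thesis using sg(3) by simp
  qed
  have wi: "cc i (w - u) > 0" using ul(3) by (simp add: cc_simps)
  define \<rho> where "\<rho> = cc i (o' - u) / cc i (w - u)"
  have oi: "cc i (o' - u) = (1 - \<sigma>) * cc i (p - u) + \<sigma> * cc i (z - u)" unfolding ou by (simp only: cc_simps(1,3))
  have o_pos: "cc i (o' - u) > 0"
    unfolding oi using sg ul(1,4) by (intro add_pos_pos mult_pos_pos) (auto simp: cc_simps)
  have o_lt: "cc i (o' - u) < cc i (w - u)"
  proof -
    have "(1 - \<sigma>) * cc i (p - u) + \<sigma> * cc i (z - u) < (1 - \<sigma>) * cc i (w - u) + \<sigma> * cc i (w - u)"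
      using sg pq(1) qw z(4) by (intro add_strict_mono mult_strict_left_mono) (auto simp: cc_simps)
    then show ?thesis unfolding oi by (simp add: algebra_simps)
  qed
  have rh: "0 < \<rho>" "\<rho> < 1" "cc i (o' - u) = \<rho> * cc i (w - u)" using o_pos o_lt wi by (simp_all add: \<rho>_def)
  have or: "o' - u = \<rho> *\<^sub>R (w - u)"
  proof -
    obtain m where m: "crs j k (m - u) (w - u) > 0" using zw by blast
    have "o' - u = (crs j k (o' - u) (w - u) / crs j k (m - u) (w - u)) *\<^sub>R (m - u) + (crs j k (m - u) (o' - u) / crs j k (m - u) (w - u)) *\<^sub>R (w - u)"
      by (rule crs_coord[OF t m])
    then obtain \<mu> where mu: "o' - u = \<mu> *\<^sub>R (w - u)" unfolding oz by auto
    then have "\<mu> * cc i (w - u) = \<rho> * cc i (w - u)" using rh(3) cc_simps(3)[of i \<mu> "w - u"] by simp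
    then show ?thesis using mu wi by simp
  qed
  have ne: "u \<noteq> w" "p \<noteq> z" using ul(3) zpn by auto
  have o1: "o' \<in> open_segment u w"
  proof -
    have "o' = (1 - \<rho>) *\<^sub>R u + \<rho> *\<^sub>R w" using or by (simp add: algebra_simps)
    then show ?thesis unfolding in_segment using rh ne(1) by blast
  qed
  have o2: "o' \<in> open_segment p z"
  proof -
    have "o' = (1 - \<sigma>) *\<^sub>R p + \<sigma> *\<^sub>R z" by (simp add: o'_def algebra_simps)
    then show ?thesis unfolding in_segment using sg ne(2) by blast
  qed
  have "crs j k (w - u) (z - p) = - ?B - ?A" by (simp add: crs_def cc_simps algebra_simps)
  then have "crs j k (w - u) (z - p) \<noteq> 0" using cr(2) zw by linarith
  then have nz: "cross2 (w - u) (z - p) \<noteq> 0" using crs_zero_iff[OF t] by blast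
  have sf: "SF o' u z" by (rule crossing_free[OF V(1,2,3) z(1) uw(1) z(2) o1 o2 nz])
  have zo: "z - o' = (1 - \<sigma>) *\<^sub>R (z - p)" by (simp add: o'_def algebra_simps)
  have uo: "u - o' = (- \<rho>) *\<^sub>R (w - u)" using or by (simp add: algebra_simps)
  have nz2: "cross2 (u - o') (z - o') \<noteq> 0" unfolding uo zo using nz rh(1) sg(2) by (simp add: cross2_simps)
  have os: "o' \<in> closed_segment u w" "o' \<in> closed_segment p z" using o1 o2 by (simp_all add: open_segment_def)
  have c1: "clear S o' u" by (rule clear_sub[OF visible_clear[OF V(1,2) uw(1)] os(1)]) simp
  have c2: "clear S o' z" by (rule clear_sub[OF visible_clear[OF V(3) z(1,2)] os(2)]) simp
  have noV: "V \<inter> closed_segment o' u \<subseteq> {o', u}" by (rule noV_subsegment[OF V(1,2) o1])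
  have zh: "z \<in> convex hull {o', u, z}" by (simp add: hull_inc)
  have zno: "z \<noteq> o'" using o2 by (auto simp: open_segment_def)
  obtain y' where y': "y' \<in> V" "y' \<in> convex hull {o', u, z}" "y' \<noteq> o'" "y' \<noteq> u" "FT o' u y'"
    and ex: "\<exists>\<alpha> \<beta>. 0 \<le> \<alpha> \<and> \<alpha> < 1 \<and> 0 < \<beta> \<and> y' - o' = \<alpha> *\<^sub>R (u - o') + \<beta> *\<^sub>R (z - o')"
    by (rule adjacent_vertex[OF V(1) nz2 c1 c2 sf noV z(1) zh zno zne])
  obtain \<alpha> \<beta> where ab: "0 < \<beta>" "y' - o' = \<alpha> *\<^sub>R (u - o') + \<beta> *\<^sub>R (z - o')" using ex by blast
  have vy: "vis u y'" using freetri_visible freetri_perm(3) y'(5) by blast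
  have wj: "cc j w < cc j u" "cc k w < cc k u" using cone_pc[OF t] uw(2) by blast+
  have oj: "cc j o' \<le> cc j u" "cc k o' \<le> cc k u"
  proof -
    have "cc j (o' - u) \<le> 0" "cc k (o' - u) \<le> 0" unfolding or cc_simps(3) using rh(1) wj by (simp_all add: cc_simps mult_nonneg_nonpos)
    then show "cc j o' \<le> cc j u" "cc k o' \<le> cc k u" by (simp_all add: cc_simps)
  qed
  have "cc j y' \<le> cc j u" "cc k y' \<le> cc k u"
    using cc_hull(1)[OF y'(2), of j "cc j u"] cc_hull(1)[OF y'(2), of k "cc k u"] oj zu by auto
  then have yc: "y' \<in> cone u (pc i)" using cone_pc[OF t] cc_neq[OF y'(1) V(1) y'(4), of j] cc_neq[OF y'(1) V(1) y'(4), of k] by auto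
  have "cc i o' < cc i w" using o_lt by (simp add: cc_simps)
  then have ylt: "cc i y' < cc i w" using cc_hull(2)[OF y'(2), of i "cc i w"] ul(3) z(4) qw by auto
  have "y' - u = (y' - o') + (o' - u)" "z - u = (z - o') + (o' - u)" by simp_all
  then have yz: "crs j k (y' - u) (w - u) = crs j k (y' - o') (w - u)" "?B = crs j k (z - o') (w - u)"
    using oz crs_simps(1) by (metis add_0_right)+
  have "crs j k (u - o') (w - u) = 0" unfolding uo by (simp only: crs_simps(1-4,7) mult_zero_right)
  then have "crs j k (y' - o') (w - u) = \<beta> * crs j k (z - o') (w - u)" unfolding ab(2) by (simp only: crs_simps(1-4,7) mult_zero_right add_0_left)
  then have "crs j k (y' - u) (w - u) > 0" unfolding yz(1) using ab(1) zw yz(2) by simp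
  then show False using re y'(1) vy yc ylt unfolding right_empty_def by blast
qed

text \<open>A norm of the displacement whose unit ball is a regular hexagon. It does not change when
  the pair is reversed and equals twice the projection on the bisector, so steps read in different
  cones can be compared.\<close>

definition hex_size :: "pt \<Rightarrow> pt \<Rightarrow> real" where "hex_size p q = \<bar>cc 0 (q - p)\<bar> + \<bar>cc 1 (q - p)\<bar> + \<bar>cc 2 (q - p)\<bar>"

lemma hex_size_tri:
  assumes "tri i j k" shows "hex_size p q = \<bar>cc i (q - p)\<bar> + \<bar>cc j (q - p)\<bar> + \<bar>cc k (q - p)\<bar>"
proof -
  have c: "cc n = cc (n mod 3)" for n by (rule cc_cong) simp
  show ?thesis using assms by (rule tri_cases) (simp_all add: hex_size_def c[of i] c[of j] c[of k])
qed

lemma hex_size_cone: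
  assumes t: "tri i j k" and "w \<in> cone u (pc i)" shows "hex_size u w = 2 * (cc i w - cc i u)"
proof -
  have "cc j w < cc j u" "cc k w < cc k u" using cone_pc[OF t] assms(2) by blast+
  then show ?thesis using cc_sum[OF t, of u] cc_sum[OF t, of w] unfolding hex_size_tri[OF t] by (simp add: cc_simps)
qed

text \<open>With \<open>a = - cc j d\<close> and \<open>b = - cc k d\<close> these are \<open>2a + b\<close> and \<open>a + b + max a b\<close> up to scaling; \<open>left_len\<close> holds
  when nothing is visible on the right of the segment.\<close>
abbreviation "left_len j k d \<equiv> 2 / sqrt 3 * (- 2 * cc j d - cc k d)"
abbreviation "max_len j k d \<equiv> 2 / sqrt 3 * max (- 2 * cc j d - cc k d) (- 2 * cc k d - cc j d)"

lemma left_len_sub: "left_len j k (s *\<^sub>R x + t *\<^sub>R y) \<le> s * left_len j k x + t * left_len j k y"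
  unfolding cc_simps by (simp add: algebra_simps)

lemma max_len_sub:
  assumes "0 \<le> s" "0 \<le> t" shows "max_len j k (s *\<^sub>R x + t *\<^sub>R y) \<le> s * max_len j k x + t * max_len j k y"
proof -
  let ?m = "\<lambda>d. max (- 2 * cc j d - cc k d) (- 2 * cc k d - cc j d)"
  have "- 2 * cc j (s *\<^sub>R x + t *\<^sub>R y) - cc k (s *\<^sub>R x + t *\<^sub>R y) = s * (- 2 * cc j x - cc k x) + t * (- 2 * cc j y - cc k y)"
    "- 2 * cc k (s *\<^sub>R x + t *\<^sub>R y) - cc j (s *\<^sub>R x + t *\<^sub>R y) = s * (- 2 * cc k x - cc j x) + t * (- 2 * cc k y - cc j y)"
    unfolding cc_simps by (simp_all add: algebra_simps)
  moreover have "s * (- 2 * cc j x - cc k x) \<le> s * ?m x" "t * (- 2 * cc j y - cc k y) \<le> t * ?m y"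
    "s * (- 2 * cc k x - cc j x) \<le> s * ?m x" "t * (- 2 * cc k y - cc j y) \<le> t * ?m y"
    using assms by (intro mult_left_mono; simp)+
  ultimately have "?m (s *\<^sub>R x + t *\<^sub>R y) \<le> s * ?m x + t * ?m y" by linarith
  then have "2 / sqrt 3 * ?m (s *\<^sub>R x + t *\<^sub>R y) \<le> 2 / sqrt 3 * (s * ?m x + t * ?m y)" by (intro mult_left_mono) auto
  then show ?thesis by (simp only: distrib_left mult.left_commute)
qed

text \<open>Both bounds are needed by the chain in \<open>cone_walk\<close>. A step that stays in
  cone \<open>i\<close> inherits right emptiness by \<open>right_empty_along\<close>; a step that
  turns out of it is read backwards in cone \<open>j\<close>, where
  \<open>right_empty_across\<close> always grants the sharper bound. The maximum in
  \<open>max_len\<close> makes the first bound independent of the side on which the closest vertex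
  lies.\<close>

lemma cone_walks:
  "u \<in> V \<Longrightarrow> w \<in> V \<Longrightarrow> vis u w \<Longrightarrow> tri i j k \<Longrightarrow> w \<in> cone u (pc i) \<Longrightarrow>
   walk (Ginf V S) u w (max_len j k (w - u)) \<and> (right_empty i j k u w \<longrightarrow> walk (Ginf V S) u w (left_len j k (w - u)))"
proof (induction "card {x \<in> V \<times> V. hex_size (fst x) (snd x) < hex_size u w}" arbitrary: u w i j k rule: less_induct)
  case less
  note u = less.prems(1) and w = less.prems(2) and uw = less.prems(3) and t = less.prems(4) and wc = less.prems(5)
  let ?c = "2 / sqrt 3 :: real"
  have IH: "walk (Ginf V S) p q (max_len j k (q - p)) \<and> (right_empty i j k p q \<longrightarrow> walk (Ginf V S) p q (left_len j k (q - p)))"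
    if h: "p \<in> V" "q \<in> V" "vis p q" "tri i j k" "q \<in> cone p (pc i)" "hex_size p q < hex_size u w" for p q i j k
  proof -
    let ?A = "{x \<in> V \<times> V. hex_size (fst x) (snd x) < hex_size p q}" and ?B = "{x \<in> V \<times> V. hex_size (fst x) (snd x) < hex_size u w}"
    have fin: "finite ?B" using finV by simp
    have "?A \<subseteq> ?B" using h(6) by (blast intro: less_trans)
    moreover have "(p, q) \<in> ?B" "(p, q) \<notin> ?A" using h(1,2,6) by simp_all
    ultimately have "?A \<subset> ?B" by blast
    from less.hyps[OF psubset_card_mono[OF fin this] h(1-5)] show ?thesis .
  qed
  have edge: "walk (Ginf V S) p q (max_len j k (q - p)) \<and> (right_empty i j k u w \<longrightarrow> walk (Ginf V S) p q (left_len j k (q - p)))"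
    if t: "tri i j k" and h: "p \<in> V" "q \<in> V" "FT u p q" "p \<in> cone u (pc i)" "q \<in> cone u (pc i)"
      "cc i p < cc i q" "cc j q < cc j p" "cc i q \<le> cc i w" "cc j w \<le> cc j q"
      "crs j k (q - u) (p - u) > 0" "crs j k (w - u) (p - u) > 0" "q = w \<or> crs j k (w - u) (q - u) > 0"
      "\<And>z. z \<in> V \<Longrightarrow> z \<in> convex hull {u, q, w} \<Longrightarrow> z \<noteq> u \<Longrightarrow> cc i q \<le> cc i z" and wc: "w \<in> cone u (pc i)" for p q i j k
  proof -
    have pu: "cc j p < cc j u" "cc k p < cc k u" using cone_pc[OF t] h(4) by blast+
    then have ip: "cc i u < cc i p" using cc_sum[OF t, of u] cc_sum[OF t, of p] by linarith
    have vpq: "vis p q" using freetri_visible freetri_perm(3) h(3) by blast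
    have pq: "p \<noteq> q" using h(6) by blast
    show ?thesis
    proof (cases "cc k q < cc k p")
      case True
      have qc: "q \<in> cone p (pc i)" using cone_pc[OF t] True h(7) by blast
      have "hex_size p q < hex_size u w" unfolding hex_size_cone[OF t qc] hex_size_cone[OF t wc] using ip h(8) by simp
      then have "walk (Ginf V S) p q (max_len j k (q - p)) \<and> (right_empty i j k p q \<longrightarrow> walk (Ginf V S) p q (left_len j k (q - p)))"
        using IH[OF h(1,2) vpq t qc] by blast
      moreover have "right_empty i j k u w \<Longrightarrow> right_empty i j k p q"
        using right_empty_along[OF t u w h(1,2) uw wc h(3,4,5,6,7) True h(8,10,11,12,13)] by blast
      ultimately show ?thesis by blast
    next
      case False
      then have kl: "cc k p < cc k q" using cc_neq[OF h(1,2) pq, of k] by simp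
      have t': "tri j i k" using t tri_perm by blast
      have pc': "p \<in> cone q (pc j)" using cone_pc[OF t'] kl h(6) by blast
      have s1: "hex_size q p = 2 * (cc j p - cc j q)" using hex_size_cone[OF t' pc'] .
      have s2: "hex_size u w = 2 * ((cc j u - cc j w) + (cc k u - cc k w))"
        using hex_size_cone[OF t wc] cc_sum[OF t, of u] cc_sum[OF t, of w] by simp
      have "cc k w < cc k u" using cone_pc[OF t] wc by blast
      then have "hex_size q p < hex_size u w" unfolding s1 s2 using pu(1) h(9) by argo
      then have "walk (Ginf V S) q p (left_len i k (p - q))"
        using IH[OF h(2,1) _ t' pc'] vpq visible_commute[of S p q] right_empty_across[OF t u h(1,2,3,4,5,6,7) kl] by blast
      then have wpq: "walk (Ginf V S) p q (left_len i k (p - q))" by (rule walk_sym)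
      \<comment> \<open>Since the coordinates sum to zero, the backward bound in cone
        \<open>j\<close> is the same number as \<open>left_len j k (q - p)\<close>.\<close>
      have eq: "- 2 * cc i (p - q) - cc k (p - q) = - 2 * cc j (q - p) - cc k (q - p)"
        using cc_sum[OF t, of p] cc_sum[OF t, of q] by (simp add: cc_simps)
      have L: "walk (Ginf V S) p q (left_len j k (q - p))" using wpq unfolding eq .
      moreover have "left_len j k (q - p) \<le> max_len j k (q - p)" by (intro mult_left_mono) auto
      ultimately show ?thesis using walk_mono by blast
    qed
  qed
  have fF: "cc j (w - u) < 0" "cc k (w - u) < 0" using cone_pc[OF t] wc by (simp_all add: cc_simps)
  have LM: "left_len j k (w - u) \<le> max_len j k (w - u)" by (intro mult_left_mono) auto
  obtain v where v: "E i u v" "v = w \<or> v \<noteq> w \<and> SF u v w \<and> cc i v < cc i w" using closest_toward[OF u w uw wc] .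
  note D = E_D[OF v(1)]
  show ?case
  proof (cases "v = w")
    case True
    have "dist u w \<le> ?c * (- cc j (w - u) - cc k (w - u))"
      using norm_le_coord[OF t, of "w - u"] fF by (simp add: dist_norm norm_minus_commute)
    also have "\<dots> \<le> left_len j k (w - u)" using fF by (intro mult_left_mono) auto
    finally have "dist u w \<le> left_len j k (w - u)" .
    moreover have "{u, w} \<in> Ginf V S" using v(1) True Ginf_iff by blast
    ultimately have "walk (Ginf V S) u w (left_len j k (w - u))" using walk_edge by blast
    then show ?thesis using LM walk_mono by blast
  next
    case False
    then have v': "SF u v w" "cc i v < cc i w" using v(2) by blast+
    have nz: "crs j k (w - u) (v - u) \<noteq> 0" using crs_nz[OF t w D(2) u] False D(3) fF by (auto simp: cc_simps)
    have horL: "left_len j k e \<le> - (?c * cc j e)" if "tri i j k" "cc i e = 0" for e j k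
    proof -
      have "- 2 * cc j e - cc k e = - cc j e" using cc_sum[OF that(1), of e] that(2) by linarith
      then show ?thesis by (simp only: mult_minus_right)
    qed
    have horM: "max_len j k e \<le> - (?c * cc j e)" if "tri i j k" "cc i e = 0" "cc j e < 0" for e j k
    proof -
      have "cc k e = - cc j e" using cc_sum[OF that(1), of e] that(2) by linarith
      then have "max (- 2 * cc j e - cc k e) (- 2 * cc k e - cc j e) = - cc j e" using that(3) by simp
      then show ?thesis by simp
    qed
    have M: "walk (Ginf V S) u w (max_len j k (w - u))" if t': "tri i j k" and l: "crs j k (w - u) (v - u) > 0" for j k
      by (rule cone_walk[OF t' u w uw wc max_len_sub _ horM[OF t'] _ v(1) False v' l])
        (use edge[OF t' _ _ _ _ _ _ _ _ _ _ _ _ _ wc] in \<open>blast | (intro mult_left_mono; simp)\<close>)+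
    have 1: "walk (Ginf V S) u w (max_len j k (w - u))"
    proof (cases "crs j k (w - u) (v - u) > 0")
      case True then show ?thesis using M[OF t] by blast
    next
      case False
      then have "crs k j (w - u) (v - u) > 0" using nz unfolding crs_def by (simp add: mult.commute)
      then have "walk (Ginf V S) u w (max_len k j (w - u))" using M[OF tri_perm(1)[OF t]] by blast
      then show ?thesis by (simp only: max.commute)
    qed
    have 2: "walk (Ginf V S) u w (left_len j k (w - u))" if re: "right_empty i j k u w"
    proof -
      have "\<not> crs j k (v - u) (w - u) > 0" using re D v'(2) unfolding right_empty_def by blast
      then have l: "crs j k (w - u) (v - u) > 0" using nz crs_anti[of j k "v - u" "w - u"] by linarith
      show ?thesis
        by (rule cone_walk[OF t u w uw wc left_len_sub _ horL[OF t] _ v(1) False v' l])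
          (use edge[OF t _ _ _ _ _ _ _ _ _ _ _ _ _ wc] re in \<open>blast | simp\<close>)+
    qed
    show ?thesis using 1 2 by blast
  qed
qed

text \<open>The origin of the factor 2: \<open>(2 * a + b)\<^sup>2\<close> is at most
  \<open>4 * (a\<^sup>2 + a * b + b\<^sup>2)\<close>.\<close>

lemma max_len_norm:
  assumes t: "tri i j k" and d: "cc j d < 0" "cc k d < 0" shows "max_len j k d \<le> 2 * norm d"
proof -
  have h: "2 / sqrt 3 * (- 2 * cc j d - cc k d) \<le> 2 * norm d" if t: "tri i j k" for j k
  proof (rule power2_le_imp_le)
    show "0 \<le> 2 * norm d" by simp
    have "(2 / sqrt 3 * (- 2 * cc j d - cc k d))\<^sup>2 = 4 / 3 * (- 2 * cc j d - cc k d)\<^sup>2" unfolding power_mult_distrib power_divide by simp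
    also have "\<dots> = 4 / 3 * (4 * (cc j d)\<^sup>2 + 4 * (cc j d * cc k d) + (cc k d)\<^sup>2)" by (simp add: power2_eq_square algebra_simps)
    also have "\<dots> \<le> 4 * (norm d)\<^sup>2" unfolding cc_norm[OF t] by simp
    finally show "(2 / sqrt 3 * (- 2 * cc j d - cc k d))\<^sup>2 \<le> (2 * norm d)\<^sup>2" by (simp add: power_mult_distrib)
  qed
  show ?thesis using h[OF t] h[OF tri_perm(1)[OF t]] by (simp add: max_def)
qed

lemma cone_cover:
  assumes "p \<in> V" "q \<in> V" "p \<noteq> q" shows "\<exists>i. q \<in> cone p (pc i) \<or> p \<in> cone q (pc i)"
proof -
  have t: "tri 0 1 2" "tri 1 0 2" "tri 2 0 1" by (simp_all add: tri_def)
  have n: "cc 0 p \<noteq> cc 0 q" "cc 1 p \<noteq> cc 1 q" "cc 2 p \<noteq> cc 2 q" using cc_neq[OF assms] by blast+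
  have "(cc 1 q < cc 1 p \<and> cc 2 q < cc 2 p) \<or> (cc 1 p < cc 1 q \<and> cc 2 p < cc 2 q) \<or>
    (cc 0 q < cc 0 p \<and> cc 2 q < cc 2 p) \<or> (cc 0 p < cc 0 q \<and> cc 2 p < cc 2 q) \<or>
    (cc 0 q < cc 0 p \<and> cc 1 q < cc 1 p) \<or> (cc 0 p < cc 0 q \<and> cc 1 p < cc 1 q)"
    using n by linarith
  then show ?thesis using cone_pc[OF t(1)] cone_pc[OF t(2)] cone_pc[OF t(3)] by blast
qed

lemma Ginf_two_spanner:
  assumes "{x, y} \<in> Vis V S" shows "walk (Ginf V S) x y (2 * dist x y)"
proof -
  obtain a b where ab: "{x, y} = {a, b}" "a \<in> V" "b \<in> V" "a \<noteq> b" "vis a b" using assms unfolding Vis_def by blast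
  have c: "walk (Ginf V S) p q (2 * dist p q)" if h: "p \<in> V" "q \<in> V" "vis p q" "q \<in> cone p (pc i)" for p q i
  proof -
    have t: "tri i (i + 1) (i + 2)" by (rule tri_succ)
    have "cc (i + 1) (q - p) < 0" "cc (i + 2) (q - p) < 0" using cone_pc[OF t] h(4) by (simp_all add: cc_simps)
    then have "max_len (i + 1) (i + 2) (q - p) \<le> 2 * dist p q" unfolding dist_norm norm_minus_commute[of p q] by (rule max_len_norm[OF t])
    then show ?thesis using cone_walks[OF h(1-3) t h(4)] walk_mono by blast
  qed
  obtain i where "b \<in> cone a (pc i) \<or> a \<in> cone b (pc i)" using cone_cover ab(2-4) by blast
  then have w: "walk (Ginf V S) a b (2 * dist a b)"
  proof
    assume "b \<in> cone a (pc i)" then show ?thesis using c ab(2,3,5) by blast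
  next
    assume "a \<in> cone b (pc i)"
    then have "walk (Ginf V S) b a (2 * dist b a)" using c[OF ab(3,2)] ab(5) visible_commute[of S a b] by blast
    then show ?thesis using walk_sym[of _ b a] by (simp add: dist_commute)
  qed
  from ab(1) consider "x = a" "y = b" | "x = b" "y = a" unfolding doubleton_eq_iff by blast
  then show ?thesis
  proof cases
    case 1 then show ?thesis using w by simp
  next
    case 2 then show ?thesis using walk_sym[OF w] by (simp add: dist_commute)
  qed
qed

lemma G7_six_spanner: "is_spanner V (Vis V S) (G7 V S) 6"
proof (rule spanner_of_walks[OF G7_subset_Vis])
  fix x y assume "{x, y} \<in> Vis V S"
  from walk_walk[OF Ginf_two_spanner[OF this] G7_three_spanner_adj]
  show "W7 x y (6 * dist x y)" by (simp add: mult.assoc[symmetric])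
qed simp

end

theorem theorem18:
  fixes V :: "pt set" and S :: "pt list set"
  assumes "valid_setting V S"
    and "general_position V"
  shows "is_plane (G7 V S) \<and> is_spanner V (Vis V S) (G7 V S) 6 \<and>
         (\<forall>u\<in>V. vdegree (G7 V S) u \<le> 7)"
proof -
  interpret setting V S by unfold_locales (use assms in auto)
  show ?thesis using G7_plane G7_six_spanner G7_degree by blast
qed

end
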